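(* Suppose $1<p<5$ (with $\alpha>0$, $\beta>0$). Then the following statements are true for all $\gamma>0$ and all $\mu>0$. (i) Any minimizing sequence $\{\vec u_n\}$ of $J(\gamma,\mu)$ is relatively compact in $H^1(\mathbb R;\mathbb C^3)$ up to translations, i.e. there exist $\{y_n\}\subset\mathbb R$ and $\vec\varphi\in H^1(\mathbb R;\mathbb C^3)$ such that $\{\vec u_n(\cdot+y_n)\}$ has a subsequence converging strongly in $H^1(\mathbb R;\mathbb C^3)$ to $\vec\varphi$. In addition, the set $\mathcal M_{\gamma,\mu}$ is non-empty. (ii) The sets $\mathcal M_{\gamma,\mu}$ form a true two-parameter family in the sense that if $(\gamma_1,\mu_1)\neq(\gamma_2,\mu_2)$ (all entries positive), then $\mathcal M_{\gamma_1,\mu_1}$ and $\mathcal M_{\gamma_2,\mu_2}$ are disjoint. (iii) For every $\vec u=(u_1,u_2,u_3)\in\mathcal M_{\gamma,\mu}$, there exist numbers $\theta_1,\theta_2\in\mathbb R$ and functions $\rho_1,\rho_2,\rho_3:\mathbb R\to[0,\infty)$ such that $u_1(x)=e^{i\theta_1}\rho_1(x)$, $u_2(x)=e^{i\theta_2}\rho_2(x)$ and $u_3(x)=e^{i(\theta_1+\theta_2)}\rho_3(x)$ for all $x\in\mathbb R$.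
   Context: Fix $\alpha>0$, $\beta>0$, $p>1$. $H^1(\mathbb R;\mathbb C^3)$ is the product of three copies of the Sobolev space $H^1(\mathbb R,\mathbb C)$; write $\vec u=(u_1,u_2,u_3)$. Define $$E(\vec u)=\sum_{i=1}^3\Big\{\frac12\int_{\mathbb R}|\partial_xu_i|^2dx-\frac{\beta}{p+1}\int_{\mathbb R}|u_i|^{p+1}dx\Big\}-\alpha\,\mathrm{Re}\int_{\mathbb R}u_1u_2\overline{u_3}\,dx ,$$ $$Q_1(\vec u)=\|u_1\|_{L^2}^2+\|u_3\|_{L^2}^2,\qquad Q_2(\vec u)=\|u_2\|_{L^2}^2+\|u_3\|_{L^2}^2.$$ For $\gamma,\mu>0$ let $J(\gamma,\mu)=\inf\{E(\vec u):\vec u\in H^1(\mathbb R;\mathbb C^3),\ Q_1(\vec u)=\gamma,\ Q_2(\vec u)=\mu\}$ and let $\mathcal M_{\gamma,\mu}$ be the set of all $\vec u\in H^1(\mathbb R;\mathbb C^3)$ with $Q_1(\vec u)=\gamma$, $Q_2(\vec u)=\mu$ and $E(\vec u)=J(\gamma,\mu)$. A minimizing sequence for $J(\gamma,\mu)$ is a sequence $\{\vec u_n\}$ in $H^1(\mathbb R;\mathbb C^3)$ with $Q_1(\vec u_n)\to\gamma$, $Q_2(\vec u_n)\to\mu$ and $E(\vec u_n)\to J(\gamma,\mu)$ as $n\to\infty$. *)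

theory Defs
  imports "HOL-Analysis.Analysis"
begin

text \<open>
  Elements of \<open>L\<^sup>2(\<real>,\<complex>)\<close> and \<open>H\<^sup>1(\<real>,\<complex>)\<close> are represented by (Borel) functions. The sets below
  contain every Borel representative of each class, and everything defined on them is invariant
  under a.e. equality.
\<close>

definition L2 :: "(real \<Rightarrow> complex) set" where
  "L2 = {f \<in> borel_measurable lborel. integrable lborel (\<lambda>x. (cmod (f x))\<^sup>2)}"

definition L2_norm :: "(real \<Rightarrow> complex) \<Rightarrow> real" where
  "L2_norm f = sqrt (LINT x|lborel. (cmod (f x))\<^sup>2)"

definition test_functions :: "(real \<Rightarrow> real) set" where
  "test_functions = {\<phi>. (\<forall>n x. ((deriv ^^ n) \<phi>) field_differentiable (at x)) \<and>
                        compact (closure {x. \<phi> x \<noteq> 0})}"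

definition has_weak_deriv :: "(real \<Rightarrow> complex) \<Rightarrow> (real \<Rightarrow> complex) \<Rightarrow> bool" where
  "has_weak_deriv f g \<longleftrightarrow>
     (\<forall>\<phi>\<in>test_functions.
        (LINT x|lborel. f x * complex_of_real (deriv \<phi> x)) =
        - (LINT x|lborel. g x * complex_of_real (\<phi> x)))"

definition H1 :: "(real \<Rightarrow> complex) set" where
  "H1 = {f \<in> L2. \<exists>g\<in>L2. has_weak_deriv f g}"

text \<open>The weak derivative is determined only up to a null set; the choice is immaterial below,
  since it is used only inside integrals.\<close>

definition weak_deriv :: "(real \<Rightarrow> complex) \<Rightarrow> real \<Rightarrow> complex" where
  "weak_deriv f = (SOME g. g \<in> L2 \<and> has_weak_deriv f g)"

text \<open>Every class in \<open>H\<^sup>1(\<real>,\<complex>)\<close> contains exactly one continuous function. Pointwise statements about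
  an element of \<open>H\<^sup>1\<close> refer to that representative.\<close>

definition is_continuous_rep :: "(real \<Rightarrow> complex) \<Rightarrow> (real \<Rightarrow> complex) \<Rightarrow> bool" where
  "is_continuous_rep f v \<longleftrightarrow> continuous_on UNIV v \<and> (AE x in lborel. f x = v x)"

definition H1_vec :: "((real \<Rightarrow> complex)^3) set" where
  "H1_vec = {u. \<forall>i. u $ i \<in> H1}"

definition H1_dist :: "(real \<Rightarrow> complex)^3 \<Rightarrow> (real \<Rightarrow> complex)^3 \<Rightarrow> real" where
  "H1_dist u v =
     sqrt (\<Sum>i\<in>UNIV. (L2_norm (\<lambda>x. (u $ i) x - (v $ i) x))\<^sup>2 +
                    (L2_norm (weak_deriv (\<lambda>x. (u $ i) x - (v $ i) x)))\<^sup>2)"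

definition translate :: "real \<Rightarrow> (real \<Rightarrow> complex)^3 \<Rightarrow> (real \<Rightarrow> complex)^3" where
  "translate y u = (\<chi> i. (\<lambda>x. (u $ i) (x + y)))"

definition energy :: "real \<Rightarrow> real \<Rightarrow> real \<Rightarrow> (real \<Rightarrow> complex)^3 \<Rightarrow> real" where
  "energy \<alpha> \<beta> p u =
     (\<Sum>i\<in>UNIV. 1 / 2 * (LINT x|lborel. (cmod (weak_deriv (u $ i) x))\<^sup>2)
               - \<beta> / (p + 1) * (LINT x|lborel. cmod ((u $ i) x) powr (p + 1)))
     - \<alpha> * Re (LINT x|lborel. (u $ 1) x * (u $ 2) x * cnj ((u $ 3) x))"

definition Q1 :: "(real \<Rightarrow> complex)^3 \<Rightarrow> real" where
  "Q1 u = (L2_norm (u $ 1))\<^sup>2 + (L2_norm (u $ 3))\<^sup>2"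

definition Q2 :: "(real \<Rightarrow> complex)^3 \<Rightarrow> real" where
  "Q2 u = (L2_norm (u $ 2))\<^sup>2 + (L2_norm (u $ 3))\<^sup>2"

text \<open>The real-valued infimum below is meaningful for \<open>\<gamma>, \<mu> > 0\<close> and \<open>1 < p < 5\<close>: the admissible set
  is then non-empty and the energy is bounded below on it.\<close>

definition J :: "real \<Rightarrow> real \<Rightarrow> real \<Rightarrow> real \<Rightarrow> real \<Rightarrow> real" where
  "J \<alpha> \<beta> p \<gamma> \<mu> = Inf {energy \<alpha> \<beta> p u | u. u \<in> H1_vec \<and> Q1 u = \<gamma> \<and> Q2 u = \<mu>}"

definition minimizers ::
    "real \<Rightarrow> real \<Rightarrow> real \<Rightarrow> real \<Rightarrow> real \<Rightarrow> ((real \<Rightarrow> complex)^3) set" where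
  "minimizers \<alpha> \<beta> p \<gamma> \<mu> =
     {u \<in> H1_vec. Q1 u = \<gamma> \<and> Q2 u = \<mu> \<and> energy \<alpha> \<beta> p u = J \<alpha> \<beta> p \<gamma> \<mu>}"

definition minimizing_sequence ::
    "real \<Rightarrow> real \<Rightarrow> real \<Rightarrow> real \<Rightarrow> real \<Rightarrow> (nat \<Rightarrow> (real \<Rightarrow> complex)^3) \<Rightarrow> bool" where
  "minimizing_sequence \<alpha> \<beta> p \<gamma> \<mu> u \<longleftrightarrow>
     (\<forall>n. u n \<in> H1_vec) \<and>
     (\<lambda>n. Q1 (u n)) \<longlonglongrightarrow> \<gamma> \<and> (\<lambda>n. Q2 (u n)) \<longlonglongrightarrow> \<mu> \<and>
     (\<lambda>n. energy \<alpha> \<beta> p (u n)) \<longlonglongrightarrow> J \<alpha> \<beta> p \<gamma> \<mu>"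

end

theory Submission
  imports Defs "HOL-Complex_Analysis.Great_Picard"
begin

text \<open>
  The key operation combines two vectors \<open>u\<close>, \<open>v\<close> into the vector with components
  \<open>sqrt (\<bar>u\<^sub>i\<bar>\<^sup>2 + \<bar>v\<^sub>i\<bar>\<^sup>2)\<close>. It adds the constraints, does not increase the sum of the Dirichlet
  energies, and does not decrease the sum of the potential terms; by the Cauchy-Schwarz inequality
  the same holds for the coupling. So the minimal energy is subadditive without any rearrangement or
  cut-off. The inequality is strict for nonzero \<open>u\<close> and \<open>v\<close>: translating the components, one
  arranges overlap in a common component or in the coupling, and if just two components are present,
  a small third one of size \<open>\<epsilon>\<close> gains energy linearly in \<open>\<epsilon>\<close> while the correction of the masses
  costs only \<open>\<epsilon>\<^sup>2\<close>.

  A minimizing sequence has negative energy and is bounded in \<open>H\<^sup>1\<close> because \<open>p < 5\<close>, hence it does not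
  tend to zero uniformly, and after translations a nonzero limit splits off, with masses and energies
  adding up asymptotically. If mass is left over, it either has nonnegative limiting energy or contains
  a second bump; both contradict strict subadditivity.

  For a minimizer \<open>u\<close> the moduli \<open>\<bar>u\<^sub>i\<bar>\<close> are minimizing too. Replacing \<open>\<bar>u\<^sub>i\<bar>\<close> near a zero by a chord, and
  rescaling to restore its mass, shows that the zeros of \<open>\<bar>u\<^sub>i\<bar>\<close> spread, so that \<open>u\<^sub>i\<close> has no zeros
  unless it vanishes identically. The equality of the Dirichlet energies of \<open>u\<^sub>i\<close> and \<open>\<bar>u\<^sub>i\<bar>\<close> then forces
  a constant phase, and the equality of the coupling terms relates the phases.
\<close>

section \<open>Test functions\<close>

text \<open>The bound \<open>p < 5\<close> enters through one count, used twice. At bounded mass the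
  potential grows at most like the power \<open>(p - 1) / 4 < 1\<close> of the Dirichlet energy,
  which gives coercivity; under dilation to small amplitude it decays more slowly than the Dirichlet
  energy, which gives negative energy for all masses. Two bumps are enough because nothing has to be
  known about what is left after the second one: it is joined back as it is, and only the limits of
  its constraints and of its energy matter. Constraints that hold only in the limit are repaired by
  scaling down with a factor tending to 1 and filling the slack with a vector of negative energy.
  The join and the modulus are not smooth at zeros. Therefore Dirichlet energies are compared
  through difference quotients at dyadic points, which see values only; the same device yields weak
  convergence of derivatives from pointwise convergence and measures how far a phase is from being
  constant. Positivity is obtained from comparison with larger functions, which needs no regularity
  of the minimizer beyond continuity: a one-sided inequality with a constant independent of the zero
  makes zeros spread by a fixed distance.\<close>

definition smooth :: "(real \<Rightarrow> real) \<Rightarrow> bool" where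
  "smooth f \<longleftrightarrow> (\<forall>n x. ((deriv ^^ n) f) field_differentiable (at x))"

text \<open>Differentiation changes the shape of a function, so an induction on the order works only
  for a whole family; it suffices to exhibit one that is closed under \<open>deriv\<close>.\<close>

lemma smoothI:
  assumes "f \<in> S" "\<And>f x. f \<in> S \<Longrightarrow> f field_differentiable (at x)" "\<And>f. f \<in> S \<Longrightarrow> deriv f \<in> S"
  shows "smooth f"
proof -
  have "(deriv ^^ n) f \<in> S" for n
    by (induction n) (auto simp: assms)
  thus ?thesis by (auto simp: smooth_def assms)
qed

lemma smooth_diff: "smooth f \<Longrightarrow> f field_differentiable (at x)"
  unfolding smooth_def by (metis funpow_0)

lemma smooth_DERIV: "smooth f \<Longrightarrow> (f has_real_derivative deriv f x) (at x)"
  using smooth_diff field_differentiable_derivI by blast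

lemma smooth_deriv: "smooth f \<Longrightarrow> smooth (deriv f)"
  unfolding smooth_def by (metis funpow_Suc_right o_apply)

lemma smooth_antideriv:
  assumes "\<And>x. (F has_real_derivative f x) (at x)" "smooth f"
  shows "smooth F"
proof -
  have d: "deriv F = f" using assms(1) DERIV_imp_deriv by blast
  show ?thesis
  proof (rule smoothI[of _ "{F} \<union> {f. smooth f}"])
    fix g x assume "g \<in> {F} \<union> {f. smooth f}"
    thus "g field_differentiable at x" using assms(1) smooth_diff unfolding field_differentiable_def by blast
  next
    fix g assume "g \<in> {F} \<union> {f. smooth f}"
    thus "deriv g \<in> {F} \<union> {f. smooth f}" using d assms smooth_deriv by auto
  qed simp
qed

lemma smooth_continuous: "smooth f \<Longrightarrow> continuous_on A f"
  using smooth_DERIV DERIV_isCont continuous_at_imp_continuous_on by blast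

text \<open>The Leibniz rule sends a product to a sum of two products, so a family that contains
  products and is closed under differentiation has to contain finite sums of them.\<close>

inductive_set smooth_algebra :: "(real \<Rightarrow> real) set" where
  mult: "smooth f \<Longrightarrow> smooth g \<Longrightarrow> (\<lambda>x. f x * g x) \<in> smooth_algebra"
| add: "f \<in> smooth_algebra \<Longrightarrow> g \<in> smooth_algebra \<Longrightarrow> (\<lambda>x. f x + g x) \<in> smooth_algebra"

lemma smooth_algebra_deriv:
  "f \<in> smooth_algebra \<Longrightarrow> \<exists>g\<in>smooth_algebra. \<forall>x. (f has_real_derivative g x) (at x)"
proof (induction rule: smooth_algebra.induct)
  case (mult f g)
  have "(\<lambda>x. deriv f x * g x + f x * deriv g x) \<in> smooth_algebra"
    by (rule smooth_algebra.add; rule smooth_algebra.mult) (auto simp: mult smooth_deriv)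
  moreover have "((\<lambda>x. f x * g x) has_real_derivative (deriv f x * g x + f x * deriv g x)) (at x)" for x
    using mult by (auto intro!: derivative_eq_intros smooth_DERIV)
  ultimately show ?case by (intro bexI[of _ "\<lambda>x. deriv f x * g x + f x * deriv g x"]) auto
next
  case (add f g)
  then obtain f' g' where "f'\<in>smooth_algebra" "g'\<in>smooth_algebra"
    "\<forall>x. (f has_real_derivative f' x) (at x)" "\<forall>x. (g has_real_derivative g' x) (at x)" by blast
  thus ?case
    by (intro bexI[of _ "\<lambda>x. f' x + g' x"]) (auto intro!: derivative_eq_intros smooth_algebra.add)
qed

lemma smooth_algebra_smooth: "f \<in> smooth_algebra \<Longrightarrow> smooth f"
proof (rule smoothI[of _ smooth_algebra])
  fix f x assume "f \<in> smooth_algebra"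
  then obtain g where g: "g\<in>smooth_algebra" "\<forall>x. (f has_real_derivative g x) (at x)"
    using smooth_algebra_deriv by blast
  thus "f field_differentiable at x" "deriv f \<in> smooth_algebra"
    unfolding field_differentiable_def using DERIV_imp_deriv[of f "g _"] by (auto, metis ext)
qed

lemma smooth_mult: "smooth f \<Longrightarrow> smooth g \<Longrightarrow> smooth (\<lambda>x. f x * g x)"
  by (rule smooth_algebra_smooth, rule smooth_algebra.mult)

lemma smooth_const: "smooth (\<lambda>x. c)"
proof (rule smoothI[of _ "range (\<lambda>c x. c)"])
  fix f :: "real \<Rightarrow> real" assume "f \<in> range (\<lambda>c x. c)"
  then obtain c where f: "f = (\<lambda>x. c)" by auto
  have "deriv f = (\<lambda>x. 0)" by (auto simp: f)
  thus "deriv f \<in> range (\<lambda>c x. c)" by auto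
qed auto

lemma smooth_add: assumes "smooth f" "smooth g" shows "smooth (\<lambda>x. f x + g x)"
proof -
  \<comment> \<open>Only sums of products belong to the family, hence the factors 1.\<close>
  have "(\<lambda>x. f x * 1 + g x * 1) \<in> smooth_algebra"
    by (intro smooth_algebra.intros assms smooth_const)
  thus ?thesis using smooth_algebra_smooth by fastforce
qed

text \<open>The free factor \<open>c\<close> of the family absorbs the powers of \<open>m\<close>
  that the chain rule produces.\<close>

lemma smooth_affine:
  assumes "smooth f" shows "smooth (\<lambda>x. f (m * x + b))"
proof (rule smoothI[of _ "{\<lambda>x. c * f (m * x + b) | c f. smooth f}"])
  show "(\<lambda>x. f (m * x + b)) \<in> {\<lambda>x. c * f (m * x + b) | c f. smooth f}"
    using assms by (intro CollectI exI[of _ 1] exI[of _ f]) auto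
next
  fix h x assume "h \<in> {\<lambda>x. c * f (m * x + b) | c f. smooth f}"
  then obtain c f where h: "h = (\<lambda>x. c * f (m * x + b))" "smooth f" by auto
  have d: "(h has_real_derivative (c * m) * deriv f (m * x + b)) (at x)" for x
    unfolding h(1) using smooth_DERIV[OF h(2)]
    by (auto intro!: derivative_eq_intros DERIV_chain2[of f "deriv f (m*x+b)" "\<lambda>x. m*x+b" x m])
  show "h field_differentiable at x" using d field_differentiable_def by blast
next
  fix h assume "h \<in> {\<lambda>x. c * f (m * x + b) | c f. smooth f}"
  then obtain c f where h: "h = (\<lambda>x. c * f (m * x + b))" "smooth f" by auto
  have d: "(h has_real_derivative (c * m) * deriv f (m * x + b)) (at x)" for x
    unfolding h(1) using smooth_DERIV[OF h(2)]
    by (auto intro!: derivative_eq_intros DERIV_chain2[of f "deriv f (m*x+b)" "\<lambda>x. m*x+b" x m])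
  hence "deriv h = (\<lambda>x. (c * m) * deriv f (m * x + b))" using DERIV_imp_deriv by blast
  thus "deriv h \<in> {\<lambda>x. c * f (m * x + b) | c f. smooth f}"
    using smooth_deriv[OF h(2)] by blast
qed

text \<open>These functions form a family that is closed under differentiation.\<close>
definition flat_exp :: "real poly \<Rightarrow> real \<Rightarrow> real" where
  "flat_exp P x = (if x > 0 then poly P (1 / x) * exp (- (1 / x)) else 0)"

text \<open>The free power \<open>t ^ k\<close> carries the induction: splitting off the constant
  coefficient leaves \<open>t\<close> times a polynomial of lower degree, which raises
  \<open>k\<close> by one.\<close>

lemma poly_exp_tendsto_0: "((\<lambda>t::real. t ^ k * poly P t * exp (- t)) \<longlongrightarrow> 0) at_top"
proof (induction P arbitrary: k)
  case 0 thus ?case by simp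
next
  case (pCons a P)
  have "((\<lambda>t::real. a * (t ^ k / exp t) + t ^ (Suc k) * poly P t * exp (- t)) \<longlongrightarrow> a * 0 + 0) at_top"
    by (intro tendsto_intros tendsto_power_div_exp_0 pCons)
  thus ?case by (simp add: algebra_simps exp_minus divide_inverse)
qed

text \<open>With \<open>t = 1 / x\<close> one has \<open>d/dx = - t^2 d/dt\<close>, and
  \<open>P(t) exp (- t)\<close> has the \<open>t\<close>-derivative
  \<open>(P' - P)(t) exp (- t)\<close>; the polynomial \<open>[:0,0,1:]\<close> is
  \<open>t^2\<close>. At the origin the difference quotient from the right is
  \<open>t P(t) exp (- t)\<close>, which tends to 0 as \<open>t\<close> grows.\<close>

lemma flat_exp_DERIV: "(flat_exp P has_real_derivative flat_exp ([:0,0,1:] * (P - pderiv P)) x) (at x)"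
proof -
  consider "x > 0" | "x < 0" | "x = 0" by linarith
  thus ?thesis
  proof cases
    case 1
    have "((\<lambda>x. poly P (1 / x) * exp (- (1 / x))) has_real_derivative flat_exp ([:0,0,1:] * (P - pderiv P)) x) (at x)"
      using 1 by (auto intro!: derivative_eq_intros DERIV_chain2[OF poly_DERIV]
        simp: flat_exp_def field_simps power2_eq_square)
    thus ?thesis
      by (rule has_field_derivative_transform_within_open[of _ _ _ "{0<..}"]) (auto simp: flat_exp_def 1)
  next
    case 2
    have "((\<lambda>x. 0) has_real_derivative flat_exp ([:0,0,1:] * (P - pderiv P)) x) (at x)"
      using 2 by (simp add: flat_exp_def)
    thus ?thesis
      by (rule has_field_derivative_transform_within_open[of _ _ _ "{..<0}"]) (auto simp: flat_exp_def 2)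
  next
    case 3
    have "((\<lambda>h. flat_exp P h / h) \<longlongrightarrow> 0) (at 0)"
    proof (subst filterlim_at_split, intro conjI)
      show "((\<lambda>h. flat_exp P h / h) \<longlongrightarrow> 0) (at_left 0)"
      proof (rule tendsto_eventually)
        show "\<forall>\<^sub>F h in at_left 0. flat_exp P h / h = 0"
          by (rule eventually_mono[OF eventually_at_left_real[of "-1" "0::real"]]) (auto simp: flat_exp_def)
      qed
      have "((\<lambda>h. (\<lambda>t. t ^ 1 * poly P t * exp (- t)) (inverse h)) \<longlongrightarrow> 0) (at_right (0::real))"
        by (rule filterlim_compose[OF poly_exp_tendsto_0 filterlim_inverse_at_top_right])
      moreover have "\<forall>\<^sub>F h in at_right 0. (\<lambda>t. t ^ 1 * poly P t * exp (- t)) (inverse h) = flat_exp P h / h"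
        by (rule eventually_mono[OF eventually_at_right_less[of "0::real"]]) (auto simp: flat_exp_def divide_inverse)
      ultimately show "((\<lambda>h. flat_exp P h / h) \<longlongrightarrow> 0) (at_right 0)"
        by (rule Lim_transform_eventually)
    qed
    thus ?thesis unfolding 3 DERIV_def by (simp add: flat_exp_def)
  qed
qed

lemma smooth_flat_exp: "smooth (flat_exp P)"
proof (rule smoothI[of _ "range flat_exp"])
  fix f assume "f \<in> range flat_exp"
  then obtain P where f: "f = flat_exp P" by auto
  show "f field_differentiable at x" for x unfolding f field_differentiable_def using flat_exp_DERIV by blast
  have "deriv f = flat_exp ([:0,0,1:] * (P - pderiv P))" unfolding f using flat_exp_DERIV DERIV_imp_deriv by blast
  thus "deriv f \<in> range flat_exp" by auto
qed simp

section \<open>Test functions and bumps\<close>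

lemma test_functions_iff:
  "\<phi> \<in> test_functions \<longleftrightarrow> smooth \<phi> \<and> (\<exists>R>0. \<forall>x. \<phi> x \<noteq> 0 \<longrightarrow> \<bar>x\<bar> < R)"
proof -
  have "compact (closure {x. \<phi> x \<noteq> 0}) \<longleftrightarrow> bounded {x. \<phi> x \<noteq> 0}"
    by (simp add: compact_eq_bounded_closed) (metis bounded_closure bounded_subset closure_subset)
  also have "\<dots> \<longleftrightarrow> (\<exists>R>0. \<forall>x. \<phi> x \<noteq> 0 \<longrightarrow> \<bar>x\<bar> < R)"
    unfolding bounded_pos_less by auto
  finally show ?thesis by (simp add: test_functions_def smooth_def)
qed

text \<open>The parameter \<open>n\<close> is a steepness: as it grows, the bumps tend pointwise to
  the indicator of the open interval while staying between 0 and 1, so test functions recover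
  integrals over intervals.\<close>

definition bump :: "real \<Rightarrow> real \<Rightarrow> real \<Rightarrow> real \<Rightarrow> real" where
  "bump a b n x = flat_exp 1 (n * (x - a)) * flat_exp 1 (n * (b - x))"

lemma bump_test: assumes "n > 0" shows "bump a b n \<in> test_functions"
proof -
  have "smooth (\<lambda>x. flat_exp 1 (n * x + (- n * a)) * flat_exp 1 ((- n) * x + n * b))"
    by (intro smooth_mult smooth_affine smooth_flat_exp)
  hence "smooth (bump a b n)" by (simp add: bump_def[abs_def] algebra_simps)
  moreover have "\<bar>x\<bar> < \<bar>a\<bar> + \<bar>b\<bar> + 1" if "bump a b n x \<noteq> 0" for x
    using that assms by (auto simp: bump_def flat_exp_def zero_less_mult_iff split: if_splits)
  ultimately show ?thesis unfolding test_functions_iff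
    by (intro conjI exI[of _ "\<bar>a\<bar> + \<bar>b\<bar> + 1"]) auto
qed

lemma flat_exp_1_bounds: "0 \<le> flat_exp 1 x" "flat_exp 1 x \<le> 1" "x > 0 \<Longrightarrow> flat_exp 1 x > 0" "x \<le> 0 \<Longrightarrow> flat_exp 1 x = 0"
  by (auto simp: flat_exp_def)

lemma bump_bounds: "0 \<le> bump a b n x" "bump a b n x \<le> 1"
  "n > 0 \<Longrightarrow> x \<le> a \<or> x \<ge> b \<Longrightarrow> bump a b n x = 0" "n > 0 \<Longrightarrow> a < x \<Longrightarrow> x < b \<Longrightarrow> bump a b n x > 0"
  by (auto simp: bump_def flat_exp_1_bounds mult_le_one mult_nonneg_nonpos)

lemma flat_exp_1_tendsto: assumes "x > 0" shows "(\<lambda>n. flat_exp 1 (real (Suc n) * x)) \<longlonglongrightarrow> 1"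
proof -
  have "(\<lambda>n. exp (- ((1 / x) * inverse (real (Suc n))))) \<longlonglongrightarrow> exp (- ((1 / x) * 0))"
    by (intro tendsto_intros LIMSEQ_inverse_real_of_nat)
  moreover have "exp (- ((1 / x) * inverse (real (Suc n)))) = flat_exp 1 (real (Suc n) * x)" for n

  proof -
    have "real (Suc n) * x > 0" using assms by simp
    thus ?thesis using assms by (simp add: flat_exp_def divide_inverse mult.commute)
  qed
  ultimately show ?thesis by simp
qed

lemma bump_tendsto: "(\<lambda>n. bump a b (real (Suc n)) x) \<longlonglongrightarrow> indicator {a<..<b} x"
proof (cases "a < x \<and> x < b")
  case True
  have "(\<lambda>n. bump a b (real (Suc n)) x) \<longlonglongrightarrow> 1 * 1"
    unfolding bump_def using True by (intro tendsto_mult flat_exp_1_tendsto) auto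
  thus ?thesis using True by simp
next
  case False
  hence "bump a b (real (Suc n)) x = 0" for n by (intro bump_bounds) auto
  thus ?thesis using False by (auto simp: indicator_def)
qed

text \<open>The primitive that vanishes to the left of the support is constant to the right of it,
  with the integral of \<open>\<eta>\<close> as its value; mean zero is what makes it compactly
  supported.\<close>

lemma test_antideriv:
  assumes "\<eta> \<in> test_functions" "(LINT x|lborel. \<eta> x) = 0"
  shows "\<exists>\<phi>\<in>test_functions. deriv \<phi> = \<eta>"
proof -
  obtain R where R: "R > 0" "\<And>x. \<eta> x \<noteq> 0 \<Longrightarrow> \<bar>x\<bar> < R" and sm: "smooth \<eta>"
    using assms test_functions_iff by blast
  have "isCont \<eta> x" for x using smooth_DERIV[OF sm] DERIV_isCont by blast
  hence "\<exists>F. \<forall>x::real. -\<infinity> < ereal x \<longrightarrow> ereal x < \<infinity> \<longrightarrow> (F has_vector_derivative \<eta> x) (at x)"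
    by (intro einterval_antiderivative) auto
  then obtain F where F: "\<And>x. (F has_real_derivative \<eta> x) (at x)"
    by (auto simp: has_real_derivative_iff_has_vector_derivative)
  define \<phi> where "\<phi> x = F x - F (-R)" for x
  have d\<phi>: "(\<phi> has_real_derivative \<eta> x) (at x)" for x
    unfolding \<phi>_def using F by (auto intro!: derivative_eq_intros)
  have const: "F y = F x" if "x \<le> y" "\<And>t. x \<le> t \<Longrightarrow> t \<le> y \<Longrightarrow> \<eta> t = 0" for x y
  proof (cases "x = y")
    case False
    show ?thesis
    proof (rule DERIV_isconst_end[of x y F])
      show "x < y" using that False by auto
      show "continuous_on {x..y} F" using F DERIV_isCont continuous_at_imp_continuous_on by blast
      show "(F has_real_derivative 0) (at t)" if "x < t" "t < y" for t
        using F[of t] \<open>\<And>t. x \<le> t \<Longrightarrow> t \<le> y \<Longrightarrow> \<eta> t = 0\<close>[of t] that by auto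
    qed
  qed simp
  have "(LINT x|lborel. \<eta> x * indicator {-R..R} x) = F R - F (-R)"
    by (rule integral_FTC_Icc_real) (use R F smooth_DERIV[OF sm] DERIV_isCont in \<open>auto intro: DERIV_isCont\<close>)
  moreover have "\<eta> x * indicator {-R..R} x = \<eta> x" for x using R(2)[of x] by (auto simp: indicator_def)
  ultimately have FR: "F R = F (-R)" using assms(2) by simp
  have "\<bar>x\<bar> < R" if "\<phi> x \<noteq> 0" for x
  proof (rule ccontr)
    assume "\<not> \<bar>x\<bar> < R"
    hence "x \<le> -R \<or> R \<le> x" by auto
    thus False
    proof
      assume x: "x \<le> -R"
      have "F (-R) = F x" by (rule const) (use x R(2) in force)+
      thus False using that by (simp add: \<phi>_def)
    next
      assume x: "R \<le> x"
      have "F x = F R" by (rule const) (use x R(2) in force)+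
      thus False using that FR by (simp add: \<phi>_def)
    qed
  qed
  hence "\<phi> \<in> test_functions" using smooth_antideriv[OF d\<phi> sm] R(1) test_functions_iff by blast
  moreover have "deriv \<phi> = \<eta>" using d\<phi> DERIV_imp_deriv by blast
  ultimately show ?thesis by blast
qed

lemma test_bounded:
  assumes "\<eta> \<in> test_functions"
  obtains R M where "R > 0" "M \<ge> 0" "\<And>x. \<bar>\<eta> x\<bar> \<le> M * indicator {-R..R} x"
proof -
  obtain R where R: "R > 0" "\<And>x. \<eta> x \<noteq> 0 \<Longrightarrow> \<bar>x\<bar> < R" and sm: "smooth \<eta>"
    using assms test_functions_iff by blast
  have "compact (\<eta> ` {-R..R})" by (intro compact_continuous_image smooth_continuous sm) auto
  then obtain M where M: "\<And>x. x \<in> {-R..R} \<Longrightarrow> \<bar>\<eta> x\<bar> \<le> M"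
    using compact_imp_bounded bounded_iff by (metis image_eqI real_norm_def)
  have M0: "M \<ge> 0" using M[of 0] R by auto
  show ?thesis
  proof (rule that[OF R(1) M0])
    fix x show "\<bar>\<eta> x\<bar> \<le> M * indicator {-R..R} x"
      using M[of x] R(2)[of x] by (cases "\<eta> x = 0") (auto simp: indicator_def M0)
  qed
qed

lemma test_measurable: "\<eta> \<in> test_functions \<Longrightarrow> \<eta> \<in> borel_measurable borel"
  using smooth_continuous borel_measurable_continuous_onI test_functions_iff by blast

lemma test_deriv: assumes "\<eta> \<in> test_functions" shows "deriv \<eta> \<in> test_functions"
proof -
  obtain R where R: "R > 0" "\<And>x. \<eta> x \<noteq> 0 \<Longrightarrow> \<bar>x\<bar> < R" and sm: "smooth \<eta>"
    using assms test_functions_iff by blast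
  have "\<bar>x\<bar> < R + 1" if "deriv \<eta> x \<noteq> 0" for x
  proof (rule ccontr)
    assume x: "\<not> \<bar>x\<bar> < R + 1"
    have "(\<eta> has_real_derivative 0) (at x)"
    proof (rule has_field_derivative_transform_within_open[of "\<lambda>x. 0" _ _ "{t. \<bar>t\<bar> > R}"])
      show "open {t. \<bar>t\<bar> > R}" by (intro open_Collect_less continuous_intros)
    qed (use x R in force)+
    thus False using that DERIV_imp_deriv by blast
  qed
  thus ?thesis using smooth_deriv[OF sm] R(1) test_functions_iff
    by (metis add_pos_pos zero_less_one)
qed

section \<open>The fundamental lemma and the lemma of du Bois-Reymond\<close>

definition loc_int :: "(real \<Rightarrow> complex) \<Rightarrow> bool" where
  "loc_int g \<longleftrightarrow> g \<in> borel_measurable borel \<and> (\<forall>a b. set_integrable lborel {a..b} g)"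

lemma loc_intD [dest]: "loc_int g \<Longrightarrow> g \<in> borel_measurable borel" "loc_int g \<Longrightarrow> set_integrable lborel {a..b} g"
  by (auto simp: loc_int_def)

lemma loc_int_diff: "loc_int f \<Longrightarrow> loc_int g \<Longrightarrow> loc_int (\<lambda>x. f x - g x)"
  by (auto simp: loc_int_def intro!: set_integral_diff)

lemma loc_int_continuous: "continuous_on UNIV g \<Longrightarrow> loc_int g"
  unfolding loc_int_def set_integrable_def
  by (auto intro!: borel_measurable_continuous_onI borel_integrable_compact elim: continuous_on_subset)

lemma loc_int_mult_test:
  assumes "loc_int w" "\<eta> \<in> test_functions"
  shows "integrable lborel (\<lambda>x. w x * complex_of_real (\<eta> x))"
proof -
  obtain R M where M: "R > 0" "M \<ge> 0" "\<And>x. \<bar>\<eta> x\<bar> \<le> M * indicator {-R..R} x" using test_bounded[OF assms(2)] by blast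
  have [measurable]: "w \<in> borel_measurable borel" "\<eta> \<in> borel_measurable borel"
    using test_measurable assms by auto
  show ?thesis
  proof (rule Bochner_Integration.integrable_bound)
    show "integrable lborel (\<lambda>x. M *\<^sub>R (indicator {-R..R} x *\<^sub>R w x))"
      using loc_intD(2)[OF assms(1), of "-R" R] unfolding set_integrable_def by (intro integrable_scaleR_right)
    show "AE x in lborel. norm (w x * complex_of_real (\<eta> x)) \<le> norm (M *\<^sub>R (indicator {-R..R} x *\<^sub>R w x))"
    proof (intro AE_I2)
      fix x
      have "cmod (w x) * \<bar>\<eta> x\<bar> \<le> cmod (w x) * (M * indicator {-R..R} x)" by (intro mult_left_mono M) auto
      thus "norm (w x * complex_of_real (\<eta> x)) \<le> norm (M *\<^sub>R (indicator {-R..R} x *\<^sub>R w x))"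
        using M(2) by (simp add: norm_mult mult_ac)
    qed
  qed auto
qed

text \<open>Half-lines are stable under intersection and generate the Borel sets, so by a Dynkin
  argument the integral vanishes over every Borel set.\<close>

lemma AE_zero_of_atMost:
  fixes f :: "real \<Rightarrow> complex"
  assumes f: "integrable lborel f" and z: "\<And>x. (LINT t:{..x}|lborel. f t) = 0"
  shows "AE x in lborel. f x = 0"
proof (rule sigma_finite_measure.density_zero[OF lborel.sigma_finite_measure_axioms f])
  fix A :: "real set" assume "A \<in> sets lborel"
  hence A: "A \<in> sigma_sets UNIV (range (\<lambda>a::real. {..a}))"
    by (simp add: borel_eq_atMost)
  have si: "set_integrable lborel B f" if "B \<in> sets borel" for B
    using integrable_mult_indicator[OF _ f, of B] that by (simp add: set_integrable_def)
  have bs: "B \<in> sets borel" if "B \<in> sigma_sets UNIV (range (\<lambda>a::real. {..a}))" for B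
    using that by (simp add: borel_eq_atMost)
  \<comment> \<open>Complements in the Dynkin argument need the integral over the whole line, which
    is a limit of integrals over half-lines.\<close>
  have tot: "(LINT t|lborel. f t) = 0"
  proof -
    have "(\<lambda>n. LINT t|lborel. indicator {..real n} t *\<^sub>R f t) \<longlonglongrightarrow> (LINT t|lborel. f t)"
    proof (rule integral_dominated_convergence[where w = "\<lambda>t. norm (f t)"])
      show "AE x in lborel. (\<lambda>n. indicat_real {..real n} x *\<^sub>R f x) \<longlonglongrightarrow> f x"
      proof (intro AE_I2 tendsto_eventually)
        fix x :: real
        obtain N where "x \<le> real N" using real_arch_simple by blast
        thus "\<forall>\<^sub>F n in sequentially. indicat_real {..real n} x *\<^sub>R f x = f x"
          by (intro eventually_sequentiallyI[of N]) auto
      qed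
    qed (use f in \<open>auto simp: indicator_def\<close>)
    thus ?thesis using z unfolding set_lebesgue_integral_def by (simp add: LIMSEQ_const_iff)
  qed
  have G: "range (\<lambda>a::real. {..a}) \<subseteq> Pow UNIV" by simp
  have I: "Int_stable (range (\<lambda>a::real. {..a}))"
  proof -
    have "{..a} \<inter> {..b} = {..min a b}" for a b :: real by auto
    thus ?thesis by (auto simp: Int_stable_def)
  qed
  show "set_lebesgue_integral lborel A f = 0"
    using I G A
  proof (induction rule: sigma_sets_induct_disjoint)
    case (basic A) thus ?case using z by auto
  next
    case empty show ?case by (simp add: set_lebesgue_integral_def)
  next
    case (compl A)
    have "set_lebesgue_integral lborel (A \<union> (UNIV - A)) f =
        set_lebesgue_integral lborel A f + set_lebesgue_integral lborel (UNIV - A) f"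
      by (rule set_integral_Un) (use compl bs si in auto)
    thus ?case using compl tot by (simp add: set_lebesgue_integral_def)
  next
    case (union A)
    have Ab: "A i \<in> sets borel" for i using union bs by blast
    have "(LINT x:(\<Union>i. A i)|lborel. f x) = (\<Sum>i. (LINT x:(A i)|lborel. f x))"
      by (rule lebesgue_integral_countable_add)
        (use union Ab in \<open>auto simp: disjoint_family_on_def intro!: si sets.countable_UN\<close>)
    thus ?case using union by simp
  qed
qed

lemma AE_zero_of_intervals:
  assumes w: "loc_int w" and z: "\<And>a b. a < b \<Longrightarrow> (LINT t:{a..b}|lborel. w t) = 0"
  shows "AE x in lborel. w x = 0"
proof -
  have z': "(LINT t:{a..b}|lborel. w t) = 0" for a b
  proof (cases "a < b")
    case False
    have "AE t in lborel. indicator {a..b} t *\<^sub>R w t = 0"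
      using AE_lborel_singleton[of a] by eventually_elim (use False in \<open>auto simp: indicator_def\<close>)
    thus ?thesis unfolding set_lebesgue_integral_def by (rule integral_eq_zero_AE)
  qed (use z in auto)
  have "AE x in lborel. indicator {-real N..real N} x *\<^sub>R w x = 0" for N :: nat
  proof (rule AE_zero_of_atMost)
    show "integrable lborel (\<lambda>x. indicat_real {- real N..real N} x *\<^sub>R w x)"
      using loc_intD(2)[OF w] unfolding set_integrable_def .
    fix x
    have "(LINT t:{..x}|lborel. indicat_real {- real N..real N} t *\<^sub>R w t) = (LINT t:{- real N..min x (real N)}|lborel. w t)"
      unfolding set_lebesgue_integral_def by (intro Bochner_Integration.integral_cong) (auto simp: indicator_def)
    thus "(LINT t:{..x}|lborel. indicat_real {- real N..real N} t *\<^sub>R w t) = 0" using z' by simp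
  qed
  hence "AE x in lborel. \<forall>N::nat. indicator {-real N..real N} x *\<^sub>R w x = 0"
    unfolding AE_all_countable by blast
  thus ?thesis
  proof eventually_elim
    case (elim x)
    obtain N where "\<bar>x\<bar> \<le> real N" using real_arch_simple by blast
    thus ?case using elim[rule_format, of N] by (auto simp: abs_le_iff)
  qed
qed

text \<open>Bumps tend boundedly to the indicator of \<open>{a<..<b}\<close>, so vanishing against
  test functions passes to integrals over intervals.\<close>

lemma fundamental_lemma:
  assumes w: "loc_int w" and z: "\<And>\<eta>. \<eta> \<in> test_functions \<Longrightarrow> (LINT x|lborel. w x * complex_of_real (\<eta> x)) = 0"
  shows "AE x in lborel. w x = 0"
proof (rule AE_zero_of_intervals[OF w])
  fix a b :: real assume "a < b"
  have [measurable]: "w \<in> borel_measurable borel" using w by auto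
  have [measurable]: "bump a b (real (Suc n)) \<in> borel_measurable borel" for n
    by (intro test_measurable bump_test) auto
  have "(\<lambda>n. LINT x|lborel. w x * complex_of_real (bump a b (real (Suc n)) x)) \<longlonglongrightarrow>
      (LINT x|lborel. w x * complex_of_real (indicator {a<..<b} x))"
  proof (rule integral_dominated_convergence[where w = "\<lambda>x. norm (indicator {a..b} x *\<^sub>R w x)"])
    show "integrable lborel (\<lambda>x. norm (indicat_real {a..b} x *\<^sub>R w x))"
      using loc_intD(2)[OF w, of a b] unfolding set_integrable_def by (rule integrable_norm)
    show "AE x in lborel. (\<lambda>n. w x * complex_of_real (bump a b (real (Suc n)) x)) \<longlonglongrightarrow> w x * complex_of_real (indicat_real {a<..<b} x)"
      by (intro AE_I2 tendsto_intros bump_tendsto)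
    show "AE x in lborel. norm (w x * complex_of_real (bump a b (real (Suc n)) x)) \<le> norm (indicat_real {a..b} x *\<^sub>R w x)" for n
    proof (intro AE_I2)
      fix x
      have "\<bar>bump a b (real (Suc n)) x\<bar> \<le> indicat_real {a..b} x"
        using bump_bounds[where a=a and b=b and x=x and n="real (Suc n)"] by (auto simp: indicator_def)
      from mult_left_mono[OF this norm_ge_zero[of "w x"]]
      show "norm (w x * complex_of_real (bump a b (real (Suc n)) x)) \<le> norm (indicat_real {a..b} x *\<^sub>R w x)"
        by (simp add: norm_mult mult_ac)
    qed
  qed measurable
  moreover have "(LINT x|lborel. w x * complex_of_real (bump a b (real (Suc n)) x)) = 0" for n
    by (intro z bump_test) auto
  ultimately have "(LINT x|lborel. w x * complex_of_real (indicator {a<..<b} x)) = 0"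
    by (simp add: LIMSEQ_const_iff)
  moreover have "(LINT x|lborel. w x * complex_of_real (indicator {a<..<b} x)) = (LINT x:{a..b}|lborel. w x)"
    unfolding set_lebesgue_integral_def
  proof (rule integral_cong_AE)
    show "AE x in lborel. w x * complex_of_real (indicat_real {a<..<b} x) = indicat_real {a..b} x *\<^sub>R w x"
      using AE_lborel_singleton[of a] AE_lborel_singleton[of b]
      by eventually_elim (auto simp: indicator_def)
  qed measurable
  ultimately show "(LINT t:{a..b}|lborel. w t) = 0" by simp
qed

lemma test_integrable: "\<eta> \<in> test_functions \<Longrightarrow> integrable lborel \<eta>"
  using loc_int_mult_test[of "\<lambda>x. 1" \<eta>] loc_int_continuous[of "\<lambda>x. 1"]
  by (simp add: complex_of_real_integrable_eq)

text \<open>Subtracting a multiple of a fixed bump \<open>B\<close> gives a test function mean zero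
  and hence turns it into the derivative of a test function. The constant is the average of
  \<open>w\<close> against \<open>B\<close> normalised to integral 1.\<close>

lemma du_Bois_Reymond:
  assumes w: "loc_int w" and z: "\<And>\<phi>. \<phi> \<in> test_functions \<Longrightarrow> (LINT x|lborel. w x * complex_of_real (deriv \<phi> x)) = 0"
  shows "\<exists>c. AE x in lborel. w x = c"
proof -
  define B where "B = bump 0 1 1"
  define I where "I = (LINT x|lborel. B x)"
  have B: "B \<in> test_functions" unfolding B_def by (rule bump_test) simp
  have "I \<noteq> 0"
  proof
    assume "I = 0"
    hence "AE x in lborel. B x = 0" unfolding I_def
      using integral_nonneg_eq_0_iff_AE[OF test_integrable[OF B]] by (auto simp: B_def bump_bounds)
    hence "AE x in lborel. x \<notin> {0<..<1::real}"
      by eventually_elim (use bump_bounds(4)[of 1 0 _ 1] in \<open>force simp: B_def\<close>)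
    hence "emeasure lborel {0<..<1::real} = 0"
      by (subst (asm) AE_iff_measurable[of "{0<..<1::real}"]) auto
    thus False by simp
  qed
  define c where "c = (LINT x|lborel. w x * complex_of_real (B x)) / complex_of_real I"
  have iwB: "integrable lborel (\<lambda>x. w x * complex_of_real (B x))" by (rule loc_int_mult_test[OF w B])
  have "AE x in lborel. w x - c = 0"
  proof (rule fundamental_lemma)
    show "loc_int (\<lambda>x. w x - c)" by (intro loc_int_diff w loc_int_continuous) auto
    fix \<eta> assume \<eta>: "\<eta> \<in> test_functions"
    define k where "k = (LINT x|lborel. \<eta> x) / I"
    have iw\<eta>: "integrable lborel (\<lambda>x. w x * complex_of_real (\<eta> x))" by (rule loc_int_mult_test[OF w \<eta>])
    have "smooth (\<lambda>x. \<eta> x + (- k) * B x)"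
      using \<eta> B by (intro smooth_add smooth_mult smooth_const) (auto simp: test_functions_iff)
    moreover obtain R1 where R1: "R1 > 0" "\<And>x. \<eta> x \<noteq> 0 \<Longrightarrow> \<bar>x\<bar> < R1" using \<eta> test_functions_iff by blast
    moreover obtain R2 where R2: "R2 > 0" "\<And>x. B x \<noteq> 0 \<Longrightarrow> \<bar>x\<bar> < R2" using B test_functions_iff by blast
    moreover have "\<bar>x\<bar> < max R1 R2" if "\<eta> x + (- k) * B x \<noteq> 0" for x
      using that R1(2)[of x] R2(2)[of x] by (cases "\<eta> x = 0") auto
    ultimately have t: "(\<lambda>x. \<eta> x + (- k) * B x) \<in> test_functions"
      unfolding test_functions_iff by (metis less_max_iff_disj)
    have "(LINT x|lborel. \<eta> x + (- k) * B x) = 0"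
      using test_integrable[OF B] test_integrable[OF \<eta>] \<open>I \<noteq> 0\<close> by (simp add: k_def I_def)
    then obtain \<phi> where \<phi>: "\<phi> \<in> test_functions" "deriv \<phi> = (\<lambda>x. \<eta> x + (- k) * B x)"
      using test_antideriv[OF t] by auto
    have "0 = (LINT x|lborel. w x * complex_of_real (\<eta> x + (- k) * B x))"
      using z[OF \<phi>(1)] unfolding \<phi>(2) by simp
    also have "\<dots> = (LINT x|lborel. w x * complex_of_real (\<eta> x) - complex_of_real k * (w x * complex_of_real (B x)))"
      by (simp add: algebra_simps)
    also have "\<dots> = (LINT x|lborel. w x * complex_of_real (\<eta> x)) - complex_of_real k * (LINT x|lborel. w x * complex_of_real (B x))"
      using iwB iw\<eta> by simp
    finally have e: "(LINT x|lborel. w x * complex_of_real (\<eta> x)) = complex_of_real (LINT x|lborel. \<eta> x) * c"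
      using \<open>I \<noteq> 0\<close> by (simp add: k_def c_def)
    have "(LINT x|lborel. (w x - c) * complex_of_real (\<eta> x)) = (LINT x|lborel. w x * complex_of_real (\<eta> x) - complex_of_real (\<eta> x) * c)"
      by (simp add: algebra_simps)
    also have "\<dots> = (LINT x|lborel. w x * complex_of_real (\<eta> x)) - complex_of_real (LINT x|lborel. \<eta> x) * c"
      using iw\<eta> test_integrable[OF \<eta>] by simp
    finally show "(LINT x|lborel. (w x - c) * complex_of_real (\<eta> x)) = 0" using e by simp
  qed
  thus ?thesis by (intro exI[of _ c]) auto
qed

section \<open>Primitives and integration by parts\<close>

definition primitive :: "(real \<Rightarrow> complex) \<Rightarrow> (real \<Rightarrow> complex) \<Rightarrow> bool" where
  "primitive F g \<longleftrightarrow> loc_int g \<and> (\<forall>a b. a \<le> b \<longrightarrow> F b - F a = (LINT x:{a..b}|lborel. g x))"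

lemma primitive_exists: "loc_int g \<Longrightarrow> \<exists>F. primitive F g"
proof -
  assume g: "loc_int g"
  \<comment> \<open>The oriented integral from 0; set integrals carry no sign.\<close>
  define F where "F x = (if 0 \<le> x then (LINT t:{0..x}|lborel. g t) else - (LINT t:{x..0}|lborel. g t))" for x
  have sp: "(LINT t:{a..c}|lborel. g t) = (LINT t:{a..b}|lborel. g t) + (LINT t:{b..c}|lborel. g t)"
    if "a \<le> b" "b \<le> c" for a b c :: real
  proof -
    have "(LINT t:{a..b} \<union> {b..c}|lborel. g t) = (LINT t:{a..b}|lborel. g t) + (LINT t:{b..c}|lborel. g t)"
    proof (rule set_integral_Un_AE)
      show "AE x in lborel. \<not> (x \<in> {a..b} \<and> x \<in> {b..c})"
        using AE_lborel_singleton[of b] by eventually_elim auto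
    qed (use g in auto)
    moreover have "{a..b} \<union> {b..c} = {a..c}" using that by auto
    ultimately show ?thesis by simp
  qed
  have "F b - F a = (LINT x:{a..b}|lborel. g x)" if "a \<le> b" for a b
    using sp[of 0 a b] sp[of a 0 b] sp[of a b 0] that unfolding F_def by auto
  thus ?thesis using g unfolding primitive_def by blast
qed

lemma primitive_continuous: assumes "primitive F g" shows "continuous_on UNIV F"
proof -
  have g: "loc_int g" and F: "\<And>a b. a \<le> b \<Longrightarrow> F b - F a = (LINT x:{a..b}|lborel. g x)"
    using assms by (auto simp: primitive_def)
  have "continuous_on {-real N..real N} F" for N :: nat
  proof -
    have "continuous_on {-real N..real N} (\<lambda>x. integral {-real N..x} g)"
      by (intro indefinite_integral_continuous_1 set_borel_integral_eq_integral(1)) (use g in auto)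
    hence "continuous_on {-real N..real N} (\<lambda>x. F (-real N) + integral {-real N..x} g)"
      by (intro continuous_intros)
    moreover have "F (-real N) + integral {-real N..x} g = F x" if "x \<in> {-real N..real N}" for x
      using F[of "-real N" x] that set_borel_integral_eq_integral(2)[OF loc_intD(2)[OF g, of "-real N" x]]
      by (simp add: algebra_simps)
    ultimately show ?thesis by (rule continuous_on_eq)
  qed
  hence "isCont F x" for x
  proof -
    obtain N where N: "\<bar>x\<bar> < real N" using reals_Archimedean2 by blast
    have "x \<in> interior {-real N..real N}" using N by (auto simp: abs_less_iff)
    thus ?thesis using \<open>continuous_on {-real N..real N} F\<close> continuous_on_interior by blast
  qed
  thus ?thesis by (simp add: continuous_at_imp_continuous_on)
qed

text \<open>Fubini on the triangle \<open>t \<le> x\<close> inside a square beyond the supports of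
  \<open>\<phi>\<close> and its derivative: integrating over \<open>t\<close> first produces
  \<open>F x - F (-L)\<close>, integrating over \<open>x\<close> first produces
  \<open>\<phi> L - \<phi> t = - \<phi> t\<close>. The constant \<open>F (-L)\<close> drops out
  because \<open>deriv \<phi>\<close> has mean zero.\<close>

lemma primitive_parts:
  assumes F: "primitive F g" and \<phi>: "\<phi> \<in> test_functions"
  shows "(LINT x|lborel. F x * complex_of_real (deriv \<phi> x)) = - (LINT x|lborel. g x * complex_of_real (\<phi> x))"
proof -
  have g: "loc_int g" and Fg: "\<And>a b. a \<le> b \<Longrightarrow> F b - F a = (LINT x:{a..b}|lborel. g x)"
    using F by (auto simp: primitive_def)
  have [measurable]: "g \<in> borel_measurable borel" using g by auto
  obtain R where R: "R > 0" "\<And>x. \<phi> x \<noteq> 0 \<Longrightarrow> \<bar>x\<bar> < R" and sm: "smooth \<phi>"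
    using \<phi> test_functions_iff by blast
  obtain R' where R': "R' > 0" "\<And>x. deriv \<phi> x \<noteq> 0 \<Longrightarrow> \<bar>x\<bar> < R'"
    using test_deriv[OF \<phi>] test_functions_iff by blast
  define L where "L = max R R'"
  have L: "L > 0" "\<And>x. \<phi> x \<noteq> 0 \<Longrightarrow> \<bar>x\<bar> < L" "\<And>x. deriv \<phi> x \<noteq> 0 \<Longrightarrow> \<bar>x\<bar> < L"
    using R R' unfolding L_def by (auto simp: less_max_iff_disj)
  have d\<phi>: "deriv \<phi> \<in> test_functions" by (rule test_deriv[OF \<phi>])
  have [measurable]: "\<phi> \<in> borel_measurable borel" "deriv \<phi> \<in> borel_measurable borel"
    using test_measurable \<phi> d\<phi> by auto
  have ftc: "(LINT x|lborel. deriv \<phi> x * indicator {t..L} x) = \<phi> L - \<phi> t" if "t \<le> L" for t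
    by (rule integral_FTC_Icc_real) (use that sm smooth_DERIV smooth_deriv DERIV_isCont in blast)+
  have \<phi>L: "\<phi> L = 0" "\<phi> (-L) = 0" using L(2)[of L] L(2)[of "-L"] L(1) by auto
  have tot: "(LINT x|lborel. deriv \<phi> x) = 0"
  proof -
    have "(LINT x|lborel. deriv \<phi> x * indicator {-L..L} x) = (LINT x|lborel. deriv \<phi> x)"
      using L(3) by (intro Bochner_Integration.integral_cong) (force simp: indicator_def)+
    thus ?thesis using ftc[of "-L"] L(1) \<phi>L by simp
  qed
  define K where "K x t = (indicator {-L..L} x * indicator {-L..L} t * (if t \<le> x then 1 else 0)) *\<^sub>R
      (complex_of_real (deriv \<phi> x) * g t)" for x t :: real
  have Kint: "integrable (lborel \<Otimes>\<^sub>M lborel) (\<lambda>(x, t). K x t)"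
  proof (rule Bochner_Integration.integrable_bound)
    let ?H = "\<lambda>(x, t). \<bar>deriv \<phi> x\<bar> * norm (indicator {-L..L} t *\<^sub>R g t)"
    have i1: "integrable lborel (\<lambda>x. \<bar>deriv \<phi> x\<bar>)" using test_integrable[OF d\<phi>] by simp
    have i2: "integrable lborel (\<lambda>t. norm (indicat_real {-L..L} t *\<^sub>R g t))"
      using loc_intD(2)[OF g, of "-L" L] unfolding set_integrable_def by (rule integrable_norm)
    show "integrable (lborel \<Otimes>\<^sub>M lborel) ?H"
    proof (rule lborel_pair.Fubini_integrable)
      show "integrable lborel (\<lambda>x. LINT y|lborel. norm (case (x, y) of (x, t) \<Rightarrow> \<bar>deriv \<phi> x\<bar> * norm (indicat_real {- L..L} t *\<^sub>R g t)))"
        using i1 by (simp add: abs_mult)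
      show "AE x in lborel. integrable lborel (\<lambda>y. case (x, y) of (x, t) \<Rightarrow> \<bar>deriv \<phi> x\<bar> * norm (indicat_real {- L..L} t *\<^sub>R g t))"
        using i2 by simp
    qed measurable
    show "AE x in lborel \<Otimes>\<^sub>M lborel. norm (case x of (x, t) \<Rightarrow> K x t) \<le> norm (?H x)"
      by (intro AE_I2) (auto simp: K_def norm_mult indicator_def)
  qed (simp add: K_def, measurable)
  have "(LINT x|lborel. LINT t|lborel. K x t) = (LINT t|lborel. LINT x|lborel. K x t)"
    using lborel_pair.Fubini_integral[OF Kint] by simp
  also have "(LINT x|lborel. LINT t|lborel. K x t) = (LINT x|lborel. F x * complex_of_real (deriv \<phi> x) - F (-L) * complex_of_real (deriv \<phi> x))"
  proof (rule Bochner_Integration.integral_cong)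
    fix x :: real
    show "(LINT t|lborel. K x t) = F x * complex_of_real (deriv \<phi> x) - F (-L) * complex_of_real (deriv \<phi> x)"
    proof (cases "x \<in> {-L..L}")
      case True
      have "(LINT t|lborel. K x t) = (LINT t|lborel. complex_of_real (deriv \<phi> x) * (indicator {-L..x} t *\<^sub>R g t))"
        by (intro Bochner_Integration.integral_cong) (use True in \<open>auto simp: K_def indicator_def\<close>)
      also have "\<dots> = complex_of_real (deriv \<phi> x) * (LINT t:{-L..x}|lborel. g t)"
        unfolding set_lebesgue_integral_def by (rule integral_mult_right_zero)
      also have "\<dots> = complex_of_real (deriv \<phi> x) * (F x - F (-L))" using Fg[of "-L" x] True by simp
      finally show ?thesis by (simp add: algebra_simps)
    next
      case False
      thus ?thesis using L(3)[of x] by (force simp: K_def)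
    qed
  qed simp
  also have "\<dots> = (LINT x|lborel. F x * complex_of_real (deriv \<phi> x))"
    using loc_int_mult_test[OF loc_int_continuous[OF primitive_continuous[OF F]] d\<phi>] test_integrable[OF d\<phi>] tot
    by simp
  also have "(LINT t|lborel. LINT x|lborel. K x t) = (LINT t|lborel. - (g t * complex_of_real (\<phi> t)))"
  proof (rule Bochner_Integration.integral_cong)
    fix t :: real
    show "(LINT x|lborel. K x t) = - (g t * complex_of_real (\<phi> t))"
    proof (cases "t \<in> {-L..L}")
      case True
      have "(LINT x|lborel. K x t) = (LINT x|lborel. complex_of_real (deriv \<phi> x * indicator {t..L} x) * g t)"
        by (intro Bochner_Integration.integral_cong) (use True in \<open>auto simp: K_def indicator_def\<close>)
      also have "\<dots> = complex_of_real (LINT x|lborel. deriv \<phi> x * indicator {t..L} x) * g t"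
        by (subst integral_mult_left_zero, subst integral_complex_of_real) simp
      also have "\<dots> = - (g t * complex_of_real (\<phi> t))" using ftc[of t] True \<phi>L by simp
      finally show ?thesis .
    next
      case False
      thus ?thesis using L(2)[of t] by (force simp: K_def)
    qed
  qed simp
  finally show ?thesis by simp
qed

section \<open>Square integrable functions and weak derivatives\<close>

text \<open>The squared norm rather than the norm, since squares are what add up under joins and
  splittings.\<close>

definition mass :: "(real \<Rightarrow> complex) \<Rightarrow> real" where
  "mass f = (LINT x|lborel. (cmod (f x))\<^sup>2)"

lemma mass_nonneg [simp]: "0 \<le> mass f"
  by (simp add: mass_def)

lemma L2_norm_sq: "(L2_norm f)\<^sup>2 = mass f"
  by (simp add: L2_norm_def mass_def)

lemma L2_iff: "f \<in> L2 \<longleftrightarrow> f \<in> borel_measurable borel \<and> integrable lborel (\<lambda>x. (cmod (f x))\<^sup>2)"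
  by (simp add: L2_def)

lemma L2_measurable: "f \<in> L2 \<Longrightarrow> f \<in> borel_measurable borel"
  by (simp add: L2_iff)

lemma L2_integrable: "f \<in> L2 \<Longrightarrow> integrable lborel (\<lambda>x. (cmod (f x))\<^sup>2)"
  by (simp add: L2_iff)

lemma L2_bound:
  assumes "f \<in> borel_measurable borel" "integrable lborel h" "\<And>x. (cmod (f x))\<^sup>2 \<le> h x"
  shows "f \<in> L2"
proof -
  have [measurable]: "f \<in> borel_measurable borel" by fact
  have "integrable lborel (\<lambda>x. (cmod (f x))\<^sup>2)"
  proof (rule Bochner_Integration.integrable_bound[OF assms(2)])
    show "AE x in lborel. norm ((cmod (f x))\<^sup>2) \<le> norm (h x)"
      by (intro AE_I2) (use assms(3) in \<open>auto intro: order_trans[OF _ abs_ge_self]\<close>)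
  qed measurable
  thus ?thesis using assms(1) by (simp add: L2_iff)
qed

lemma cmod_add_sq: "(cmod (a + b))\<^sup>2 \<le> 2 * (cmod a)\<^sup>2 + 2 * (cmod b)\<^sup>2"
proof -
  have "(cmod (a + b))\<^sup>2 \<le> (cmod a + cmod b)\<^sup>2" by (intro power_mono norm_triangle_ineq) auto
  thus ?thesis using sum_squares_bound[of "cmod a" "cmod b"] by (simp add: power2_sum)
qed

lemma L2_add: assumes "f \<in> L2" "g \<in> L2" shows "(\<lambda>x. f x + g x) \<in> L2"
proof (rule L2_bound[where h = "\<lambda>x. 2 * (cmod (f x))\<^sup>2 + 2 * (cmod (g x))\<^sup>2"])
  have [measurable]: "f \<in> borel_measurable borel" "g \<in> borel_measurable borel" using assms L2_measurable by auto
  show "(\<lambda>x. f x + g x) \<in> borel_measurable borel" by measurable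
qed (use assms L2_integrable cmod_add_sq in auto)

lemma L2_scale: assumes "f \<in> L2" shows "(\<lambda>x. c * f x) \<in> L2"
proof (rule L2_bound[where h = "\<lambda>x. (cmod c)\<^sup>2 * (cmod (f x))\<^sup>2"])
  have [measurable]: "f \<in> borel_measurable borel" using assms L2_measurable by auto
  show "(\<lambda>x. c * f x) \<in> borel_measurable borel" by measurable
qed (use assms L2_integrable in \<open>auto simp: norm_mult power_mult_distrib\<close>)

lemma L2_diff: assumes "f \<in> L2" "g \<in> L2" shows "(\<lambda>x. f x - g x) \<in> L2"
  using L2_add[OF assms(1) L2_scale[OF assms(2), of "-1"]] by simp

lemma L2_zero [simp]: "(\<lambda>x. 0) \<in> L2"
  by (simp add: L2_iff)

lemma mass_zero [simp]: "mass (\<lambda>x. 0) = 0"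
  by (simp add: mass_def)

lemma mass_scale: "mass (\<lambda>x. c * f x) = (cmod c)\<^sup>2 * mass f"
  by (simp add: mass_def norm_mult power_mult_distrib)

lemma L2_translate: assumes "f \<in> L2" shows "(\<lambda>x. f (x + y)) \<in> L2"
proof -
  have [measurable]: "f \<in> borel_measurable borel" using assms L2_measurable by auto
  show ?thesis using lborel_integrable_real_affine[OF L2_integrable[OF assms], of 1 y]
    by (simp add: L2_iff add.commute)
qed

lemma integral_translate: "(LINT x|lborel. h (x + y)) = (LINT x|lborel. h x :: 'a::{banach, second_countable_topology})" for y :: real
  using lborel_integral_real_affine[of 1 h y] by (simp add: add.commute)

lemma mass_translate: "mass (\<lambda>x. f (x + y)) = mass f"
  unfolding mass_def by (rule integral_translate[of "\<lambda>x. (cmod (f x))\<^sup>2"])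

lemma L2_mult_integrable:
  assumes "f \<in> L2" "g \<in> L2" shows "integrable lborel (\<lambda>x. f x * g x)"
    and "integrable lborel (\<lambda>x. cmod (f x) * cmod (g x))"
proof -
  have [measurable]: "f \<in> borel_measurable borel" "g \<in> borel_measurable borel" using assms L2_measurable by auto
  have b: "cmod (f x) * cmod (g x) \<le> (cmod (f x))\<^sup>2 + (cmod (g x))\<^sup>2" for x
    using sum_squares_bound[of "cmod (f x)" "cmod (g x)"] mult_nonneg_nonneg[OF norm_ge_zero norm_ge_zero, of "f x" "g x"] by linarith
  have i: "integrable lborel (\<lambda>x. (cmod (f x))\<^sup>2 + (cmod (g x))\<^sup>2)" using assms L2_integrable by auto
  show "integrable lborel (\<lambda>x. f x * g x)"
    by (rule Bochner_Integration.integrable_bound[OF i]) (auto simp: norm_mult intro!: AE_I2 order_trans[OF b])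
  thus "integrable lborel (\<lambda>x. cmod (f x) * cmod (g x))" using integrable_norm by (fastforce simp: norm_mult)
qed

lemma Cauchy_Schwarz_L2:
  assumes "f \<in> L2" "g \<in> L2"
  shows "(LINT x|lborel. cmod (f x) * cmod (g x)) \<le> sqrt (mass f) * sqrt (mass g)"
proof -
  have [measurable]: "f \<in> borel_measurable borel" "g \<in> borel_measurable borel" using assms L2_measurable by auto
  let ?I = "LINT x|lborel. cmod (f x) * cmod (g x)"
  have I0: "?I \<ge> 0" by simp
  have e: "(\<integral>\<^sup>+x. ennreal (cmod (h x))^2 \<partial>lborel) = ennreal (mass h)" if "h \<in> L2" for h
    unfolding mass_def using nn_integral_eq_integral[OF L2_integrable[OF that]] by (simp add: ennreal_power)
  have "(\<integral>\<^sup>+x. ennreal (cmod (f x)) * ennreal (cmod (g x)) \<partial>lborel) = ennreal ?I"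
    using nn_integral_eq_integral[OF L2_mult_integrable(2)[OF assms]] by (simp add: ennreal_mult')
  hence "(ennreal ?I)\<^sup>2 \<le> ennreal (mass f) * ennreal (mass g)"
    using Cauchy_Schwarz_nn_integral[of "\<lambda>x. ennreal (cmod (f x))" lborel "\<lambda>x. ennreal (cmod (g x))"]
    by (simp add: e assms)
  hence "?I\<^sup>2 \<le> mass f * mass g" using I0 by (simp add: ennreal_power ennreal_mult'[symmetric] ennreal_le_iff)
  thus ?thesis using I0 real_le_rsqrt[of ?I "mass f * mass g"] by (simp add: real_sqrt_mult)
qed

lemma inner_L2_bound:
  assumes "f \<in> L2" "g \<in> L2"
  shows "cmod (LINT x|lborel. f x * g x) \<le> sqrt (mass f) * sqrt (mass g)"
proof -
  have "cmod (LINT x|lborel. f x * g x) \<le> (LINT x|lborel. cmod (f x * g x))" by (rule integral_norm_bound)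
  thus ?thesis using Cauchy_Schwarz_L2[OF assms] by (simp add: norm_mult)
qed

lemma L2_indicator: assumes "f \<in> L2" "A \<in> sets borel" shows "(\<lambda>x. indicator A x *\<^sub>R f x) \<in> L2"
proof (rule L2_bound[OF _ L2_integrable[OF assms(1)]])
  have [measurable]: "f \<in> borel_measurable borel" "A \<in> sets borel" using assms L2_measurable by auto
  show "(\<lambda>x. indicator A x *\<^sub>R f x) \<in> borel_measurable borel" by measurable
qed (auto simp: indicator_def)

lemma indicator_L2: "(\<lambda>x. complex_of_real (indicator {a..b} x)) \<in> L2"
proof (rule L2_bound[where h = "indicator {a..b}"])
  show "integrable lborel (indicator {a..b} :: real \<Rightarrow> real)" by (simp add: emeasure_lborel_Icc_eq)
qed (auto simp: indicator_def)

lemma L2_loc_int: assumes "f \<in> L2" shows "loc_int f"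
  unfolding loc_int_def set_integrable_def
  using L2_mult_integrable(1)[OF indicator_L2 assms] L2_measurable[OF assms] by (auto simp: scaleR_conv_of_real)

text \<open>Cauchy-Schwarz against the indicator of the interval. Hoelder continuity, the sup
  bounds, the Jensen inequality for dyadic averages and the energy gained by a chord all rest on
  this estimate.\<close>

lemma interval_bound:
  assumes "g \<in> L2" "a \<le> b"
  shows "(cmod (LINT x:{a..b}|lborel. g x))\<^sup>2 \<le> (b - a) * (LINT x:{a..b}|lborel. (cmod (g x))\<^sup>2)"
proof -
  let ?i = "\<lambda>x. complex_of_real (indicator {a..b} x)" and ?g = "\<lambda>x. indicator {a..b} x *\<^sub>R g x"
  have g: "?g \<in> L2" by (intro L2_indicator assms) auto
  have Ni: "mass ?i = b - a"
  proof -
    have "(cmod (?i x))\<^sup>2 = indicator {a..b} x" for x by (auto simp: indicator_def)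
    thus ?thesis unfolding mass_def using assms by simp
  qed
  have Ng: "mass ?g = (LINT x:{a..b}|lborel. (cmod (g x))\<^sup>2)"
    unfolding mass_def set_lebesgue_integral_def by (intro Bochner_Integration.integral_cong) (auto simp: indicator_def)
  have "(LINT x:{a..b}|lborel. g x) = (LINT x|lborel. ?i x * ?g x)"
    unfolding set_lebesgue_integral_def by (intro Bochner_Integration.integral_cong) (auto simp: indicator_def)
  hence "cmod (LINT x:{a..b}|lborel. g x) \<le> sqrt (mass ?i) * sqrt (mass ?g)"
    using inner_L2_bound[OF indicator_L2[of a b] g] by simp
  hence "(cmod (LINT x:{a..b}|lborel. g x))\<^sup>2 \<le> (sqrt (mass ?i) * sqrt (mass ?g))\<^sup>2" by (intro power_mono) auto
  also have "\<dots> = mass ?i * mass ?g" by (simp add: power_mult_distrib)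
  finally show ?thesis by (simp add: Ni Ng)
qed

lemma set_integral_le_mass:
  assumes "g \<in> L2" "A \<in> sets borel" shows "(LINT x:A|lborel. (cmod (g x))\<^sup>2) \<le> mass g"
  unfolding mass_def set_lebesgue_integral_def
proof (rule integral_mono_AE)
  show "integrable lborel (\<lambda>x. indicat_real A x *\<^sub>R (cmod (g x))\<^sup>2)"
    by (rule integrable_mult_indicator) (use assms L2_integrable in auto)
qed (use assms L2_integrable in \<open>auto simp: indicator_def\<close>)

text \<open>The function \<open>f\<close> is then the continuous representative of its class in \<open>H\<^sup>1\<close>, with weak derivative \<open>g\<close>.\<close>
definition H1_pair :: "(real \<Rightarrow> complex) \<Rightarrow> (real \<Rightarrow> complex) \<Rightarrow> bool" where
  "H1_pair f g \<longleftrightarrow> f \<in> L2 \<and> g \<in> L2 \<and> (\<forall>a b. a \<le> b \<longrightarrow> f b - f a = (LINT x:{a..b}|lborel. g x))"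

lemma H1_pair_L2: "H1_pair f g \<Longrightarrow> f \<in> L2" "H1_pair f g \<Longrightarrow> g \<in> L2"
  by (auto simp: H1_pair_def)

lemma H1_pair_measurable: "H1_pair f g \<Longrightarrow> f \<in> borel_measurable borel" "H1_pair f g \<Longrightarrow> g \<in> borel_measurable borel"
  using H1_pair_L2 L2_measurable by auto

lemma H1_pair_primitive: "H1_pair f g \<Longrightarrow> primitive f g"
  using L2_loc_int by (auto simp: H1_pair_def primitive_def)

lemma H1_pair_continuous: "H1_pair f g \<Longrightarrow> continuous_on UNIV f"
  using H1_pair_primitive primitive_continuous by blast

lemma H1_pair_diff_eq: "H1_pair f g \<Longrightarrow> a \<le> b \<Longrightarrow> f b - f a = (LINT x:{a..b}|lborel. g x)"
  by (simp add: H1_pair_def)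

lemma H1_pair_cong_AE: assumes "H1_pair f g" "AE x in lborel. g x = h x" "h \<in> L2" shows "H1_pair f h"
proof -
  have "(LINT x:{a..b}|lborel. g x) = (LINT x:{a..b}|lborel. h x)" for a b
    unfolding set_lebesgue_integral_def
  proof (rule integral_cong_AE)
    have [measurable]: "g \<in> borel_measurable borel" "h \<in> borel_measurable borel" using assms H1_pair_L2 L2_measurable by auto
    show "(\<lambda>x. indicat_real {a..b} x *\<^sub>R g x) \<in> borel_measurable lborel" "(\<lambda>x. indicat_real {a..b} x *\<^sub>R h x) \<in> borel_measurable lborel"
      by measurable
  qed (use assms(2) in auto)
  thus ?thesis using assms by (simp add: H1_pair_def)
qed

lemma mass_cong_AE:
  assumes "AE x in lborel. f x = h x" "f \<in> borel_measurable borel" "h \<in> borel_measurable borel"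
  shows "mass f = mass h"
  unfolding mass_def
proof (rule integral_cong_AE)
  have [measurable]: "f \<in> borel_measurable borel" "h \<in> borel_measurable borel" by fact+
  show "(\<lambda>x. (cmod (f x))\<^sup>2) \<in> borel_measurable lborel" "(\<lambda>x. (cmod (h x))\<^sup>2) \<in> borel_measurable lborel"
    by measurable
qed (use assms in auto)

section \<open>Weak derivatives and continuous representatives\<close>

lemma weak_deriv_unique:
  assumes "has_weak_deriv f g" "has_weak_deriv f h" "loc_int g" "loc_int h"
  shows "AE x in lborel. g x = h x"
proof -
  have "AE x in lborel. g x - h x = 0"
  proof (rule fundamental_lemma)
    show "loc_int (\<lambda>x. g x - h x)" by (intro loc_int_diff assms)
    fix \<eta> assume t: "\<eta> \<in> test_functions"
    have "(LINT x|lborel. g x * complex_of_real (\<eta> x)) = (LINT x|lborel. h x * complex_of_real (\<eta> x))"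
      using assms t by (auto simp: has_weak_deriv_def)
    thus "(LINT x|lborel. (g x - h x) * complex_of_real (\<eta> x)) = 0"
      using loc_int_mult_test[OF assms(3) t] loc_int_mult_test[OF assms(4) t] by (simp add: algebra_simps)
  qed
  thus ?thesis by simp
qed

lemma H1_pair_has_weak_deriv: "H1_pair f g \<Longrightarrow> has_weak_deriv f g"
  using primitive_parts H1_pair_primitive unfolding has_weak_deriv_def by blast

lemma H1_pair_H1: "H1_pair f g \<Longrightarrow> f \<in> H1"
  using H1_pair_has_weak_deriv H1_pair_L2 unfolding H1_def by blast

lemma H1_weak_deriv: assumes "f \<in> H1" shows "weak_deriv f \<in> L2" "has_weak_deriv f (weak_deriv f)"
  using assms someI_ex[of "\<lambda>g. g \<in> L2 \<and> has_weak_deriv f g"] by (auto simp: H1_def weak_deriv_def)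

lemma H1_pair_weak_deriv_AE: assumes "H1_pair f g" shows "AE x in lborel. weak_deriv f x = g x"
  by (rule weak_deriv_unique[OF H1_weak_deriv(2)[OF H1_pair_H1[OF assms]] H1_pair_has_weak_deriv[OF assms]
        L2_loc_int[OF H1_weak_deriv(1)[OF H1_pair_H1[OF assms]]] L2_loc_int[OF H1_pair_L2(2)[OF assms]]])

lemma H1_pair_unique: assumes "H1_pair f g" "H1_pair f h" shows "AE x in lborel. g x = h x"
  by (rule weak_deriv_unique[OF assms[THEN H1_pair_has_weak_deriv] assms[THEN H1_pair_L2(2), THEN L2_loc_int]])

lemma H1_pair_weak_deriv: assumes "H1_pair f g" shows "H1_pair f (weak_deriv f)"
proof (rule H1_pair_cong_AE[OF assms _ H1_weak_deriv(1)[OF H1_pair_H1[OF assms]]])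
  show "AE x in lborel. g x = weak_deriv f x" using H1_pair_weak_deriv_AE[OF assms] by eventually_elim simp
qed

lemma mass_weak_deriv: assumes "H1_pair f g" shows "mass (weak_deriv f) = mass g"
  by (rule mass_cong_AE[OF H1_pair_weak_deriv_AE[OF assms]])
    (use H1_pair_measurable[OF assms] H1_pair_measurable[OF H1_pair_weak_deriv[OF assms]] in auto)

text \<open>An honest equality of functions: both sides have the same weak derivatives, so the
  choice operator picks the same one.\<close>

lemma weak_deriv_cong_AE:
  assumes "AE x in lborel. f x = h x" "f \<in> borel_measurable borel" "h \<in> borel_measurable borel"
  shows "weak_deriv f = weak_deriv h"
proof -
  have "has_weak_deriv f g \<longleftrightarrow> has_weak_deriv h g" for g
  proof -
    have "(LINT x|lborel. f x * complex_of_real (deriv \<phi> x)) = (LINT x|lborel. h x * complex_of_real (deriv \<phi> x))"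
      if "\<phi> \<in> test_functions" for \<phi>
    proof (rule integral_cong_AE)
      have [measurable]: "f \<in> borel_measurable borel" "h \<in> borel_measurable borel" "deriv \<phi> \<in> borel_measurable borel"
        using assms test_measurable test_deriv that by auto
      show "(\<lambda>x. f x * complex_of_real (deriv \<phi> x)) \<in> borel_measurable lborel" "(\<lambda>x. h x * complex_of_real (deriv \<phi> x)) \<in> borel_measurable lborel"
        by measurable
    qed (use assms in auto)
    thus ?thesis by (simp add: has_weak_deriv_def)
  qed
  thus ?thesis by (simp add: weak_deriv_def)
qed

text \<open>A primitive of the weak derivative is continuous, and its difference from
  \<open>f\<close> annihilates all derivatives of test functions; hence the difference is a
  constant, and adding it to the primitive gives the representative.\<close>

lemma H1_continuous_rep:
  assumes "f \<in> H1"
  shows "\<exists>h. H1_pair h (weak_deriv f) \<and> (AE x in lborel. f x = h x)"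
proof -
  have f: "f \<in> L2" and g: "weak_deriv f \<in> L2" "has_weak_deriv f (weak_deriv f)"
    using assms H1_weak_deriv by (auto simp: H1_def)
  obtain F where F: "primitive F (weak_deriv f)" using primitive_exists[OF L2_loc_int[OF g(1)]] by blast
  have lF: "loc_int F" using loc_int_continuous primitive_continuous[OF F] by blast
  have "\<exists>c. AE x in lborel. f x - F x = c"
  proof (rule du_Bois_Reymond)
    show "loc_int (\<lambda>x. f x - F x)" by (intro loc_int_diff L2_loc_int f lF)
    fix \<phi> assume t: "\<phi> \<in> test_functions"
    have "(LINT x|lborel. f x * complex_of_real (deriv \<phi> x)) = (LINT x|lborel. F x * complex_of_real (deriv \<phi> x))"
      using primitive_parts[OF F t] g(2) t by (simp add: has_weak_deriv_def)
    thus "(LINT x|lborel. (f x - F x) * complex_of_real (deriv \<phi> x)) = 0"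
      using loc_int_mult_test[OF lF test_deriv[OF t]] loc_int_mult_test[OF L2_loc_int[OF f] test_deriv[OF t]]
      by (simp add: algebra_simps)
  qed
  then obtain c where c: "AE x in lborel. f x - F x = c" by blast
  define h where "h x = F x + c" for x
  have fh: "AE x in lborel. f x = h x" using c by eventually_elim (auto simp: h_def)
  have hm: "h \<in> borel_measurable borel" unfolding h_def using loc_intD(1)[OF lF] by measurable
  have "integrable lborel (\<lambda>x. (cmod (h x))\<^sup>2)"
  proof (subst integrable_cong_AE)
    show "AE x in lborel. (cmod (h x))\<^sup>2 = (cmod (f x))\<^sup>2" using fh by eventually_elim auto
    show "integrable lborel (\<lambda>x. (cmod (f x))\<^sup>2)" by (rule L2_integrable[OF f])
  qed (use hm L2_measurable[OF f] in measurable)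
  hence "h \<in> L2" using hm by (simp add: L2_iff)
  hence "H1_pair h (weak_deriv f)" using F g(1) by (simp add: H1_pair_def primitive_def h_def)
  thus ?thesis using fh by blast
qed

lemma H1_pair_add: assumes "H1_pair f g" "H1_pair f' g'" shows "H1_pair (\<lambda>x. f x + f' x) (\<lambda>x. g x + g' x)"
proof -
  have "(LINT x:{a..b}|lborel. g x + g' x) = (LINT x:{a..b}|lborel. g x) + (LINT x:{a..b}|lborel. g' x)" for a b
    using assms by (intro set_integral_add loc_intD(2) L2_loc_int H1_pair_L2)
  thus ?thesis using assms by (auto simp: H1_pair_def L2_add algebra_simps)
qed

lemma H1_pair_scale: assumes "H1_pair f g" shows "H1_pair (\<lambda>x. c * f x) (\<lambda>x. c * g x)"
  using assms by (auto simp: H1_pair_def L2_scale right_diff_distrib[symmetric])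

lemma H1_pair_diff: assumes "H1_pair f g" "H1_pair f' g'" shows "H1_pair (\<lambda>x. f x - f' x) (\<lambda>x. g x - g' x)"
  using H1_pair_add[OF assms(1) H1_pair_scale[OF assms(2), of "-1"]] by simp

lemma H1_pair_zero: "H1_pair (\<lambda>x. 0) (\<lambda>x. 0)"
  by (simp add: H1_pair_def)

lemma H1_pair_translate: assumes "H1_pair f g" shows "H1_pair (\<lambda>x. f (x + y)) (\<lambda>x. g (x + y))"
proof -
  have "(LINT x:{a..b}|lborel. g (x + y)) = (LINT x:{a+y..b+y}|lborel. g x)" for a b
  proof -
    have "(LINT x:{a..b}|lborel. g (x + y)) = (LINT x|lborel. (\<lambda>x. indicator {a+y..b+y} x *\<^sub>R g x) (x + y))"
      unfolding set_lebesgue_integral_def by (intro Bochner_Integration.integral_cong) (auto simp: indicator_def)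
    thus ?thesis using integral_translate[of "\<lambda>x. indicator {a+y..b+y} x *\<^sub>R g x" y]
      by (simp add: set_lebesgue_integral_def)
  qed
  thus ?thesis using assms by (auto simp: H1_pair_def L2_translate)
qed

section \<open>Pointwise bounds\<close>

lemma H1_pair_Holder: assumes "H1_pair f g" shows "(cmod (f b - f a))\<^sup>2 \<le> \<bar>b - a\<bar> * mass g"
proof -
  have *: "(cmod (f b - f a))\<^sup>2 \<le> (b - a) * mass g" if "a \<le> b" for a b
  proof -
    have "(cmod (f b - f a))\<^sup>2 \<le> (b - a) * (LINT x:{a..b}|lborel. (cmod (g x))\<^sup>2)"
      using interval_bound[OF H1_pair_L2(2)[OF assms] that] H1_pair_diff_eq[OF assms that] by simp
    also have "\<dots> \<le> (b - a) * mass g" using that by (intro mult_left_mono set_integral_le_mass H1_pair_L2(2)[OF assms]) auto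
    finally show ?thesis .
  qed
  show ?thesis using *[of a b] *[of b a] by (cases "a \<le> b") (auto simp: norm_minus_commute)
qed

text \<open>The value at \<open>x\<close> is compared by Hoelder continuity with all values on
  \<open>{x..x+l}\<close> and then averaged. The length \<open>l\<close> stays free:
  \<open>l = 1\<close> gives the plain sup bound, and a length adapted to the Dirichlet energy gives
  the interpolation behind coercivity.\<close>

lemma H1_pair_sup_bound: assumes "H1_pair f g" "l > 0" shows "(cmod (f x))\<^sup>2 \<le> 2 / l * mass f + 2 * l * mass g"
proof -
  have "l * (cmod (f x))\<^sup>2 = (LINT t:{x..x+l}|lborel. (cmod (f x))\<^sup>2)"
    using assms by (simp add: set_lebesgue_integral_def)
  also have "\<dots> \<le> (LINT t:{x..x+l}|lborel. 2 * (cmod (f t))\<^sup>2 + 2 * l * mass g)"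
  proof (rule set_integral_mono)
    show "set_integrable lborel {x..x + l} (\<lambda>t. 2 * (cmod (f t))\<^sup>2 + 2 * l * mass g)"
      unfolding set_integrable_def using assms H1_pair_continuous
      by (intro borel_integrable_compact continuous_intros) (auto intro: continuous_on_subset)
    fix t assume t: "t \<in> {x..x+l}"
    have "(cmod (f x))\<^sup>2 \<le> 2 * (cmod (f t))\<^sup>2 + 2 * (cmod (f x - f t))\<^sup>2"
      using cmod_add_sq[of "f t" "f x - f t"] by simp
    also have "(cmod (f x - f t))\<^sup>2 \<le> \<bar>x - t\<bar> * mass g" by (rule H1_pair_Holder[OF assms(1)])
    also have "\<dots> \<le> l * mass g" using t by (intro mult_right_mono) auto
    finally show "(cmod (f x))\<^sup>2 \<le> 2 * (cmod (f t))\<^sup>2 + 2 * l * mass g" by simp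
  qed (simp add: set_integrable_def emeasure_lborel_Icc_eq)
  also have "\<dots> = 2 * (LINT t:{x..x+l}|lborel. (cmod (f t))\<^sup>2) + l * (2 * l * mass g)"
  proof -
    have i: "set_integrable lborel {x..x+l} (\<lambda>t. (cmod (f t))\<^sup>2)"
      unfolding set_integrable_def
      by (rule integrable_mult_indicator[OF _ L2_integrable[OF H1_pair_L2(1)[OF assms(1)]]]) simp
    have i2: "set_integrable lborel {x..x+l} (\<lambda>t. 2 * (cmod (f t))\<^sup>2)" using i by simp
    have i3: "set_integrable lborel {x..x+l} (\<lambda>t. 2 * l * mass g)"
      by (simp add: set_integrable_def emeasure_lborel_Icc_eq)
    have "(LINT t:{x..x+l}|lborel. 2 * (cmod (f t))\<^sup>2 + 2 * l * mass g) =
        2 * (LINT t:{x..x+l}|lborel. (cmod (f t))\<^sup>2) + (LINT t:{x..x+l}|lborel. 2 * l * mass g)"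
      by (simp only: set_integral_add(2)[OF i2 i3] set_integral_mult_right)
    thus ?thesis using assms by (simp add: set_lebesgue_integral_def)
  qed
  also have "\<dots> \<le> 2 * mass f + l * (2 * l * mass g)"
    using set_integral_le_mass[OF H1_pair_L2(1)[OF assms(1)], of "{x..x+l}"] by simp
  finally have "l * (cmod (f x))\<^sup>2 \<le> 2 * mass f + l * (2 * l * mass g)" .
  hence "(cmod (f x))\<^sup>2 \<le> (2 * mass f + l * (2 * l * mass g)) / l" using assms(2) by (simp add: field_simps)
  also have "\<dots> = 2 / l * mass f + 2 * l * mass g" using assms(2) by (simp add: field_simps)
  finally show ?thesis .
qed

section \<open>Fatou's lemma and completeness of the square integrable functions\<close>

lemma nn_integral_mass: "f \<in> L2 \<Longrightarrow> (\<integral>\<^sup>+x. ennreal ((cmod (f x))\<^sup>2) \<partial>lborel) = ennreal (mass f)"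
  unfolding mass_def by (rule nn_integral_eq_integral[OF L2_integrable]) auto

lemma L2_nn_integral:
  assumes [measurable]: "f \<in> borel_measurable borel"
    and "(\<integral>\<^sup>+x. ennreal ((cmod (f x))\<^sup>2) \<partial>lborel) \<le> ennreal C" "0 \<le> C"
  shows "f \<in> L2" "mass f \<le> C"
proof -
  have "integrable lborel (\<lambda>x. (cmod (f x))\<^sup>2)"
  proof (rule integrableI_bounded)
    show "(\<integral>\<^sup>+ x. ennreal (norm ((cmod (f x))\<^sup>2)) \<partial>lborel) < \<infinity>"
      using assms(2) by (simp add: le_less_trans)
  qed measurable
  thus "f \<in> L2" by (simp add: L2_iff)
  from nn_integral_mass[OF this] show "mass f \<le> C" using assms(2,3) by (simp add: ennreal_le_iff)
qed

lemma Fatou_mass: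
  assumes "\<And>n. f n \<in> L2" "\<And>n. mass (f n) \<le> C" "0 \<le> C" "g \<in> borel_measurable borel"
    "AE x in lborel. (\<lambda>n. f n x) \<longlonglongrightarrow> g x"
  shows "g \<in> L2" "mass g \<le> C"
proof -
  have [measurable]: "f n \<in> borel_measurable borel" for n using assms L2_measurable by auto
  have "(\<integral>\<^sup>+x. ennreal ((cmod (g x))\<^sup>2) \<partial>lborel) = (\<integral>\<^sup>+x. liminf (\<lambda>n. ennreal ((cmod (f n x))\<^sup>2)) \<partial>lborel)"
  proof (rule nn_integral_cong_AE)
    show "AE x in lborel. ennreal ((cmod (g x))\<^sup>2) = liminf (\<lambda>n. ennreal ((cmod (f n x))\<^sup>2))"
      using assms(5)
    proof eventually_elim
      case (elim x)
      have "(\<lambda>n. ennreal ((cmod (f n x))\<^sup>2)) \<longlonglongrightarrow> ennreal ((cmod (g x))\<^sup>2)"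
        using elim by (intro tendsto_intros)
      thus ?case by (rule lim_imp_Liminf[OF trivial_limit_sequentially, symmetric])
    qed
  qed
  also have "\<dots> \<le> liminf (\<lambda>n. \<integral>\<^sup>+x. ennreal ((cmod (f n x))\<^sup>2) \<partial>lborel)"
    by (rule nn_integral_liminf) measurable
  also have "\<dots> \<le> liminf (\<lambda>n::nat. ennreal C)"
    by (intro Liminf_mono always_eventually allI) (auto simp: nn_integral_mass[OF assms(1)] intro!: ennreal_leI assms)
  also have "\<dots> = ennreal C" by (simp add: Liminf_const)
  finally have *: "(\<integral>\<^sup>+x. ennreal ((cmod (g x))\<^sup>2) \<partial>lborel) \<le> ennreal C" .
  show "g \<in> L2" "mass g \<le> C" using L2_nn_integral[OF assms(4) * assms(3)] by auto
qed

lemma L2_cnj: assumes "f \<in> L2" shows "(\<lambda>x. cnj (f x)) \<in> L2"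
proof -
  have "(\<lambda>x. cnj (f x)) \<in> borel_measurable borel"
    by (rule measurable_compose[OF L2_measurable[OF assms]])
      (intro borel_measurable_continuous_onI continuous_intros)
  thus ?thesis using assms by (simp add: L2_iff)
qed

lemma mass_diff_expand:
  assumes "f \<in> L2" "g \<in> L2"
  shows "mass (\<lambda>x. f x - g x) = mass f - 2 * Re (LINT x|lborel. f x * cnj (g x)) + mass g"
proof -
  note g' = L2_cnj[OF assms(2)]
  note i = L2_mult_integrable(1)[OF assms(1) g']
  have "mass (\<lambda>x. f x - g x) = (LINT x|lborel. (cmod (f x))\<^sup>2 - 2 * Re (f x * cnj (g x)) + (cmod (g x))\<^sup>2)"
    unfolding mass_def by (intro Bochner_Integration.integral_cong) (auto simp: cmod_power2 power2_diff algebra_simps)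
  also have "\<dots> = mass f - 2 * (LINT x|lborel. Re (f x * cnj (g x))) + mass g"
    unfolding mass_def
    by (simp only: Bochner_Integration.integral_add Bochner_Integration.integral_diff integral_mult_right_zero
        Bochner_Integration.integrable_diff integrable_mult_right
        L2_integrable[OF assms(1)] L2_integrable[OF assms(2)] integrable_Re[OF i])
  also have "(LINT x|lborel. Re (f x * cnj (g x))) = Re (LINT x|lborel. f x * cnj (g x))"
    by (rule integral_Re[OF i])
  finally show ?thesis .
qed

lemma mass_cnj: "mass (\<lambda>x. cnj (f x)) = mass f"
  by (simp add: mass_def)

text \<open>Riesz-Fischer: a subsequence with summable increments converges almost everywhere, and
  Fatou's lemma turns the Cauchy estimates into convergence in mean square.\<close>

lemma L2_complete:
  assumes g: "\<And>n. g n \<in> L2"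
    and cau: "\<And>e. e > 0 \<Longrightarrow> \<exists>M. \<forall>m\<ge>M. \<forall>n\<ge>M. mass (\<lambda>x. g m x - g n x) \<le> e"
  shows "\<exists>h\<in>L2. (\<lambda>n. mass (\<lambda>x. g n x - h x)) \<longlonglongrightarrow> 0"
proof -
  have gm [measurable]: "g n \<in> borel_measurable borel" for n using g L2_measurable by auto
  \<comment> \<open>The tolerance \<open>(1/4)^k\<close> for the squared norm makes the norms of the
    increments at most \<open>(1/2)^k\<close>, which is summable.\<close>
  have "\<exists>M. \<forall>k::nat. \<forall>m\<ge>M k. \<forall>n\<ge>M k. mass (\<lambda>x. g m x - g n x) \<le> (1/4)^k"
    by (intro choice allI cau) simp
  then obtain M where M: "\<And>k m n. m \<ge> M k \<Longrightarrow> n \<ge> M k \<Longrightarrow> mass (\<lambda>x. g m x - g n x) \<le> (1/4)^k" by blast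
  \<comment> \<open>Partial sums are monotone and at least as large as every earlier
    \<open>M i\<close>, so the Cauchy bound of level \<open>k\<close> holds for all later
    indices.\<close>
  define r where "r k = (\<Sum>i\<le>k. M i)" for k
  have r1: "r k \<ge> M k" for k unfolding r_def by (rule member_le_sum) auto
  have r2: "r (Suc k) \<ge> M k" for k using r1[of k] by (simp add: r_def)
  define d where "d k x = g (r (Suc k)) x - g (r k) x" for k x
  have dL: "d k \<in> L2" for k unfolding d_def by (intro L2_diff g)
  have [measurable]: "d k \<in> borel_measurable borel" for k using dL L2_measurable by auto
  have Nd: "sqrt (mass (d k)) \<le> (1/2)^k" for k
  proof -
    have "mass (d k) \<le> (1/4)^k" unfolding d_def by (intro M r1 r2)
    also have "(1/4::real)^k = ((1/2)^k)\<^sup>2" by (simp add: power2_eq_square power_mult_distrib[symmetric])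
    finally show ?thesis using real_sqrt_le_mono real_le_lsqrt by (metis divide_nonneg_nonneg zero_le_one zero_le_numeral zero_le_power mass_nonneg)
  qed
  \<comment> \<open>Square integrability on the line does not control the integral of the modulus,
    so the increments are summed on \<open>{-R..R}\<close>, by Cauchy-Schwarz with the
    indicator.\<close>
  have loc: "AE x in lborel. x \<in> {-real R..real R} \<longrightarrow> summable (\<lambda>k. cmod (d k x))" for R :: nat
  proof -
    let ?I = "\<lambda>x. complex_of_real (indicator {-real R..real R} x)"
    have b: "(\<integral>\<^sup>+x. ennreal (cmod (?I x) * cmod (d k x)) \<partial>lborel) \<le> ennreal (sqrt (mass ?I) * (1/2)^k)" for k
    proof -
      have "(\<integral>\<^sup>+x. ennreal (cmod (?I x) * cmod (d k x)) \<partial>lborel) = ennreal (LINT x|lborel. cmod (?I x) * cmod (d k x))"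
        by (rule nn_integral_eq_integral[OF L2_mult_integrable(2)[OF indicator_L2 dL]]) auto
      also have "\<dots> \<le> ennreal (sqrt (mass ?I) * (1/2)^k)"
        using Cauchy_Schwarz_L2[OF indicator_L2 dL] mult_left_mono[OF Nd[of k], of "sqrt (mass ?I)"]
        by (intro ennreal_leI) (force intro: order_trans)
      finally show ?thesis .
    qed
    have "(\<integral>\<^sup>+x. (\<Sum>k. ennreal (cmod (?I x) * cmod (d k x))) \<partial>lborel) = (\<Sum>k. \<integral>\<^sup>+x. ennreal (cmod (?I x) * cmod (d k x)) \<partial>lborel)"
      by (rule nn_integral_suminf) measurable
    also have "\<dots> \<le> (\<Sum>k. ennreal (sqrt (mass ?I) * (1/2)^k))" by (intro suminf_le b) auto
    also have "\<dots> = ennreal (\<Sum>k. sqrt (mass ?I) * (1/2)^k)"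
      by (rule suminf_ennreal2) (auto intro!: summable_mult summable_geometric)
    also have "\<dots> < \<infinity>" by simp
    finally have "AE x in lborel. (\<Sum>k. ennreal (cmod (?I x) * cmod (d k x))) \<noteq> \<infinity>"
      by (intro nn_integral_noteq_infinite) auto
    thus ?thesis
    proof eventually_elim
      case (elim x)
      show ?case
      proof
        assume "x \<in> {-real R..real R}"
        thus "summable (\<lambda>k. cmod (d k x))" using elim by (intro summable_suminf_not_top) auto
      qed
    qed
  qed
  hence "AE x in lborel. \<forall>R::nat. x \<in> {-real R..real R} \<longrightarrow> summable (\<lambda>k. cmod (d k x))"
    unfolding AE_all_countable by blast
  hence conv: "AE x in lborel. convergent (\<lambda>k. g (r k) x)"
  proof eventually_elim
    case (elim x)
    obtain R :: nat where "\<bar>x\<bar> \<le> real R" using real_arch_simple by blast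
    hence "summable (\<lambda>k. d k x)" using elim summable_norm_cancel by (metis abs_le_iff atLeastAtMost_iff minus_le_iff)
    hence "(\<lambda>n. \<Sum>k<n. d k x) \<longlonglongrightarrow> suminf (\<lambda>k. d k x)" by (rule summable_LIMSEQ)
    hence "(\<lambda>n. (\<Sum>k<n. d k x) + g (r 0) x) \<longlonglongrightarrow> suminf (\<lambda>k. d k x) + g (r 0) x" by (intro tendsto_intros)
    moreover have "(\<Sum>k<n. d k x) + g (r 0) x = g (r n) x" for n
      using sum_lessThan_telescope[of "\<lambda>k. g (r k) x" n] by (simp add: d_def)
    ultimately show ?case by (auto simp: convergent_def)
  qed
  define h where "h x = lim (\<lambda>k. g (r k) x)" for x
  have hm [measurable]: "h \<in> borel_measurable borel" unfolding h_def by measurable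
  have lim: "AE x in lborel. (\<lambda>k. g (r k) x) \<longlonglongrightarrow> h x"
    using conv by eventually_elim (simp add: h_def convergent_LIMSEQ_iff)
  \<comment> \<open>Fatou's lemma in the first index of the Cauchy bound, along the subsequence,
    with the second index \<open>n\<close> kept fixed.\<close>
  have key: "(\<lambda>x. h x - g n x) \<in> L2 \<and> mass (\<lambda>x. h x - g n x) \<le> (1/4)^k" if "n \<ge> M k" for n k
  proof -
    let ?f = "\<lambda>j x. g (r (j + k)) x - g n x"
    have rk: "r (j + k) \<ge> M k" for j
    proof -
      have "r k \<le> r (j + k)" unfolding r_def by (rule sum_mono2) auto
      thus ?thesis using r1[of k] by linarith
    qed
    have 1: "?f j \<in> L2" for j by (intro L2_diff g)
    have 2: "mass (?f j) \<le> (1/4)^k" for j by (intro M rk that)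
    have 3: "AE x in lborel. (\<lambda>j. ?f j x) \<longlonglongrightarrow> h x - g n x"
      using lim
    proof eventually_elim
      case (elim x) thus ?case using LIMSEQ_ignore_initial_segment[OF elim, of k] by (intro tendsto_intros)
    qed
    have 4: "(\<lambda>x. h x - g n x) \<in> borel_measurable borel" by measurable
    show ?thesis using Fatou_mass[where f = ?f, OF 1 2 _ 4 3] by simp
  qed
  have hL: "h \<in> L2" using L2_add[OF g[of "M 0"] conjunct1[OF key[of 0 "M 0"]]] by simp
  have "(\<lambda>n. mass (\<lambda>x. g n x - h x)) \<longlonglongrightarrow> 0"
  proof (rule LIMSEQ_I)
    fix e :: real assume "e > 0"
    then obtain k where k: "(1/4::real)^k < e" using real_arch_pow_inv[of e "1/4"] by auto
    have "norm (mass (\<lambda>x. g n x - h x) - 0) < e" if "n \<ge> M k" for n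
    proof -
      have "mass (\<lambda>x. g n x - h x) = mass (\<lambda>x. h x - g n x)" by (simp add: mass_def norm_minus_commute)
      thus ?thesis using key[OF that] k by simp
    qed
    thus "\<exists>no. \<forall>n\<ge>no. norm (mass (\<lambda>x. g n x - h x) - 0) < e" by blast
  qed
  thus ?thesis using hL by blast
qed

section \<open>Dyadic difference quotients\<close>

text \<open>\<open>cell_lo\<close> and \<open>cell_hi\<close> are the end points of the half-open
  dyadic cell of length \<open>1 / 2 ^ n\<close> that contains \<open>x\<close>.\<close>

definition cell_lo :: "nat \<Rightarrow> real \<Rightarrow> real" where "cell_lo n x = of_int \<lfloor>2 ^ n * x\<rfloor> / 2 ^ n"
definition cell_hi :: "nat \<Rightarrow> real \<Rightarrow> real" where "cell_hi n x = (of_int \<lfloor>2 ^ n * x\<rfloor> + 1) / 2 ^ n"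

text \<open>Averaging over the dyadic cells of length \<open>2\<^sup>-\<^sup>n\<close> is written as an integral against a symmetric
  kernel, so that Fubini's theorem replaces sums over cells.\<close>
definition cell_kernel :: "nat \<Rightarrow> real \<Rightarrow> real \<Rightarrow> real" where
  "cell_kernel n x t = (if \<lfloor>2 ^ n * t\<rfloor> = \<lfloor>2 ^ n * x\<rfloor> then 2 ^ n else 0)"

definition dyadic_avg :: "nat \<Rightarrow> (real \<Rightarrow> complex) \<Rightarrow> real \<Rightarrow> complex" where
  "dyadic_avg n a x = (LINT t|lborel. cell_kernel n x t *\<^sub>R a t)"

definition dyadic_diff :: "nat \<Rightarrow> (real \<Rightarrow> complex) \<Rightarrow> real \<Rightarrow> complex" where
  "dyadic_diff n f x = 2 ^ n * (f (cell_hi n x) - f (cell_lo n x))"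

lemma cell_lo_le: "cell_lo n x \<le> x" "x < cell_hi n x" "cell_lo n x \<le> cell_hi n x" "cell_hi n x = cell_lo n x + 1 / 2 ^ n"
proof -
  have "of_int \<lfloor>2 ^ n * x\<rfloor> \<le> 2 ^ n * x" "2 ^ n * x < of_int \<lfloor>2 ^ n * x\<rfloor> + 1" by linarith+
  thus "cell_lo n x \<le> x" "x < cell_hi n x" by (simp_all add: cell_lo_def cell_hi_def field_simps)
  thus "cell_lo n x \<le> cell_hi n x" by simp
  show "cell_hi n x = cell_lo n x + 1 / 2 ^ n" by (simp add: cell_lo_def cell_hi_def add_divide_distrib)
qed

lemma cell_lo_mono: "x \<le> y \<Longrightarrow> cell_lo n x \<le> cell_lo n y"
  by (simp add: cell_lo_def divide_right_mono floor_mono)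

lemma cell_lo_tendsto: "(\<lambda>n. cell_lo n x) \<longlonglongrightarrow> x"
proof -
  have "(\<lambda>n. cell_lo n x - x) \<longlonglongrightarrow> 0"
  proof (rule Lim_null_comparison)
    show "(\<lambda>n. (1/2::real) ^ n) \<longlonglongrightarrow> 0" by (rule LIMSEQ_realpow_zero) auto
    show "\<forall>\<^sub>F n in sequentially. norm (cell_lo n x - x) \<le> (1/2) ^ n"
    proof (intro always_eventually allI)
      fix n show "norm (cell_lo n x - x) \<le> (1/2) ^ n"
        using cell_lo_le(1)[of n x] cell_lo_le(2)[where n=n and x=x] cell_lo_le(4)[of n x] by (simp add: power_one_over)
    qed
  qed
  thus ?thesis by (simp add: LIM_zero_iff)
qed

lemma same_cell: "\<lfloor>2 ^ n * t\<rfloor> = \<lfloor>2 ^ n * x\<rfloor> \<longleftrightarrow> cell_lo n x \<le> t \<and> t < cell_hi n x"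
proof -
  have "\<lfloor>2 ^ n * t\<rfloor> = \<lfloor>2 ^ n * x\<rfloor> \<longleftrightarrow> of_int \<lfloor>2 ^ n * x\<rfloor> \<le> 2 ^ n * t \<and> 2 ^ n * t < of_int \<lfloor>2 ^ n * x\<rfloor> + 1"
    by (rule floor_eq_iff)
  thus ?thesis by (simp add: cell_lo_def cell_hi_def field_simps)
qed

lemma cell_kernel_sym: "cell_kernel n x t = cell_kernel n t x" "0 \<le> cell_kernel n x t"
  by (auto simp: cell_kernel_def)

lemma cell_kernel_eq: "cell_kernel n x t = 2 ^ n * indicator {cell_lo n x..<cell_hi n x} t"
  by (auto simp: cell_kernel_def same_cell indicator_def)

lemma cell_kernel_measurable [measurable]: "(\<lambda>(x, t). cell_kernel n x t) \<in> borel_measurable (borel \<Otimes>\<^sub>M borel)"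
  unfolding cell_kernel_def by measurable

lemma cell_kernel_measurable2 [measurable]: "cell_kernel n x \<in> borel_measurable borel" "(\<lambda>x. cell_kernel n x t) \<in> borel_measurable borel"
  unfolding cell_kernel_def by measurable

lemma nn_integral_cell_kernel: "(\<integral>\<^sup>+t. ennreal (cell_kernel n x t) \<partial>lborel) = 1"
proof -
  have "(\<integral>\<^sup>+t. ennreal (cell_kernel n x t) \<partial>lborel) = (\<integral>\<^sup>+t. ennreal (2 ^ n) * indicator {cell_lo n x..<cell_hi n x} t \<partial>lborel)"
    by (intro nn_integral_cong) (auto simp: cell_kernel_eq indicator_def)
  also have "\<dots> = ennreal (2 ^ n) * ennreal (cell_hi n x - cell_lo n x)" using cell_lo_le(3)[of n x] by (simp add: nn_integral_cmult_indicator)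
  also have "\<dots> = 1" using cell_lo_le(4)[of n x] by (simp add: ennreal_mult'[symmetric])
  finally show ?thesis .
qed

lemma nn_integral_ker2: "(\<integral>\<^sup>+x. ennreal (cell_kernel n x t) \<partial>lborel) = 1"
  using nn_integral_cell_kernel[of n t] by (simp add: cell_kernel_sym(1)[of n t])

lemma integral_cell_kernel: "integrable lborel (cell_kernel n x)" "(LINT t|lborel. cell_kernel n x t) = 1"
proof -
  show i: "integrable lborel (cell_kernel n x)"
    by (rule integrableI_bounded) (use nn_integral_cell_kernel[of n x] in \<open>auto simp: cell_kernel_sym(2)\<close>)
  show "(LINT t|lborel. cell_kernel n x t) = 1"
    using nn_integral_eq_integral[OF i] nn_integral_cell_kernel[of n x] by (simp add: cell_kernel_sym(2))
qed

lemma dyadic_avg_eq: assumes "a \<in> L2" shows "dyadic_avg n a x = 2 ^ n * (LINT t:{cell_lo n x..cell_hi n x}|lborel. a t)"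
proof -
  have [measurable]: "a \<in> borel_measurable borel" using assms L2_measurable by auto
  have "dyadic_avg n a x = (LINT t|lborel. 2 ^ n * (indicator {cell_lo n x..cell_hi n x} t *\<^sub>R a t))"
    unfolding dyadic_avg_def
  proof (rule integral_cong_AE)
    show "AE t in lborel. cell_kernel n x t *\<^sub>R a t = 2 ^ n * (indicator {cell_lo n x..cell_hi n x} t *\<^sub>R a t)"
      using AE_lborel_singleton[of "cell_hi n x"]
      by eventually_elim (auto simp: cell_kernel_eq indicator_def scaleR_conv_of_real)
  qed measurable
  thus ?thesis unfolding set_lebesgue_integral_def by (simp only: integral_mult_right_zero)
qed

lemma dyadic_avg_measurable: assumes "a \<in> L2" shows "dyadic_avg n a \<in> borel_measurable borel"
proof -
  have [measurable]: "a \<in> borel_measurable borel" using assms L2_measurable by auto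
  show ?thesis unfolding dyadic_avg_def by measurable
qed

text \<open>Cauchy-Schwarz on a single cell; the right-hand side is written with the kernel so that
  a later integration over \<open>x\<close> can be exchanged with the one over
  \<open>t\<close>.\<close>

lemma dyadic_avg_Jensen:
  assumes "a \<in> L2"
  shows "ennreal ((cmod (dyadic_avg n a x))\<^sup>2) \<le> (\<integral>\<^sup>+t. ennreal (cell_kernel n x t * (cmod (a t))\<^sup>2) \<partial>lborel)"
proof -
  have [measurable]: "a \<in> borel_measurable borel" using assms L2_measurable by auto
  let ?S = "LINT t:{cell_lo n x..cell_hi n x}|lborel. (cmod (a t))\<^sup>2"
  have "(cmod (dyadic_avg n a x))\<^sup>2 = (2 ^ n)\<^sup>2 * (cmod (LINT t:{cell_lo n x..cell_hi n x}|lborel. a t))\<^sup>2"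
    by (simp add: dyadic_avg_eq[OF assms] norm_mult norm_power power_mult_distrib)
  also have "\<dots> \<le> (2 ^ n)\<^sup>2 * ((cell_hi n x - cell_lo n x) * ?S)"
    by (intro mult_left_mono interval_bound assms cell_lo_le) auto
  also have "\<dots> = 2 ^ n * ?S" using cell_lo_le(4)[of n x] by (simp add: power2_eq_square)
  finally have 1: "(cmod (dyadic_avg n a x))\<^sup>2 \<le> 2 ^ n * ?S" .
  have i: "integrable lborel (\<lambda>t. indicator {cell_lo n x..cell_hi n x} t *\<^sub>R (cmod (a t))\<^sup>2)"
    by (rule integrable_mult_indicator) (use assms L2_integrable in auto)
  have "ennreal (2 ^ n * ?S) = ennreal (2 ^ n) * (\<integral>\<^sup>+t. ennreal (indicator {cell_lo n x..cell_hi n x} t *\<^sub>R (cmod (a t))\<^sup>2) \<partial>lborel)"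
    unfolding set_lebesgue_integral_def by (subst nn_integral_eq_integral[OF i]) (auto simp: ennreal_mult')
  also have "\<dots> = (\<integral>\<^sup>+t. ennreal (2 ^ n) * ennreal (indicator {cell_lo n x..cell_hi n x} t *\<^sub>R (cmod (a t))\<^sup>2) \<partial>lborel)"
    by (rule nn_integral_cmult[symmetric]) measurable
  also have "\<dots> = (\<integral>\<^sup>+t. ennreal (cell_kernel n x t * (cmod (a t))\<^sup>2) \<partial>lborel)"
  proof (rule nn_integral_cong_AE)
    show "AE t in lborel. ennreal (2 ^ n) * ennreal (indicator {cell_lo n x..cell_hi n x} t *\<^sub>R (cmod (a t))\<^sup>2) = ennreal (cell_kernel n x t * (cmod (a t))\<^sup>2)"
      using AE_lborel_singleton[of "cell_hi n x"]
      by eventually_elim (auto simp: cell_kernel_eq indicator_def ennreal_mult')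
  qed
  finally have 2: "ennreal (2 ^ n * ?S) = (\<integral>\<^sup>+t. ennreal (cell_kernel n x t * (cmod (a t))\<^sup>2) \<partial>lborel)" .
  show ?thesis using ennreal_leI[OF 1] 2 by simp
qed

text \<open>Jensen's inequality on each cell, then Tonelli: by symmetry the kernel integrates to 1
  in the other variable as well.\<close>

lemma dyadic_avg_L2: assumes "a \<in> L2" shows "dyadic_avg n a \<in> L2" "mass (dyadic_avg n a) \<le> mass a"
proof -
  have [measurable]: "a \<in> borel_measurable borel" using assms L2_measurable by auto
  have "(\<integral>\<^sup>+x. ennreal ((cmod (dyadic_avg n a x))\<^sup>2) \<partial>lborel) \<le> (\<integral>\<^sup>+x. \<integral>\<^sup>+t. ennreal (cell_kernel n x t * (cmod (a t))\<^sup>2) \<partial>lborel \<partial>lborel)"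
    by (intro nn_integral_mono dyadic_avg_Jensen assms)
  also have "\<dots> = (\<integral>\<^sup>+t. \<integral>\<^sup>+x. ennreal (cell_kernel n x t * (cmod (a t))\<^sup>2) \<partial>lborel \<partial>lborel)"
    by (rule lborel_pair.Fubini'[symmetric]) measurable
  also have "\<dots> = (\<integral>\<^sup>+t. ennreal ((cmod (a t))\<^sup>2) \<partial>lborel)"
  proof (rule nn_integral_cong)
    fix t
    have "(\<integral>\<^sup>+x. ennreal (cell_kernel n x t * (cmod (a t))\<^sup>2) \<partial>lborel) = (\<integral>\<^sup>+x. ennreal (cell_kernel n x t) * ennreal ((cmod (a t))\<^sup>2) \<partial>lborel)"
      by (simp add: ennreal_mult'')
    also have "\<dots> = (\<integral>\<^sup>+x. ennreal (cell_kernel n x t) \<partial>lborel) * ennreal ((cmod (a t))\<^sup>2)"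
      by (rule nn_integral_multc) measurable
    finally show "(\<integral>\<^sup>+x. ennreal (cell_kernel n x t * (cmod (a t))\<^sup>2) \<partial>lborel) = ennreal ((cmod (a t))\<^sup>2)"
      by (simp add: nn_integral_ker2)
  qed
  also have "\<dots> = ennreal (mass a)" by (rule nn_integral_mass[OF assms])
  finally show "dyadic_avg n a \<in> L2" "mass (dyadic_avg n a) \<le> mass a"
    using L2_nn_integral[OF dyadic_avg_measurable[OF assms]] mass_nonneg by blast+
qed

text \<open>The kernel is symmetric, and Fubini applies because a product is dominated by a sum of
  squares. This moves an average from one factor to the other, in the orthogonality of the
  martingale as well as in the weak convergence of derivatives.\<close>

lemma dyadic_avg_self_adjoint:
  assumes "a \<in> L2" "b \<in> L2"
  shows "(LINT x|lborel. dyadic_avg n a x * b x) = (LINT x|lborel. a x * dyadic_avg n b x)"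
proof -
  have [measurable]: "a \<in> borel_measurable borel" "b \<in> borel_measurable borel" using assms L2_measurable by auto
  let ?F = "\<lambda>(x, t). cell_kernel n x t *\<^sub>R (a t * b x)"
  have i: "integrable (lborel \<Otimes>\<^sub>M lborel) ?F"
  proof (rule integrableI_bounded)
    show "?F \<in> borel_measurable (lborel \<Otimes>\<^sub>M lborel)" by measurable
    have "(\<integral>\<^sup>+ p. ennreal (norm (?F p)) \<partial>(lborel \<Otimes>\<^sub>M lborel)) =
        (\<integral>\<^sup>+x. \<integral>\<^sup>+t. ennreal (cell_kernel n x t * (cmod (a t) * cmod (b x))) \<partial>lborel \<partial>lborel)"
      by (subst lborel.nn_integral_fst[symmetric], measurable) (simp add: norm_mult cell_kernel_sym(2))
    also have "\<dots> \<le> (\<integral>\<^sup>+x. \<integral>\<^sup>+t. ennreal (cell_kernel n x t) * ennreal ((cmod (a t))\<^sup>2) + ennreal (cell_kernel n x t) * ennreal ((cmod (b x))\<^sup>2) \<partial>lborel \<partial>lborel)"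
    proof (intro nn_integral_mono)
      fix x t
      have "cmod (a t) * cmod (b x) \<le> (cmod (a t))\<^sup>2 + (cmod (b x))\<^sup>2"
        using sum_squares_bound[of "cmod (a t)" "cmod (b x)"] mult_nonneg_nonneg[OF norm_ge_zero norm_ge_zero, of "a t" "b x"] by linarith
      hence "cell_kernel n x t * (cmod (a t) * cmod (b x)) \<le> cell_kernel n x t * ((cmod (a t))\<^sup>2 + (cmod (b x))\<^sup>2)"
        by (intro mult_left_mono cell_kernel_sym)
      hence "ennreal (cell_kernel n x t * (cmod (a t) * cmod (b x))) \<le> ennreal (cell_kernel n x t * (cmod (a t))\<^sup>2 + cell_kernel n x t * (cmod (b x))\<^sup>2)"
        by (intro ennreal_leI) (simp add: algebra_simps)
      thus "ennreal (cell_kernel n x t * (cmod (a t) * cmod (b x))) \<le> ennreal (cell_kernel n x t) * ennreal ((cmod (a t))\<^sup>2) + ennreal (cell_kernel n x t) * ennreal ((cmod (b x))\<^sup>2)"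
        by (simp add: ennreal_mult'' ennreal_plus cell_kernel_sym(2) del: ennreal_plus[symmetric])
    qed
    also have "\<dots> = (\<integral>\<^sup>+x. \<integral>\<^sup>+t. ennreal (cell_kernel n x t) * ennreal ((cmod (a t))\<^sup>2) \<partial>lborel \<partial>lborel) +
        (\<integral>\<^sup>+x. \<integral>\<^sup>+t. ennreal (cell_kernel n x t) * ennreal ((cmod (b x))\<^sup>2) \<partial>lborel \<partial>lborel)"
      by (simp add: nn_integral_add)
    also have "(\<integral>\<^sup>+x. \<integral>\<^sup>+t. ennreal (cell_kernel n x t) * ennreal ((cmod (a t))\<^sup>2) \<partial>lborel \<partial>lborel) =
        (\<integral>\<^sup>+t. \<integral>\<^sup>+x. ennreal (cell_kernel n x t) * ennreal ((cmod (a t))\<^sup>2) \<partial>lborel \<partial>lborel)"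
      by (rule lborel_pair.Fubini'[symmetric]) measurable
    also have "\<dots> = ennreal (mass a)"
      by (subst nn_integral_multc, measurable) (simp add: nn_integral_ker2 nn_integral_mass assms)
    also have "(\<integral>\<^sup>+x. \<integral>\<^sup>+t. ennreal (cell_kernel n x t) * ennreal ((cmod (b x))\<^sup>2) \<partial>lborel \<partial>lborel) = ennreal (mass b)"
      by (subst nn_integral_multc, measurable) (simp add: nn_integral_cell_kernel nn_integral_mass assms)
    finally show "(\<integral>\<^sup>+ p. ennreal (norm (?F p)) \<partial>(lborel \<Otimes>\<^sub>M lborel)) < \<infinity>" by (simp add: le_less_trans)
  qed
  have "(LINT x|lborel. dyadic_avg n a x * b x) = (LINT x|lborel. LINT t|lborel. cell_kernel n x t *\<^sub>R (a t * b x))"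
  proof (rule Bochner_Integration.integral_cong)
    fix x show "dyadic_avg n a x * b x = (LINT t|lborel. cell_kernel n x t *\<^sub>R (a t * b x))"
      unfolding dyadic_avg_def by (subst integral_mult_left_zero[symmetric]) simp
  qed simp
  also have "\<dots> = (LINT t|lborel. LINT x|lborel. cell_kernel n x t *\<^sub>R (a t * b x))"
    using lborel_pair.Fubini_integral[OF i] by simp
  also have "\<dots> = (LINT t|lborel. a t * dyadic_avg n b t)"
  proof (rule Bochner_Integration.integral_cong)
    fix t show "(LINT x|lborel. cell_kernel n x t *\<^sub>R (a t * b x)) = a t * dyadic_avg n b t"
      unfolding dyadic_avg_def by (subst integral_mult_right_zero[symmetric]) (simp add: cell_kernel_sym(1)[of n t])
  qed simp
  finally show ?thesis .
qed

lemma dyadic_avg_const: assumes "\<And>t. \<lfloor>2 ^ n * t\<rfloor> = \<lfloor>2 ^ n * x\<rfloor> \<Longrightarrow> a t = a x" shows "dyadic_avg n a x = a x"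
proof -
  have "dyadic_avg n a x = (LINT t|lborel. cell_kernel n x t *\<^sub>R a x)"
    unfolding dyadic_avg_def by (intro Bochner_Integration.integral_cong) (auto simp: cell_kernel_def intro: assms)
  also have "\<dots> = (LINT t|lborel. cell_kernel n x t) *\<^sub>R a x"
    by (rule integral_scaleR_left) (simp add: integral_cell_kernel)
  finally show ?thesis by (simp add: integral_cell_kernel)
qed

section \<open>Difference quotients as a martingale\<close>

lemma dyadic_diff_cell: "\<lfloor>2 ^ n * t\<rfloor> = \<lfloor>2 ^ n * x\<rfloor> \<Longrightarrow> dyadic_diff n f t = dyadic_diff n f x"
  by (simp add: dyadic_diff_def cell_lo_def cell_hi_def)

lemma dyadic_avg_dyadic_diff_same: "dyadic_avg n (dyadic_diff n f) x = dyadic_diff n f x"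
  by (rule dyadic_avg_const[OF dyadic_diff_cell])

lemma dyadic_avg_cnj: "dyadic_avg n (\<lambda>x. cnj (a x)) x = cnj (dyadic_avg n a x)"
  unfolding dyadic_avg_def
  using Bochner_Integration.integral_cnj[where M = lborel and f = "\<lambda>t. cell_kernel n x t *\<^sub>R a t"] by simp

lemma dyadic_diff_eq_dyadic_avg: "H1_pair f g \<Longrightarrow> dyadic_diff n f x = dyadic_avg n g x"
  using H1_pair_diff_eq[OF _ cell_lo_le(3)] by (simp add: dyadic_diff_def dyadic_avg_eq H1_pair_L2)

lemma dyadic_diff_L2: assumes "H1_pair f g" shows "dyadic_diff n f \<in> L2" "mass (dyadic_diff n f) \<le> mass g"
  using dyadic_avg_L2[OF H1_pair_L2(2)[OF assms], of n] dyadic_diff_eq_dyadic_avg[OF assms, abs_def] by (auto simp: ext[OF dyadic_diff_eq_dyadic_avg[OF assms]])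

lemma dyadic_diff_measurable: assumes "f \<in> borel_measurable borel" shows "dyadic_diff n f \<in> borel_measurable borel"
proof -
  have [measurable]: "f \<in> borel_measurable borel" by fact
  show ?thesis unfolding dyadic_diff_def cell_lo_def cell_hi_def by measurable
qed

lemma interval_dyadic_diff_cell:
  "(LINT t:{of_int k / 2 ^ n..(of_int k + 1) / 2 ^ n}|lborel. dyadic_diff n f t) = f ((of_int k + 1) / 2 ^ n) - f (of_int k / 2 ^ n)"
proof -
  define x where "x = of_int k / (2::real) ^ n"
  have k: "\<lfloor>2 ^ n * x\<rfloor> = k" by (simp add: x_def)
  have e: "dyadic_diff n f x = 2 ^ n * (f ((of_int k + 1) / 2 ^ n) - f (of_int k / 2 ^ n))"
    unfolding dyadic_diff_def cell_lo_def cell_hi_def k ..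
  have "(LINT t:{of_int k / 2 ^ n..(of_int k + 1) / 2 ^ n}|lborel. dyadic_diff n f t) = (LINT t:{cell_lo n x..<cell_hi n x}|lborel. dyadic_diff n f x)"
  proof -
    have "{of_int k / 2 ^ n..(of_int k + 1) / 2 ^ n} = insert (cell_hi n x) {cell_lo n x..<cell_hi n x}"
      using cell_lo_le(3)[of n x] by (auto simp: cell_lo_def cell_hi_def k)
    hence "(LINT t:{of_int k / 2 ^ n..(of_int k + 1) / 2 ^ n}|lborel. dyadic_diff n f t) = (LINT t:insert (cell_hi n x) {cell_lo n x..<cell_hi n x}|lborel. dyadic_diff n f t)" by simp
    also have "\<dots> = (LINT t:{cell_lo n x..<cell_hi n x}|lborel. dyadic_diff n f t)"
      unfolding set_lebesgue_integral_def
    proof (rule integral_cong_AE)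
      \<comment> \<open>Here \<open>f\<close> is arbitrary; measurability of its difference quotient
        comes from constancy on the cell.\<close>
      have m: "(\<lambda>t. indicat_real {cell_lo n x..<cell_hi n x} t *\<^sub>R dyadic_diff n f t) = (\<lambda>t. indicat_real {cell_lo n x..<cell_hi n x} t *\<^sub>R dyadic_diff n f x)"
        using dyadic_diff_cell same_cell by (fastforce simp: indicator_def)
      show 1: "(\<lambda>t. indicat_real {cell_lo n x..<cell_hi n x} t *\<^sub>R dyadic_diff n f t) \<in> borel_measurable lborel" unfolding m by measurable
      have m2: "(\<lambda>t. indicat_real (insert (cell_hi n x) {cell_lo n x..<cell_hi n x}) t *\<^sub>R dyadic_diff n f t) =
          (\<lambda>t. indicat_real {cell_lo n x..<cell_hi n x} t *\<^sub>R dyadic_diff n f x + indicat_real {cell_hi n x} t *\<^sub>R dyadic_diff n f (cell_hi n x))"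
        using dyadic_diff_cell same_cell by (fastforce simp: indicator_def)
      show "(\<lambda>t. indicat_real (insert (cell_hi n x) {cell_lo n x..<cell_hi n x}) t *\<^sub>R dyadic_diff n f t) \<in> borel_measurable lborel" unfolding m2 by measurable
      show "AE t in lborel. indicat_real (insert (cell_hi n x) {cell_lo n x..<cell_hi n x}) t *\<^sub>R dyadic_diff n f t = indicat_real {cell_lo n x..<cell_hi n x} t *\<^sub>R dyadic_diff n f t"
        using AE_lborel_singleton[of "cell_hi n x"] by eventually_elim (auto simp: indicator_def)
    qed
    also have "\<dots> = (LINT t:{cell_lo n x..<cell_hi n x}|lborel. dyadic_diff n f x)"
      using dyadic_diff_cell same_cell by (intro set_lebesgue_integral_cong) auto
    finally show ?thesis .
  qed
  also have "\<dots> = (cell_hi n x - cell_lo n x) *\<^sub>R dyadic_diff n f x"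
    using cell_lo_le(3)[of n x] by (simp add: set_lebesgue_integral_def)
  also have "\<dots> = f ((of_int k + 1) / 2 ^ n) - f (of_int k / 2 ^ n)"
    unfolding e using cell_lo_le(4)[of n x] by (simp add: scaleR_conv_of_real)
  finally show ?thesis .
qed

lemma interval_Un:
  assumes "loc_int g" "a \<le> b" "b \<le> c"
  shows "(LINT t:{a..c}|lborel. g t) = (LINT t:{a..b}|lborel. g t) + (LINT t:{b..c}|lborel. g t)"
proof -
  obtain F where "primitive F g" using primitive_exists[OF assms(1)] by blast
  hence "\<And>a b. a \<le> b \<Longrightarrow> (LINT x:{a..b}|lborel. g x) = F b - F a" by (auto simp: primitive_def)
  thus ?thesis using assms by simp
qed

lemma interval_dyadic_diff:
  assumes "loc_int (dyadic_diff n f)"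
  shows "(LINT t:{of_int k / 2 ^ n..(of_int k + real j) / 2 ^ n}|lborel. dyadic_diff n f t) = f ((of_int k + real j) / 2 ^ n) - f (of_int k / 2 ^ n)"
proof (induction j)
  case 0
  have "(LINT t:{of_int k / 2 ^ n..of_int k / 2 ^ n}|lborel. dyadic_diff n f t) = 0"
    unfolding set_lebesgue_integral_def
    by (rule integral_eq_zero_AE) (use AE_lborel_singleton[of "of_int k / 2 ^ n"] in eventually_elim, auto simp: indicator_def)
  thus ?case by simp
next
  case (Suc j)
  let ?m = "of_int k + real j"
  have "(LINT t:{of_int k / 2 ^ n..(?m + 1) / 2 ^ n}|lborel. dyadic_diff n f t) =
      (LINT t:{of_int k / 2 ^ n..?m / 2 ^ n}|lborel. dyadic_diff n f t) + (LINT t:{?m / 2 ^ n..(?m + 1) / 2 ^ n}|lborel. dyadic_diff n f t)"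
    by (rule interval_Un[OF assms]) (auto simp: divide_right_mono)
  also have "(LINT t:{?m / 2 ^ n..(?m + 1) / 2 ^ n}|lborel. dyadic_diff n f t) = f ((?m + 1) / 2 ^ n) - f (?m / 2 ^ n)"
    using interval_dyadic_diff_cell[where k = "k + int j" and n = n and f = f] by simp
  finally show ?case using Suc by (simp add: algebra_simps)
qed

text \<open>The tower property of the martingale: a cell of level \<open>n\<close> consists of
  \<open>2 ^ (m - n)\<close> cells of level \<open>m\<close>, over which the increments of
  \<open>f\<close> telescope.\<close>

lemma dyadic_avg_dyadic_diff:
  assumes "dyadic_diff m f \<in> L2" "n \<le> m"
  shows "dyadic_avg n (dyadic_diff m f) x = dyadic_diff n f x"
proof -
  define k where "k = \<lfloor>2 ^ n * x\<rfloor> * 2 ^ (m - n)"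
  define j :: nat where "j = 2 ^ (m - n)"
  have p: "(2::real) ^ m = 2 ^ n * 2 ^ (m - n)" using assms(2) by (simp add: power_add[symmetric])
  have cell_lo: "cell_lo n x = of_int k / 2 ^ m" by (simp add: cell_lo_def k_def p)
  have cell_hi: "cell_hi n x = (of_int k + real j) / 2 ^ m" by (simp add: cell_hi_def k_def j_def p field_simps)
  show ?thesis using interval_dyadic_diff[OF L2_loc_int[OF assms(1)], of k j] by (simp add: dyadic_avg_eq[OF assms(1)] dyadic_diff_def cell_lo cell_hi)
qed

text \<open>Pythagoras: level \<open>n\<close> is the projection of level \<open>m\<close> onto
  functions that are constant on cells, so the inner product of the two equals
  \<open>mass (dyadic_diff n f)\<close>.\<close>

lemma dyadic_diff_orthogonal:
  assumes "dyadic_diff m f \<in> L2" "dyadic_diff n f \<in> L2" "n \<le> m"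
  shows "mass (\<lambda>x. dyadic_diff m f x - dyadic_diff n f x) = mass (dyadic_diff m f) - mass (dyadic_diff n f)"
proof -
  have "(LINT x|lborel. dyadic_diff m f x * cnj (dyadic_diff n f x)) = (LINT x|lborel. dyadic_diff m f x * dyadic_avg n (\<lambda>x. cnj (dyadic_diff n f x)) x)"
    by (simp add: dyadic_avg_cnj dyadic_avg_dyadic_diff_same)
  also have "\<dots> = (LINT x|lborel. dyadic_avg n (dyadic_diff m f) x * cnj (dyadic_diff n f x))"
    by (rule dyadic_avg_self_adjoint[OF assms(1) L2_cnj[OF assms(2)], symmetric])
  also have "\<dots> = (LINT x|lborel. complex_of_real ((cmod (dyadic_diff n f x))\<^sup>2))"
    by (simp only: dyadic_avg_dyadic_diff[OF assms(1,3)] complex_norm_square)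
  also have "\<dots> = complex_of_real (mass (dyadic_diff n f))" unfolding mass_def by (rule integral_complex_of_real)
  finally show ?thesis using mass_diff_expand[OF assms(1,2)] by simp
qed

lemma incseq_mass_dyadic_diff: assumes "\<And>n. dyadic_diff n f \<in> L2" shows "incseq (\<lambda>n. mass (dyadic_diff n f))"
  unfolding incseq_def
proof (intro allI impI)
  fix m n :: nat assume mn: "m \<le> n"
  show "mass (dyadic_diff m f) \<le> mass (dyadic_diff n f)"
    using dyadic_diff_orthogonal[OF assms assms mn] mass_nonneg[of "\<lambda>x. dyadic_diff n f x - dyadic_diff m f x"] by linarith
qed

lemma mass_add_le: assumes "f \<in> L2" "g \<in> L2" shows "sqrt (mass (\<lambda>x. f x + g x)) \<le> sqrt (mass f) + sqrt (mass g)"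
proof -
  define h where "h x = - g x" for x
  have h: "h \<in> L2" using L2_scale[OF assms(2), of "-1"] by (simp add: h_def[abs_def])
  have Nh: "mass h = mass g" "mass (\<lambda>x. cnj (h x)) = mass g" by (simp_all add: mass_def h_def)
  have "mass (\<lambda>x. f x + g x) = mass (\<lambda>x. f x - h x)" by (simp add: h_def)
  also have "\<dots> = mass f - 2 * Re (LINT x|lborel. f x * cnj (h x)) + mass g"
    using mass_diff_expand[OF assms(1) h] by (simp add: Nh)
  also have "\<dots> \<le> mass f + 2 * (sqrt (mass f) * sqrt (mass g)) + mass g"
    using inner_L2_bound[OF assms(1) L2_cnj[OF h]] abs_Re_le_cmod[of "LINT x|lborel. f x * cnj (h x)"]
    unfolding Nh by linarith
  also have "\<dots> = (sqrt (mass f) + sqrt (mass g))\<^sup>2" by (simp add: power2_sum)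
  finally have "mass (\<lambda>x. f x + g x) \<le> (sqrt (mass f) + sqrt (mass g))\<^sup>2" .
  thus ?thesis by (intro real_le_lsqrt) auto
qed

lemma mass_diff_le: assumes "f \<in> L2" "g \<in> L2" shows "sqrt (mass f) \<le> sqrt (mass g) + sqrt (mass (\<lambda>x. f x - g x))"
  using mass_add_le[OF assms(2) L2_diff[OF assms]] by simp

lemma mass_diff_sym: "mass (\<lambda>x. f x - g x) = mass (\<lambda>x. g x - f x)"
  by (simp add: mass_def norm_minus_commute)

lemma mass_tendsto:
  assumes "\<And>n. f n \<in> L2" "g \<in> L2" "(\<lambda>n. mass (\<lambda>x. f n x - g x)) \<longlonglongrightarrow> 0"
  shows "(\<lambda>n. mass (f n)) \<longlonglongrightarrow> mass g"
proof -
  have s: "(\<lambda>n. sqrt (mass (\<lambda>x. f n x - g x))) \<longlonglongrightarrow> 0"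
    using tendsto_real_sqrt[OF assms(3)] by simp
  have "(\<lambda>n. sqrt (mass (f n)) - sqrt (mass g)) \<longlonglongrightarrow> 0"
  proof (rule Lim_null_comparison[OF _ s], intro always_eventually allI)
    fix n
    show "norm (sqrt (mass (f n)) - sqrt (mass g)) \<le> sqrt (mass (\<lambda>x. f n x - g x))"
      using mass_diff_le[OF assms(1)[of n] assms(2)] mass_diff_le[OF assms(2) assms(1)[of n]]
      by (simp add: mass_diff_sym[of g])
  qed
  hence "(\<lambda>n. sqrt (mass (f n))) \<longlonglongrightarrow> sqrt (mass g)" by (simp add: LIM_zero_iff)
  from tendsto_power[OF this, of 2] show ?thesis by simp
qed

text \<open>The dyadic difference quotients form a martingale that is bounded in \<open>L\<^sup>2\<close>; its limit is the weak
  derivative. In this way pointwise inequalities between difference quotients become inequalities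
  between Dirichlet energies.\<close>
theorem H1_pair_of_dyadic_diff:
  assumes f: "continuous_on UNIV f" "f \<in> L2" and d: "\<And>n. dyadic_diff n f \<in> L2" "\<And>n. mass (dyadic_diff n f) \<le> C"
  shows "\<exists>g. H1_pair f g \<and> mass g \<le> C \<and> (\<lambda>n. mass (\<lambda>x. dyadic_diff n f x - g x)) \<longlonglongrightarrow> 0"
proof -
  obtain L where L: "(\<lambda>n. mass (dyadic_diff n f)) \<longlonglongrightarrow> L" "\<And>n. mass (dyadic_diff n f) \<le> L"
    using incseq_convergent[OF incseq_mass_dyadic_diff[OF d(1)]] d(2) by blast
  have "\<exists>g\<in>L2. (\<lambda>n. mass (\<lambda>x. dyadic_diff n f x - g x)) \<longlonglongrightarrow> 0"
  proof (rule L2_complete[OF d(1)])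
    fix e :: real assume "e > 0"
    then obtain M where M: "\<And>n. n \<ge> M \<Longrightarrow> \<bar>mass (dyadic_diff n f) - L\<bar> < e"
      using LIMSEQ_D[OF L(1)] by force
    have "mass (\<lambda>x. dyadic_diff m f x - dyadic_diff n f x) \<le> e" if "m \<ge> M" "n \<ge> M" for m n
    proof (cases "n \<le> m")
      case True
      show ?thesis using dyadic_diff_orthogonal[OF d(1) d(1) True] M[OF that(1)] M[OF that(2)] L(2)[of m] L(2)[of n] by linarith
    next
      case False
      hence "m \<le> n" by simp
      show ?thesis using dyadic_diff_orthogonal[OF d(1) d(1) \<open>m \<le> n\<close>] M[OF that(1)] M[OF that(2)] L(2)[of m] L(2)[of n]
        by (simp add: mass_diff_sym[of "dyadic_diff m f"])
    qed
    thus "\<exists>M. \<forall>m\<ge>M. \<forall>n\<ge>M. mass (\<lambda>x. dyadic_diff m f x - dyadic_diff n f x) \<le> e" by blast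
  qed
  then obtain g where g: "g \<in> L2" "(\<lambda>n. mass (\<lambda>x. dyadic_diff n f x - g x)) \<longlonglongrightarrow> 0" by blast
  have "mass g \<le> C" using LIMSEQ_le_const2[OF mass_tendsto[OF d(1) g]] d(2) by blast
  moreover have "f b - f a = (LINT x:{a..b}|lborel. g x)" if ab: "a \<le> b" for a b
  proof -
    obtain G where G: "primitive G g" using primitive_exists[OF L2_loc_int[OF g(1)]] by blast
    have lom: "cell_lo n a \<le> cell_lo n b" for n
      by (rule cell_lo_mono[OF ab])
    have e: "f (cell_lo n b) - f (cell_lo n a) = (LINT t:{cell_lo n a..cell_lo n b}|lborel. dyadic_diff n f t)" for n
    proof -
      have "\<lfloor>2 ^ n * a\<rfloor> \<le> \<lfloor>2 ^ n * b\<rfloor>" using ab by (intro floor_mono) simp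
      then obtain j :: nat where j: "\<lfloor>2 ^ n * b\<rfloor> = \<lfloor>2 ^ n * a\<rfloor> + int j" using zle_iff_zadd by blast
      hence "cell_lo n b = (of_int \<lfloor>2 ^ n * a\<rfloor> + real j) / 2 ^ n" by (simp add: cell_lo_def)
      thus ?thesis using interval_dyadic_diff[OF L2_loc_int[OF d(1)], where n = n and k = "\<lfloor>2 ^ n * a\<rfloor>" and j = j] by (simp add: cell_lo_def)
    qed
    \<comment> \<open>At dyadic points the increments of \<open>f\<close> are integrals of
      difference quotients and those of \<open>G\<close> are integrals of \<open>g\<close>, so
      mean-square convergence compares them. Continuity then moves the end points to
      \<open>a\<close> and \<open>b\<close>.\<close>
    have "(\<lambda>n. (f (cell_lo n b) - f (cell_lo n a)) - (G (cell_lo n b) - G (cell_lo n a))) \<longlonglongrightarrow> 0"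
    proof (rule Lim_null_comparison)
      \<comment> \<open>The left end points of the two cells are at most \<open>b - a\<close> plus
        one cell length apart.\<close>
      let ?K = "b - a + 1"
      have "(\<lambda>n. sqrt (?K * mass (\<lambda>x. dyadic_diff n f x - g x))) \<longlonglongrightarrow> sqrt (?K * 0)"
        by (intro tendsto_intros g)
      thus "(\<lambda>n. sqrt (?K * mass (\<lambda>x. dyadic_diff n f x - g x))) \<longlonglongrightarrow> 0" by simp
      show "\<forall>\<^sub>F n in sequentially. norm ((f (cell_lo n b) - f (cell_lo n a)) - (G (cell_lo n b) - G (cell_lo n a))) \<le> sqrt (?K * mass (\<lambda>x. dyadic_diff n f x - g x))"
      proof (intro always_eventually allI)
        fix n
        let ?d = "\<lambda>x. dyadic_diff n f x - g x"
        have dL: "?d \<in> L2" by (intro L2_diff d g)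
        have "(f (cell_lo n b) - f (cell_lo n a)) - (G (cell_lo n b) - G (cell_lo n a)) = (LINT t:{cell_lo n a..cell_lo n b}|lborel. ?d t)"
        proof -
          have "G (cell_lo n b) - G (cell_lo n a) = (LINT t:{cell_lo n a..cell_lo n b}|lborel. g t)"
            using G lom by (auto simp: primitive_def)
          moreover have "(LINT t:{cell_lo n a..cell_lo n b}|lborel. ?d t) = (LINT t:{cell_lo n a..cell_lo n b}|lborel. dyadic_diff n f t) - (LINT t:{cell_lo n a..cell_lo n b}|lborel. g t)"
            by (rule set_integral_diff(2)) (auto intro!: loc_intD(2) L2_loc_int d g)
          ultimately show ?thesis using e by simp
        qed
        hence "(norm ((f (cell_lo n b) - f (cell_lo n a)) - (G (cell_lo n b) - G (cell_lo n a))))\<^sup>2 \<le> (cell_lo n b - cell_lo n a) * (LINT t:{cell_lo n a..cell_lo n b}|lborel. (cmod (?d t))\<^sup>2)"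
          using interval_bound[OF dL lom] by simp
        also have "\<dots> \<le> ?K * mass ?d"
        proof (rule mult_mono)
          have "1 / 2 ^ n \<le> (1::real)" by simp
          thus "cell_lo n b - cell_lo n a \<le> ?K" using cell_lo_le(1)[of n b] cell_lo_le(2)[where n=n and x=a] cell_lo_le(4)[of n a] by linarith
          show "(LINT t:{cell_lo n a..cell_lo n b}|lborel. (cmod (?d t))\<^sup>2) \<le> mass ?d" by (rule set_integral_le_mass[OF dL]) auto
          show "0 \<le> (LINT t:{cell_lo n a..cell_lo n b}|lborel. (cmod (?d t))\<^sup>2)" by (simp add: set_lebesgue_integral_def)
        qed (use ab in auto)
        finally show "norm ((f (cell_lo n b) - f (cell_lo n a)) - (G (cell_lo n b) - G (cell_lo n a))) \<le> sqrt (?K * mass ?d)"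
          by (rule real_le_rsqrt)
      qed
    qed
    moreover have "(\<lambda>n. (f (cell_lo n b) - f (cell_lo n a)) - (G (cell_lo n b) - G (cell_lo n a))) \<longlonglongrightarrow> (f b - f a) - (G b - G a)"
      using f(1) primitive_continuous[OF G]
      by (intro tendsto_intros continuous_on_tendsto_compose[OF f(1) cell_lo_tendsto] continuous_on_tendsto_compose[OF primitive_continuous[OF G] cell_lo_tendsto]) auto
    ultimately have "(f b - f a) - (G b - G a) = 0" by (rule LIMSEQ_unique[symmetric])
    thus ?thesis using G ab by (auto simp: primitive_def)
  qed
  ultimately show ?thesis using f g by (auto simp: H1_pair_def)
qed

text \<open>The limit supplied by martingale convergence is itself a weak derivative of
  \<open>f\<close>, and weak derivatives are unique almost everywhere.\<close>

theorem dyadic_diff_tendsto: assumes "H1_pair f g" shows "(\<lambda>n. mass (\<lambda>x. dyadic_diff n f x - g x)) \<longlonglongrightarrow> 0"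
proof -
  obtain h where h: "H1_pair f h" "(\<lambda>n. mass (\<lambda>x. dyadic_diff n f x - h x)) \<longlonglongrightarrow> 0"
    using H1_pair_of_dyadic_diff[OF H1_pair_continuous[OF assms] H1_pair_L2(1)[OF assms] dyadic_diff_L2[OF assms]] by blast
  have "mass (\<lambda>x. dyadic_diff n f x - g x) = mass (\<lambda>x. dyadic_diff n f x - h x)" for n
  proof (rule mass_cong_AE)
    show "AE x in lborel. dyadic_diff n f x - g x = dyadic_diff n f x - h x" using H1_pair_unique[OF assms h(1)] by eventually_elim simp
  qed (intro L2_measurable L2_diff dyadic_diff_L2[OF assms] H1_pair_L2[OF assms] H1_pair_L2[OF h(1)])+
  thus ?thesis using h by simp
qed

lemma mass_dyadic_diff_tendsto: assumes "H1_pair f g" shows "(\<lambda>n. mass (dyadic_diff n f)) \<longlonglongrightarrow> mass g"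
  by (rule mass_tendsto[OF dyadic_diff_L2(1)[OF assms] H1_pair_L2(2)[OF assms] dyadic_diff_tendsto[OF assms]])

section \<open>The energy functionals\<close>

text \<open>Strict inequalities between integrals start here: continuity spreads positivity from one
  point to an interval.\<close>

lemma integral_pos_of_continuous:
  fixes F :: "real \<Rightarrow> real"
  assumes "integrable lborel F" "\<And>x. 0 \<le> F x" "continuous_on UNIV F" "0 < F x0"
  shows "0 < (LINT x|lborel. F x)"
proof -
  have "isCont F x0" using assms(3) by (simp add: continuous_on_eq_continuous_at)
  then obtain d where d: "d > 0" "\<And>x. dist x x0 < d \<Longrightarrow> dist (F x) (F x0) < F x0 / 2"
    using assms(4) unfolding continuous_at_eps_delta by (metis half_gt_zero)
  have b: "F x0 / 2 * indicator {x0 - d/2..x0 + d/2} x \<le> F x" for x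
  proof (cases "x \<in> {x0 - d/2..x0 + d/2}")
    case True
    hence "\<bar>x - x0\<bar> < d" using d(1) unfolding atLeastAtMost_iff by argo
    hence "\<bar>F x - F x0\<bar> < F x0 / 2" using d(2)[of x] by (simp add: dist_real_def)
    thus ?thesis using True by (simp del: atLeastAtMost_iff) argo
  qed (use assms(2) in simp)
  have "(LINT x|lborel. F x0 / 2 * indicator {x0 - d/2..x0 + d/2} x) \<le> (LINT x|lborel. F x)"
    by (rule integral_mono[OF _ assms(1) b]) (auto simp: emeasure_lborel_Icc_eq)
  moreover have "(LINT x|lborel. F x0 / 2 * indicator {x0 - d/2..x0 + d/2} x) = F x0 / 2 * d"
    using d(1) by simp
  ultimately show ?thesis using d(1) assms(4) by (smt (verit) mult_pos_pos half_gt_zero)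
qed

definition dirichlet :: "(real \<Rightarrow> complex) \<Rightarrow> real" where "dirichlet f = mass (weak_deriv f)"

text \<open>Continuous representatives only, so that zeros, values at a point and the identity
  \<open>f = (\<lambda>x. 0)\<close> have a literal meaning.\<close>

definition H1C :: "(real \<Rightarrow> complex) set" where "H1C = {f. \<exists>g. H1_pair f g}"

lemma H1C_H1_pair: "f \<in> H1C \<Longrightarrow> H1_pair f (weak_deriv f)"
  using H1_pair_weak_deriv by (auto simp: H1C_def)

lemma H1_pair_H1C: "H1_pair f g \<Longrightarrow> f \<in> H1C" "H1_pair f g \<Longrightarrow> dirichlet f = mass g"
  using mass_weak_deriv by (auto simp: H1C_def dirichlet_def)

lemma dirichlet_nonneg [simp]: "0 \<le> dirichlet f" by (simp add: dirichlet_def)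

lemma H1C_L2: "f \<in> H1C \<Longrightarrow> f \<in> L2" using H1C_H1_pair H1_pair_L2 by blast
lemma H1C_continuous: "f \<in> H1C \<Longrightarrow> continuous_on UNIV f" using H1C_H1_pair H1_pair_continuous by blast
lemma H1C_measurable: "f \<in> H1C \<Longrightarrow> f \<in> borel_measurable borel" using H1C_L2 L2_measurable by blast
lemma H1C_H1: "f \<in> H1C \<Longrightarrow> f \<in> H1" using H1C_H1_pair H1_pair_H1 by blast

lemma H1C_sup: "f \<in> H1C \<Longrightarrow> l > 0 \<Longrightarrow> (cmod (f x))\<^sup>2 \<le> 2 / l * mass f + 2 * l * dirichlet f"
  unfolding dirichlet_def by (rule H1_pair_sup_bound[OF H1C_H1_pair])

lemma H1C_sup1: assumes "f \<in> H1C" shows "cmod (f x) \<le> sqrt (2 * mass f + 2 * dirichlet f)"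
  using H1C_sup[OF assms, of 1 x] by (intro real_le_rsqrt) simp

lemma H1C_zero: "(\<lambda>x. 0) \<in> H1C" "dirichlet (\<lambda>x. 0) = 0"
  using H1_pair_H1C[OF H1_pair_zero] by simp_all

lemma H1C_scale: assumes "f \<in> H1C" shows "(\<lambda>x. c * f x) \<in> H1C" "dirichlet (\<lambda>x. c * f x) = (cmod c)\<^sup>2 * dirichlet f"
  using H1_pair_H1C[OF H1_pair_scale[OF H1C_H1_pair[OF assms]]] by (simp_all add: mass_scale dirichlet_def)

lemma H1C_translate: assumes "f \<in> H1C" shows "(\<lambda>x. f (x + y)) \<in> H1C" "dirichlet (\<lambda>x. f (x + y)) = dirichlet f"
  using H1_pair_H1C[OF H1_pair_translate[OF H1C_H1_pair[OF assms]]] by (simp_all add: mass_translate[of "weak_deriv f"] dirichlet_def)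

lemma H1C_diff: "f \<in> H1C \<Longrightarrow> g \<in> H1C \<Longrightarrow> (\<lambda>x. f x - g x) \<in> H1C"
  using H1_pair_H1C(1)[OF H1_pair_diff[OF H1C_H1_pair H1C_H1_pair]] .

lemma mass_zero_iff: assumes "f \<in> H1C" shows "mass f = 0 \<longleftrightarrow> f = (\<lambda>x. 0)"
proof
  assume N0: "mass f = 0"
  have "f x = 0" for x
  proof (rule ccontr)
    assume "f x \<noteq> 0"
    have "0 < (LINT x|lborel. (cmod (f x))\<^sup>2)"
      by (rule integral_pos_of_continuous[of _ x])
        (use \<open>f x \<noteq> 0\<close> H1C_L2[OF assms] H1C_continuous[OF assms] in \<open>auto intro!: L2_integrable continuous_intros\<close>)
    thus False using N0 by (simp add: mass_def)
  qed
  thus "f = (\<lambda>x. 0)" by auto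
qed simp

section \<open>Joining two functions\<close>

definition join1 :: "(real \<Rightarrow> complex) \<Rightarrow> (real \<Rightarrow> complex) \<Rightarrow> real \<Rightarrow> complex" where
  "join1 f g x = complex_of_real (sqrt ((cmod (f x))\<^sup>2 + (cmod (g x))\<^sup>2))"

lemma join1_norm: "cmod (join1 f g x) = norm (f x, g x)" "join1 f g x = complex_of_real (norm (f x, g x))"
  by (simp_all add: join1_def norm_Pair)

lemma join1_sq: "(cmod (join1 f g x))\<^sup>2 = (cmod (f x))\<^sup>2 + (cmod (g x))\<^sup>2"
  by (simp add: join1_def)

lemma join1_L2: assumes "f \<in> L2" "g \<in> L2" shows "join1 f g \<in> L2" "mass (join1 f g) = mass f + mass g"
proof -
  have [measurable]: "f \<in> borel_measurable borel" "g \<in> borel_measurable borel" using assms L2_measurable by auto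
  show "join1 f g \<in> L2"
  proof (rule L2_bound)
    show "join1 f g \<in> borel_measurable borel" unfolding join1_def by measurable
    show "integrable lborel (\<lambda>x. (cmod (f x))\<^sup>2 + (cmod (g x))\<^sup>2)" using assms L2_integrable by auto
  qed (simp add: join1_sq)
  show "mass (join1 f g) = mass f + mass g" unfolding mass_def join1_sq using assms L2_integrable by simp
qed

text \<open>The join is the norm of the pair \<open>(f x, g x)\<close>, and a norm is 1-Lipschitz by
  the reverse triangle inequality.\<close>

lemma dyadic_diff_join1: "(cmod (dyadic_diff n (join1 f g) x))\<^sup>2 \<le> (cmod (dyadic_diff n f x))\<^sup>2 + (cmod (dyadic_diff n g x))\<^sup>2"
proof -
  have "cmod (join1 f g a - join1 f g b) = \<bar>norm (f a, g a) - norm (f b, g b)\<bar>" for a b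
    unfolding join1_norm(2) by (simp add: norm_of_real flip: of_real_diff)
  hence "(cmod (join1 f g a - join1 f g b))\<^sup>2 \<le> (norm ((f a, g a) - (f b, g b)))\<^sup>2" for a b
    by (metis abs_ge_zero norm_triangle_ineq3 power_mono)
  hence *: "(cmod (join1 f g a - join1 f g b))\<^sup>2 \<le> (cmod (f a - f b))\<^sup>2 + (cmod (g a - g b))\<^sup>2" for a b
    by (simp add: norm_Pair)
  have "(cmod (dyadic_diff n (join1 f g) x))\<^sup>2 = (2 ^ n)\<^sup>2 * (cmod (join1 f g (cell_hi n x) - join1 f g (cell_lo n x)))\<^sup>2"
    by (simp add: dyadic_diff_def norm_mult norm_power power_mult_distrib)
  also have "\<dots> \<le> (2 ^ n)\<^sup>2 * ((cmod (f (cell_hi n x) - f (cell_lo n x)))\<^sup>2 + (cmod (g (cell_hi n x) - g (cell_lo n x)))\<^sup>2)"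
    by (intro mult_left_mono *) auto
  also have "\<dots> = (cmod (dyadic_diff n f x))\<^sup>2 + (cmod (dyadic_diff n g x))\<^sup>2"
    by (simp add: dyadic_diff_def norm_mult norm_power power_mult_distrib distrib_left)
  finally show ?thesis .
qed

text \<open>The pointwise inequality holds for the difference quotients at every dyadic level with
  one bound, so it survives in the limit; the square root is never differentiated at common
  zeros.\<close>

lemma join1_H1C:
  assumes "f \<in> H1C" "g \<in> H1C"
  shows "join1 f g \<in> H1C" "dirichlet (join1 f g) \<le> dirichlet f + dirichlet g"
proof -
  note f = H1C_H1_pair[OF assms(1)] and g = H1C_H1_pair[OF assms(2)]
  have c: "continuous_on UNIV (join1 f g)"
    unfolding join1_def using H1C_continuous[OF assms(1)] H1C_continuous[OF assms(2)] by (intro continuous_intros)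
  have L: "join1 f g \<in> L2" using join1_L2 H1C_L2 assms by blast
  have b: "dyadic_diff n (join1 f g) \<in> L2 \<and> mass (dyadic_diff n (join1 f g)) \<le> dirichlet f + dirichlet g" for n
  proof
    have i: "integrable lborel (\<lambda>x. (cmod (dyadic_diff n f x))\<^sup>2 + (cmod (dyadic_diff n g x))\<^sup>2)"
      using L2_integrable[OF dyadic_diff_L2(1)[OF f]] L2_integrable[OF dyadic_diff_L2(1)[OF g]] by auto
    show d: "dyadic_diff n (join1 f g) \<in> L2"
      by (rule L2_bound[OF dyadic_diff_measurable[OF L2_measurable[OF L]] i dyadic_diff_join1])
    have "mass (dyadic_diff n (join1 f g)) \<le> (LINT x|lborel. (cmod (dyadic_diff n f x))\<^sup>2 + (cmod (dyadic_diff n g x))\<^sup>2)"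
      unfolding mass_def by (rule integral_mono[OF L2_integrable[OF d] i dyadic_diff_join1])
    also have "\<dots> = mass (dyadic_diff n f) + mass (dyadic_diff n g)"
      unfolding mass_def using L2_integrable[OF dyadic_diff_L2(1)[OF f]] L2_integrable[OF dyadic_diff_L2(1)[OF g]] by simp
    also have "\<dots> \<le> dirichlet f + dirichlet g" unfolding dirichlet_def using dyadic_diff_L2(2)[OF f] dyadic_diff_L2(2)[OF g] by (rule add_mono)
    finally show "mass (dyadic_diff n (join1 f g)) \<le> dirichlet f + dirichlet g" .
  qed
  obtain h where "H1_pair (join1 f g) h" "mass h \<le> dirichlet f + dirichlet g"
    using H1_pair_of_dyadic_diff[OF c L conjunct1[OF b] conjunct2[OF b]] by blast
  thus "join1 f g \<in> H1C" "dirichlet (join1 f g) \<le> dirichlet f + dirichlet g" using H1_pair_H1C by auto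
qed

text \<open>With \<open>r = sqrt (x^2 + y^2)\<close> one has
  \<open>r^q = (x^2 + y^2) * r^(q - 2)\<close>, and both \<open>x\<close> and \<open>y\<close> are
  at most \<open>r\<close>; strictness comes from \<open>x < r\<close>.\<close>

lemma powr_superadd:
  fixes x y q :: real
  assumes "0 \<le> x" "0 \<le> y" "q > 2"
  shows "x powr q + y powr q \<le> sqrt (x\<^sup>2 + y\<^sup>2) powr q"
    and "0 < x \<Longrightarrow> 0 < y \<Longrightarrow> x powr q + y powr q < sqrt (x\<^sup>2 + y\<^sup>2) powr q"
proof -
  define r where "r = sqrt (x\<^sup>2 + y\<^sup>2)"
  have r0: "r \<ge> 0" by (simp add: r_def)
  have rsq: "r\<^sup>2 = x\<^sup>2 + y\<^sup>2" by (simp add: r_def)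
  have le: "z powr q \<le> z\<^sup>2 * r powr (q - 2)" if "0 \<le> z" "z \<le> r" for z
  proof (cases "z = 0")
    case False
    have "z powr q = z powr 2 * z powr (q - 2)" by (simp add: powr_add[symmetric])
    also have "\<dots> \<le> z powr 2 * r powr (q - 2)" using that assms by (intro mult_left_mono powr_mono2) auto
    finally show ?thesis using False that by simp
  qed simp
  have xr: "x \<le> r" "y \<le> r" unfolding r_def using assms by (auto intro: real_le_rsqrt)
  have e: "r powr q = x\<^sup>2 * r powr (q - 2) + y\<^sup>2 * r powr (q - 2)"
  proof (cases "r = 0")
    case False
    hence "r powr q = r powr 2 * r powr (q - 2)" by (simp add: powr_add[symmetric])
    also have "r powr 2 = r\<^sup>2" using False r0 by simp
    finally show ?thesis by (simp add: rsq algebra_simps)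
  qed (use assms in simp)
  show "x powr q + y powr q \<le> sqrt (x\<^sup>2 + y\<^sup>2) powr q"
    using le[OF assms(1) xr(1)] le[OF assms(2) xr(2)] e unfolding r_def by linarith
  assume p: "0 < x" "0 < y"
  have "x < r" unfolding r_def using p by (intro real_less_rsqrt) auto
  hence "x powr (q - 2) < r powr (q - 2)" using p assms by (intro powr_less_mono2) auto
  hence "x powr 2 * x powr (q - 2) < x powr 2 * r powr (q - 2)" using p by (intro mult_strict_left_mono) auto
  moreover have "x powr q = x powr 2 * x powr (q - 2)" by (simp add: powr_add[symmetric])
  ultimately have "x powr q < x\<^sup>2 * r powr (q - 2)" using p by simp
  thus "x powr q + y powr q < sqrt (x\<^sup>2 + y\<^sup>2) powr q"
    using le[OF assms(2) xr(2)] e unfolding r_def by linarith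
qed

text \<open>Cauchy-Schwarz in the plane for the first two factors; the third is merely bounded by
  the length of \<open>(a3, b3)\<close>.\<close>

lemma triple_prod_ineq:
  fixes a1 a2 a3 b1 b2 b3 :: real
  assumes "0 \<le> a1" "0 \<le> a2" "0 \<le> a3" "0 \<le> b1" "0 \<le> b2" "0 \<le> b3"
  shows "a1 * a2 * a3 + b1 * b2 * b3 \<le> sqrt (a1\<^sup>2 + b1\<^sup>2) * sqrt (a2\<^sup>2 + b2\<^sup>2) * sqrt (a3\<^sup>2 + b3\<^sup>2)"
proof -
  let ?r = "sqrt (a3\<^sup>2 + b3\<^sup>2)"
  have r: "a3 \<le> ?r" "b3 \<le> ?r" by (auto intro: real_le_rsqrt)
  have "(a1 * a2 + b1 * b2)\<^sup>2 \<le> (a1\<^sup>2 + b1\<^sup>2) * (a2\<^sup>2 + b2\<^sup>2)"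
    using zero_le_power2[of "a1 * b2 - a2 * b1"] by (simp add: power2_eq_square algebra_simps)
  hence c: "a1 * a2 + b1 * b2 \<le> sqrt (a1\<^sup>2 + b1\<^sup>2) * sqrt (a2\<^sup>2 + b2\<^sup>2)"
    by (simp add: real_le_rsqrt real_sqrt_mult[symmetric])
  have "a1 * a2 * a3 + b1 * b2 * b3 \<le> a1 * a2 * ?r + b1 * b2 * ?r"
    using assms r by (intro add_mono mult_left_mono) auto
  also have "\<dots> = (a1 * a2 + b1 * b2) * ?r" by (simp add: algebra_simps)
  also have "\<dots> \<le> sqrt (a1\<^sup>2 + b1\<^sup>2) * sqrt (a2\<^sup>2 + b2\<^sup>2) * ?r" using c by (intro mult_right_mono) auto
  finally show ?thesis .
qed

section \<open>The coupling\<close>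

definition coupling :: "(real \<Rightarrow> complex) \<Rightarrow> (real \<Rightarrow> complex) \<Rightarrow> (real \<Rightarrow> complex) \<Rightarrow> complex" where
  "coupling a b c = (LINT x|lborel. a x * b x * cnj (c x))"

text \<open>The value of the coupling when all phases are aligned, and an upper bound for its real
  part in general.\<close>

definition abs_coupling :: "(real \<Rightarrow> complex) \<Rightarrow> (real \<Rightarrow> complex) \<Rightarrow> (real \<Rightarrow> complex) \<Rightarrow> real" where
  "abs_coupling a b c = (LINT x|lborel. cmod (a x) * cmod (b x) * cmod (c x))"

lemma triple_integrable:
  assumes "a \<in> H1C" "b \<in> H1C" "c \<in> H1C"
  shows "integrable lborel (\<lambda>x. cmod (a x) * cmod (b x) * cmod (c x))"
    and "integrable lborel (\<lambda>x. a x * b x * cnj (c x))"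
proof -
  have [measurable]: "a \<in> borel_measurable borel" "b \<in> borel_measurable borel" "c \<in> borel_measurable borel"
    using assms H1C_measurable by auto
  have [measurable]: "(\<lambda>x. cnj (c x)) \<in> borel_measurable borel"
    using L2_cnj[OF H1C_L2[OF assms(3)]] L2_measurable by blast
  let ?M = "sqrt (2 * mass c + 2 * dirichlet c)"
  have i: "integrable lborel (\<lambda>x. cmod (a x) * cmod (b x) * ?M)"
    using L2_mult_integrable(2)[OF H1C_L2 H1C_L2] assms by auto
  have b: "cmod (a x) * cmod (b x) * cmod (c x) \<le> cmod (a x) * cmod (b x) * ?M" for x
    by (intro mult_left_mono H1C_sup1 assms) auto
  show "integrable lborel (\<lambda>x. cmod (a x) * cmod (b x) * cmod (c x))"
    by (rule Bochner_Integration.integrable_bound[OF i]) (use b in \<open>auto intro!: AE_I2 order_trans[OF _ abs_ge_self]\<close>)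
  show "integrable lborel (\<lambda>x. a x * b x * cnj (c x))"
    by (rule Bochner_Integration.integrable_bound[OF i]) (use b in \<open>auto simp: norm_mult intro!: AE_I2 order_trans[OF _ abs_ge_self]\<close>)
qed

lemma coupling_le_abs_coupling: "a \<in> H1C \<Longrightarrow> b \<in> H1C \<Longrightarrow> c \<in> H1C \<Longrightarrow> cmod (coupling a b c) \<le> abs_coupling a b c"
  unfolding coupling_def abs_coupling_def
  using integral_norm_bound[of lborel "\<lambda>x. a x * b x * cnj (c x)"] by (simp add: norm_mult)

lemma abs_coupling_nonneg: "0 \<le> abs_coupling a b c" by (simp add: abs_coupling_def)

lemma abs_coupling_bound: assumes "a \<in> H1C" "b \<in> H1C" "c \<in> H1C" "\<And>x. cmod (c x) \<le> M"
  shows "abs_coupling a b c \<le> M * (mass a + mass b)"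
proof -
  have "abs_coupling a b c \<le> (LINT x|lborel. M * ((cmod (a x))\<^sup>2 + (cmod (b x))\<^sup>2))"
    unfolding abs_coupling_def
  proof (rule integral_mono[OF triple_integrable(1)[OF assms(1-3)]])
    show "integrable lborel (\<lambda>x. M * ((cmod (a x))\<^sup>2 + (cmod (b x))\<^sup>2))"
      using assms H1C_L2 L2_integrable by auto
    fix x
    have "cmod (a x) * cmod (b x) \<le> (cmod (a x))\<^sup>2 + (cmod (b x))\<^sup>2"
      using sum_squares_bound[of "cmod (a x)" "cmod (b x)"] mult_nonneg_nonneg[OF norm_ge_zero norm_ge_zero, of "a x" "b x"] by linarith
    moreover have "0 \<le> M" using assms(4)[of x] norm_ge_zero order_trans by blast
    ultimately show "cmod (a x) * cmod (b x) * cmod (c x) \<le> M * ((cmod (a x))\<^sup>2 + (cmod (b x))\<^sup>2)"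
      using mult_mono[of "cmod (a x) * cmod (b x)" "(cmod (a x))\<^sup>2 + (cmod (b x))\<^sup>2" "cmod (c x)" M] assms(4)[of x]
      by (simp add: mult.commute)
  qed
  also have "\<dots> = M * (mass a + mass b)" unfolding mass_def using assms H1C_L2 L2_integrable by auto
  finally show ?thesis .
qed

text \<open>A join has nonnegative components, so its coupling is real and already equal to its
  \<open>abs_coupling\<close>; the rest is the pointwise product inequality.\<close>

lemma abs_coupling_join1:
  assumes "a \<in> H1C" "b \<in> H1C" "c \<in> H1C" "a' \<in> H1C" "b' \<in> H1C" "c' \<in> H1C"
  shows "abs_coupling a b c + abs_coupling a' b' c' \<le> Re (coupling (join1 a a') (join1 b b') (join1 c c'))"
proof -
  have e: "coupling (join1 a a') (join1 b b') (join1 c c') = complex_of_real (abs_coupling (join1 a a') (join1 b b') (join1 c c'))"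
    unfolding coupling_def abs_coupling_def by (subst integral_complex_of_real[symmetric]) (simp add: join1_def)
  have "abs_coupling a b c + abs_coupling a' b' c' = (LINT x|lborel. cmod (a x) * cmod (b x) * cmod (c x) + cmod (a' x) * cmod (b' x) * cmod (c' x))"
    unfolding abs_coupling_def using assms triple_integrable by auto
  also have "\<dots> \<le> abs_coupling (join1 a a') (join1 b b') (join1 c c')"
    unfolding abs_coupling_def
  proof (rule integral_mono)
    show "integrable lborel (\<lambda>x. cmod (join1 a a' x) * cmod (join1 b b' x) * cmod (join1 c c' x))"
      by (intro triple_integrable join1_H1C assms)
    show "integrable lborel (\<lambda>x. cmod (a x) * cmod (b x) * cmod (c x) + cmod (a' x) * cmod (b' x) * cmod (c' x))"
      using assms triple_integrable by auto
  qed (use triple_prod_ineq in \<open>auto simp: join1_def\<close>)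
  finally show ?thesis by (simp add: e)
qed

section \<open>The potential term\<close>

definition potential :: "real \<Rightarrow> (real \<Rightarrow> complex) \<Rightarrow> real" where
  "potential p f = (LINT x|lborel. cmod (f x) powr (p + 1))"

lemma potential_nonneg [simp]: "0 \<le> potential p f" by (simp add: potential_def)

lemma powr_bound: fixes z M p :: real assumes "p > 1" "0 \<le> z" "z \<le> M" shows "z powr (p + 1) \<le> M powr (p - 1) * z\<^sup>2"
proof (cases "z = 0")
  case False
  have "z powr (p + 1) = z powr (p - 1) * z powr 2" by (simp add: powr_add[symmetric] add.commute)
  also have "\<dots> \<le> M powr (p - 1) * z powr 2" using assms by (intro mult_right_mono powr_mono2) auto
  finally show ?thesis using False assms by simp
qed simp

lemma potential_integrable: assumes "f \<in> H1C" "p > 1" shows "integrable lborel (\<lambda>x. cmod (f x) powr (p + 1))"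
proof (rule Bochner_Integration.integrable_bound)
  let ?M = "sqrt (2 * mass f + 2 * dirichlet f)"
  have [measurable]: "f \<in> borel_measurable borel" using assms H1C_measurable by auto
  show "integrable lborel (\<lambda>x. ?M powr (p - 1) * (cmod (f x))\<^sup>2)"
    using L2_integrable[OF H1C_L2[OF assms(1)]] by auto
  show "AE x in lborel. norm (cmod (f x) powr (p + 1)) \<le> norm (?M powr (p - 1) * (cmod (f x))\<^sup>2)"
    using powr_bound[OF assms(2) norm_ge_zero H1C_sup1[OF assms(1)]] by (auto intro!: AE_I2 order_trans[OF _ abs_ge_self])
  show "(\<lambda>x. cmod (f x) powr (p + 1)) \<in> borel_measurable lborel" by measurable
qed

lemma potential_bound: assumes "f \<in> H1C" "p > 1" "\<And>x. cmod (f x) \<le> M" shows "potential p f \<le> M powr (p - 1) * mass f"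
proof -
  have "potential p f \<le> (LINT x|lborel. M powr (p - 1) * (cmod (f x))\<^sup>2)"
    unfolding potential_def
    by (rule integral_mono[OF potential_integrable[OF assms(1,2)]])
      (use L2_integrable[OF H1C_L2[OF assms(1)]] powr_bound[OF assms(2) norm_ge_zero assms(3)] in auto)
  thus ?thesis by (simp add: mass_def)
qed

text \<open>The power \<open>p + 1 > 2\<close> is superadditive pointwise, strictly where neither
  function vanishes; by continuity one such point makes the integrals differ.\<close>

lemma potential_join1:
  assumes "f \<in> H1C" "g \<in> H1C" "p > 1"
  shows "potential p f + potential p g \<le> potential p (join1 f g)"
    and "f x0 \<noteq> 0 \<Longrightarrow> g x0 \<noteq> 0 \<Longrightarrow> potential p f + potential p g < potential p (join1 f g)"
proof -
  note j = join1_H1C(1)[OF assms(1,2)]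
  let ?F = "\<lambda>x. cmod (join1 f g x) powr (p + 1) - (cmod (f x) powr (p + 1) + cmod (g x) powr (p + 1))"
  have i: "integrable lborel ?F"
    using potential_integrable[OF assms(1,3)] potential_integrable[OF assms(2,3)] potential_integrable[OF j assms(3)] by auto
  have nn: "0 \<le> ?F x" for x
    using powr_superadd(1)[of "cmod (f x)" "cmod (g x)" "p + 1"] assms by (simp add: join1_def)
  have e: "potential p (join1 f g) - (potential p f + potential p g) = (LINT x|lborel. ?F x)"
    unfolding potential_def
    using potential_integrable[OF assms(1,3)] potential_integrable[OF assms(2,3)] potential_integrable[OF j assms(3)] by simp
  have "0 \<le> (LINT x|lborel. ?F x)" by (rule Bochner_Integration.integral_nonneg[OF nn])
  thus "potential p f + potential p g \<le> potential p (join1 f g)" using e by linarith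
  assume x0: "f x0 \<noteq> 0" "g x0 \<noteq> 0"
  have "0 < (LINT x|lborel. ?F x)"
  proof (rule integral_pos_of_continuous[OF i nn])
    show "continuous_on UNIV ?F"
      using H1C_continuous[OF assms(1)] H1C_continuous[OF assms(2)] H1C_continuous[OF j] assms(3)
      by (intro continuous_intros continuous_on_powr') auto
    show "0 < ?F x0"
      using powr_superadd(2)[of "cmod (f x0)" "cmod (g x0)" "p + 1"] assms x0 by (simp add: join1_def)
  qed
  thus "potential p f + potential p g < potential p (join1 f g)" using e by simp
qed

lemma potential_scale: "potential p (\<lambda>x. c * f x) = cmod c powr (p + 1) * potential p f"
  by (simp add: potential_def norm_mult powr_mult)

lemma potential_translate: "potential p (\<lambda>x. f (x + y)) = potential p f"
  unfolding potential_def by (rule integral_translate[of "\<lambda>x. cmod (f x) powr (p + 1)"])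

lemma potential_zero: "potential p (\<lambda>x. 0) = 0"
  by (simp add: potential_def)

text \<open>The factor \<open>sqrt l\<close> keeps the mass. Since \<open>(p - 1) / 2 < 2\<close>
  exactly when \<open>p < 5\<close>, a nonzero potential outweighs the Dirichlet energy for small
  \<open>l\<close>.\<close>

lemma H1C_dilate:
  assumes "f \<in> H1C" "l > 0"
  defines "h \<equiv> \<lambda>x. complex_of_real (sqrt l) * f (l * x)"
  shows "h \<in> H1C" "mass h = mass f" "dirichlet h = l\<^sup>2 * dirichlet f" "potential p h = l powr ((p - 1) / 2) * potential p f"
proof -
  have sub: "(LINT x|lborel. k (l * x)) = (1 / l) *\<^sub>R (LINT x|lborel. k x)" for k :: "real \<Rightarrow> 'b::{banach, second_countable_topology}"
    using lborel_integral_real_affine[of l k 0] assms(2) by simp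
  let ?g = "weak_deriv f"
  note Wf = H1C_H1_pair[OF assms(1)]
  have L: "(\<lambda>x. k (l * x)) \<in> L2" if "k \<in> L2" for k
  proof -
    have [measurable]: "k \<in> borel_measurable borel" using that L2_measurable by auto
    show ?thesis using lborel_integrable_real_affine[OF L2_integrable[OF that], of l 0] assms(2) by (simp add: L2_iff)
  qed
  have Nl: "mass (\<lambda>x. k (l * x)) = mass k / l" for k
    unfolding mass_def using sub[of "\<lambda>x. (cmod (k x))\<^sup>2"] by simp
  have "H1_pair (\<lambda>x. f (l * x)) (\<lambda>x. complex_of_real l * ?g (l * x))"
    unfolding H1_pair_def
  proof (intro conjI allI impI L L2_scale H1_pair_L2(1)[OF Wf] H1_pair_L2(2)[OF Wf])
    fix a b :: real assume "a \<le> b"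
    hence "l * a \<le> l * b" using assms(2) by simp
    hence "f (l * b) - f (l * a) = (LINT x:{l*a..l*b}|lborel. ?g x)" using H1_pair_diff_eq[OF Wf] by blast
    also have "\<dots> = complex_of_real l * (LINT x|lborel. indicator {l*a..l*b} (l * x) *\<^sub>R ?g (l * x))"
      using sub[of "\<lambda>x. indicator {l*a..l*b} x *\<^sub>R ?g x"] assms(2)
      by (simp add: set_lebesgue_integral_def scaleR_conv_of_real)
    also have "\<dots> = (LINT x|lborel. complex_of_real l * (indicator {l*a..l*b} (l * x) *\<^sub>R ?g (l * x)))"
      by (rule integral_mult_right_zero[symmetric])
    also have "\<dots> = (LINT x:{a..b}|lborel. complex_of_real l * ?g (l * x))"
      unfolding set_lebesgue_integral_def
      by (intro Bochner_Integration.integral_cong) (use assms(2) in \<open>auto simp: indicator_def\<close>)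
    finally show "f (l * b) - f (l * a) = (LINT x:{a..b}|lborel. complex_of_real l * ?g (l * x))" .
  qed
  hence Wh: "H1_pair h (\<lambda>x. complex_of_real (sqrt l) * (complex_of_real l * ?g (l * x)))"
    unfolding h_def by (rule H1_pair_scale)
  show "h \<in> H1C" by (rule H1_pair_H1C(1)[OF Wh])
  show "mass h = mass f" unfolding h_def using assms(2) by (simp add: mass_scale Nl)
  have "dirichlet h = mass (\<lambda>x. complex_of_real (sqrt l) * (complex_of_real l * ?g (l * x)))" by (rule H1_pair_H1C(2)[OF Wh])
  thus "dirichlet h = l\<^sup>2 * dirichlet f" using assms(2) by (simp add: mass_scale Nl dirichlet_def)
  have "potential p (\<lambda>x. f (l * x)) = potential p f / l" unfolding potential_def using sub[of "\<lambda>x. cmod (f x) powr (p + 1)"] by simp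
  hence "potential p h = sqrt l powr (p + 1) * (potential p f / l)" unfolding h_def using assms(2) by (simp add: potential_scale)
  also have "sqrt l powr (p + 1) = l powr ((p + 1) / 2)" using assms(2) by (simp add: powr_half_sqrt[symmetric] powr_powr)
  also have "l powr ((p + 1) / 2) * (potential p f / l) = (l powr ((p + 1) / 2) / l powr 1) * potential p f" using assms(2) by simp
  also have "l powr ((p + 1) / 2) / l powr 1 = l powr ((p + 1) / 2 - 1)" by (simp only: powr_diff)
  also have "(p + 1) / 2 - 1 = (p - 1) / 2" by (simp add: field_simps)
  finally show "potential p h = l powr ((p - 1) / 2) * potential p f" .
qed

lemma H1C_nontrivial: "\<exists>f\<in>H1C. mass f = 1"
proof -
  define B where "B = bump 0 1 1"
  have t: "B \<in> test_functions" unfolding B_def by (rule bump_test) simp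
  have L: "(\<lambda>x. complex_of_real (\<phi> x)) \<in> L2" if tt: "\<phi> \<in> test_functions" for \<phi>
  proof -
    have [measurable]: "\<phi> \<in> borel_measurable borel" using tt test_measurable by auto
    obtain R M where M: "M \<ge> 0" "\<And>x. \<bar>\<phi> x\<bar> \<le> M * indicator {-R..R} x" by (rule test_bounded[OF tt]) blast
    show ?thesis
    proof (rule L2_bound[where h = "\<lambda>x. M\<^sup>2 * indicator {-R..R} x"])
      fix x
      have "\<bar>\<phi> x\<bar>\<^sup>2 \<le> (M * indicator {-R..R} x)\<^sup>2" by (intro power_mono M) auto
      thus "(cmod (complex_of_real (\<phi> x)))\<^sup>2 \<le> M\<^sup>2 * indicator {-R..R} x" by (auto simp: power_mult_distrib indicator_def)
    qed (auto simp: emeasure_lborel_Icc_eq)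
  qed
  have sm: "smooth B" using t test_functions_iff by blast
  have "H1_pair (\<lambda>x. complex_of_real (B x)) (\<lambda>x. complex_of_real (deriv B x))"
    unfolding H1_pair_def
  proof (intro conjI allI impI L t test_deriv)
    fix a b :: real assume ab: "a \<le> b"
    have "(LINT x|lborel. deriv B x * indicator {a..b} x) = B b - B a"
      by (rule integral_FTC_Icc_real[OF ab]) (use smooth_DERIV[OF sm] smooth_DERIV[OF smooth_deriv[OF sm]] DERIV_isCont in blast)+
    hence "complex_of_real (B b - B a) = (LINT x|lborel. complex_of_real (deriv B x * indicator {a..b} x))"
      by (subst integral_complex_of_real) simp
    thus "complex_of_real (B b) - complex_of_real (B a) = (LINT x:{a..b}|lborel. complex_of_real (deriv B x))"
      by (simp add: set_lebesgue_integral_def scaleR_conv_of_real mult.commute)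
  qed
  hence C: "(\<lambda>x. complex_of_real (B x)) \<in> H1C" by (rule H1_pair_H1C)
  let ?f = "\<lambda>x. complex_of_real (B x)"
  have "?f (1/2) \<noteq> 0" using bump_bounds(4)[of 1 0 "1/2" 1] by (simp add: B_def)
  hence "mass ?f \<noteq> 0" using mass_zero_iff[OF C] by metis
  hence N0: "mass ?f > 0" using mass_nonneg[of ?f] by linarith
  have "mass (\<lambda>x. complex_of_real (1 / sqrt (mass ?f)) * ?f x) = 1"
  proof -
    have "(cmod (complex_of_real (1 / sqrt m)))\<^sup>2 * m = 1" if "m > 0" for m
      using that by (simp add: norm_divide power_divide)
    from this[OF N0] show ?thesis unfolding mass_scale .
  qed
  thus ?thesis using H1C_scale(1)[OF C] by blast
qed

text \<open>The tangent at 1 to the convex function \<open>y powr q\<close>. It bounds to first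
  order what the potential loses when the mass is scaled down.\<close>

lemma Bernoulli_powr:
  fixes y q :: real
  assumes "1 \<le> q" "0 \<le> y" shows "1 + q * (y - 1) \<le> y powr q"
proof (cases "y = 0")
  case False
  hence y: "y > 0" using assms by simp
  let ?f = "\<lambda>y. y powr q - q * (y - 1)"
  have d: "((\<lambda>y. y powr q - q * (y - 1)) has_real_derivative q * (x powr (q - 1) - 1)) (at x)" if "x > 0" for x
    using that by (auto intro!: derivative_eq_intros simp: algebra_simps)
  have "?f 1 \<le> ?f y"
  proof (cases "y \<le> 1")
    case True
    show ?thesis
    proof (rule DERIV_nonpos_imp_nonincreasing[where f = ?f, OF True])
      show "\<exists>z. ((\<lambda>y. y powr q - q * (y - 1)) has_real_derivative z) (at x) \<and> z \<le> 0" if "y \<le> x" "x \<le> 1" for x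
      proof (intro exI conjI)
        show "(?f has_real_derivative q * (x powr (q - 1) - 1)) (at x)" using d that y by simp
        have "x powr (q - 1) \<le> 1" using that assms y by (intro powr_le1) auto
        thus "q * (x powr (q - 1) - 1) \<le> 0" using assms by (intro mult_nonneg_nonpos) auto
      qed
    qed
  next
    case False
    show ?thesis
    proof (rule DERIV_nonneg_imp_nondecreasing[where f = ?f and a = 1 and b = y])
      show "1 \<le> y" using False by simp
      show "\<exists>z. ((\<lambda>y. y powr q - q * (y - 1)) has_real_derivative z) (at x) \<and> 0 \<le> z" if "1 \<le> x" "x \<le> y" for x
      proof (intro exI conjI)
        show "(?f has_real_derivative q * (x powr (q - 1) - 1)) (at x)" using d that by simp
        have "1 \<le> x powr (q - 1)" using that assms by (intro ge_one_powr_ge_zero) auto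
        thus "0 \<le> q * (x powr (q - 1) - 1)" using assms by simp
      qed
    qed
  qed
  thus ?thesis by simp
qed (use assms in simp)

lemma sublinear:
  fixes A a \<eta> :: real
  assumes "0 \<le> A" "0 \<le> a" "a < 1" "\<eta> > 0"
  shows "\<exists>B. \<forall>s\<ge>1. A * s powr a \<le> \<eta> * s + B"
proof -
  \<comment> \<open>Beyond \<open>M\<close> the power is at most \<open>\<eta> * s\<close>; up to
    \<open>M\<close> it is bounded by its value at \<open>M\<close>.\<close>
  define M where "M = max 1 ((A / \<eta>) powr (1 / (1 - a)))"
  have "A * s powr a \<le> \<eta> * s + A * M powr a" if s: "s \<ge> 1" for s
  proof (cases "s \<le> M")
    case True
    have "A * s powr a \<le> A * M powr a" using True s assms by (intro mult_left_mono powr_mono2) auto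
    thus ?thesis using s assms by (simp add: add_increasing)
  next
    case False
    hence "(A / \<eta>) powr (1 / (1 - a)) \<le> s" by (simp add: M_def)
    hence "((A / \<eta>) powr (1 / (1 - a))) powr (1 - a) \<le> s powr (1 - a)" using assms by (intro powr_mono2) auto
    hence "A / \<eta> \<le> s powr (1 - a)" using assms by (simp add: powr_powr)
    hence "A \<le> \<eta> * s powr (1 - a)" using assms by (simp add: field_simps)
    hence "A * s powr a \<le> \<eta> * s powr (1 - a) * s powr a" by (intro mult_right_mono) auto
    also have "\<dots> = \<eta> * s" using s by (simp add: powr_add[symmetric] mult.assoc)
    finally show ?thesis using assms by (simp add: add_increasing2)
  qed
  thus ?thesis by blast
qed

text \<open>The sup bound on an interval of length \<open>1 / sqrt (1 + dirichlet f)\<close>, which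
  balances its two terms: the sup grows only with the fourth root of the Dirichlet energy, as in the
  Gagliardo-Nirenberg inequality.\<close>

lemma H1C_sup_coercive:
  assumes "f \<in> H1C" "mass f \<le> K"
  shows "cmod (f x) \<le> sqrt (2 * K + 2) * (1 + dirichlet f) powr (1/4)"
proof -
  let ?s = "sqrt (1 + dirichlet f)"
  have s: "?s > 0" by (simp add: add_pos_nonneg)
  have ss: "?s * ?s = 1 + dirichlet f" using dirichlet_nonneg[of f] by simp
  have "(cmod (f x))\<^sup>2 \<le> 2 / (1 / ?s) * mass f + 2 * (1 / ?s) * dirichlet f" using s by (intro H1C_sup[OF assms(1)]) simp
  also have "\<dots> \<le> 2 * ?s * K + 2 * ?s"
  proof -
    have "dirichlet f / ?s \<le> ?s" using s ss by (simp add: divide_le_eq)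
    moreover have "?s * mass f \<le> ?s * K" using s assms by (intro mult_left_mono) auto
    ultimately show ?thesis by simp
  qed
  also have "\<dots> = (2 * K + 2) * ?s" by (simp add: algebra_simps)
  finally have "cmod (f x) \<le> sqrt ((2 * K + 2) * ?s)" by (rule real_le_rsqrt)
  also have "\<dots> = sqrt (2 * K + 2) * sqrt ?s" by (rule real_sqrt_mult)
  also have "sqrt ?s = (1 + dirichlet f) powr (1/4)" using dirichlet_nonneg[of f] by (simp add: powr_half_sqrt[symmetric] powr_powr)
  finally show ?thesis .
qed

definition H1C_vec :: "((real \<Rightarrow> complex)^3) set" where "H1C_vec = {u. \<forall>i. u $ i \<in> H1C}"

lemma H1C_vec_D: "u \<in> H1C_vec \<Longrightarrow> u $ i \<in> H1C" by (simp add: H1C_vec_def)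

definition triple :: "'a \<Rightarrow> 'a \<Rightarrow> 'a \<Rightarrow> 'a^3" where
  "triple a b c = (\<chi> i. if i = 1 then a else if i = 2 then b else c)"

lemma triple_simps [simp]: "triple a b c $ 1 = a" "triple a b c $ 2 = b" "triple a b c $ 3 = c"
  by (simp_all add: triple_def)

lemma H1C_vec_iff: "u \<in> H1C_vec \<longleftrightarrow> u $ 1 \<in> H1C \<and> u $ 2 \<in> H1C \<and> u $ 3 \<in> H1C"
  by (simp add: H1C_vec_def forall_3)

definition join :: "(real \<Rightarrow> complex)^3 \<Rightarrow> (real \<Rightarrow> complex)^3 \<Rightarrow> (real \<Rightarrow> complex)^3" where
  "join u v = (\<chi> i. join1 (u $ i) (v $ i))"

lemma join_nth [simp]: "join u v $ i = join1 (u $ i) (v $ i)" by (simp add: join_def)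

lemma join_H1C_vec: "u \<in> H1C_vec \<Longrightarrow> v \<in> H1C_vec \<Longrightarrow> join u v \<in> H1C_vec"
  by (simp add: H1C_vec_def join1_H1C)

lemma Q_eq: "Q1 u = mass (u $ 1) + mass (u $ 3)" "Q2 u = mass (u $ 2) + mass (u $ 3)"
  by (simp_all add: Q1_def Q2_def L2_norm_sq)

lemma mass_join1: "f \<in> H1C \<Longrightarrow> g \<in> H1C \<Longrightarrow> mass (join1 f g) = mass f + mass g"
  using join1_L2 H1C_L2 by blast

lemma Q_join: "u \<in> H1C_vec \<Longrightarrow> v \<in> H1C_vec \<Longrightarrow> Q1 (join u v) = Q1 u + Q1 v"
  "u \<in> H1C_vec \<Longrightarrow> v \<in> H1C_vec \<Longrightarrow> Q2 (join u v) = Q2 u + Q2 v"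
  by (simp_all add: Q_eq mass_join1 H1C_vec_D)

section \<open>The energy of a vector: coercivity and negative values\<close>

locale three_wave =
  fixes \<alpha> \<beta> p :: real
  assumes a0: "\<alpha> > 0" and b0: "\<beta> > 0" and p1: "1 < p" and p5: "p < 5"
begin

definition part_energy :: "(real \<Rightarrow> complex) \<Rightarrow> real" where
  "part_energy f = 1 / 2 * dirichlet f - \<beta> / (p + 1) * potential p f"

definition total_energy :: "(real \<Rightarrow> complex)^3 \<Rightarrow> real" where
  "total_energy u = part_energy (u $ 1) + part_energy (u $ 2) + part_energy (u $ 3) - \<alpha> * Re (coupling (u $ 1) (u $ 2) (u $ 3))"

lemma energy_eq: "energy \<alpha> \<beta> p u = total_energy u"
  by (simp add: energy_def total_energy_def part_energy_def dirichlet_def mass_def potential_def coupling_def sum_3)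

lemma part_energy_zero: "part_energy (\<lambda>x. 0) = 0"
  by (simp add: part_energy_def H1C_zero potential_zero)

lemma part_energy_join1:
  assumes "f \<in> H1C" "g \<in> H1C"
  shows "part_energy (join1 f g) \<le> part_energy f + part_energy g" "f x0 \<noteq> 0 \<Longrightarrow> g x0 \<noteq> 0 \<Longrightarrow> part_energy (join1 f g) < part_energy f + part_energy g"
proof -
  have c: "\<beta> / (p + 1) > 0" using b0 p1 by simp
  show "part_energy (join1 f g) \<le> part_energy f + part_energy g"
    using join1_H1C(2)[OF assms] mult_left_mono[OF potential_join1(1)[OF assms p1], of "\<beta> / (p + 1)"] c
    unfolding part_energy_def by (simp add: distrib_left)
  show "part_energy (join1 f g) < part_energy f + part_energy g" if "f x0 \<noteq> 0" "g x0 \<noteq> 0"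
    using join1_H1C(2)[OF assms] mult_strict_left_mono[OF potential_join1(2)[OF assms p1 that] c]
    unfolding part_energy_def by (simp add: distrib_left)
qed

lemma part_energy_translate: "f \<in> H1C \<Longrightarrow> part_energy (\<lambda>x. f (x + y)) = part_energy f"
  by (simp add: part_energy_def H1C_translate potential_translate)

lemma T_join:
  assumes "u \<in> H1C_vec" "v \<in> H1C_vec"
  shows "abs_coupling (u$1) (u$2) (u$3) + abs_coupling (v$1) (v$2) (v$3) \<le> Re (coupling (join u v $ 1) (join u v $ 2) (join u v $ 3))"
  using abs_coupling_join1 assms by (simp add: H1C_vec_D)

lemma Re_coupling_le: "u \<in> H1C_vec \<Longrightarrow> Re (coupling (u$1) (u$2) (u$3)) \<le> abs_coupling (u$1) (u$2) (u$3)"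
  using coupling_le_abs_coupling complex_Re_le_cmod H1C_vec_D order_trans by blast

lemma total_energy_join:
  assumes "u \<in> H1C_vec" "v \<in> H1C_vec"
  shows "total_energy (join u v) \<le> total_energy u + total_energy v"
    and "\<And>i x0. (u $ i) x0 \<noteq> 0 \<Longrightarrow> (v $ i) x0 \<noteq> 0 \<Longrightarrow> total_energy (join u v) < total_energy u + total_energy v"
proof -
  have t: "\<alpha> * Re (coupling (u$1) (u$2) (u$3)) + \<alpha> * Re (coupling (v$1) (v$2) (v$3)) \<le> \<alpha> * Re (coupling (join u v $ 1) (join u v $ 2) (join u v $ 3))"
    using T_join[OF assms] Re_coupling_le[OF assms(1)] Re_coupling_le[OF assms(2)] a0
    by (simp add: distrib_left[symmetric] del: join_nth)
  have s: "part_energy (join u v $ i) \<le> part_energy (u $ i) + part_energy (v $ i)" for i using part_energy_join1(1) assms H1C_vec_D by simp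
  show "total_energy (join u v) \<le> total_energy u + total_energy v" using t s[of 1] s[of 2] s[of 3] unfolding total_energy_def by linarith
  fix i x0 assume "(u $ i) x0 \<noteq> 0" "(v $ i) x0 \<noteq> 0"
  hence "part_energy (join u v $ i) < part_energy (u $ i) + part_energy (v $ i)" using part_energy_join1(2) assms H1C_vec_D by simp
  moreover have "i = 1 \<or> i = 2 \<or> i = 3" using exhaust_3 by blast
  ultimately show "total_energy (join u v) < total_energy u + total_energy v" using t s[of 1] s[of 2] s[of 3] unfolding total_energy_def by auto
qed

text \<open>A bound for the rate at which \<open>part_energy\<close> can increase when the mass is
  changed by a small relative amount.\<close>

definition energy_slope :: "(real \<Rightarrow> complex) \<Rightarrow> real" where "energy_slope f = 1 / 2 * dirichlet f + \<beta> / 2 * potential p f"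

lemma energy_slope_nonneg: "0 \<le> energy_slope f" using b0 by (simp add: energy_slope_def)

text \<open>Multiplication by \<open>sqrt (1 + t)\<close> changes the mass by the factor
  \<open>1 + t\<close>. The Dirichlet part is linear in \<open>t\<close>, and the Bernoulli
  inequality with exponent \<open>(p + 1) / 2\<close> bounds the loss of the potential; the factor
  \<open>\<beta> / 2\<close> in \<open>energy_slope\<close> is \<open>\<beta> / (p + 1)\<close>
  times this exponent.\<close>

lemma part_energy_scale_sqrt:
  assumes "f \<in> H1C" "-1 \<le> t"
  shows "part_energy (\<lambda>x. complex_of_real (sqrt (1 + t)) * f x) \<le> part_energy f + \<bar>t\<bar> * energy_slope f"
proof -
  let ?c = "sqrt (1 + t)" let ?q = "(p + 1) / 2"
  have e: "part_energy (\<lambda>x. complex_of_real ?c * f x) = 1 / 2 * ((1 + t) * dirichlet f) - \<beta> / (p + 1) * ((1 + t) powr ?q * potential p f)"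
  proof -
    have "(cmod (complex_of_real ?c))\<^sup>2 = 1 + t" using assms by simp
    moreover have "cmod (complex_of_real ?c) powr (p + 1) = (1 + t) powr ?q"
      using assms by (simp add: powr_half_sqrt[symmetric] powr_powr)
    ultimately show ?thesis unfolding part_energy_def H1C_scale(2)[OF assms(1)] potential_scale by simp
  qed
  have B: "1 - (1 + t) powr ?q \<le> \<bar>t\<bar> * ?q"
  proof (cases "t \<ge> 0")
    case True
    have "1 \<le> (1 + t) powr ?q" using True p1 by (intro ge_one_powr_ge_zero) auto
    moreover have "0 \<le> \<bar>t\<bar> * ?q" using p1 by simp
    ultimately show ?thesis by linarith
  next
    case False
    have "1 + ?q * t \<le> (1 + t) powr ?q" using Bernoulli_powr[of ?q "1 + t"] p1 assms(2) by simp
    thus ?thesis using False by (simp add: mult.commute)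
  qed
  have "\<beta> / (p + 1) * ((1 - (1 + t) powr ?q) * potential p f) \<le> \<beta> / (p + 1) * (\<bar>t\<bar> * ?q * potential p f)"
    using b0 p1 by (intro mult_left_mono mult_right_mono B) auto
  also have "\<dots> = \<bar>t\<bar> * (\<beta> / 2 * potential p f)" using p1 by (simp add: field_simps)
  finally have 1: "\<beta> / (p + 1) * potential p f - \<beta> / (p + 1) * ((1 + t) powr ?q * potential p f) \<le> \<bar>t\<bar> * (\<beta> / 2 * potential p f)"
    by (simp add: algebra_simps)
  have 2: "t * dirichlet f \<le> \<bar>t\<bar> * dirichlet f" by (intro mult_right_mono) auto
  have 3: "\<bar>t\<bar> * energy_slope f = 1 / 2 * (\<bar>t\<bar> * dirichlet f) + \<bar>t\<bar> * (\<beta> / 2 * potential p f)" by (simp add: energy_slope_def algebra_simps)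
  have 4: "1 / 2 * ((1 + t) * dirichlet f) = 1 / 2 * dirichlet f + 1 / 2 * (t * dirichlet f)" by (simp add: algebra_simps)
  show ?thesis unfolding e 3 4 using 1 2 unfolding part_energy_def by linarith
qed

text \<open>At bounded mass the sup grows with the fourth root of the Dirichlet energy. So the
  potential is of order \<open>(p - 1) / 4\<close> and the coupling of order \<open>1 / 4\<close> in
  it, and both exponents are below 1.\<close>

lemma coercive: "\<exists>B. \<forall>u\<in>H1C_vec. (\<forall>i. mass (u $ i) \<le> K) \<longrightarrow> (dirichlet (u $ 1) + dirichlet (u $ 2) + dirichlet (u $ 3)) / 4 - B \<le> total_energy u"
proof (cases "K \<ge> 0")
  case False
  have "\<not> (\<forall>i. mass (u $ i) \<le> K)" for u :: "(real \<Rightarrow> complex)^3"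
    using False mass_nonneg[of "u $ 1"] by (metis linorder_not_le order_trans)
  thus ?thesis by blast
next
  case K: True
  define C where "C = sqrt (2 * K + 2)"
  have C0: "C \<ge> 0" using K by (simp add: C_def)
  define A1 where "A1 = \<beta> / (p + 1) * (C powr (p - 1) * K)"
  define A2 where "A2 = \<alpha> * (2 * K * C)"
  have A0: "0 \<le> A1" "0 \<le> A2" unfolding A1_def A2_def using C0 K a0 b0 p1 by auto
  \<comment> \<open>Of the factor \<open>1/2\<close> of each Dirichlet energy, \<open>1/8\<close>
    pays for the potential; in the third component another \<open>1/8\<close> pays for the coupling,
    which leaves \<open>1/4\<close>.\<close>
  obtain B1 where B1: "\<And>s. s \<ge> 1 \<Longrightarrow> A1 * s powr ((p - 1) / 4) \<le> 1/8 * s + B1"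
    using sublinear[of A1 "(p - 1) / 4" "1/8"] A0 p1 p5 by auto
  obtain B2 where B2: "\<And>s. s \<ge> 1 \<Longrightarrow> A2 * s powr (1/4) \<le> 1/8 * s + B2"
    using sublinear[of A2 "1/4" "1/8"] A0 by auto
  have Sb: "1 / 2 * dirichlet f - (1/8 * (1 + dirichlet f) + B1) \<le> part_energy f" if "f \<in> H1C" "mass f \<le> K" for f
  proof -
    have "potential p f \<le> (C * (1 + dirichlet f) powr (1/4)) powr (p - 1) * mass f"
      unfolding C_def by (intro potential_bound that p1 H1C_sup_coercive)
    also have "\<dots> \<le> (C * (1 + dirichlet f) powr (1/4)) powr (p - 1) * K" by (intro mult_left_mono that) auto
    also have "\<dots> = C powr (p - 1) * K * (1 + dirichlet f) powr ((p - 1) / 4)"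
      using C0 by (simp add: powr_mult powr_powr)
    finally have "\<beta> / (p + 1) * potential p f \<le> A1 * (1 + dirichlet f) powr ((p - 1) / 4)"
      unfolding A1_def using b0 p1 mult_left_mono[of "potential p f" _ "\<beta> / (p + 1)"] by (simp add: mult.assoc)
    thus ?thesis using B1[of "1 + dirichlet f"] dirichlet_nonneg[of f] unfolding part_energy_def by linarith
  qed
  have Tb: "\<alpha> * Re (coupling (u$1) (u$2) (u$3)) \<le> 1/8 * (1 + dirichlet (u$3)) + B2" if u: "u \<in> H1C_vec" "\<forall>i. mass (u $ i) \<le> K" for u
  proof -
    let ?M = "C * (1 + dirichlet (u$3)) powr (1/4)"
    have "Re (coupling (u$1) (u$2) (u$3)) \<le> ?M * (mass (u$1) + mass (u$2))"
      using Re_coupling_le[OF u(1)] abs_coupling_bound[OF H1C_vec_D H1C_vec_D H1C_vec_D, OF u(1) u(1) u(1), of 3 ?M 1 2] H1C_sup_coercive[OF H1C_vec_D[OF u(1)], of 3 K] u(2)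
      unfolding C_def by force
    also have "\<dots> \<le> ?M * (2 * K)" using u(2)[rule_format, of 1] u(2)[rule_format, of 2] C0 by (intro mult_left_mono) auto
    finally have "\<alpha> * Re (coupling (u$1) (u$2) (u$3)) \<le> \<alpha> * (?M * (2 * K))" using a0 by (intro mult_left_mono) auto
    also have "\<dots> = A2 * (1 + dirichlet (u$3)) powr (1/4)" by (simp add: A2_def)
    finally show ?thesis using B2[of "1 + dirichlet (u$3)"] dirichlet_nonneg[of "u$3"] by linarith
  qed
  have arith: "(d1 + d2 + d3) / 4 - (1/2 + 3 * B1 + B2) \<le> s1 + s2 + s3 - T"
    if "T \<le> 1/8 * (1 + d3) + B2" "1/2 * d1 - (1/8 * (1 + d1) + B1) \<le> s1" "1/2 * d2 - (1/8 * (1 + d2) + B1) \<le> s2"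
      "1/2 * d3 - (1/8 * (1 + d3) + B1) \<le> s3" "0 \<le> d1" "0 \<le> d2" for T d1 d2 d3 s1 s2 s3 :: real
    using that by argo
  have "(dirichlet (u $ 1) + dirichlet (u $ 2) + dirichlet (u $ 3)) / 4 - (1/2 + 3 * B1 + B2) \<le> total_energy u" if u: "u \<in> H1C_vec" "\<forall>i. mass (u $ i) \<le> K" for u
    unfolding total_energy_def
    by (rule arith[OF Tb[OF u] Sb[OF H1C_vec_D[OF u(1)] u(2)[rule_format]] Sb[OF H1C_vec_D[OF u(1)] u(2)[rule_format]]
      Sb[OF H1C_vec_D[OF u(1)] u(2)[rule_format]] dirichlet_nonneg dirichlet_nonneg])
  thus ?thesis by blast
qed

text \<open>Factoring out \<open>l powr ((p - 1) / 2)\<close> leaves a positive power of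
  \<open>l\<close> against the constant \<open>c\<close>, because \<open>p < 5\<close>.\<close>

lemma neg_profile: "\<exists>l0>0. \<forall>l. 0 < l \<longrightarrow> l < l0 \<longrightarrow> 1 / 2 * (a * l\<^sup>2) - c * l powr ((p - 1) / 2) < 0" if "c > 0" for a c :: real
proof -
  define e where "e = 2 - (p - 1) / 2"
  have e: "e > 0" using p5 by (simp add: e_def)
  have ev: "eventually ((\<le>) 0) (at_right (0::real))"
    by (rule eventually_mono[OF eventually_at_right_less]) simp
  have "((\<lambda>l. 1 / 2 * a * l powr e) \<longlongrightarrow> 1 / 2 * a * 0 powr e) (at_right 0)"
    using e by (intro tendsto_intros tendsto_powr') (auto simp: ev intro: tendsto_ident_at)
  hence "((\<lambda>l. 1 / 2 * a * l powr e) \<longlongrightarrow> 0) (at_right 0)" by simp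
  hence "\<forall>\<^sub>F l in at_right 0. 1 / 2 * a * l powr e < c" using that by (rule order_tendstoD)
  then obtain l0 where l0: "l0 > 0" "\<And>l. 0 < l \<Longrightarrow> l < l0 \<Longrightarrow> 1 / 2 * a * l powr e < c"
    unfolding eventually_at_right_field by auto
  have "1 / 2 * (a * l\<^sup>2) - c * l powr ((p - 1) / 2) < 0" if "0 < l" "l < l0" for l
  proof -
    have "l\<^sup>2 = l powr e * l powr ((p - 1) / 2)" using that by (simp add: powr_add[symmetric] e_def)
    hence "1 / 2 * (a * l\<^sup>2) - c * l powr ((p - 1) / 2) = (1 / 2 * a * l powr e - c) * l powr ((p - 1) / 2)"
      by (simp add: algebra_simps)
    also have "\<dots> < 0" using l0(2)[OF that] that by (intro mult_neg_pos) auto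
    finally show ?thesis .
  qed
  thus ?thesis using l0 by blast
qed

text \<open>Two dilated copies of one profile and no third component: the two masses are then the
  two constraints, and the coupling is zero. One mass may vanish, since the slack left in the two
  constraints need not be positive in both.\<close>

lemma negative_energy:
  assumes "0 \<le> n1" "0 \<le> n2" "n1 \<noteq> 0 \<or> n2 \<noteq> 0"
  shows "\<exists>\<psi>\<in>H1C_vec. Q1 \<psi> = n1 \<and> Q2 \<psi> = n2 \<and> total_energy \<psi> < 0"
proof -
  obtain f where f: "f \<in> H1C" "mass f = 1" using H1C_nontrivial by blast
  have "f \<noteq> (\<lambda>x. 0)" using f by auto
  then obtain x0 where x0: "f x0 \<noteq> 0" by auto
  have Pf: "potential p f > 0" unfolding potential_def
  proof (rule integral_pos_of_continuous[OF potential_integrable[OF f(1) p1]])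
    show "continuous_on UNIV (\<lambda>x. cmod (f x) powr (p + 1))"
      using H1C_continuous[OF f(1)] p1 by (intro continuous_intros continuous_on_powr') auto
  qed (use x0 in auto)
  have sg: "\<exists>l0>0. \<forall>l. 0 < l \<longrightarrow> l < l0 \<longrightarrow> part_energy (\<lambda>x. complex_of_real (sqrt n) * (complex_of_real (sqrt l) * f (l * x))) < 0"
    if "n > 0" for n
  proof -
    have c: "0 < \<beta> / (p + 1) * (sqrt n powr (p + 1) * potential p f)" using that b0 p1 Pf by simp
    obtain l0 where l0: "l0 > 0" "\<And>l. 0 < l \<Longrightarrow> l < l0 \<Longrightarrow> 1 / 2 * ((n * dirichlet f) * l\<^sup>2) - (\<beta> / (p + 1) * (sqrt n powr (p + 1) * potential p f)) * l powr ((p - 1) / 2) < 0"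
      using neg_profile[of "\<beta> / (p + 1) * (sqrt n powr (p + 1) * potential p f)" "n * dirichlet f"] c by blast
    show ?thesis
    proof (intro exI[of _ l0] conjI allI impI l0(1))
      fix l :: real assume l: "0 < l" "l < l0"
      note h = H1C_dilate[OF f(1) l(1)]
      show "part_energy (\<lambda>x. complex_of_real (sqrt n) * (complex_of_real (sqrt l) * f (l * x))) < 0"
      proof -
        have "part_energy (\<lambda>x. complex_of_real (sqrt n) * (complex_of_real (sqrt l) * f (l * x))) =
            1 / 2 * (n * (l\<^sup>2 * dirichlet f)) - \<beta> / (p + 1) * (sqrt n powr (p + 1) * (l powr ((p - 1) / 2) * potential p f))"
          unfolding part_energy_def H1C_scale(2)[OF h(1)] h(3)
          by (subst potential_scale, subst h(4)) (use that in simp)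
        thus ?thesis using l0(2)[OF l] by (simp add: mult_ac)
      qed
    qed
  qed
  define g where "g l n = (\<lambda>x. complex_of_real (sqrt n) * (complex_of_real (sqrt l) * f (l * x)))" for l n
  have gC: "g l n \<in> H1C" "mass (g l n) = n" if "l > 0" "n \<ge> 0" for l n
    unfolding g_def using H1C_dilate[OF f(1) that(1)] that f(2) by (auto intro!: H1C_scale simp: mass_scale)
  have g0: "g l 0 = (\<lambda>x. 0)" for l by (simp add: g_def)
  have ex: "\<exists>l0>0. \<forall>l. 0 < l \<longrightarrow> l < l0 \<longrightarrow> part_energy (g l n) \<le> 0 \<and> (n \<noteq> 0 \<longrightarrow> part_energy (g l n) < 0)" if "n \<ge> 0" for n
  proof (cases "n = 0")
    case True thus ?thesis by (intro exI[of _ 1]) (simp add: g0 part_energy_zero)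
  next
    case False thus ?thesis using sg[of n] that unfolding g_def[symmetric] by (metis less_imp_le less_eq_real_def)
  qed
  obtain l1 l2 where l: "l1 > 0" "\<And>l. 0 < l \<Longrightarrow> l < l1 \<Longrightarrow> part_energy (g l n1) \<le> 0 \<and> (n1 \<noteq> 0 \<longrightarrow> part_energy (g l n1) < 0)"
    "l2 > 0" "\<And>l. 0 < l \<Longrightarrow> l < l2 \<Longrightarrow> part_energy (g l n2) \<le> 0 \<and> (n2 \<noteq> 0 \<longrightarrow> part_energy (g l n2) < 0)"
    using ex[OF assms(1)] ex[OF assms(2)] by blast
  define m where "m = min l1 l2 / 2"
  have m: "0 < m" "m < l1" "m < l2" using l by (auto simp: m_def min_def)
  let ?\<psi> = "triple (g m n1) (g m n2) (\<lambda>x. 0)"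
  have "total_energy ?\<psi> < 0"
    using l(2)[OF m(1,2)] l(4)[OF m(1,3)] assms(3) by (auto simp: total_energy_def part_energy_zero coupling_def)
  moreover have "?\<psi> \<in> H1C_vec" using gC[OF m(1)] assms H1C_zero by (simp add: H1C_vec_iff)
  moreover have "Q1 ?\<psi> = n1" "Q2 ?\<psi> = n2" using gC(2)[OF m(1)] assms by (simp_all add: Q_eq)
  ultimately show ?thesis by blast
qed

end

section \<open>Strict subadditivity\<close>

definition nonneg_fun :: "(real \<Rightarrow> complex) \<Rightarrow> bool" where
  "nonneg_fun f \<longleftrightarrow> (\<forall>x. f x = complex_of_real (cmod (f x)))"

lemma nonneg_fun_join1: "nonneg_fun (join1 f g)"
  by (simp add: nonneg_fun_def join1_def)

lemma nonneg_fun_scale: "nonneg_fun f \<Longrightarrow> 0 \<le> c \<Longrightarrow> nonneg_fun (\<lambda>x. complex_of_real c * f x)"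
  unfolding nonneg_fun_def by (metis abs_of_nonneg norm_mult norm_of_real of_real_mult)

lemma coupling_nonneg_fun: assumes "nonneg_fun a" "nonneg_fun b" "nonneg_fun c" shows "coupling a b c = complex_of_real (abs_coupling a b c)"
proof -
  have "a x * b x * cnj (c x) = complex_of_real (cmod (a x) * cmod (b x) * cmod (c x))" for x
    using assms unfolding nonneg_fun_def by (metis complex_cnj_complex_of_real of_real_mult)
  thus ?thesis unfolding coupling_def abs_coupling_def by (simp only: integral_complex_of_real)
qed

lemma abs_coupling_scale: "abs_coupling (\<lambda>x. c1 * a x) (\<lambda>x. c2 * b x) (\<lambda>x. c3 * c x) = cmod c1 * cmod c2 * cmod c3 * abs_coupling a b c"
proof -
  have "abs_coupling (\<lambda>x. c1 * a x) (\<lambda>x. c2 * b x) (\<lambda>x. c3 * c x) =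
      (LINT x|lborel. (cmod c1 * cmod c2 * cmod c3) * (cmod (a x) * cmod (b x) * cmod (c x)))"
    unfolding abs_coupling_def by (simp add: norm_mult mult_ac)
  thus ?thesis unfolding abs_coupling_def by (simp only: integral_mult_right_zero)
qed

lemma abs_coupling_perm: "abs_coupling a b c = abs_coupling b c a" "abs_coupling a b c = abs_coupling a c b"
  unfolding abs_coupling_def by (simp_all add: mult_ac)

lemma abs_coupling_pos: assumes "a \<in> H1C" "b \<in> H1C" "c \<in> H1C" "a x0 \<noteq> 0" "b x0 \<noteq> 0" "c x0 \<noteq> 0" shows "abs_coupling a b c > 0"
  unfolding abs_coupling_def
proof (rule integral_pos_of_continuous[OF triple_integrable(1)[OF assms(1-3)], where ?x0.0 = x0])
  show "continuous_on UNIV (\<lambda>x. cmod (a x) * cmod (b x) * cmod (c x))"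
    by (intro continuous_intros H1C_continuous assms)
qed (use assms in auto)

lemma coupling_translate: "coupling (\<lambda>x. a (x + y)) (\<lambda>x. b (x + y)) (\<lambda>x. c (x + y)) = coupling a b c"
  unfolding coupling_def by (rule integral_translate[of "\<lambda>x. a x * b x * cnj (c x)"])

lemma three_cases: fixes i j k :: 3 assumes "i \<noteq> j" "i \<noteq> k" "j \<noteq> k" shows "m = i \<or> m = j \<or> m = k"
  using assms exhaust_3[of i] exhaust_3[of j] exhaust_3[of k] exhaust_3[of m] by (elim disjE) simp_all

context three_wave begin

text \<open>The coupling gains at least half of \<open>\<alpha> * e * abs_coupling f g h\<close>,
  while the new component \<open>e * h\<close> and the rescaling of \<open>f\<close> and
  \<open>g\<close> cost at most \<open>e^2 * M\<close>. The signs \<open>s\<close> and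
  \<open>s'\<close> stay free because they depend on which component is the empty one.\<close>

lemma perturb_core:
  assumes "f \<in> H1C" "g \<in> H1C" "h \<in> H1C" "f x0 \<noteq> 0" "g x0 \<noteq> 0" "h x0 \<noteq> 0"
  shows "\<exists>e>0. \<forall>s\<in>{-1,1}. \<forall>s'\<in>{-1,1}. \<bar>s * e\<^sup>2 / mass f\<bar> \<le> 1/2 \<and> \<bar>s' * e\<^sup>2 / mass g\<bar> \<le> 1/2 \<and>
    part_energy (\<lambda>x. complex_of_real (sqrt (1 + s * e\<^sup>2 / mass f)) * f x) + part_energy (\<lambda>x. complex_of_real (sqrt (1 + s' * e\<^sup>2 / mass g)) * g x)
    + part_energy (\<lambda>x. complex_of_real e * h x) - \<alpha> * (sqrt (1 + s * e\<^sup>2 / mass f) * sqrt (1 + s' * e\<^sup>2 / mass g) * e * abs_coupling f g h) < part_energy f + part_energy g"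
proof -
  have Nf: "mass f > 0" using mass_zero_iff[OF assms(1)] assms(4) mass_nonneg[of f] by (metis less_eq_real_def)
  have Ng: "mass g > 0" using mass_zero_iff[OF assms(2)] assms(5) mass_nonneg[of g] by (metis less_eq_real_def)
  define T where "T = abs_coupling f g h"
  have T: "T > 0" unfolding T_def using abs_coupling_pos assms by blast
  define M where "M = energy_slope f / mass f + energy_slope g / mass g + 1 / 2 * dirichlet h"
  have M: "M \<ge> 0" unfolding M_def using energy_slope_nonneg Nf Ng by simp
  \<comment> \<open>The first three entries give \<open>e^2 / mass \<le> 1/2\<close> for both
    functions, so each square root is at least \<open>sqrt (1/2)\<close>; the last entry makes
    \<open>e * M\<close> smaller than \<open>\<alpha> * T / 2\<close>.\<close>
  define e where "e = Min {1, mass f / 2, mass g / 2, \<alpha> * T / (4 * (M + 1))}"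
  have e0: "e > 0" unfolding e_def using Nf Ng T M a0 by simp
  have e1: "e \<le> 1" "e \<le> mass f / 2" "e \<le> mass g / 2" "e \<le> \<alpha> * T / (4 * (M + 1))" unfolding e_def by (intro Min_le; simp)+
  have ee: "e\<^sup>2 \<le> e" using e0 e1 by (simp add: power2_eq_square mult_left_le)
  have "e * (4 * (M + 1)) \<le> \<alpha> * T" using e1(4) M by (simp add: field_simps)
  moreover have "e * M < e * (2 * (M + 1))" using e0 M by (intro mult_strict_left_mono) auto
  ultimately have eM: "e * M < \<alpha> * T / 2" by (simp add: algebra_simps)
  have "\<bar>s * e\<^sup>2 / mass f\<bar> \<le> 1/2 \<and> \<bar>s' * e\<^sup>2 / mass g\<bar> \<le> 1/2 \<and>
    part_energy (\<lambda>x. complex_of_real (sqrt (1 + s * e\<^sup>2 / mass f)) * f x) + part_energy (\<lambda>x. complex_of_real (sqrt (1 + s' * e\<^sup>2 / mass g)) * g x)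
    + part_energy (\<lambda>x. complex_of_real e * h x) - \<alpha> * (sqrt (1 + s * e\<^sup>2 / mass f) * sqrt (1 + s' * e\<^sup>2 / mass g) * e * T) < part_energy f + part_energy g"
    if s: "s \<in> {-1,1}" "s' \<in> {-1,1}" for s s'
  proof -
    have as: "\<bar>s * e\<^sup>2 / mass f\<bar> = e\<^sup>2 / mass f" "\<bar>s' * e\<^sup>2 / mass g\<bar> = e\<^sup>2 / mass g" using s Nf Ng by (auto simp: abs_mult)
    have b: "\<bar>s * e\<^sup>2 / mass f\<bar> \<le> 1/2" "\<bar>s' * e\<^sup>2 / mass g\<bar> \<le> 1/2" unfolding as using ee e1 Nf Ng by (simp_all add: divide_le_eq)
    have b': "-1 \<le> s * e\<^sup>2 / mass f" "-1 \<le> s' * e\<^sup>2 / mass g"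
      using b unfolding abs_le_iff by linarith+
    have q: "sqrt (1/2) \<le> sqrt (1 + s * e\<^sup>2 / mass f)" "sqrt (1/2) \<le> sqrt (1 + s' * e\<^sup>2 / mass g)"
      using b unfolding abs_le_iff by (intro real_sqrt_le_mono; linarith)+
    have "sqrt (1/2) * sqrt (1/2) \<le> sqrt (1 + s * e\<^sup>2 / mass f) * sqrt (1 + s' * e\<^sup>2 / mass g)"
      by (intro mult_mono q order_trans[OF _ q(1)]) simp_all
    hence qq: "1/2 \<le> sqrt (1 + s * e\<^sup>2 / mass f) * sqrt (1 + s' * e\<^sup>2 / mass g)" by simp
    have "1/2 * (\<alpha> * e * T) \<le> sqrt (1 + s * e\<^sup>2 / mass f) * sqrt (1 + s' * e\<^sup>2 / mass g) * (\<alpha> * e * T)"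
      using a0 e0 T by (intro mult_right_mono qq) auto
    hence 1: "1/2 * (\<alpha> * e * T) \<le> \<alpha> * (sqrt (1 + s * e\<^sup>2 / mass f) * sqrt (1 + s' * e\<^sup>2 / mass g) * e * T)"
      by (simp add: mult_ac)
    have 2: "part_energy (\<lambda>x. complex_of_real (sqrt (1 + s * e\<^sup>2 / mass f)) * f x) \<le> part_energy f + e\<^sup>2 / mass f * energy_slope f"
      using part_energy_scale_sqrt[OF assms(1) b'(1)] unfolding as(1) .
    have 3: "part_energy (\<lambda>x. complex_of_real (sqrt (1 + s' * e\<^sup>2 / mass g)) * g x) \<le> part_energy g + e\<^sup>2 / mass g * energy_slope g"
      using part_energy_scale_sqrt[OF assms(2) b'(2)] unfolding as(2) .
    have "0 \<le> \<beta> / (p + 1) * potential p (\<lambda>x. complex_of_real e * h x)" using b0 p1 by simp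
    hence 4: "part_energy (\<lambda>x. complex_of_real e * h x) \<le> 1 / 2 * (e\<^sup>2 * dirichlet h)"
      using e0 unfolding part_energy_def H1C_scale(2)[OF assms(3)] norm_of_real power2_abs by linarith
    have 5: "e\<^sup>2 / mass f * energy_slope f + e\<^sup>2 / mass g * energy_slope g + 1 / 2 * (e\<^sup>2 * dirichlet h) = e * (e * M)"
      by (simp add: M_def power2_eq_square algebra_simps)
    have 6: "e * (e * M) < e * (\<alpha> * T / 2)" using eM e0 by (rule mult_strict_left_mono)
    have 7: "e * (\<alpha> * T / 2) = 1/2 * (\<alpha> * e * T)" by simp
    show ?thesis using b 1 2 3 4 5 6 7 by linarith
  qed
  thus ?thesis using e0 unfolding T_def by blast
qed

text \<open>Shifting the three masses along \<open>(1, 1, -1)\<close> preserves both constraints; which sign fills the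
  empty component \<open>k\<close> depends on \<open>k\<close>.\<close>
lemma perturb:
  assumes w: "w \<in> H1C_vec" "\<And>m. nonneg_fun (w $ m)" and k: "w $ k = (\<lambda>x. 0)" "\<And>m. m \<noteq> k \<Longrightarrow> (w $ m) 0 \<noteq> 0"
  shows "\<exists>h\<in>H1C_vec. Q1 h = Q1 w \<and> Q2 h = Q2 w \<and> total_energy h < total_energy w"
proof -
  have Npos: "mass (w $ m) > 0" if "m \<noteq> k" for m
    using mass_zero_iff[OF H1C_vec_D[OF w(1)], of m] k(2)[OF that] mass_nonneg[of "w $ m"] by (metis less_eq_real_def)
  have EW: "total_energy w = part_energy (w $ 1) + part_energy (w $ 2) + part_energy (w $ 3)"
  proof -
    have "k = 1 \<or> k = 2 \<or> k = 3" using exhaust_3 by blast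
    hence "coupling (w $ 1) (w $ 2) (w $ 3) = 0" using k(1) by (elim disjE) (simp_all add: coupling_def)
    thus ?thesis by (simp add: total_energy_def)
  qed
  have Nsc: "mass (\<lambda>x. complex_of_real (sqrt (1 + s * e\<^sup>2 / mass f)) * f x) = mass f + s * e\<^sup>2"
    if "mass f > 0" "\<bar>s * e\<^sup>2 / mass f\<bar> \<le> 1/2" for s e f
  proof -
    have "0 \<le> 1 + s * e\<^sup>2 / mass f" using that(2) unfolding abs_le_iff by linarith
    hence "mass (\<lambda>x. complex_of_real (sqrt (1 + s * e\<^sup>2 / mass f)) * f x) = (1 + s * e\<^sup>2 / mass f) * mass f"
      unfolding mass_scale by simp
    also have "\<dots> = mass f + s * e\<^sup>2" using that(1) by (simp add: distrib_right)
    finally show ?thesis .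
  qed
  \<comment> \<open>The outcome for an unspecified pair of occupied components \<open>i\<close> and
    \<open>j\<close>, from which the three cases for \<open>k\<close> read off their vector.\<close>
  define G where "G i j s s' e c c' \<phi> \<longleftrightarrow> \<phi> \<in> H1C \<and> nonneg_fun \<phi> \<and> mass \<phi> = 1 \<and> c \<ge> 0 \<and> c' \<ge> 0 \<and> e > 0 \<and>
      mass (\<lambda>x. complex_of_real c * (w $ i) x) = mass (w $ i) + s * e\<^sup>2 \<and> mass (\<lambda>x. complex_of_real c' * (w $ j) x) = mass (w $ j) + s' * e\<^sup>2 \<and>
      part_energy (\<lambda>x. complex_of_real c * (w $ i) x) + part_energy (\<lambda>x. complex_of_real c' * (w $ j) x) + part_energy (\<lambda>x. complex_of_real e * \<phi> x)
      - \<alpha> * abs_coupling (\<lambda>x. complex_of_real c * (w $ i) x) (\<lambda>x. complex_of_real c' * (w $ j) x) (\<lambda>x. complex_of_real e * \<phi> x) < part_energy (w $ i) + part_energy (w $ j)"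
    for i j s s' e c c' \<phi>
  have main: "\<exists>e c c' \<phi>. G i j s s' e c c' \<phi>"
    if ij: "i \<noteq> k" "j \<noteq> k" and s: "s \<in> {-1,1}" "s' \<in> {-1,1}" for i j s s'
  proof -
    \<comment> \<open>The new component has the shape of an occupied one, so all three are nonzero
      at 0.\<close>
    define r where "r = 1 / sqrt (mass (w $ i))"
    have r: "r > 0" "r\<^sup>2 * mass (w $ i) = 1" using Npos[OF ij(1)] by (simp_all add: r_def power_divide)
    define \<phi> where "\<phi> = (\<lambda>x. complex_of_real r * (w $ i) x)"
    have \<phi>: "\<phi> \<in> H1C" "nonneg_fun \<phi>" "\<phi> 0 \<noteq> 0" "mass \<phi> = 1"
      using H1C_scale(1)[OF H1C_vec_D[OF w(1)]] nonneg_fun_scale[OF w(2)] r k(2)[OF ij(1)]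
      by (simp_all add: \<phi>_def mass_scale)
    obtain e where e: "e > 0" "\<bar>s * e\<^sup>2 / mass (w $ i)\<bar> \<le> 1/2" "\<bar>s' * e\<^sup>2 / mass (w $ j)\<bar> \<le> 1/2"
      "part_energy (\<lambda>x. complex_of_real (sqrt (1 + s * e\<^sup>2 / mass (w $ i))) * (w $ i) x) + part_energy (\<lambda>x. complex_of_real (sqrt (1 + s' * e\<^sup>2 / mass (w $ j))) * (w $ j) x)
      + part_energy (\<lambda>x. complex_of_real e * \<phi> x) - \<alpha> * (sqrt (1 + s * e\<^sup>2 / mass (w $ i)) * sqrt (1 + s' * e\<^sup>2 / mass (w $ j)) * e * abs_coupling (w $ i) (w $ j) \<phi>) < part_energy (w $ i) + part_energy (w $ j)"
      using perturb_core[OF H1C_vec_D[OF w(1)] H1C_vec_D[OF w(1)] \<phi>(1) k(2)[OF ij(1)] k(2)[OF ij(2)] \<phi>(3)] s by blast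
    let ?c = "sqrt (1 + s * e\<^sup>2 / mass (w $ i))" and ?c' = "sqrt (1 + s' * e\<^sup>2 / mass (w $ j))"
    have "0 \<le> 1 + s * e\<^sup>2 / mass (w $ i)" "0 \<le> 1 + s' * e\<^sup>2 / mass (w $ j)"
      using e(2,3) unfolding abs_le_iff by linarith+
    hence c: "?c \<ge> 0" "?c' \<ge> 0" by simp_all
    have "abs_coupling (\<lambda>x. complex_of_real ?c * (w $ i) x) (\<lambda>x. complex_of_real ?c' * (w $ j) x) (\<lambda>x. complex_of_real e * \<phi> x) = ?c * ?c' * e * abs_coupling (w $ i) (w $ j) \<phi>"
      unfolding abs_coupling_scale norm_of_real using c e(1) by (simp only: abs_of_nonneg less_imp_le)
    thus ?thesis unfolding G_def using e(1,4) c \<phi> Nsc[OF Npos[OF ij(1)] e(2)] Nsc[OF Npos[OF ij(2)] e(3)]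
      by (intro exI[of _ e] exI[of _ ?c] exI[of _ ?c'] exI[of _ \<phi>]) simp
  qed
  have s1: "(1::real) \<in> {-1, 1}" "(-1::real) \<in> {-1, 1}" by auto
  have sc: "mass (\<lambda>x. complex_of_real e * \<phi> x) = e\<^sup>2" if "mass \<phi> = 1" for e \<phi> using that by (simp add: mass_scale)
  have "k = 1 \<or> k = 2 \<or> k = 3" using exhaust_3 by blast
  thus ?thesis
  proof (elim disjE)
    assume k1: "k = 1"
    have ne: "2 \<noteq> k" "3 \<noteq> k" using k1 by auto
    obtain e c c' \<phi> where G: "G 2 3 1 (-1) e c c' \<phi>" using main[OF ne s1] by blast
    have h: "\<phi> \<in> H1C" "nonneg_fun \<phi>" "mass \<phi> = 1" "c \<ge> 0" "c' \<ge> 0" "e > 0"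
      "mass (\<lambda>x. complex_of_real c * (w $ 2) x) = mass (w $ 2) + 1 * e\<^sup>2" "mass (\<lambda>x. complex_of_real c' * (w $ 3) x) = mass (w $ 3) + (-1) * e\<^sup>2"
      "part_energy (\<lambda>x. complex_of_real c * (w $ 2) x) + part_energy (\<lambda>x. complex_of_real c' * (w $ 3) x) + part_energy (\<lambda>x. complex_of_real e * \<phi> x)
      - \<alpha> * abs_coupling (\<lambda>x. complex_of_real c * (w $ 2) x) (\<lambda>x. complex_of_real c' * (w $ 3) x) (\<lambda>x. complex_of_real e * \<phi> x) < part_energy (w $ 2) + part_energy (w $ 3)"
      using G unfolding G_def by simp_all
    let ?h = "triple (\<lambda>x. complex_of_real e * \<phi> x) (\<lambda>x. complex_of_real c * (w $ 2) x) (\<lambda>x. complex_of_real c' * (w $ 3) x)"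
    have "?h \<in> H1C_vec" using h(1) H1C_vec_D[OF w(1)] by (simp add: H1C_vec_iff H1C_scale(1))
    moreover have "Q1 ?h = Q1 w" "Q2 ?h = Q2 w" using h(7,8) sc[OF h(3)] k(1) k1 by (simp_all add: Q_eq)
    moreover have "total_energy ?h < total_energy w"
      using h(9) k(1) k1 h(4-6) unfolding EW unfolding total_energy_def
      by (simp add: coupling_nonneg_fun nonneg_fun_scale h(2) w(2) part_energy_zero abs_coupling_perm(1)[of "\<lambda>x. complex_of_real e * \<phi> x"])
    ultimately show ?thesis by blast
  next
    assume k1: "k = 2"
    have ne: "1 \<noteq> k" "3 \<noteq> k" using k1 by auto
    obtain e c c' \<phi> where G: "G 1 3 1 (-1) e c c' \<phi>" using main[OF ne s1] by blast
    have h: "\<phi> \<in> H1C" "nonneg_fun \<phi>" "mass \<phi> = 1" "c \<ge> 0" "c' \<ge> 0" "e > 0"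
      "mass (\<lambda>x. complex_of_real c * (w $ 1) x) = mass (w $ 1) + 1 * e\<^sup>2" "mass (\<lambda>x. complex_of_real c' * (w $ 3) x) = mass (w $ 3) + (-1) * e\<^sup>2"
      "part_energy (\<lambda>x. complex_of_real c * (w $ 1) x) + part_energy (\<lambda>x. complex_of_real c' * (w $ 3) x) + part_energy (\<lambda>x. complex_of_real e * \<phi> x)
      - \<alpha> * abs_coupling (\<lambda>x. complex_of_real c * (w $ 1) x) (\<lambda>x. complex_of_real c' * (w $ 3) x) (\<lambda>x. complex_of_real e * \<phi> x) < part_energy (w $ 1) + part_energy (w $ 3)"
      using G unfolding G_def by simp_all
    let ?h = "triple (\<lambda>x. complex_of_real c * (w $ 1) x) (\<lambda>x. complex_of_real e * \<phi> x) (\<lambda>x. complex_of_real c' * (w $ 3) x)"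
    have "?h \<in> H1C_vec" using h(1) H1C_vec_D[OF w(1)] by (simp add: H1C_vec_iff H1C_scale(1))
    moreover have "Q1 ?h = Q1 w" "Q2 ?h = Q2 w" using h(7,8) sc[OF h(3)] k(1) k1 by (simp_all add: Q_eq)
    moreover have "total_energy ?h < total_energy w"
      using h(9) k(1) k1 h(4-6) unfolding EW unfolding total_energy_def
      by (simp add: coupling_nonneg_fun nonneg_fun_scale h(2) w(2) part_energy_zero abs_coupling_perm(2)[of "\<lambda>x. complex_of_real c * (w $ 1) x" "\<lambda>x. complex_of_real e * \<phi> x"])
    ultimately show ?thesis by blast
  next
    assume k1: "k = 3"
    have ne: "1 \<noteq> k" "2 \<noteq> k" using k1 by auto
    obtain e c c' \<phi> where G: "G 1 2 (-1) (-1) e c c' \<phi>" using main[OF ne s1(2) s1(2)] by blast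
    have h: "\<phi> \<in> H1C" "nonneg_fun \<phi>" "mass \<phi> = 1" "c \<ge> 0" "c' \<ge> 0" "e > 0"
      "mass (\<lambda>x. complex_of_real c * (w $ 1) x) = mass (w $ 1) + (-1) * e\<^sup>2" "mass (\<lambda>x. complex_of_real c' * (w $ 2) x) = mass (w $ 2) + (-1) * e\<^sup>2"
      "part_energy (\<lambda>x. complex_of_real c * (w $ 1) x) + part_energy (\<lambda>x. complex_of_real c' * (w $ 2) x) + part_energy (\<lambda>x. complex_of_real e * \<phi> x)
      - \<alpha> * abs_coupling (\<lambda>x. complex_of_real c * (w $ 1) x) (\<lambda>x. complex_of_real c' * (w $ 2) x) (\<lambda>x. complex_of_real e * \<phi> x) < part_energy (w $ 1) + part_energy (w $ 2)"
      using G unfolding G_def by simp_all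
    let ?h = "triple (\<lambda>x. complex_of_real c * (w $ 1) x) (\<lambda>x. complex_of_real c' * (w $ 2) x) (\<lambda>x. complex_of_real e * \<phi> x)"
    have "?h \<in> H1C_vec" using h(1) H1C_vec_D[OF w(1)] by (simp add: H1C_vec_iff H1C_scale(1))
    moreover have "Q1 ?h = Q1 w" "Q2 ?h = Q2 w" using h(7,8) sc[OF h(3)] k(1) k1 by (simp_all add: Q_eq)
    moreover have "total_energy ?h < total_energy w"
      using h(9) k(1) k1 h(4-6) unfolding EW unfolding total_energy_def
      by (simp add: coupling_nonneg_fun nonneg_fun_scale h(2) w(2) part_energy_zero)
    ultimately show ?thesis by blast
  qed
qed

lemma translate_nth [simp]: "(translate y u $ m) x = (u $ m) (x + y)" "translate y u $ m = (\<lambda>x. (u $ m) (x + y))"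
  by (simp_all add: translate_def)

lemma translate_H1C_vec: assumes "u \<in> H1C_vec"
  shows "translate y u \<in> H1C_vec" "Q1 (translate y u) = Q1 u" "Q2 (translate y u) = Q2 u" "total_energy (translate y u) = total_energy u"
proof -
  show "translate y u \<in> H1C_vec" using assms by (simp add: H1C_vec_def H1C_translate)
  show "Q1 (translate y u) = Q1 u" "Q2 (translate y u) = Q2 u" by (simp_all add: Q_eq mass_translate)
  show "total_energy (translate y u) = total_energy u" using assms by (simp add: total_energy_def part_energy_translate H1C_vec_D coupling_translate)
qed

theorem strict_subadditive:
  assumes "\<phi> \<in> H1C_vec" "\<psi> \<in> H1C_vec" "\<phi> $ i \<noteq> (\<lambda>x. 0)" "\<psi> $ j \<noteq> (\<lambda>x. 0)"
  shows "\<exists>h\<in>H1C_vec. Q1 h = Q1 \<phi> + Q1 \<psi> \<and> Q2 h = Q2 \<phi> + Q2 \<psi> \<and> total_energy h < total_energy \<phi> + total_energy \<psi>"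
proof (cases "\<exists>m. \<phi> $ m \<noteq> (\<lambda>x. 0) \<and> \<psi> $ m \<noteq> (\<lambda>x. 0)")
  case True
  then obtain m x1 x2 where x: "(\<phi> $ m) x1 \<noteq> 0" "(\<psi> $ m) x2 \<noteq> 0" unfolding fun_eq_iff by blast
  let ?\<psi> = "translate (x2 - x1) \<psi>"
  note t = translate_H1C_vec[OF assms(2), of "x2 - x1"]
  have "(?\<psi> $ m) x1 \<noteq> 0" using x by simp
  from total_energy_join(2)[OF assms(1) t(1) x(1) this] have "total_energy (join \<phi> ?\<psi>) < total_energy \<phi> + total_energy \<psi>" using t(4) by simp
  thus ?thesis using join_H1C_vec[OF assms(1) t(1)] Q_join[OF assms(1) t(1)] t by (intro bexI[of _ "join \<phi> ?\<psi>"]) auto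
next
  case False
  \<comment> \<open>No component is nonzero in both vectors. So each vector has a zero component and
    no coupling to lose, and every component may be translated on its own, here to a point where it
    does not vanish. For a component that is identically zero the chosen point is
    irrelevant.\<close>
  define z where "z m = (SOME x. join1 (\<phi> $ m) (\<psi> $ m) x \<noteq> 0)" for m
  define v where "v = (\<chi> m. (\<lambda>x. join1 (\<phi> $ m) (\<psi> $ m) (x + z m)))"
  have vm: "v $ m = (\<lambda>x. join1 (\<phi> $ m) (\<psi> $ m) (x + z m))" for m by (simp add: v_def)
  have v0: "(v $ m) 0 \<noteq> 0 \<or> v $ m = (\<lambda>x. 0)" for m
  proof (cases "\<exists>x. join1 (\<phi> $ m) (\<psi> $ m) x \<noteq> 0")
    case True
    hence "join1 (\<phi> $ m) (\<psi> $ m) (z m) \<noteq> 0" unfolding z_def by (rule someI_ex)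
    thus ?thesis by (simp add: vm)
  qed (simp add: vm)
  have nz: "v $ m \<noteq> (\<lambda>x. 0)" if nn: "\<phi> $ m \<noteq> (\<lambda>x. 0) \<or> \<psi> $ m \<noteq> (\<lambda>x. 0)" for m
  proof -
    obtain x where "(\<phi> $ m) x \<noteq> 0 \<or> (\<psi> $ m) x \<noteq> 0" using nn unfolding fun_eq_iff by blast
    hence "(v $ m) (x - z m) \<noteq> 0" unfolding vm join1_def by (auto simp: add_nonneg_eq_0_iff)
    thus ?thesis by auto
  qed
  have C: "join1 (\<phi> $ m) (\<psi> $ m) \<in> H1C" for m using join1_H1C H1C_vec_D assms by blast
  have vC: "v \<in> H1C_vec" by (simp add: H1C_vec_def vm H1C_translate C)
  have vn: "nonneg_fun (v $ m)" for m using nonneg_fun_join1 by (simp add: vm nonneg_fun_def)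
  have vN: "mass (v $ m) = mass (\<phi> $ m) + mass (\<psi> $ m)" for m
    unfolding vm mass_translate[of "join1 (\<phi> $ m) (\<psi> $ m)"] using mass_join1 H1C_vec_D assms by blast
  have vS: "part_energy (v $ m) \<le> part_energy (\<phi> $ m) + part_energy (\<psi> $ m)" for m
    unfolding vm part_energy_translate[OF C] using part_energy_join1(1) H1C_vec_D assms by blast
  have Q: "Q1 v = Q1 \<phi> + Q1 \<psi>" "Q2 v = Q2 \<phi> + Q2 \<psi>" by (simp_all add: Q_eq vN)
  have T0: "coupling (u $ 1) (u $ 2) (u $ 3) = 0" if ex: "\<exists>m. u $ m = (\<lambda>x. 0)" for u :: "(real \<Rightarrow> complex)^3"
  proof -
    obtain m where m: "u $ m = (\<lambda>x. 0)" using ex by blast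
    have "m = 1 \<or> m = 2 \<or> m = 3" using exhaust_3 by blast
    thus ?thesis using m by (elim disjE) (simp_all add: coupling_def)
  qed
  have "\<phi> $ j = (\<lambda>x. 0)" "\<psi> $ i = (\<lambda>x. 0)" using False assms by auto
  hence "coupling (\<phi> $ 1) (\<phi> $ 2) (\<phi> $ 3) = 0" "coupling (\<psi> $ 1) (\<psi> $ 2) (\<psi> $ 3) = 0"
    using T0[of \<phi>] T0[of \<psi>] by blast+
  hence E: "total_energy \<phi> + total_energy \<psi> = (part_energy (\<phi> $ 1) + part_energy (\<psi> $ 1)) + (part_energy (\<phi> $ 2) + part_energy (\<psi> $ 2)) + (part_energy (\<phi> $ 3) + part_energy (\<psi> $ 3))"
    unfolding total_energy_def by simp
  have Ev: "total_energy v \<le> total_energy \<phi> + total_energy \<psi> - \<alpha> * abs_coupling (v $ 1) (v $ 2) (v $ 3)"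
    unfolding E using vS[of 1] vS[of 2] vS[of 3] unfolding total_energy_def by (simp add: coupling_nonneg_fun vn)
  show ?thesis
  proof (cases "\<exists>k. v $ k = (\<lambda>x. 0)")
    case False
    hence "abs_coupling (v $ 1) (v $ 2) (v $ 3) > 0" using v0 by (intro abs_coupling_pos[of _ _ _ 0] H1C_vec_D vC) auto
    hence "total_energy v < total_energy \<phi> + total_energy \<psi>" using Ev a0 by (smt (verit) mult_pos_pos)
    thus ?thesis using vC Q by blast
  next
    case True
    then obtain k where k: "v $ k = (\<lambda>x. 0)" by blast
    \<comment> \<open>Component \<open>i\<close> is occupied by \<open>\<phi>\<close> and component
      \<open>j\<close> by \<open>\<psi>\<close>, so \<open>k\<close> is the only empty one.\<close>
    have "i \<noteq> j" using False assms by auto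
    moreover have "i \<noteq> k" "j \<noteq> k" using nz k assms by auto
    ultimately have c: "m = i \<or> m = j \<or> m = k" for m by (rule three_cases)
    have "(v $ m) 0 \<noteq> 0" if "m \<noteq> k" for m using c[of m] that v0[of m] nz assms by auto
    then obtain h where h: "h \<in> H1C_vec" "Q1 h = Q1 v" "Q2 h = Q2 v" "total_energy h < total_energy v"
      using perturb[OF vC vn k] by blast
    have "0 \<le> \<alpha> * abs_coupling (v $ 1) (v $ 2) (v $ 3)" using a0 abs_coupling_nonneg by simp
    hence "total_energy h < total_energy \<phi> + total_energy \<psi>" using h(4) Ev by linarith
    thus ?thesis using h Q by auto
  qed
qed

end

section \<open>The minimal energy\<close>

lemma energy_slope_bounds:
  assumes "f \<in> H1C" "mass f \<le> K" "dirichlet f \<le> K" "1 < p"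
  shows "potential p f \<le> sqrt (4 * K) powr (p - 1) * K" "cmod (f x) \<le> sqrt (4 * K)"
proof -
  have s: "cmod (f x) \<le> sqrt (4 * K)" for x
    using H1C_sup1[OF assms(1), of x] real_sqrt_le_mono[of "2 * mass f + 2 * dirichlet f" "4 * K"] assms by linarith
  show "cmod (f x) \<le> sqrt (4 * K)" by (rule s)
  have "potential p f \<le> sqrt (4 * K) powr (p - 1) * mass f" by (rule potential_bound[OF assms(1,4) s])
  also have "\<dots> \<le> sqrt (4 * K) powr (p - 1) * K" using assms by (intro mult_left_mono) auto
  finally show "potential p f \<le> sqrt (4 * K) powr (p - 1) * K" .
qed

context three_wave begin

text \<open>Every quantity in the theorem depends only on almost-everywhere classes, so passing to
  continuous representatives loses nothing; even \<open>weak_deriv\<close> stays literally the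
  same.\<close>

lemma H1_vec_rep:
  assumes "u \<in> H1_vec"
  shows "\<exists>v\<in>H1C_vec. (\<forall>i. AE x in lborel. (u $ i) x = (v $ i) x) \<and> total_energy v = total_energy u \<and> Q1 v = Q1 u \<and> Q2 v = Q2 u"
proof -
  have "\<exists>h. H1_pair h (weak_deriv (u $ i)) \<and> (AE x in lborel. (u $ i) x = h x)" for i
    using H1_continuous_rep assms by (simp add: H1_vec_def)
  then obtain h where h: "\<And>i. H1_pair (h i) (weak_deriv (u $ i))" "\<And>i. AE x in lborel. (u $ i) x = h i x" by metis
  let ?v = "\<chi> i. h i"
  have um [measurable]: "u $ i \<in> borel_measurable borel" for i
    using assms L2_measurable by (auto simp: H1_vec_def H1_def)
  have hm [measurable]: "h i \<in> borel_measurable borel" for i using H1_pair_measurable[OF h(1)] by auto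
  have cm: "(\<lambda>x. cnj (f x)) \<in> borel_measurable borel" if "f \<in> borel_measurable borel" for f :: "real \<Rightarrow> complex"
    by (rule measurable_compose[OF that]) (intro borel_measurable_continuous_onI continuous_intros)
  have [measurable]: "(\<lambda>x. cnj ((u $ i) x)) \<in> borel_measurable borel" "(\<lambda>x. cnj (h i x)) \<in> borel_measurable borel" for i
    by (intro cm um hm)+
  have NN: "mass (h i) = mass (u $ i)" for i by (rule mass_cong_AE[OF h(2) um hm, symmetric])
  have PP: "potential p (h i) = potential p (u $ i)" for i
    unfolding potential_def
  proof (rule integral_cong_AE)
    show "AE x in lborel. cmod (h i x) powr (p + 1) = cmod ((u $ i) x) powr (p + 1)"
      using h(2)[of i] by eventually_elim simp
  qed measurable
  have DD: "dirichlet (h i) = dirichlet (u $ i)" for i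
    unfolding dirichlet_def weak_deriv_cong_AE[OF h(2) um hm, of i] ..
  have TT: "coupling (h 1) (h 2) (h 3) = coupling (u $ 1) (u $ 2) (u $ 3)"
    unfolding coupling_def
  proof (rule integral_cong_AE)
    show "AE x in lborel. h 1 x * h 2 x * cnj (h 3 x) = (u $ 1) x * (u $ 2) x * cnj ((u $ 3) x)"
      using h(2)[of 1] h(2)[of 2] h(2)[of 3] by eventually_elim simp
  qed measurable
  have "?v \<in> H1C_vec" using H1_pair_H1C[OF h(1)] by (simp add: H1C_vec_def)
  moreover have "total_energy ?v = total_energy u" by (simp add: total_energy_def part_energy_def NN PP DD TT)
  ultimately show ?thesis using h(2) NN by (intro bexI[of _ ?v]) (simp_all add: Q_eq)
qed

lemma H1C_vec_H1_vec: "u \<in> H1C_vec \<Longrightarrow> u \<in> H1_vec"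
  by (simp add: H1C_vec_def H1_vec_def H1C_H1)

lemma mass_le_Q:
  shows "mass (u $ i) \<le> Q1 u + Q2 u"
proof -
  have "i = 1 \<or> i = 2 \<or> i = 3" using exhaust_3 by blast
  thus ?thesis
    using mass_nonneg[of "u $ 1"] mass_nonneg[of "u $ 2"] mass_nonneg[of "u $ 3"] by (elim disjE) (simp_all add: Q_eq)
qed

abbreviation "Jm \<equiv> J \<alpha> \<beta> p"

lemma J_set: "{energy \<alpha> \<beta> p u | u. u \<in> H1_vec \<and> Q1 u = \<gamma> \<and> Q2 u = \<mu>} = total_energy ` {u \<in> H1C_vec. Q1 u = \<gamma> \<and> Q2 u = \<mu>}"
proof -
  have "\<exists>v\<in>H1C_vec. Q1 v = Q1 u \<and> Q2 v = Q2 u \<and> total_energy u = total_energy v" if "u \<in> H1_vec" for u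
    using H1_vec_rep[OF that] by metis
  thus ?thesis using H1C_vec_H1_vec unfolding energy_eq by (auto simp: image_def)
qed

lemma J_bdd: "bdd_below (total_energy ` {u \<in> H1C_vec. Q1 u = \<gamma> \<and> Q2 u = \<mu>})"
proof -
  obtain B where B: "\<And>u. u \<in> H1C_vec \<Longrightarrow> (\<forall>i. mass (u $ i) \<le> \<gamma> + \<mu>) \<Longrightarrow> (dirichlet (u $ 1) + dirichlet (u $ 2) + dirichlet (u $ 3)) / 4 - B \<le> total_energy u"
    using coercive[of "\<gamma> + \<mu>"] by blast
  have "- B \<le> total_energy u" if "u \<in> H1C_vec" "Q1 u = \<gamma>" "Q2 u = \<mu>" for u
  proof -
    have "\<forall>i. mass (u $ i) \<le> \<gamma> + \<mu>" using mass_le_Q[of u] that by blast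
    hence "(dirichlet (u $ 1) + dirichlet (u $ 2) + dirichlet (u $ 3)) / 4 - B \<le> total_energy u" using B that by blast
    moreover have "0 \<le> (dirichlet (u $ 1) + dirichlet (u $ 2) + dirichlet (u $ 3)) / 4" by simp
    ultimately show ?thesis by linarith
  qed
  thus ?thesis by (intro bdd_belowI[of _ "- B"]) auto
qed

lemma J_le: "u \<in> H1C_vec \<Longrightarrow> Jm (Q1 u) (Q2 u) \<le> total_energy u"
  unfolding J_def J_set by (rule cInf_lower[OF _ J_bdd]) auto

lemma J_approach:
  assumes "\<gamma> > 0" "\<mu> > 0" "e > 0"
  shows "\<exists>u\<in>H1C_vec. Q1 u = \<gamma> \<and> Q2 u = \<mu> \<and> total_energy u < Jm \<gamma> \<mu> + e"
proof -
  have "total_energy ` {u \<in> H1C_vec. Q1 u = \<gamma> \<and> Q2 u = \<mu>} \<noteq> {}"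
    using negative_energy[of \<gamma> \<mu>] assms by auto
  thus ?thesis
    using cInf_lessD[of "total_energy ` {u \<in> H1C_vec. Q1 u = \<gamma> \<and> Q2 u = \<mu>}" "Jm \<gamma> \<mu> + e"] assms(3)
    unfolding J_def J_set by auto
qed

lemma J_neg: assumes "\<gamma> > 0" "\<mu> > 0" shows "Jm \<gamma> \<mu> < 0"
proof -
  obtain \<psi> where "\<psi> \<in> H1C_vec" "Q1 \<psi> = \<gamma>" "Q2 \<psi> = \<mu>" "total_energy \<psi> < 0" using negative_energy[of \<gamma> \<mu>] assms by auto
  thus ?thesis using J_le[of \<psi>] by simp
qed

lemma J_le_sub:
  assumes "u \<in> H1C_vec" "Q1 u \<le> \<gamma>" "Q2 u \<le> \<mu>"
  shows "Jm \<gamma> \<mu> \<le> total_energy u"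
proof (cases "Q1 u = \<gamma> \<and> Q2 u = \<mu>")
  case True thus ?thesis using J_le[OF assms(1)] by simp
next
  case False
  obtain \<psi> where \<psi>: "\<psi> \<in> H1C_vec" "Q1 \<psi> = \<gamma> - Q1 u" "Q2 \<psi> = \<mu> - Q2 u" "total_energy \<psi> < 0"
    using negative_energy[of "\<gamma> - Q1 u" "\<mu> - Q2 u"] assms False by auto
  have "Jm \<gamma> \<mu> \<le> total_energy (join u \<psi>)"
    using J_le[OF join_H1C_vec[OF assms(1) \<psi>(1)]] Q_join[OF assms(1) \<psi>(1)] \<psi> by simp
  also have "\<dots> \<le> total_energy u + total_energy \<psi>" by (rule total_energy_join[OF assms(1) \<psi>(1)])
  finally show ?thesis using \<psi>(4) by linarith
qed

lemma bounded_of_energy: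
  assumes "\<And>n. k n \<in> H1C_vec" "\<And>n i. mass (k n $ i) \<le> K" "\<And>n. total_energy (k n) \<le> e"
  shows "\<exists>K'. \<forall>n i. dirichlet (k n $ i) \<le> K'"
proof -
  obtain B where B: "\<And>u. u \<in> H1C_vec \<Longrightarrow> (\<forall>i. mass (u $ i) \<le> K) \<Longrightarrow> (dirichlet (u $ 1) + dirichlet (u $ 2) + dirichlet (u $ 3)) / 4 - B \<le> total_energy u"
    using coercive[of K] by blast
  have "dirichlet (k n $ i) \<le> 4 * (e + B)" for n i
  proof -
    have "i = 1 \<or> i = 2 \<or> i = 3" using exhaust_3 by blast
    hence "dirichlet (k n $ i) \<le> dirichlet (k n $ 1) + dirichlet (k n $ 2) + dirichlet (k n $ 3)" by (elim disjE) simp_all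
    moreover have "(dirichlet (k n $ 1) + dirichlet (k n $ 2) + dirichlet (k n $ 3)) / 4 - B \<le> e" using B[of "k n"] assms order_trans by blast
    ultimately show ?thesis by argo
  qed
  thus ?thesis by blast
qed

text \<open>The factor \<open>sqrt s\<close> multiplies both constraints by \<open>s\<close> at
  once. The one-component energies rise by an amount of order \<open>1 - s\<close> and the cubic
  coupling loses the factor \<open>sqrt s ^ 3\<close>; both errors vanish as \<open>s\<close> tends
  to 1, uniformly under the bound \<open>K\<close>.\<close>

lemma scaled_energy:
  assumes "u \<in> H1C_vec" "0 \<le> s" "s \<le> 1" "\<And>i. mass (u $ i) \<le> K" "\<And>i. dirichlet (u $ i) \<le> K"
  defines "v \<equiv> (\<chi> i. (\<lambda>x. complex_of_real (sqrt s) * (u $ i) x))"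
  shows "v \<in> H1C_vec" "Q1 v = s * Q1 u" "Q2 v = s * Q2 u"
    "total_energy v \<le> total_energy u + (1 - s) * (3 * (1/2 * K + \<beta> / 2 * (sqrt (4 * K) powr (p - 1) * K))) + \<alpha> * (1 - sqrt s ^ 3) * (sqrt (4 * K) * (2 * K))"
proof -
  show "v \<in> H1C_vec" using assms(1) by (simp add: H1C_vec_def v_def H1C_scale)
  show "Q1 v = s * Q1 u" "Q2 v = s * Q2 u" using assms(2) by (simp_all add: Q_eq v_def mass_scale distrib_left)
  define K1 where "K1 = 1/2 * K + \<beta> / 2 * (sqrt (4 * K) powr (p - 1) * K)"
  have Sb: "part_energy (v $ i) \<le> part_energy (u $ i) + (1 - s) * K1" for i
  proof -
    have "part_energy (v $ i) \<le> part_energy (u $ i) + \<bar>s - 1\<bar> * energy_slope (u $ i)"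
      using part_energy_scale_sqrt[OF H1C_vec_D[OF assms(1), of i], of "s - 1"] assms(2) by (simp add: v_def)
    also have "energy_slope (u $ i) \<le> K1" unfolding energy_slope_def K1_def
      using energy_slope_bounds(1)[OF H1C_vec_D[OF assms(1)] assms(4,5) p1, of i] assms(5)[of i] b0 by (intro add_mono mult_left_mono) auto
    finally show ?thesis using assms(3) by (simp add: mult_left_mono)
  qed
  let ?T = "coupling (u $ 1) (u $ 2) (u $ 3)"
  have Tv: "coupling (v $ 1) (v $ 2) (v $ 3) = complex_of_real (sqrt s ^ 3) * ?T"
  proof -
    have *: "complex_of_real c * a * (complex_of_real c * b) * cnj (complex_of_real c * d) = complex_of_real (c ^ 3) * (a * b * cnj d)"
      for a b d c by (simp add: power3_eq_cube mult_ac)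
    have "coupling (v $ 1) (v $ 2) (v $ 3) = (LINT x|lborel. complex_of_real (sqrt s ^ 3) * ((u $ 1) x * (u $ 2) x * cnj ((u $ 3) x)))"
      unfolding coupling_def v_def vec_lambda_beta * ..
    thus ?thesis unfolding coupling_def by (simp only: integral_mult_right_zero)
  qed
  have "abs_coupling (u $ 1) (u $ 2) (u $ 3) \<le> sqrt (4 * K) * (mass (u $ 1) + mass (u $ 2))"
    by (intro abs_coupling_bound H1C_vec_D assms energy_slope_bounds(2)[OF _ _ _ p1])
  also have "\<dots> \<le> sqrt (4 * K) * (2 * K)"
  proof (rule mult_left_mono)
    show "mass (u $ 1) + mass (u $ 2) \<le> 2 * K" using assms(4)[of 1] assms(4)[of 2] by simp
    have "0 \<le> K" using assms(4)[of 1] mass_nonneg order_trans by blast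
    thus "0 \<le> sqrt (4 * K)" by simp
  qed
  finally have "Re ?T \<le> sqrt (4 * K) * (2 * K)" using Re_coupling_le[OF assms(1)] by linarith
  moreover have "0 \<le> \<alpha> * (1 - sqrt s ^ 3)" using a0 assms(2,3) by (simp add: power_le_one)
  ultimately have "\<alpha> * (1 - sqrt s ^ 3) * Re ?T \<le> \<alpha> * (1 - sqrt s ^ 3) * (sqrt (4 * K) * (2 * K))" by (rule mult_left_mono)
  hence T: "\<alpha> * Re ?T - \<alpha> * (sqrt s ^ 3 * Re ?T) \<le> \<alpha> * (1 - sqrt s ^ 3) * (sqrt (4 * K) * (2 * K))"
    by (simp only: left_diff_distrib right_diff_distrib mult_1_right mult.assoc mult_1_left)
  have R: "Re (coupling (v $ 1) (v $ 2) (v $ 3)) = sqrt s ^ 3 * Re ?T" unfolding Tv by simp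
  show "total_energy v \<le> total_energy u + (1 - s) * (3 * (1/2 * K + \<beta> / 2 * (sqrt (4 * K) powr (p - 1) * K))) + \<alpha> * (1 - sqrt s ^ 3) * (sqrt (4 * K) * (2 * K))"
    unfolding K1_def[symmetric] total_energy_def R using T Sb[of 1] Sb[of 2] Sb[of 3] by (simp add: mult.assoc)
qed

text \<open>Scaling down puts the constraints below \<open>\<gamma>\<close> and
  \<open>\<mu>\<close>, where \<open>J_le_sub\<close> applies; the factor tends to 1 and costs
  nothing in the limit.\<close>

theorem J_approx:
  assumes pos: "\<gamma> > 0" "\<mu> > 0"
    and k: "\<And>n. k n \<in> H1C_vec" "(\<lambda>n. Q1 (k n)) \<longlonglongrightarrow> \<gamma>" "(\<lambda>n. Q2 (k n)) \<longlonglongrightarrow> \<mu>"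
    and e: "(\<lambda>n. e n) \<longlonglongrightarrow> L" "\<And>n. total_energy (k n) \<le> e n"
  shows "Jm \<gamma> \<mu> \<le> L"
proof -
  obtain B where B: "\<And>n. norm (Q1 (k n) + Q2 (k n)) \<le> B"
    using convergent_imp_Bseq[OF convergentI[OF tendsto_add[OF k(2,3)]]] unfolding Bseq_def by auto
  have NB: "mass (k n $ i) \<le> B" for n i using mass_le_Q[of "k n" i] B[of n] by simp
  obtain E where E: "\<And>n. norm (e n) \<le> E" using convergent_imp_Bseq[OF convergentI[OF e(1)]] unfolding Bseq_def by auto
  have EE: "total_energy (k n) \<le> E" for n using e(2)[of n] E[of n] by simp
  obtain D where D: "\<And>n i. dirichlet (k n $ i) \<le> D" using bounded_of_energy[of k B E, OF k(1) NB EE] by blast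
  define K where "K = max B D"
  have K: "mass (k n $ i) \<le> K" "dirichlet (k n $ i) \<le> K" for n i using NB[of n i] D[of n i] by (auto simp: K_def)
  \<comment> \<open>If a constraint of \<open>k n\<close> is zero, the quotient is 0 by convention,
    and \<open>s n = 0\<close> still satisfies both inequalities.\<close>
  define s where "s n = min 1 (min (\<gamma> / Q1 (k n)) (\<mu> / Q2 (k n)))" for n
  have q: "0 \<le> Q1 (k n)" "0 \<le> Q2 (k n)" for n by (simp_all add: Q_eq)
  have s01: "0 \<le> s n" "s n \<le> 1" for n using q[of n] pos by (auto simp: s_def)
  have "(\<lambda>n. s n) \<longlonglongrightarrow> min 1 (min (\<gamma> / \<gamma>) (\<mu> / \<mu>))"
    unfolding s_def by (intro tendsto_intros k) (use pos in auto)
  hence s1: "(\<lambda>n. s n) \<longlonglongrightarrow> 1" using pos by simp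
  let ?r = "\<lambda>n. e n + (1 - s n) * (3 * (1/2 * K + \<beta> / 2 * (sqrt (4 * K) powr (p - 1) * K))) + \<alpha> * (1 - sqrt (s n) ^ 3) * (sqrt (4 * K) * (2 * K))"
  have "?r \<longlonglongrightarrow> L + (1 - 1) * (3 * (1/2 * K + \<beta> / 2 * (sqrt (4 * K) powr (p - 1) * K))) + \<alpha> * (1 - sqrt 1 ^ 3) * (sqrt (4 * K) * (2 * K))"
    by (intro tendsto_intros e s1)
  hence r: "?r \<longlonglongrightarrow> L" by simp
  have "Jm \<gamma> \<mu> \<le> ?r n" for n
  proof -
    note sc = scaled_energy[OF k(1)[of n] s01(1)[of n] s01(2)[of n] K(1)[of n] K(2)[of n]]
    have "s n * Q1 (k n) \<le> \<gamma>"
    proof (cases "Q1 (k n) = 0")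
      case False
      hence "s n \<le> \<gamma> / Q1 (k n)" "Q1 (k n) > 0" using q[of n] by (auto simp: s_def)
      thus ?thesis by (simp add: field_simps)
    qed (use pos in simp)
    moreover have "s n * Q2 (k n) \<le> \<mu>"
    proof (cases "Q2 (k n) = 0")
      case False
      hence "s n \<le> \<mu> / Q2 (k n)" "Q2 (k n) > 0" using q[of n] by (auto simp: s_def)
      thus ?thesis by (simp add: field_simps)
    qed (use pos in simp)
    ultimately show ?thesis using J_le_sub[OF sc(1), where \<gamma> = \<gamma> and \<mu> = \<mu>] sc(2-4) e(2)[of n] by simp
  qed
  thus ?thesis using LIMSEQ_le_const[OF r] by blast
qed

end

section \<open>Splitting off bumps\<close>

lemma tendsto_0_bound:
  fixes f :: "nat \<Rightarrow> real"
  assumes "f \<longlonglongrightarrow> 0" "e > 0" shows "\<exists>n0. \<forall>n\<ge>n0. f n < e"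
  using order_tendstoD(2)[OF assms] by (simp add: eventually_sequentially)

text \<open>Outside a large interval \<open>\<phi>\<close> has little mass and Cauchy-Schwarz with
  \<open>mass (v n) \<le> K\<close> suffices; inside, the sup bound permits dominated
  convergence.\<close>

lemma cross_tendsto_0:
  assumes \<phi>: "\<phi> \<in> L2" and v: "\<And>n. v n \<in> L2" "\<And>n. mass (v n) \<le> K" "\<And>n x. cmod (v n x) \<le> M" "\<And>x. (\<lambda>n. v n x) \<longlonglongrightarrow> 0"
  shows "(\<lambda>n. LINT x|lborel. cmod (\<phi> x) * cmod (v n x)) \<longlonglongrightarrow> 0"
proof (rule LIMSEQ_I)
  fix e :: real assume e: "e > 0"
  have [measurable]: "\<phi> \<in> borel_measurable borel" "v n \<in> borel_measurable borel" for n using \<phi> v L2_measurable by auto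
  let ?I = "\<lambda>R::nat. {-real R..real R}"
  let ?t = "\<lambda>R x. indicator (- ?I R) x *\<^sub>R \<phi> x"
  have tL: "?t R \<in> L2" for R by (intro L2_indicator \<phi>) auto
  have "(\<lambda>R. LINT x|lborel. (cmod (?t R x))\<^sup>2) \<longlonglongrightarrow> (LINT x|lborel. (\<lambda>x::real. 0::real) x)"
  proof (rule integral_dominated_convergence[where w = "\<lambda>x. (cmod (\<phi> x))\<^sup>2"])
    show "AE x in lborel. (\<lambda>R. (cmod (?t R x))\<^sup>2) \<longlonglongrightarrow> 0"
    proof (intro AE_I2 tendsto_eventually)
      fix x :: real
      obtain R0 :: nat where "\<bar>x\<bar> \<le> real R0" using real_arch_simple by blast
      thus "\<forall>\<^sub>F R in sequentially. (cmod (?t R x))\<^sup>2 = 0"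
        by (intro eventually_sequentiallyI[of R0]) (auto simp: indicator_def)
    qed
  qed (use L2_integrable[OF \<phi>] in \<open>auto simp: indicator_def\<close>)
  hence "(\<lambda>R. mass (?t R)) \<longlonglongrightarrow> 0" by (simp add: mass_def)
  hence "(\<lambda>R. sqrt (mass (?t R)) * sqrt K) \<longlonglongrightarrow> sqrt 0 * sqrt K" by (intro tendsto_intros)
  hence "(\<lambda>R. sqrt (mass (?t R)) * sqrt K) \<longlonglongrightarrow> 0" by simp
  then obtain R where R: "sqrt (mass (?t R)) * sqrt K < e / 2"
    using tendsto_0_bound[of "\<lambda>R. sqrt (mass (?t R)) * sqrt K" "e/2"] e by auto
  have "(\<lambda>n. LINT x|lborel. cmod (indicator (?I R) x *\<^sub>R \<phi> x) * cmod (v n x)) \<longlonglongrightarrow> (LINT x|lborel. (\<lambda>x::real. 0::real) x)"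
  proof (rule integral_dominated_convergence[where w = "\<lambda>x. M * norm (indicator (?I R) x *\<^sub>R \<phi> x)"])
    show "integrable lborel (\<lambda>x. M * norm (indicator (?I R) x *\<^sub>R \<phi> x))"
      using loc_intD(2)[OF L2_loc_int[OF \<phi>], of "-real R" "real R"] integrable_norm unfolding set_integrable_def by (intro integrable_mult_right) blast
    show "AE x in lborel. (\<lambda>n. cmod (indicator (?I R) x *\<^sub>R \<phi> x) * cmod (v n x)) \<longlonglongrightarrow> 0"
    proof (intro AE_I2)
      fix x
      have "(\<lambda>n. cmod (indicator (?I R) x *\<^sub>R \<phi> x) * cmod (v n x)) \<longlonglongrightarrow> cmod (indicator (?I R) x *\<^sub>R \<phi> x) * cmod 0"
        by (intro tendsto_intros v)
      thus "(\<lambda>n. cmod (indicator (?I R) x *\<^sub>R \<phi> x) * cmod (v n x)) \<longlonglongrightarrow> 0" by simp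
    qed
    show "AE x in lborel. norm (cmod (indicator (?I R) x *\<^sub>R \<phi> x) * cmod (v n x)) \<le> M * norm (indicator (?I R) x *\<^sub>R \<phi> x)" for n
    proof (intro AE_I2)
      fix x
      show "norm (cmod (indicator (?I R) x *\<^sub>R \<phi> x) * cmod (v n x)) \<le> M * norm (indicator (?I R) x *\<^sub>R \<phi> x)"
        using mult_right_mono[OF v(3)[of n x] norm_ge_zero[of "indicat_real (?I R) x *\<^sub>R \<phi> x"]] by (simp add: mult.commute)
    qed
  qed measurable
  hence "(\<lambda>n. LINT x|lborel. cmod (indicator (?I R) x *\<^sub>R \<phi> x) * cmod (v n x)) \<longlonglongrightarrow> 0" by simp
  then obtain n0 where n0: "\<And>n. n \<ge> n0 \<Longrightarrow> (LINT x|lborel. cmod (indicator (?I R) x *\<^sub>R \<phi> x) * cmod (v n x)) < e / 2"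
    using tendsto_0_bound[of "\<lambda>n. LINT x|lborel. cmod (indicator (?I R) x *\<^sub>R \<phi> x) * cmod (v n x)" "e/2"] e by auto
  have "norm ((LINT x|lborel. cmod (\<phi> x) * cmod (v n x)) - 0) < e" if "n \<ge> n0" for n
  proof -
    have iL: "(\<lambda>x. indicator (?I R) x *\<^sub>R \<phi> x) \<in> L2" by (intro L2_indicator \<phi>) auto
    have "(LINT x|lborel. cmod (\<phi> x) * cmod (v n x)) =
        (LINT x|lborel. cmod (indicator (?I R) x *\<^sub>R \<phi> x) * cmod (v n x) + cmod (?t R x) * cmod (v n x))"
      by (intro Bochner_Integration.integral_cong) (auto simp: indicator_def)
    also have "\<dots> = (LINT x|lborel. cmod (indicator (?I R) x *\<^sub>R \<phi> x) * cmod (v n x)) + (LINT x|lborel. cmod (?t R x) * cmod (v n x))"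
      by (rule Bochner_Integration.integral_add[OF L2_mult_integrable(2)[OF iL v(1)] L2_mult_integrable(2)[OF tL v(1)]])
    also have "(LINT x|lborel. cmod (?t R x) * cmod (v n x)) \<le> sqrt (mass (?t R)) * sqrt (mass (v n))"
      by (rule Cauchy_Schwarz_L2[OF tL v(1)])
    also have "\<dots> \<le> sqrt (mass (?t R)) * sqrt K" using v(2) by (intro mult_left_mono) auto
    finally have "(LINT x|lborel. cmod (\<phi> x) * cmod (v n x)) < e" using n0[OF that] R by linarith
    moreover have "0 \<le> (LINT x|lborel. cmod (\<phi> x) * cmod (v n x))" by simp
    ultimately show ?thesis by simp
  qed
  thus "\<exists>no. \<forall>n\<ge>no. norm ((LINT x|lborel. cmod (\<phi> x) * cmod (v n x)) - 0) < e" by blast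
qed

section \<open>Pointwise splitting inequalities\<close>

lemma powr_lipschitz:
  fixes x y q L :: real
  assumes "0 \<le> x" "0 \<le> y" "x \<le> L" "y \<le> L" "1 < q"
  shows "\<bar>x powr q - y powr q\<bar> \<le> q * L powr (q - 1) * \<bar>x - y\<bar>"
proof -
  have *: "b powr q - a powr q \<le> q * L powr (q - 1) * (b - a)" if "0 \<le> a" "a \<le> b" "b \<le> L" for a b
  proof (cases "a = b")
    case False
    hence ab: "a < b" using that by simp
    have "\<exists>l z. a < z \<and> z < b \<and> DERIV (\<lambda>z. z powr q) z :> l \<and> b powr q - a powr q = (b - a) * l"
    proof (rule MVT[OF ab])
      show "continuous_on {a..b} (\<lambda>z. z powr q)" using that assms by (intro continuous_on_powr' continuous_intros) auto
      show "(\<lambda>z. z powr q) differentiable (at z)" if "a < z" "z < b" for z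
      proof -
        have "z > 0" using that \<open>0 \<le> a\<close> by linarith
        from has_real_derivative_powr[OF this, of q] show ?thesis unfolding real_differentiable_def by blast
      qed
    qed
    then obtain l z where z0: "a < z" "z < b" "DERIV (\<lambda>z. z powr q) z :> l" "b powr q - a powr q = (b - a) * l" by blast
    have "l = q * z powr (q - 1)"
      using DERIV_unique[OF z0(3) has_real_derivative_powr] z0(1) \<open>0 \<le> a\<close> by simp
    hence z: "a < z" "z < b" "b powr q - a powr q = (b - a) * (q * z powr (q - 1))" using z0 by auto
    have "z powr (q - 1) \<le> L powr (q - 1)" using z that assms by (intro powr_mono2) auto
    hence "(b - a) * (q * z powr (q - 1)) \<le> (b - a) * (q * L powr (q - 1))" using ab assms by (intro mult_left_mono) auto
    thus ?thesis using z by (simp add: mult_ac)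
  qed simp
  show ?thesis
  proof (cases "x \<le> y")
    case True
    have "x powr q \<le> y powr q" using True assms by (intro powr_mono2) auto
    thus ?thesis using *[of x y] True assms by simp
  next
    case False
    have "y powr q \<le> x powr q" using False assms by (intro powr_mono2) auto
    thus ?thesis using *[of y x] False assms by simp
  qed
qed

text \<open>A quantitative form of the Brezis-Lieb lemma. If \<open>cmod b \<le> cmod a\<close>,
  then the power changes from \<open>a\<close> to \<open>a + b\<close> by at most the order of
  \<open>cmod a powr (q - 1) * cmod b\<close>, and \<open>q > 2\<close> leaves a spare factor
  \<open>cmod a\<close>. The product \<open>cmod a * cmod b\<close> has an integral that tends to
  zero for the remainders considered here.\<close>

lemma powr_split:
  fixes a b :: complex
  assumes "cmod a \<le> M" "cmod b \<le> M" "q > 2"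
  shows "\<bar>cmod (a + b) powr q - cmod a powr q - cmod b powr q\<bar> \<le> (q * 2 powr (q - 1) * M powr (q - 2) + M powr (q - 2)) * (cmod a * cmod b)"
proof -
  have *: "\<bar>cmod (a + b) powr q - cmod a powr q - cmod b powr q\<bar> \<le> (q * 2 powr (q - 1) * M powr (q - 2) + M powr (q - 2)) * (cmod a * cmod b)"
    if "cmod b \<le> cmod a" "cmod a \<le> M" for a b :: complex
  proof -
    have "cmod (a + b) \<le> 2 * cmod a" using norm_triangle_ineq[of a b] that by linarith
    hence "\<bar>cmod (a + b) powr q - cmod a powr q\<bar> \<le> q * (2 * cmod a) powr (q - 1) * \<bar>cmod (a + b) - cmod a\<bar>"
      using assms by (intro powr_lipschitz) auto
    also have "\<dots> \<le> q * (2 * cmod a) powr (q - 1) * cmod b"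
      using norm_triangle_ineq3[of "a + b" a] assms by (intro mult_left_mono) auto
    also have "(2 * cmod a) powr (q - 1) = 2 powr (q - 1) * (cmod a powr (q - 2) * cmod a)"
      using assms by (cases "a = 0") (auto simp: powr_mult powr_mult_base mult.commute)
    also have "q * (2 powr (q - 1) * (cmod a powr (q - 2) * cmod a)) * cmod b = q * 2 powr (q - 1) * cmod a powr (q - 2) * (cmod a * cmod b)" by simp
    also have "\<dots> \<le> q * 2 powr (q - 1) * M powr (q - 2) * (cmod a * cmod b)"
      using that assms by (intro mult_right_mono mult_left_mono powr_mono2) auto
    finally have 1: "\<bar>cmod (a + b) powr q - cmod a powr q\<bar> \<le> q * 2 powr (q - 1) * M powr (q - 2) * (cmod a * cmod b)" .
    have "cmod b powr q \<le> M powr (q - 2) * (cmod b)\<^sup>2"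
      using powr_bound[of "q - 1" "cmod b" M] assms that by simp
    also have "\<dots> \<le> M powr (q - 2) * (cmod a * cmod b)"
      using that by (intro mult_left_mono) (auto simp: power2_eq_square mult_right_mono)
    finally have 2: "cmod b powr q \<le> M powr (q - 2) * (cmod a * cmod b)" .
    have "0 \<le> cmod b powr q" by simp
    hence "\<bar>cmod (a + b) powr q - cmod a powr q - cmod b powr q\<bar> \<le>
        q * 2 powr (q - 1) * M powr (q - 2) * (cmod a * cmod b) + M powr (q - 2) * (cmod a * cmod b)"
      using 1 2 unfolding abs_le_iff by linarith
    thus ?thesis by (simp add: distrib_right)
  qed
  show ?thesis
  proof (cases "cmod b \<le> cmod a")
    case True thus ?thesis using *[of b a] assms by blast
  next
    case False
    thus ?thesis using *[of a b] assms by (simp add: add.commute mult.commute)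
  qed
qed

text \<open>Each of the six mixed terms contains a factor from the \<open>a\<close> side and one
  from the \<open>b\<close> side; the remaining factor is bounded by \<open>M\<close>.\<close>

lemma triple_split:
  fixes a1 a2 a3 b1 b2 b3 :: complex
  assumes "cmod a1 \<le> M" "cmod a2 \<le> M" "cmod a3 \<le> M" "cmod b1 \<le> M" "cmod b2 \<le> M" "cmod b3 \<le> M"
  shows "cmod ((a1 + b1) * (a2 + b2) * cnj (a3 + b3) - a1 * a2 * cnj a3 - b1 * b2 * cnj b3)
    \<le> M * (cmod a1 * cmod b3 + cmod a1 * cmod b2 + cmod a1 * cmod b2 + cmod a2 * cmod b1 + cmod a2 * cmod b1 + cmod a3 * cmod b1)"
proof -
  have "(a1 + b1) * (a2 + b2) * cnj (a3 + b3) - a1 * a2 * cnj a3 - b1 * b2 * cnj b3 =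
    a1 * a2 * cnj b3 + a1 * b2 * cnj a3 + a1 * b2 * cnj b3 + b1 * a2 * cnj a3 + b1 * a2 * cnj b3 + b1 * b2 * cnj a3"
    by (simp add: algebra_simps)
  also have "cmod \<dots> \<le> cmod (a1 * a2 * cnj b3) + cmod (a1 * b2 * cnj a3) + cmod (a1 * b2 * cnj b3) + cmod (b1 * a2 * cnj a3) + cmod (b1 * a2 * cnj b3) + cmod (b1 * b2 * cnj a3)"
    by (intro norm_triangle_mono order_refl)
  also have "\<dots> \<le> M * (cmod a1 * cmod b3) + M * (cmod a1 * cmod b2) + M * (cmod a1 * cmod b2) + M * (cmod a2 * cmod b1) + M * (cmod a2 * cmod b1) + M * (cmod a3 * cmod b1)"
  proof (intro add_mono)
    have m: "cmod x * cmod y * cmod z \<le> M * (cmod x * cmod z)" "cmod x * cmod y * cmod z \<le> M * (cmod y * cmod x)"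
      "cmod x * cmod z * cmod y \<le> M * (cmod x * cmod z)"
      if "cmod y \<le> M" "cmod z \<le> M" for x y z
      using mult_right_mono[OF that(1), of "cmod x * cmod z"] mult_right_mono[OF that(2), of "cmod x * cmod y"] by (simp_all add: mult_ac)
    show "cmod (a1 * a2 * cnj b3) \<le> M * (cmod a1 * cmod b3)" using m(1)[of a2 b3 a1] assms by (simp add: norm_mult)
    show "cmod (a1 * b2 * cnj a3) \<le> M * (cmod a1 * cmod b2)" using m(3)[of a3 b2 a1] assms by (simp add: norm_mult)
    show "cmod (a1 * b2 * cnj b3) \<le> M * (cmod a1 * cmod b2)" using m(3)[of b3 b2 a1] assms by (simp add: norm_mult)
    show "cmod (b1 * a2 * cnj a3) \<le> M * (cmod a2 * cmod b1)" using m(2)[of a2 a3 b1] assms by (simp add: norm_mult)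
    show "cmod (b1 * a2 * cnj b3) \<le> M * (cmod a2 * cmod b1)" using m(2)[of a2 b3 b1] assms by (simp add: norm_mult)
    show "cmod (b1 * b2 * cnj a3) \<le> M * (cmod a3 * cmod b1)" using m(1)[of b2 a3 b1] assms by (simp add: norm_mult mult_ac)
  qed
  also have "\<dots> = M * (cmod a1 * cmod b3 + cmod a1 * cmod b2 + cmod a1 * cmod b2 + cmod a2 * cmod b1 + cmod a2 * cmod b1 + cmod a3 * cmod b1)"
    by (simp add: distrib_left)
  finally show ?thesis .
qed

text \<open>Hoelder continuity passes to pointwise limits. So do the bounds on difference quotients,
  by Fatou's lemma, since a difference quotient at a point involves two values only.\<close>

lemma pointwise_limit_H1C:
  assumes f: "\<And>n. f n \<in> H1C" "\<And>n. mass (f n) \<le> K" "\<And>n. dirichlet (f n) \<le> K" and lim: "\<And>x. (\<lambda>n. f n x) \<longlonglongrightarrow> g x"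
  shows "g \<in> H1C" "mass g \<le> K" "dirichlet g \<le> K"
proof -
  have K: "0 \<le> K" using f(2)[of 0] mass_nonneg order_trans by blast
  have "(cmod (g b - g a))\<^sup>2 \<le> \<bar>b - a\<bar> * K" for a b
  proof (rule LIMSEQ_le_const2)
    show "(\<lambda>n. (cmod (f n b - f n a))\<^sup>2) \<longlonglongrightarrow> (cmod (g b - g a))\<^sup>2" by (intro tendsto_intros lim)
    have "(cmod (f n b - f n a))\<^sup>2 \<le> \<bar>b - a\<bar> * K" for n
      using H1_pair_Holder[OF H1C_H1_pair[OF f(1)], of n b a] mult_left_mono[OF f(3)[of n], of "\<bar>b - a\<bar>"] unfolding dirichlet_def by linarith
    thus "\<exists>m. \<forall>n\<ge>m. (cmod (f n b - f n a))\<^sup>2 \<le> \<bar>b - a\<bar> * K" by blast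
  qed
  hence h: "cmod (g b - g a) \<le> sqrt (\<bar>b - a\<bar> * K)" for a b by (rule real_le_rsqrt)
  have "isCont g a" for a
  proof -
    have "((\<lambda>b. sqrt (\<bar>b - a\<bar> * K)) \<longlongrightarrow> sqrt (\<bar>a - a\<bar> * K)) (at a)" by (intro tendsto_intros)
    hence z: "((\<lambda>b. sqrt (\<bar>b - a\<bar> * K)) \<longlongrightarrow> 0) (at a)" by simp
    have "\<forall>\<^sub>F b in at a. norm (g b - g a) \<le> sqrt (\<bar>b - a\<bar> * K)"
      using h by (intro always_eventually allI)
    hence "((\<lambda>b. g b - g a) \<longlongrightarrow> 0) (at a)" using z by (rule Lim_null_comparison)
    thus ?thesis by (simp add: isCont_def LIM_zero_iff)
  qed
  hence c: "continuous_on UNIV g" by (simp add: continuous_at_imp_continuous_on)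
  have gm: "g \<in> borel_measurable borel" by (rule borel_measurable_continuous_onI[OF c])
  note gL = Fatou_mass[OF H1C_L2[OF f(1)] f(2) K gm AE_I2[OF lim]]
  have d: "dyadic_diff n g \<in> L2 \<and> mass (dyadic_diff n g) \<le> K" for n
  proof -
    have 1: "dyadic_diff n (f j) \<in> L2" for j by (rule dyadic_diff_L2(1)[OF H1C_H1_pair[OF f(1)]])
    have 2: "mass (dyadic_diff n (f j)) \<le> K" for j using dyadic_diff_L2(2)[OF H1C_H1_pair[OF f(1)]] f(3) unfolding dirichlet_def by (rule order_trans)
    have 3: "(\<lambda>j. dyadic_diff n (f j) x) \<longlonglongrightarrow> dyadic_diff n g x" for x unfolding dyadic_diff_def by (intro tendsto_intros lim)
    show ?thesis using Fatou_mass[OF 1 2 K dyadic_diff_measurable[OF gm] AE_I2[OF 3]] by blast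
  qed
  obtain g' where "H1_pair g g'" "mass g' \<le> K" using H1_pair_of_dyadic_diff[OF c gL(1) conjunct1[OF d] conjunct2[OF d]] by blast
  thus "g \<in> H1C" "mass g \<le> K" "dirichlet g \<le> K" using H1_pair_H1C gL by auto
qed

text \<open>Up to a small error \<open>weak_deriv \<phi>\<close> is its own average at a fixed
  dyadic level \<open>m\<close>. Self-adjointness moves the average to
  \<open>weak_deriv (v n)\<close> and turns it into a difference quotient of \<open>v n\<close>,
  which tends to zero pointwise.\<close>

lemma deriv_cross_tendsto_0:
  assumes \<phi>: "\<phi> \<in> H1C" and v: "\<And>n. v n \<in> H1C" "\<And>n. mass (v n) \<le> K" "\<And>n. dirichlet (v n) \<le> K" "\<And>x. (\<lambda>n. v n x) \<longlonglongrightarrow> 0"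
  shows "(\<lambda>n. LINT x|lborel. weak_deriv \<phi> x * cnj (weak_deriv (v n) x)) \<longlonglongrightarrow> 0"
proof (rule LIMSEQ_I)
  fix e :: real assume e: "e > 0"
  note H1_pair\<phi> = H1C_H1_pair[OF \<phi>] and Wv = H1C_H1_pair[OF v(1)]
  let ?g = "weak_deriv \<phi>" and ?h = "\<lambda>n x. cnj (weak_deriv (v n) x)"
  have K: "0 \<le> K" using v(2)[of 0] mass_nonneg order_trans by blast
  have hL: "?h n \<in> L2" "mass (?h n) \<le> K" for n using L2_cnj[OF H1_pair_L2(2)[OF Wv]] v(3) by (simp_all add: mass_cnj dirichlet_def)
  have "(\<lambda>m. sqrt (mass (\<lambda>x. dyadic_diff m \<phi> x - ?g x)) * sqrt K) \<longlonglongrightarrow> sqrt 0 * sqrt K"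
    by (intro tendsto_intros dyadic_diff_tendsto H1_pair\<phi>)
  hence "(\<lambda>m. sqrt (mass (\<lambda>x. dyadic_diff m \<phi> x - ?g x)) * sqrt K) \<longlonglongrightarrow> 0" by simp
  then obtain m where m: "sqrt (mass (\<lambda>x. dyadic_diff m \<phi> x - ?g x)) * sqrt K < e / 2"
    using tendsto_0_bound[of "\<lambda>m. sqrt (mass (\<lambda>x. dyadic_diff m \<phi> x - ?g x)) * sqrt K" "e/2"] e by auto
  have sb: "cmod (v n x) \<le> sqrt (4 * K)" for n x
    using H1C_sup1[OF v(1), of n x] real_sqrt_le_mono[of "2 * mass (v n) + 2 * dirichlet (v n)" "4 * K"] v(2,3)[of n] by linarith
  have "(\<lambda>n. LINT x|lborel. cmod (dyadic_diff m \<phi> x) * cmod (dyadic_diff m (v n) x)) \<longlonglongrightarrow> 0"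
  proof (rule cross_tendsto_0[where K = K and M = "2 ^ m * (2 * sqrt (4 * K))"])
    show "dyadic_diff m \<phi> \<in> L2" by (rule dyadic_diff_L2[OF H1_pair\<phi>])
    show "dyadic_diff m (v n) \<in> L2" for n by (rule dyadic_diff_L2[OF Wv])
    show "mass (dyadic_diff m (v n)) \<le> K" for n using dyadic_diff_L2(2)[OF Wv, of m n] v(3)[of n] by (simp add: dirichlet_def)
    show "cmod (dyadic_diff m (v n) x) \<le> 2 ^ m * (2 * sqrt (4 * K))" for n x
    proof -
      have "cmod (v n (cell_hi m x) - v n (cell_lo m x)) \<le> 2 * sqrt (4 * K)"
        using norm_triangle_ineq4[of "v n (cell_hi m x)" "v n (cell_lo m x)"] sb[of n "cell_hi m x"] sb[of n "cell_lo m x"] by linarith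
      thus ?thesis unfolding dyadic_diff_def norm_mult norm_power by (simp add: mult_left_mono)
    qed
    have "(\<lambda>n. dyadic_diff m (v n) x) \<longlonglongrightarrow> 2 ^ m * (0 - 0)" for x unfolding dyadic_diff_def by (intro tendsto_intros v)
    thus "(\<lambda>n. dyadic_diff m (v n) x) \<longlonglongrightarrow> 0" for x by simp
  qed
  then obtain n0 where n0: "\<And>n. n \<ge> n0 \<Longrightarrow> (LINT x|lborel. cmod (dyadic_diff m \<phi> x) * cmod (dyadic_diff m (v n) x)) < e / 2"
    using tendsto_0_bound[of "\<lambda>n. LINT x|lborel. cmod (dyadic_diff m \<phi> x) * cmod (dyadic_diff m (v n) x)" "e/2"] e by auto
  have "norm ((LINT x|lborel. ?g x * ?h n x) - 0) < e" if "n \<ge> n0" for n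
  proof -
    note dL = dyadic_diff_L2(1)[OF H1_pair\<phi>, of m]
    have "(LINT x|lborel. dyadic_diff m \<phi> x * ?h n x) = (LINT x|lborel. dyadic_avg m (dyadic_diff m \<phi>) x * ?h n x)" by (simp add: dyadic_avg_dyadic_diff_same)
    also have "\<dots> = (LINT x|lborel. dyadic_diff m \<phi> x * dyadic_avg m (?h n) x)" by (rule dyadic_avg_self_adjoint[OF dL hL(1)])
    also have "\<dots> = (LINT x|lborel. dyadic_diff m \<phi> x * cnj (dyadic_diff m (v n) x))" by (simp add: dyadic_avg_cnj dyadic_diff_eq_dyadic_avg[OF Wv])
    finally have s: "(LINT x|lborel. dyadic_diff m \<phi> x * ?h n x) = (LINT x|lborel. dyadic_diff m \<phi> x * cnj (dyadic_diff m (v n) x))" .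
    have "cmod (LINT x|lborel. dyadic_diff m \<phi> x * cnj (dyadic_diff m (v n) x)) \<le> (LINT x|lborel. cmod (dyadic_diff m \<phi> x) * cmod (dyadic_diff m (v n) x))"
      using integral_norm_bound[of lborel "\<lambda>x. dyadic_diff m \<phi> x * cnj (dyadic_diff m (v n) x)"] by (simp add: norm_mult)
    hence 1: "cmod (LINT x|lborel. dyadic_diff m \<phi> x * ?h n x) < e / 2" using n0[OF that] s by simp
    note gd = L2_diff[OF dL H1_pair_L2(2)[OF H1_pair\<phi>]]
    have "cmod (LINT x|lborel. (dyadic_diff m \<phi> x - ?g x) * ?h n x) \<le> sqrt (mass (\<lambda>x. dyadic_diff m \<phi> x - ?g x)) * sqrt (mass (?h n))"
      by (rule inner_L2_bound[OF gd hL(1)])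
    also have "\<dots> \<le> sqrt (mass (\<lambda>x. dyadic_diff m \<phi> x - ?g x)) * sqrt K" using hL(2) by (intro mult_left_mono) auto
    finally have 2: "cmod (LINT x|lborel. (dyadic_diff m \<phi> x - ?g x) * ?h n x) < e / 2" using m by linarith
    have "(LINT x|lborel. (dyadic_diff m \<phi> x - ?g x) * ?h n x) = (LINT x|lborel. dyadic_diff m \<phi> x * ?h n x) - (LINT x|lborel. ?g x * ?h n x)"
      unfolding left_diff_distrib
      by (rule Bochner_Integration.integral_diff[OF L2_mult_integrable(1)[OF dL hL(1)] L2_mult_integrable(1)[OF H1_pair_L2(2)[OF H1_pair\<phi>] hL(1)]])
    hence "(LINT x|lborel. ?g x * ?h n x) = (LINT x|lborel. dyadic_diff m \<phi> x * ?h n x) - (LINT x|lborel. (dyadic_diff m \<phi> x - ?g x) * ?h n x)" by simp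
    hence "cmod (LINT x|lborel. ?g x * ?h n x) \<le> cmod (LINT x|lborel. dyadic_diff m \<phi> x * ?h n x) + cmod (LINT x|lborel. (dyadic_diff m \<phi> x - ?g x) * ?h n x)"
      by (simp only: norm_triangle_ineq4)
    thus ?thesis using 1 2 by simp
  qed
  thus "\<exists>no. \<forall>n\<ge>no. norm ((LINT x|lborel. ?g x * ?h n x) - 0) < e" by blast
qed

lemma mass_add_expand:
  assumes "a \<in> L2" "b \<in> L2"
  shows "mass (\<lambda>x. a x + b x) = mass a + mass b + 2 * Re (LINT x|lborel. a x * cnj (b x))"
proof -
  have i: "integrable lborel (\<lambda>x. a x * cnj (b x))" by (rule L2_mult_integrable(1)[OF assms(1) L2_cnj[OF assms(2)]])
  have mb: "(\<lambda>x. - b x) \<in> L2" using L2_scale[OF assms(2), of "-1"] by simp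
  have "mass (\<lambda>x. a x - (- b x)) = mass a - 2 * Re (LINT x|lborel. a x * cnj (- b x)) + mass (\<lambda>x. - b x)"
    by (rule mass_diff_expand[OF assms(1) mb])
  moreover have "mass (\<lambda>x. - b x) = mass b" by (simp add: mass_def)
  moreover have "(LINT x|lborel. a x * cnj (- b x)) = - (LINT x|lborel. a x * cnj (b x))" by simp
  ultimately show ?thesis by simp
qed

lemma H1C_add: assumes "f \<in> H1C" "g \<in> H1C" shows "(\<lambda>x. f x + g x) \<in> H1C"
  "dirichlet (\<lambda>x. f x + g x) = mass (\<lambda>x. weak_deriv f x + weak_deriv g x)"
  using H1_pair_H1C[OF H1_pair_add[OF H1C_H1_pair[OF assms(1)] H1C_H1_pair[OF assms(2)]]] by auto

lemma mass_diff_bound: assumes "f \<in> L2" "g \<in> L2" shows "mass (\<lambda>x. f x - g x) \<le> 2 * mass f + 2 * mass g"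
proof -
  have "mass (\<lambda>x. f x - g x) \<le> (LINT x|lborel. 2 * (cmod (f x))\<^sup>2 + 2 * (cmod (g x))\<^sup>2)"
    unfolding mass_def
  proof (rule integral_mono[OF L2_integrable[OF L2_diff[OF assms]]])
    show "integrable lborel (\<lambda>x. 2 * (cmod (f x))\<^sup>2 + 2 * (cmod (g x))\<^sup>2)" using assms L2_integrable by auto
    show "(cmod (f x - g x))\<^sup>2 \<le> 2 * (cmod (f x))\<^sup>2 + 2 * (cmod (g x))\<^sup>2" for x
      using cmod_add_sq[of "f x" "- g x"] by simp
  qed
  thus ?thesis unfolding mass_def using assms L2_integrable by simp
qed

lemma H1C_diff_bounds:
  assumes "f \<in> H1C" "g \<in> H1C" "mass f \<le> K" "mass g \<le> K" "dirichlet f \<le> K" "dirichlet g \<le> K"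
  shows "mass (\<lambda>x. f x - g x) \<le> 4 * K" "dirichlet (\<lambda>x. f x - g x) \<le> 4 * K"
proof -
  show "mass (\<lambda>x. f x - g x) \<le> 4 * K" using mass_diff_bound[OF H1C_L2 H1C_L2, OF assms(1,2)] assms by linarith
  have "dirichlet (\<lambda>x. f x - g x) = mass (\<lambda>x. weak_deriv f x - weak_deriv g x)"
    using H1_pair_H1C(2)[OF H1_pair_diff[OF H1C_H1_pair[OF assms(1)] H1C_H1_pair[OF assms(2)]]] .
  also have "\<dots> \<le> 2 * dirichlet f + 2 * dirichlet g" unfolding dirichlet_def by (intro mass_diff_bound H1_pair_L2(2)[OF H1C_H1_pair] assms)
  finally show "dirichlet (\<lambda>x. f x - g x) \<le> 4 * K" using assms by linarith
qed

lemma H1C_sup4: "f \<in> H1C \<Longrightarrow> mass f \<le> K \<Longrightarrow> dirichlet f \<le> K \<Longrightarrow> cmod (f x) \<le> sqrt (4 * K)"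
  by (rule energy_slope_bounds(2)[of f K 2]) auto

text \<open>Bounds on mass and Dirichlet energy with pointwise convergence to zero: the working form
  of weak convergence to zero.\<close>

locale vanishing =
  fixes v :: "nat \<Rightarrow> real \<Rightarrow> complex" and K :: real
  assumes v: "\<And>n. v n \<in> H1C" "\<And>n. mass (v n) \<le> K" "\<And>n. dirichlet (v n) \<le> K" "\<And>x. (\<lambda>n. v n x) \<longlonglongrightarrow> 0"
begin

lemma sup: "cmod (v n x) \<le> sqrt (4 * K)" by (rule H1C_sup4[OF v(1-3)])

lemma cross: "\<phi> \<in> H1C \<Longrightarrow> (\<lambda>n. LINT x|lborel. cmod (\<phi> x) * cmod (v n x)) \<longlonglongrightarrow> 0"
  by (rule cross_tendsto_0[OF H1C_L2 H1C_L2[OF v(1)] v(2) sup v(4)])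

lemma split_mass: assumes "\<phi> \<in> H1C" shows "(\<lambda>n. mass (\<lambda>x. \<phi> x + v n x) - mass \<phi> - mass (v n)) \<longlonglongrightarrow> 0"
proof (rule Lim_null_comparison)
  have "(\<lambda>n. 2 * (LINT x|lborel. cmod (\<phi> x) * cmod (v n x))) \<longlonglongrightarrow> 2 * 0" by (intro tendsto_intros cross assms)
  thus "(\<lambda>n. 2 * (LINT x|lborel. cmod (\<phi> x) * cmod (v n x))) \<longlonglongrightarrow> 0" by simp
  show "\<forall>\<^sub>F n in sequentially. norm (mass (\<lambda>x. \<phi> x + v n x) - mass \<phi> - mass (v n)) \<le> 2 * (LINT x|lborel. cmod (\<phi> x) * cmod (v n x))"
  proof (intro always_eventually allI)
    fix n
    have "cmod (LINT x|lborel. \<phi> x * cnj (v n x)) \<le> (LINT x|lborel. cmod (\<phi> x) * cmod (v n x))"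
      using integral_norm_bound[of lborel "\<lambda>x. \<phi> x * cnj (v n x)"] by (simp add: norm_mult)
    moreover have "\<bar>Re (LINT x|lborel. \<phi> x * cnj (v n x))\<bar> \<le> cmod (LINT x|lborel. \<phi> x * cnj (v n x))" by (rule abs_Re_le_cmod)
    ultimately show "norm (mass (\<lambda>x. \<phi> x + v n x) - mass \<phi> - mass (v n)) \<le> 2 * (LINT x|lborel. cmod (\<phi> x) * cmod (v n x))"
      using mass_add_expand[OF H1C_L2[OF assms] H1C_L2[OF v(1)], of n] by simp
  qed
qed

lemma split_dirichlet: assumes "\<phi> \<in> H1C" shows "(\<lambda>n. dirichlet (\<lambda>x. \<phi> x + v n x) - dirichlet \<phi> - dirichlet (v n)) \<longlonglongrightarrow> 0"
proof -
  have "(\<lambda>n. 2 * Re (LINT x|lborel. weak_deriv \<phi> x * cnj (weak_deriv (v n) x))) \<longlonglongrightarrow> 2 * Re 0"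
    by (intro tendsto_intros deriv_cross_tendsto_0[OF assms v])
  moreover have "dirichlet (\<lambda>x. \<phi> x + v n x) - dirichlet \<phi> - dirichlet (v n) = 2 * Re (LINT x|lborel. weak_deriv \<phi> x * cnj (weak_deriv (v n) x))" for n
    using mass_add_expand[OF H1_pair_L2(2)[OF H1C_H1_pair[OF assms]] H1_pair_L2(2)[OF H1C_H1_pair[OF v(1)]], of n] H1C_add(2)[OF assms v(1), of n]
    by (simp add: dirichlet_def)
  ultimately show ?thesis by simp
qed

lemma split_potential:
  assumes "\<phi> \<in> H1C" "p > 1"
  shows "(\<lambda>n. potential p (\<lambda>x. \<phi> x + v n x) - potential p \<phi> - potential p (v n)) \<longlonglongrightarrow> 0"
proof -
  define M where "M = max (sqrt (4 * K)) (sqrt (2 * mass \<phi> + 2 * dirichlet \<phi>))"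
  have M: "cmod (\<phi> x) \<le> M" "cmod (v n x) \<le> M" for x n
    using sup[of n x] H1C_sup1[OF assms(1), of x] by (auto simp: M_def)
  define C where "C = (p + 1) * 2 powr (p + 1 - 1) * M powr (p + 1 - 2) + M powr (p + 1 - 2)"
  show ?thesis
  proof (rule Lim_null_comparison)
    have "(\<lambda>n. C * (LINT x|lborel. cmod (\<phi> x) * cmod (v n x))) \<longlonglongrightarrow> C * 0" by (intro tendsto_intros cross assms)
    thus "(\<lambda>n. C * (LINT x|lborel. cmod (\<phi> x) * cmod (v n x))) \<longlonglongrightarrow> 0" by simp
    show "\<forall>\<^sub>F n in sequentially. norm (potential p (\<lambda>x. \<phi> x + v n x) - potential p \<phi> - potential p (v n)) \<le> C * (LINT x|lborel. cmod (\<phi> x) * cmod (v n x))"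
    proof (intro always_eventually allI)
      fix n
      let ?d = "\<lambda>x. cmod (\<phi> x + v n x) powr (p + 1) - cmod (\<phi> x) powr (p + 1) - cmod (v n x) powr (p + 1)"
      note i = potential_integrable[OF H1C_add(1)[OF assms(1) v(1)] assms(2), of n] potential_integrable[OF assms] potential_integrable[OF v(1) assms(2), of n]
      have e: "potential p (\<lambda>x. \<phi> x + v n x) - potential p \<phi> - potential p (v n) = (LINT x|lborel. ?d x)"
        unfolding potential_def using i by simp
      have "norm (LINT x|lborel. ?d x) \<le> (LINT x|lborel. norm (?d x))" by (rule integral_norm_bound)
      also have "\<dots> \<le> (LINT x|lborel. C * (cmod (\<phi> x) * cmod (v n x)))"
      proof (rule integral_mono)
        show "integrable lborel (\<lambda>x. norm (?d x))" using i by (intro integrable_norm Bochner_Integration.integrable_diff)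
        show "integrable lborel (\<lambda>x. C * (cmod (\<phi> x) * cmod (v n x)))"
          using L2_mult_integrable(2)[OF H1C_L2[OF assms(1)] H1C_L2[OF v(1)], of n] by (rule integrable_mult_right)
        show "norm (?d x) \<le> C * (cmod (\<phi> x) * cmod (v n x))" for x
          unfolding C_def real_norm_def by (rule powr_split[OF M]) (use assms in simp)
      qed
      also have "\<dots> = C * (LINT x|lborel. cmod (\<phi> x) * cmod (v n x))" by (rule integral_mult_right_zero)
      finally show "norm (potential p (\<lambda>x. \<phi> x + v n x) - potential p \<phi> - potential p (v n)) \<le> C * (LINT x|lborel. cmod (\<phi> x) * cmod (v n x))"
        unfolding e .
    qed
  qed
qed

end

lemma split_coupling:
  assumes "vanishing v1 K" "vanishing v2 K" "vanishing v3 K" and \<phi>: "\<phi>1 \<in> H1C" "\<phi>2 \<in> H1C" "\<phi>3 \<in> H1C"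
  shows "(\<lambda>n. coupling (\<lambda>x. \<phi>1 x + v1 n x) (\<lambda>x. \<phi>2 x + v2 n x) (\<lambda>x. \<phi>3 x + v3 n x) - coupling \<phi>1 \<phi>2 \<phi>3 - coupling (v1 n) (v2 n) (v3 n)) \<longlonglongrightarrow> 0"
proof -
  interpret v1: vanishing v1 K by fact
  interpret v2: vanishing v2 K by fact
  interpret v3: vanishing v3 K by fact
  define M where "M = Max {sqrt (4 * K), sqrt (2 * mass \<phi>1 + 2 * dirichlet \<phi>1), sqrt (2 * mass \<phi>2 + 2 * dirichlet \<phi>2), sqrt (2 * mass \<phi>3 + 2 * dirichlet \<phi>3)}"
  have M: "sqrt (4 * K) \<le> M" "sqrt (2 * mass \<phi>1 + 2 * dirichlet \<phi>1) \<le> M" "sqrt (2 * mass \<phi>2 + 2 * dirichlet \<phi>2) \<le> M" "sqrt (2 * mass \<phi>3 + 2 * dirichlet \<phi>3) \<le> M"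
    unfolding M_def by (intro Max_ge; simp)+
  have b: "cmod (\<phi>1 x) \<le> M" "cmod (\<phi>2 x) \<le> M" "cmod (\<phi>3 x) \<le> M" "cmod (v1 n x) \<le> M" "cmod (v2 n x) \<le> M" "cmod (v3 n x) \<le> M" for n x
    using H1C_sup1[OF \<phi>(1), of x] H1C_sup1[OF \<phi>(2), of x] H1C_sup1[OF \<phi>(3), of x] v1.sup[of n x] v2.sup[of n x] v3.sup[of n x] M
    by linarith+
  let ?I = "\<lambda>\<phi> v. LINT x|lborel. cmod (\<phi> x) * cmod (v x)"
  let ?B = "\<lambda>n. M * (?I \<phi>1 (v3 n) + ?I \<phi>1 (v2 n) + ?I \<phi>1 (v2 n) + ?I \<phi>2 (v1 n) + ?I \<phi>2 (v1 n) + ?I \<phi>3 (v1 n))"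
  show ?thesis
  proof (rule Lim_null_comparison)
    have "?B \<longlonglongrightarrow> M * (0 + 0 + 0 + 0 + 0 + 0)" by (intro tendsto_intros v1.cross v2.cross v3.cross \<phi>)
    thus "?B \<longlonglongrightarrow> 0" by simp
    show "\<forall>\<^sub>F n in sequentially. norm (coupling (\<lambda>x. \<phi>1 x + v1 n x) (\<lambda>x. \<phi>2 x + v2 n x) (\<lambda>x. \<phi>3 x + v3 n x) - coupling \<phi>1 \<phi>2 \<phi>3 - coupling (v1 n) (v2 n) (v3 n)) \<le> ?B n"
    proof (intro always_eventually allI)
      fix n
      let ?d = "\<lambda>x. (\<phi>1 x + v1 n x) * (\<phi>2 x + v2 n x) * cnj (\<phi>3 x + v3 n x) - \<phi>1 x * \<phi>2 x * cnj (\<phi>3 x) - v1 n x * v2 n x * cnj (v3 n x)"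
      note i = triple_integrable(2)[OF H1C_add(1)[OF \<phi>(1) v1.v(1)] H1C_add(1)[OF \<phi>(2) v2.v(1)] H1C_add(1)[OF \<phi>(3) v3.v(1)], of n n n]
        triple_integrable(2)[OF \<phi>] triple_integrable(2)[OF v1.v(1) v2.v(1) v3.v(1), of n n n]
      have e: "coupling (\<lambda>x. \<phi>1 x + v1 n x) (\<lambda>x. \<phi>2 x + v2 n x) (\<lambda>x. \<phi>3 x + v3 n x) - coupling \<phi>1 \<phi>2 \<phi>3 - coupling (v1 n) (v2 n) (v3 n) = (LINT x|lborel. ?d x)"
        unfolding coupling_def
        by (simp only: Bochner_Integration.integral_diff[OF Bochner_Integration.integrable_diff[OF i(1,2)] i(3)] Bochner_Integration.integral_diff[OF i(1,2)])
      have ci: "integrable lborel (\<lambda>x. cmod (f x) * cmod (g x))" if "f \<in> H1C" "g \<in> H1C" for f g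
        by (rule L2_mult_integrable(2)[OF H1C_L2 H1C_L2, OF that])
      note ci' = ci[OF \<phi>(1) v3.v(1), of n] ci[OF \<phi>(1) v2.v(1), of n] ci[OF \<phi>(2) v1.v(1), of n] ci[OF \<phi>(3) v1.v(1), of n]
      have "norm (LINT x|lborel. ?d x) \<le> (LINT x|lborel. norm (?d x))" by (rule integral_norm_bound)
      also have "\<dots> \<le> (LINT x|lborel. M * (cmod (\<phi>1 x) * cmod (v3 n x) + cmod (\<phi>1 x) * cmod (v2 n x) + cmod (\<phi>1 x) * cmod (v2 n x) + cmod (\<phi>2 x) * cmod (v1 n x) + cmod (\<phi>2 x) * cmod (v1 n x) + cmod (\<phi>3 x) * cmod (v1 n x)))"
      proof (rule integral_mono)
        show "integrable lborel (\<lambda>x. norm (?d x))"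
          by (intro integrable_norm Bochner_Integration.integrable_diff i)
        show "integrable lborel (\<lambda>x. M * (cmod (\<phi>1 x) * cmod (v3 n x) + cmod (\<phi>1 x) * cmod (v2 n x) + cmod (\<phi>1 x) * cmod (v2 n x) + cmod (\<phi>2 x) * cmod (v1 n x) + cmod (\<phi>2 x) * cmod (v1 n x) + cmod (\<phi>3 x) * cmod (v1 n x)))"
          by (intro integrable_mult_right Bochner_Integration.integrable_add ci')
        show "norm (?d x) \<le> M * (cmod (\<phi>1 x) * cmod (v3 n x) + cmod (\<phi>1 x) * cmod (v2 n x) + cmod (\<phi>1 x) * cmod (v2 n x) + cmod (\<phi>2 x) * cmod (v1 n x) + cmod (\<phi>2 x) * cmod (v1 n x) + cmod (\<phi>3 x) * cmod (v1 n x))" for x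
          by (rule triple_split[OF b])
      qed
      also have "\<dots> = ?B n"
        by (simp only: integral_mult_right_zero Bochner_Integration.integral_add Bochner_Integration.integrable_add ci')
      finally show "norm (coupling (\<lambda>x. \<phi>1 x + v1 n x) (\<lambda>x. \<phi>2 x + v2 n x) (\<lambda>x. \<phi>3 x + v3 n x) - coupling \<phi>1 \<phi>2 \<phi>3 - coupling (v1 n) (v2 n) (v3 n)) \<le> ?B n"
        unfolding e .
    qed
  qed
qed

section \<open>Splitting of constraints and energy along a sequence\<close>

definition vdiff :: "(real \<Rightarrow> complex)^3 \<Rightarrow> (real \<Rightarrow> complex)^3 \<Rightarrow> (real \<Rightarrow> complex)^3" where
  "vdiff u v = (\<chi> i. (\<lambda>x. (u $ i) x - (v $ i) x))"

lemma vdiff_nth [simp]: "vdiff u v $ i = (\<lambda>x. (u $ i) x - (v $ i) x)"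
  by (simp add: vdiff_def)

context three_wave begin

theorem splitting:
  assumes U: "\<And>n. U n \<in> H1C_vec" "\<And>n i. mass (U n $ i) \<le> K" "\<And>n i. dirichlet (U n $ i) \<le> K" "\<And>i x. (\<lambda>n. (U n $ i) x) \<longlonglongrightarrow> (\<phi> $ i) x"
  defines "V \<equiv> \<lambda>n. vdiff (U n) \<phi>"
  shows "\<phi> \<in> H1C_vec" "\<And>n. V n \<in> H1C_vec" "\<And>n i. mass (V n $ i) \<le> 4 * K" "\<And>n i. dirichlet (V n $ i) \<le> 4 * K"
    "(\<lambda>n. Q1 (U n) - Q1 \<phi> - Q1 (V n)) \<longlonglongrightarrow> 0" "(\<lambda>n. Q2 (U n) - Q2 \<phi> - Q2 (V n)) \<longlonglongrightarrow> 0"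
    "(\<lambda>n. total_energy (U n) - total_energy \<phi> - total_energy (V n)) \<longlonglongrightarrow> 0"
proof -
  note lim = pointwise_limit_H1C[OF H1C_vec_D[OF U(1)] U(2,3,4)]
  show \<phi>: "\<phi> \<in> H1C_vec" using lim(1) by (simp add: H1C_vec_def)
  have \<phi>C: "\<phi> $ i \<in> H1C" for i by (rule lim(1))
  show V: "V n \<in> H1C_vec" for n using H1C_diff[OF H1C_vec_D[OF U(1)] \<phi>C] by (simp add: H1C_vec_def V_def)
  show NV: "mass (V n $ i) \<le> 4 * K" "dirichlet (V n $ i) \<le> 4 * K" for n i
    using H1C_diff_bounds[OF H1C_vec_D[OF U(1)] \<phi>C U(2) lim(2) U(3) lim(3)] by (simp_all add: V_def)
  have van: "vanishing (\<lambda>n. V n $ i) (4 * K)" for i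
  proof
    have "(\<lambda>n. (U n $ i) x - (\<phi> $ i) x) \<longlonglongrightarrow> (\<phi> $ i) x - (\<phi> $ i) x" for x by (intro tendsto_intros U)
    thus "(\<lambda>n. (V n $ i) x) \<longlonglongrightarrow> 0" for x by (simp add: V_def)
  qed (use V NV H1C_vec_D in auto)
  have eq: "(\<lambda>x. (\<phi> $ i) x + (V n $ i) x) = U n $ i" for n i by (simp add: V_def)
  have n: "(\<lambda>n. mass (U n $ i) - mass (\<phi> $ i) - mass (V n $ i)) \<longlonglongrightarrow> 0" for i
    using vanishing.split_mass[OF van[of i] \<phi>C[of i]] unfolding eq .
  have "(\<lambda>n. (mass (U n $ 1) - mass (\<phi> $ 1) - mass (V n $ 1)) + (mass (U n $ 3) - mass (\<phi> $ 3) - mass (V n $ 3))) \<longlonglongrightarrow> 0 + 0" by (intro tendsto_add n)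
  thus "(\<lambda>n. Q1 (U n) - Q1 \<phi> - Q1 (V n)) \<longlonglongrightarrow> 0" by (simp add: Q_eq algebra_simps)
  have "(\<lambda>n. (mass (U n $ 2) - mass (\<phi> $ 2) - mass (V n $ 2)) + (mass (U n $ 3) - mass (\<phi> $ 3) - mass (V n $ 3))) \<longlonglongrightarrow> 0 + 0" by (intro tendsto_add n)
  thus "(\<lambda>n. Q2 (U n) - Q2 \<phi> - Q2 (V n)) \<longlonglongrightarrow> 0" by (simp add: Q_eq algebra_simps)
  have s: "(\<lambda>n. part_energy (U n $ i) - part_energy (\<phi> $ i) - part_energy (V n $ i)) \<longlonglongrightarrow> 0" for i
  proof -
    have "(\<lambda>n. 1 / 2 * (dirichlet (U n $ i) - dirichlet (\<phi> $ i) - dirichlet (V n $ i)) - \<beta> / (p + 1) * (potential p (U n $ i) - potential p (\<phi> $ i) - potential p (V n $ i))) \<longlonglongrightarrow> 1 / 2 * 0 - \<beta> / (p + 1) * 0"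
      using vanishing.split_dirichlet[OF van[of i] \<phi>C[of i]] vanishing.split_potential[OF van[of i] \<phi>C[of i] p1] unfolding eq
      by (intro tendsto_diff tendsto_mult_left)
    moreover have "part_energy (U n $ i) - part_energy (\<phi> $ i) - part_energy (V n $ i) =
        1 / 2 * (dirichlet (U n $ i) - dirichlet (\<phi> $ i) - dirichlet (V n $ i)) - \<beta> / (p + 1) * (potential p (U n $ i) - potential p (\<phi> $ i) - potential p (V n $ i))" for n
      unfolding part_energy_def right_diff_distrib by argo
    ultimately show ?thesis by simp
  qed
  have t: "(\<lambda>n. coupling (U n $ 1) (U n $ 2) (U n $ 3) - coupling (\<phi> $ 1) (\<phi> $ 2) (\<phi> $ 3) - coupling (V n $ 1) (V n $ 2) (V n $ 3)) \<longlonglongrightarrow> 0"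
    using split_coupling[OF van[of 1] van[of 2] van[of 3] \<phi>C[of 1] \<phi>C[of 2] \<phi>C[of 3]] unfolding eq .
  have "(\<lambda>n. (part_energy (U n $ 1) - part_energy (\<phi> $ 1) - part_energy (V n $ 1)) + (part_energy (U n $ 2) - part_energy (\<phi> $ 2) - part_energy (V n $ 2)) + (part_energy (U n $ 3) - part_energy (\<phi> $ 3) - part_energy (V n $ 3))
    - \<alpha> * Re (coupling (U n $ 1) (U n $ 2) (U n $ 3) - coupling (\<phi> $ 1) (\<phi> $ 2) (\<phi> $ 3) - coupling (V n $ 1) (V n $ 2) (V n $ 3))) \<longlonglongrightarrow> 0 + 0 + 0 - \<alpha> * Re 0"
    by (intro tendsto_diff[OF tendsto_add[OF tendsto_add]] s tendsto_mult_left tendsto_Re t)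
  moreover have "total_energy (U n) - total_energy \<phi> - total_energy (V n) =
      (part_energy (U n $ 1) - part_energy (\<phi> $ 1) - part_energy (V n $ 1)) + (part_energy (U n $ 2) - part_energy (\<phi> $ 2) - part_energy (V n $ 2)) + (part_energy (U n $ 3) - part_energy (\<phi> $ 3) - part_energy (V n $ 3))
      - \<alpha> * Re (coupling (U n $ 1) (U n $ 2) (U n $ 3) - coupling (\<phi> $ 1) (\<phi> $ 2) (\<phi> $ 3) - coupling (V n $ 1) (V n $ 2) (V n $ 3))" for n
    unfolding total_energy_def minus_complex.sel right_diff_distrib by argo
  ultimately show "(\<lambda>n. total_energy (U n) - total_energy \<phi> - total_energy (V n)) \<longlonglongrightarrow> 0" by simp
qed

text \<open>Potential and coupling are bounded by the mass times a positive power of the sup. A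
  sequence that tends to zero uniformly therefore has asymptotically nonnegative energy; any other
  one keeps a large value along a subsequence.\<close>

lemma dichotomy:
  assumes u: "\<And>n. u n \<in> H1C_vec" "\<And>n i. mass (u n $ i) \<le> K"
  shows "(\<forall>\<eta>>0. \<forall>\<^sub>F n in sequentially. - \<eta> \<le> total_energy (u n)) \<or>
    (\<exists>\<delta>>0. \<exists>r::nat\<Rightarrow>nat. strict_mono r \<and> (\<forall>k. \<exists>i x. \<delta> \<le> cmod ((u (r k) $ i) x)))"
proof (cases "\<forall>\<delta>>0. \<forall>\<^sub>F n in sequentially. \<forall>i x. cmod ((u n $ i) x) < \<delta>")
  case False
  then obtain \<delta> where \<delta>: "\<delta> > 0" "\<not> (\<forall>\<^sub>F n in sequentially. \<forall>i x. cmod ((u n $ i) x) < \<delta>)" by blast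
  obtain r :: "nat \<Rightarrow> nat" where "strict_mono r" "\<And>k. \<not> (\<forall>i x. cmod ((u (r k) $ i) x) < \<delta>)"
    using not_eventually_sequentiallyD[OF \<delta>(2)] by blast
  thus ?thesis using \<delta>(1) by (meson not_le)
next
  case True
  have K: "0 \<le> K" using u(2)[of 0 1] mass_nonneg order_trans by blast
  have "\<forall>\<^sub>F n in sequentially. - \<eta> \<le> total_energy (u n)" if \<eta>: "\<eta> > 0" for \<eta>
  proof -
    \<comment> \<open>What three potentials and one coupling can take away from the energy when all
      values are below \<open>d\<close>; it tends to zero with \<open>d\<close>.\<close>
    let ?B = "\<lambda>d. 3 * (\<beta> / (p + 1) * (d powr (p - 1) * K)) + \<alpha> * (d * (2 * K))"
    have ev: "eventually ((\<le>) 0) (at_right (0::real))" by (rule eventually_mono[OF eventually_at_right_less]) simp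
    have "(?B \<longlongrightarrow> 3 * (\<beta> / (p + 1) * (0 powr (p - 1) * K)) + \<alpha> * (0 * (2 * K))) (at_right 0)"
      using p1 ev by (intro tendsto_intros tendsto_powr') (auto intro: tendsto_ident_at)
    hence "(?B \<longlongrightarrow> 0) (at_right 0)" by simp
    hence "\<forall>\<^sub>F d in at_right 0. ?B d < \<eta>" using \<eta> by (rule order_tendstoD)
    then obtain d where d: "d > 0" "?B d < \<eta>"
      unfolding eventually_at_right_field using dense by (metis (no_types, lifting))
    have "\<forall>\<^sub>F n in sequentially. \<forall>i x. cmod ((u n $ i) x) < d" using True d by blast
    thus ?thesis
    proof eventually_elim
      case (elim n)
      have b: "cmod ((u n $ i) x) \<le> d" for i x using elim less_imp_le by blast
      have "- (\<beta> / (p + 1) * (d powr (p - 1) * K)) \<le> part_energy (u n $ i)" for i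
      proof -
        have "potential p (u n $ i) \<le> d powr (p - 1) * mass (u n $ i)" by (rule potential_bound[OF H1C_vec_D[OF u(1)] p1 b])
        also have "\<dots> \<le> d powr (p - 1) * K" by (intro mult_left_mono u) auto
        finally have "\<beta> / (p + 1) * potential p (u n $ i) \<le> \<beta> / (p + 1) * (d powr (p - 1) * K)"
          using b0 p1 by (intro mult_left_mono) auto
        thus ?thesis unfolding part_energy_def using dirichlet_nonneg[of "u n $ i"] by argo
      qed
      moreover have "\<alpha> * Re (coupling (u n $ 1) (u n $ 2) (u n $ 3)) \<le> \<alpha> * (d * (2 * K))"
      proof -
        have "Re (coupling (u n $ 1) (u n $ 2) (u n $ 3)) \<le> d * (mass (u n $ 1) + mass (u n $ 2))"
          using Re_coupling_le[OF u(1)] abs_coupling_bound[OF H1C_vec_D H1C_vec_D H1C_vec_D b, OF u(1) u(1) u(1)] by (rule order_trans)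
        also have "\<dots> \<le> d * (2 * K)" using u(2)[of n 1] u(2)[of n 2] d by (intro mult_left_mono) auto
        finally show ?thesis using a0 by (intro mult_left_mono) auto
      qed
      ultimately have "- ?B d \<le> total_energy (u n)" unfolding total_energy_def by (smt (verit))
      thus ?case using d(2) by linarith
    qed
  qed
  thus ?thesis by blast
qed

text \<open>Arzela-Ascoli with a global Hoelder bound: a diagonal subsequence converges at the
  rationals, and equicontinuity extends this to all reals. Moving the large values to 0 keeps the
  limit from vanishing.\<close>

lemma extraction:
  assumes u: "\<And>n. u n \<in> H1C_vec" "\<And>n i. mass (u n $ i) \<le> K" "\<And>n i. dirichlet (u n $ i) \<le> K"
    and \<delta>: "\<delta> > 0" "\<And>n. \<exists>i x. \<delta> \<le> cmod ((u n $ i) x)"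
  shows "\<exists>(y :: nat \<Rightarrow> real) (r :: nat \<Rightarrow> nat) \<phi>. strict_mono r \<and>
    (\<forall>i x. (\<lambda>k. (u (r k) $ i) (x + y (r k))) \<longlonglongrightarrow> (\<phi> $ i) x) \<and> (\<exists>i. \<phi> $ i \<noteq> (\<lambda>x. 0))"
proof -
  obtain y where y: "\<And>n. \<exists>i. \<delta> \<le> cmod ((u n $ i) (y n))" using \<delta>(2) by metis
  define f where "f n x = (\<chi> i. (u n $ i) (x + y n))" for n and x :: real
  have fb: "cmod (f n x $ i) \<le> sqrt (4 * K)" for n x i
    unfolding f_def using H1C_sup4[OF H1C_vec_D[OF u(1)] u(2,3)] by simp
  have fn: "norm (f n x) \<le> 3 * sqrt (4 * K)" for n x
  proof -
    have "norm (f n x) \<le> (\<Sum>i\<in>UNIV. norm (f n x $ i))" unfolding norm_vec_def by (rule L2_set_le_sum) auto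
    also have "\<dots> \<le> 3 * sqrt (4 * K)" using fb[of n x 1] fb[of n x 2] fb[of n x 3] by (simp add: sum_3)
    finally show ?thesis .
  qed
  obtain r :: "nat \<Rightarrow> nat" where r: "strict_mono r" "\<And>q. q \<in> \<rat> \<Longrightarrow> \<exists>l. (\<lambda>n. f (r n) q) \<longlonglongrightarrow> l"
    using function_convergent_subsequence[OF countable_rat, of f "3 * sqrt (4 * K)"] fn by metis
  have eq: "(cmod (f n x $ i - f n q $ i))\<^sup>2 \<le> \<bar>x - q\<bar> * K" for n x q i
  proof -
    have "(cmod ((u n $ i) (x + y n) - (u n $ i) (q + y n)))\<^sup>2 \<le> \<bar>(x + y n) - (q + y n)\<bar> * mass (weak_deriv (u n $ i))"
      by (rule H1_pair_Holder[OF H1C_H1_pair[OF H1C_vec_D[OF u(1)]]])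
    also have "\<dots> \<le> \<bar>x - q\<bar> * K" using u(3)[of n i] unfolding dirichlet_def by (simp add: mult_left_mono)
    finally show ?thesis by (simp add: f_def)
  qed
  have "Cauchy (\<lambda>n. f (r n) x $ i)" for x i
  proof (rule metric_CauchyI)
    fix e :: real assume e: "e > 0"
    have K: "0 \<le> K" using u(2)[of 0 1] mass_nonneg order_trans by blast
    \<comment> \<open>By the Hoelder bound, a move by less than \<open>d\<close> changes each
      function by less than \<open>e/3\<close>.\<close>
    define d where "d = (e/3)\<^sup>2 / (K + 1)"
    have d: "d > 0" using e K by (simp add: d_def)
    obtain q where q: "q \<in> \<rat>" "x < q" "q < x + d" using Rats_dense_in_real[of x "x + d"] d by auto
    have "\<bar>x - q\<bar> * K \<le> d * K" using q K by (intro mult_right_mono) auto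
    also have "\<dots> < (e/3)\<^sup>2" using e K by (simp add: d_def field_simps)
    finally have s: "cmod (f n x $ i - f n q $ i) < e/3" for n
      using eq[of n x i q] e by (intro power_less_imp_less_base[of _ 2 "e/3"]) auto
    obtain l where l: "(\<lambda>n. f (r n) q) \<longlonglongrightarrow> l" using r(2) q(1) by blast
    have "Cauchy (\<lambda>n. f (r n) q $ i)" using tendsto_vec_nth[OF l, of i] LIMSEQ_imp_Cauchy by blast
    then obtain M where M: "\<And>m n. m \<ge> M \<Longrightarrow> n \<ge> M \<Longrightarrow> dist (f (r m) q $ i) (f (r n) q $ i) < e/3"
      using e unfolding Cauchy_def by (meson zero_less_divide_iff zero_less_numeral)
    have "dist (f (r m) x $ i) (f (r n) x $ i) < e" if "m \<ge> M" "n \<ge> M" for m n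
    proof -
      have "dist (f (r m) x $ i) (f (r n) x $ i) \<le> dist (f (r m) x $ i) (f (r m) q $ i) + dist (f (r m) q $ i) (f (r n) q $ i) + dist (f (r n) q $ i) (f (r n) x $ i)"
        using dist_triangle[of "f (r m) x $ i" "f (r n) x $ i" "f (r m) q $ i"]
          dist_triangle[of "f (r m) q $ i" "f (r n) x $ i" "f (r n) q $ i"] by linarith
      moreover have "dist (f (r m) x $ i) (f (r m) q $ i) < e/3" using s[of "r m"] by (simp add: dist_norm)
      moreover have "dist (f (r n) q $ i) (f (r n) x $ i) < e/3" using s[of "r n"] by (simp add: dist_norm norm_minus_commute)
      ultimately show ?thesis using M[OF that] by linarith
    qed
    thus "\<exists>M. \<forall>m\<ge>M. \<forall>n\<ge>M. dist (f (r m) x $ i) (f (r n) x $ i) < e" by blast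
  qed
  hence "\<exists>l. (\<lambda>n. f (r n) x $ i) \<longlonglongrightarrow> l" for x i using Cauchy_convergent convergent_def by blast
  then obtain g where g: "\<And>x i. (\<lambda>n. f (r n) x $ i) \<longlonglongrightarrow> g x i" by metis
  define \<phi> where "\<phi> = (\<chi> i. (\<lambda>x. g x i))"
  have lim: "(\<lambda>k. (u (r k) $ i) (x + y (r k))) \<longlonglongrightarrow> (\<phi> $ i) x" for i x
    using g[of x i] by (simp add: f_def \<phi>_def)
  \<comment> \<open>The component carrying the large value may change along the sequence, so the sum
    of the three moduli is followed instead.\<close>
  have "(\<lambda>k. \<Sum>i\<in>UNIV. cmod ((u (r k) $ i) (0 + y (r k)))) \<longlonglongrightarrow> (\<Sum>i\<in>UNIV. cmod ((\<phi> $ i) 0))"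
    by (intro tendsto_intros lim)
  moreover have "\<delta> \<le> (\<Sum>i\<in>UNIV. cmod ((u (r k) $ i) (0 + y (r k))))" for k
  proof -
    obtain i where i: "\<delta> \<le> cmod ((u (r k) $ i) (y (r k)))" using y by blast
    also have "\<dots> \<le> (\<Sum>i\<in>UNIV. cmod ((u (r k) $ i) (y (r k))))" by (rule member_le_sum) auto
    finally show ?thesis by simp
  qed
  ultimately have "\<delta> \<le> (\<Sum>i\<in>UNIV. cmod ((\<phi> $ i) 0))" by (intro LIMSEQ_le_const) auto
  hence "\<exists>i. \<phi> $ i \<noteq> (\<lambda>x. 0)" using \<delta>(1) by (metis (no_types, lifting) norm_zero not_le sum.neutral)
  thus ?thesis using r(1) lim by blast
qed

end

section \<open>Compactness of minimizing sequences\<close>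

context three_wave begin

text \<open>The outcome of one extraction, as a predicate because it occurs twice: for the
  minimizing sequence with bound \<open>K\<close>, then for its remainder with bound
  \<open>4 * K\<close>.\<close>

definition splits_off ::
    "(nat \<Rightarrow> (real \<Rightarrow> complex)^3) \<Rightarrow> real \<Rightarrow> (nat \<Rightarrow> real) \<Rightarrow> (nat \<Rightarrow> nat) \<Rightarrow> (real \<Rightarrow> complex)^3 \<Rightarrow> bool" where
  "splits_off u K y r \<phi> \<longleftrightarrow> strict_mono (r :: nat \<Rightarrow> nat) \<and> \<phi> \<in> H1C_vec \<and> (\<exists>i. \<phi> $ i \<noteq> (\<lambda>x. 0)) \<and>
    (\<forall>k. vdiff (translate (y k) (u (r k))) \<phi> \<in> H1C_vec) \<and>
    (\<forall>k i. mass (vdiff (translate (y k) (u (r k))) \<phi> $ i) \<le> 4 * K \<and> dirichlet (vdiff (translate (y k) (u (r k))) \<phi> $ i) \<le> 4 * K) \<and>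
    (\<lambda>k. Q1 (u (r k)) - Q1 \<phi> - Q1 (vdiff (translate (y k) (u (r k))) \<phi>)) \<longlonglongrightarrow> 0 \<and>
    (\<lambda>k. Q2 (u (r k)) - Q2 \<phi> - Q2 (vdiff (translate (y k) (u (r k))) \<phi>)) \<longlonglongrightarrow> 0 \<and>
    (\<lambda>k. total_energy (u (r k)) - total_energy \<phi> - total_energy (vdiff (translate (y k) (u (r k))) \<phi>)) \<longlonglongrightarrow> 0"

lemma splits_offD:
  assumes "splits_off u K y r \<phi>"
  defines "v \<equiv> \<lambda>k. vdiff (translate (y k) (u (r k))) \<phi>"
  shows "strict_mono r" "\<phi> \<in> H1C_vec" "\<exists>i. \<phi> $ i \<noteq> (\<lambda>x. 0)" "v k \<in> H1C_vec" "mass (v k $ i) \<le> 4 * K" "dirichlet (v k $ i) \<le> 4 * K"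
    "(\<lambda>k. Q1 (u (r k)) - Q1 \<phi> - Q1 (v k)) \<longlonglongrightarrow> 0" "(\<lambda>k. Q2 (u (r k)) - Q2 \<phi> - Q2 (v k)) \<longlonglongrightarrow> 0"
    "(\<lambda>k. total_energy (u (r k)) - total_energy \<phi> - total_energy (v k)) \<longlonglongrightarrow> 0"
  using assms(1) unfolding splits_off_def v_def by (elim conjE; blast)+

lemma bump_extraction:
  assumes u: "\<And>n. u n \<in> H1C_vec" "\<And>n i. mass (u n $ i) \<le> K" "\<And>n i. dirichlet (u n $ i) \<le> K"
    and neg: "\<not> (\<forall>\<eta>>0. \<forall>\<^sub>F n in sequentially. - \<eta> \<le> total_energy (u n))"
  shows "\<exists>y r \<phi>. splits_off u K y r \<phi>"
proof -
  have "\<exists>\<delta>>0. \<exists>r::nat\<Rightarrow>nat. strict_mono r \<and> (\<forall>k. \<exists>i x. \<delta> \<le> cmod ((u (r k) $ i) x))"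
    using dichotomy[of u K, OF u(1) u(2)]
  proof (rule disjE)
    assume "\<forall>\<eta>>0. \<forall>\<^sub>F n in sequentially. - \<eta> \<le> total_energy (u n)"
    with neg show ?thesis by (rule notE)
  qed
  then obtain \<delta> and r0 :: "nat \<Rightarrow> nat" where \<delta>: "\<delta> > 0" and r0: "strict_mono r0" "\<And>k. \<exists>i x. \<delta> \<le> cmod ((u (r0 k) $ i) x)"
    by (elim exE conjE) (rule that, assumption+, erule spec)
  obtain y r1 \<phi> where H: "strict_mono (r1 :: nat \<Rightarrow> nat) \<and>
      (\<forall>i x. (\<lambda>k. (u (r0 (r1 k)) $ i) (x + y (r1 k))) \<longlonglongrightarrow> (\<phi> $ i) x) \<and> (\<exists>i. \<phi> $ i \<noteq> (\<lambda>x. 0))"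
    using extraction[of "\<lambda>n. u (r0 n)" K \<delta>, OF u(1) u(2) u(3) \<delta> r0(2)] by blast
  note r1 = H[THEN conjunct1] and lim = H[THEN conjunct2, THEN conjunct1, rule_format] and nz = H[THEN conjunct2, THEN conjunct2]
  define r where "r k = r0 (r1 k)" for k
  define Y where "Y k = y (r1 k)" for k
  have sm: "strict_mono r" using r0(1) r1 by (simp add: r_def strict_mono_def)
  define U where "U k = translate (Y k) (u (r k))" for k
  note t = translate_H1C_vec[OF u(1)]
  have U: "U k \<in> H1C_vec" "mass (U k $ i) \<le> K" "dirichlet (U k $ i) \<le> K" for k i
    using t(1) u H1C_vec_D[OF u(1)] by (simp_all add: U_def mass_translate H1C_translate)
  have lU: "(\<lambda>k. (U k $ i) x) \<longlonglongrightarrow> (\<phi> $ i) x" for i x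
    using lim[of i x] by (simp add: U_def r_def Y_def)
  note sp = splitting[OF U lU]
  \<comment> \<open>Translation invariance: the splitting is stated for the original sequence,
    although it is the translated one that converges.\<close>
  have Qs: "Q1 (U k) = Q1 (u (r k))" "Q2 (U k) = Q2 (u (r k))" "total_energy (U k) = total_energy (u (r k))" for k
    using t by (simp_all add: U_def)
  show ?thesis
    unfolding splits_off_def
  proof (rule exI[of _ Y], rule exI[of _ r], rule exI[of _ \<phi>], intro conjI allI)
    fix k i
    show "vdiff (translate (Y k) (u (r k))) \<phi> \<in> H1C_vec" "mass (vdiff (translate (Y k) (u (r k))) \<phi> $ i) \<le> 4 * K"
      "dirichlet (vdiff (translate (Y k) (u (r k))) \<phi> $ i) \<le> 4 * K"
      using sp(2)[of k] sp(3,4)[of k i] unfolding U_def by blast+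
  qed (use sm sp(1) nz sp(5-7)[unfolded Qs, unfolded U_def] in blast)+
qed

lemma Q_zero_or: assumes "u \<in> H1C_vec" "Q1 u \<noteq> 0 \<or> Q2 u \<noteq> 0" shows "\<exists>i. u $ i \<noteq> (\<lambda>x. 0)"
proof (rule ccontr)
  assume "\<nexists>i. u $ i \<noteq> (\<lambda>x. 0)"
  hence "u $ i = (\<lambda>x. 0)" for i by blast
  thus False using assms(2) by (simp add: Q_eq)
qed

theorem compactness:
  assumes pos: "\<gamma> > 0" "\<mu> > 0"
    and U: "\<And>n. U n \<in> H1C_vec" "(\<lambda>n. Q1 (U n)) \<longlonglongrightarrow> \<gamma>" "(\<lambda>n. Q2 (U n)) \<longlonglongrightarrow> \<mu>" "(\<lambda>n. total_energy (U n)) \<longlonglongrightarrow> Jm \<gamma> \<mu>"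
  shows "\<exists>y r \<phi>. strict_mono (r :: nat \<Rightarrow> nat) \<and> \<phi> \<in> H1C_vec \<and> Q1 \<phi> = \<gamma> \<and> Q2 \<phi> = \<mu> \<and> total_energy \<phi> = Jm \<gamma> \<mu> \<and>
    (\<forall>i. (\<lambda>k. mass (vdiff (translate (y k) (U (r k))) \<phi> $ i)) \<longlonglongrightarrow> 0 \<and> (\<lambda>k. dirichlet (vdiff (translate (y k) (U (r k))) \<phi> $ i)) \<longlonglongrightarrow> 0)"
proof -
  let ?J = "Jm \<gamma> \<mu>"
  obtain B where B: "\<And>n. norm (Q1 (U n) + Q2 (U n)) \<le> B"
    using convergent_imp_Bseq[OF convergentI[OF tendsto_add[OF U(2,3)]]] unfolding Bseq_def by auto
  have NB: "mass (U n $ i) \<le> B" for n i using mass_le_Q[of "U n" i] B[of n] by simp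
  obtain E where E: "\<And>n. norm (total_energy (U n)) \<le> E" using convergent_imp_Bseq[OF convergentI[OF U(4)]] unfolding Bseq_def by auto
  have EE: "total_energy (U n) \<le> E" for n using E[of n] by simp
  obtain D where D: "\<And>n i. dirichlet (U n $ i) \<le> D" using bounded_of_energy[of U B E, OF U(1) NB EE] by blast
  define K where "K = max B D"
  have K: "mass (U n $ i) \<le> K" "dirichlet (U n $ i) \<le> K" for n i using NB[of n i] D[of n i] by (auto simp: K_def)
  \<comment> \<open>Asymptotically nonnegative energy is incompatible with the limit
    \<open>Jm \<gamma> \<mu> < 0\<close>.\<close>
  have "\<not> (\<forall>\<eta>>0. \<forall>\<^sub>F n in sequentially. - \<eta> \<le> total_energy (U n))"
  proof
    assume *: "\<forall>\<eta>>0. \<forall>\<^sub>F n in sequentially. - \<eta> \<le> total_energy (U n)"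
    have J: "?J < 0" by (rule J_neg[OF pos])
    have "- ?J / 2 > 0" using J by simp
    hence "\<forall>\<^sub>F n in sequentially. - (- ?J / 2) \<le> total_energy (U n)" using * by blast
    hence "- (- ?J / 2) \<le> ?J" by (rule tendsto_lowerbound[OF U(4)]) simp
    thus False using J by simp
  qed
  then obtain y r \<phi> where so: "splits_off U K y r \<phi>"
    using bump_extraction[of U K, OF U(1) K(1) K(2)] by blast
  define v where "v k = vdiff (translate (y k) (U (r k))) \<phi>" for k
  note D = splits_offD[OF so, folded v_def]
  note r = D(1) and \<phi> = D(2,3) and V = D(4-6) and s1 = D(7) and s2 = D(8) and s3 = D(9)
  define a b e where "a = \<gamma> - Q1 \<phi>" and "b = \<mu> - Q2 \<phi>" and "e = ?J - total_energy \<phi>"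
  have sub: "(\<lambda>k. Q1 (U (r k))) \<longlonglongrightarrow> \<gamma>" "(\<lambda>k. Q2 (U (r k))) \<longlonglongrightarrow> \<mu>" "(\<lambda>k. total_energy (U (r k))) \<longlonglongrightarrow> ?J"
    using LIMSEQ_subseq_LIMSEQ[OF U(2) r] LIMSEQ_subseq_LIMSEQ[OF U(3) r] LIMSEQ_subseq_LIMSEQ[OF U(4) r] by (simp_all add: o_def)
  have va: "(\<lambda>k. Q1 (v k)) \<longlonglongrightarrow> a"
    using tendsto_diff[OF tendsto_diff[OF sub(1) tendsto_const[of "Q1 \<phi>"]] s1] by (simp add: a_def)
  have vb: "(\<lambda>k. Q2 (v k)) \<longlonglongrightarrow> b"
    using tendsto_diff[OF tendsto_diff[OF sub(2) tendsto_const[of "Q2 \<phi>"]] s2] by (simp add: b_def)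
  have ve: "(\<lambda>k. total_energy (v k)) \<longlonglongrightarrow> e"
    using tendsto_diff[OF tendsto_diff[OF sub(3) tendsto_const[of "total_energy \<phi>"]] s3] by (simp add: e_def)
  have Qn: "0 \<le> Q1 u" "0 \<le> Q2 u" for u by (simp_all add: Q_eq)
  have ab: "0 \<le> a" "0 \<le> b" using LIMSEQ_le_const[OF va] LIMSEQ_le_const[OF vb] Qn by blast+
  have ab0: "a = 0 \<and> b = 0"
  proof (rule ccontr)
    assume nz: "\<not> (a = 0 \<and> b = 0)"
    obtain i where i: "\<phi> $ i \<noteq> (\<lambda>x. 0)" using \<phi>(2) by blast
    show False
    proof (cases "\<forall>\<eta>>0. \<forall>\<^sub>F n in sequentially. - \<eta> \<le> total_energy (v n)")
      \<comment> \<open>The remainder then has limiting energy \<open>e \<ge> 0\<close>, and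
        replacing it by a vector of the same masses and negative energy goes below the
        infimum.\<close>
      case True
      have "- \<eta> \<le> e" if "\<eta> > 0" for \<eta> using tendsto_lowerbound[OF ve] True that by simp
      hence e0: "0 \<le> e" by (metis add.inverse_inverse neg_0_less_iff_less neg_less_iff_less not_le dense)
      obtain \<psi> where \<psi>: "\<psi> \<in> H1C_vec" "Q1 \<psi> = a" "Q2 \<psi> = b" "total_energy \<psi> < 0" using negative_energy[OF ab] nz by blast
      obtain j where j: "\<psi> $ j \<noteq> (\<lambda>x. 0)" using Q_zero_or[OF \<psi>(1)] \<psi> nz by blast
      obtain h where "h \<in> H1C_vec" "Q1 h = Q1 \<phi> + Q1 \<psi>" "Q2 h = Q2 \<phi> + Q2 \<psi>" "total_energy h < total_energy \<phi> + total_energy \<psi>"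
        using strict_subadditive[OF \<phi>(1) \<psi>(1) i j] by blast
      hence "?J < total_energy \<phi> + total_energy \<psi>" using J_le[of h] \<psi> by (simp add: a_def b_def)
      thus False using \<psi>(4) e0 unfolding e_def by linarith
    next
      \<comment> \<open>Merging the two bumps gains strictly, and the rest \<open>w k\<close> is
        joined to the result whatever it looks like. The constraints are then met only in the limit,
        hence \<open>J_approx\<close>.\<close>
      case False
      obtain z q \<psi> where so2: "splits_off v (4 * K) z q \<psi>"
        using bump_extraction[of v "4 * K", OF V(1) V(2) V(3) False] by blast
      define w where "w k = vdiff (translate (z k) (v (q k))) \<psi>" for k
      note D' = splits_offD[OF so2, folded w_def]
      note q = D'(1) and \<psi> = D'(2,3) and w = D'(4) and t1 = D'(7) and t2 = D'(8) and t3 = D'(9)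
      have sub2: "(\<lambda>k. Q1 (v (q k))) \<longlonglongrightarrow> a" "(\<lambda>k. Q2 (v (q k))) \<longlonglongrightarrow> b" "(\<lambda>k. total_energy (v (q k))) \<longlonglongrightarrow> e"
        using LIMSEQ_subseq_LIMSEQ[OF va q] LIMSEQ_subseq_LIMSEQ[OF vb q] LIMSEQ_subseq_LIMSEQ[OF ve q] by (simp_all add: o_def)
      have wa: "(\<lambda>k. Q1 (w k)) \<longlonglongrightarrow> a - Q1 \<psi>"
        using tendsto_diff[OF tendsto_diff[OF sub2(1) tendsto_const[of "Q1 \<psi>"]] t1] by simp
      have wb: "(\<lambda>k. Q2 (w k)) \<longlonglongrightarrow> b - Q2 \<psi>"
        using tendsto_diff[OF tendsto_diff[OF sub2(2) tendsto_const[of "Q2 \<psi>"]] t2] by simp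
      have we: "(\<lambda>k. total_energy (w k)) \<longlonglongrightarrow> e - total_energy \<psi>"
        using tendsto_diff[OF tendsto_diff[OF sub2(3) tendsto_const[of "total_energy \<psi>"]] t3] by simp
      obtain j where j: "\<psi> $ j \<noteq> (\<lambda>x. 0)" using \<psi>(2) by blast
      obtain h where h: "h \<in> H1C_vec" "Q1 h = Q1 \<phi> + Q1 \<psi>" "Q2 h = Q2 \<phi> + Q2 \<psi>" "total_energy h < total_energy \<phi> + total_energy \<psi>"
        using strict_subadditive[OF \<phi>(1) \<psi>(1) i j] by blast
      have j1: "join h (w k) \<in> H1C_vec" for k by (rule join_H1C_vec[OF h(1) w])
      have "(\<lambda>k. Q1 h + Q1 (w k)) \<longlonglongrightarrow> Q1 h + (a - Q1 \<psi>)" by (intro tendsto_intros wa)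
      hence j2: "(\<lambda>k. Q1 (join h (w k))) \<longlonglongrightarrow> \<gamma>" by (simp add: Q_join[OF h(1) w] h(2) a_def)
      have "(\<lambda>k. Q2 h + Q2 (w k)) \<longlonglongrightarrow> Q2 h + (b - Q2 \<psi>)" by (intro tendsto_intros wb)
      hence j3: "(\<lambda>k. Q2 (join h (w k))) \<longlonglongrightarrow> \<mu>" by (simp add: Q_join[OF h(1) w] h(3) b_def)
      have j4: "(\<lambda>k. total_energy h + total_energy (w k)) \<longlonglongrightarrow> total_energy h + (e - total_energy \<psi>)" by (intro tendsto_intros we)
      have j5: "total_energy (join h (w k)) \<le> total_energy h + total_energy (w k)" for k by (rule total_energy_join(1)[OF h(1) w])
      have "?J \<le> total_energy h + (e - total_energy \<psi>)" by (rule J_approx[OF pos j1 j2 j3 j4 j5])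
      thus False using h(4) unfolding e_def by linarith
    qed
  qed
  have Q\<phi>: "Q1 \<phi> = \<gamma>" "Q2 \<phi> = \<mu>" using ab0 by (simp_all add: a_def b_def)
  have Nv: "(\<lambda>k. mass (v k $ i)) \<longlonglongrightarrow> 0" for i
  proof (rule Lim_null_comparison)
    have "(\<lambda>k. Q1 (v k) + Q2 (v k)) \<longlonglongrightarrow> a + b" by (intro tendsto_intros va vb)
    thus "(\<lambda>k. Q1 (v k) + Q2 (v k)) \<longlonglongrightarrow> 0" using ab0 by simp
    show "\<forall>\<^sub>F k in sequentially. norm (mass (v k $ i)) \<le> Q1 (v k) + Q2 (v k)"
      using mass_le_Q by (intro always_eventually allI) simp
  qed
  let ?M = "sqrt (4 * (4 * K))"
  have Pv: "(\<lambda>k. potential p (v k $ i)) \<longlonglongrightarrow> 0" for i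
  proof (rule Lim_null_comparison)
    have "(\<lambda>k. ?M powr (p - 1) * mass (v k $ i)) \<longlonglongrightarrow> ?M powr (p - 1) * 0" by (intro tendsto_intros Nv)
    thus "(\<lambda>k. ?M powr (p - 1) * mass (v k $ i)) \<longlonglongrightarrow> 0" by simp
    show "\<forall>\<^sub>F k in sequentially. norm (potential p (v k $ i)) \<le> ?M powr (p - 1) * mass (v k $ i)"
      using potential_bound[OF H1C_vec_D[OF V(1)] p1 H1C_sup4[OF H1C_vec_D[OF V(1)] V(2,3)]] by (intro always_eventually allI) simp
  qed
  have Tv: "(\<lambda>k. Re (coupling (v k $ 1) (v k $ 2) (v k $ 3))) \<longlonglongrightarrow> 0"
  proof (rule Lim_null_comparison)
    have "(\<lambda>k. ?M * (mass (v k $ 1) + mass (v k $ 2))) \<longlonglongrightarrow> ?M * (0 + 0)" by (intro tendsto_intros Nv)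
    thus "(\<lambda>k. ?M * (mass (v k $ 1) + mass (v k $ 2))) \<longlonglongrightarrow> 0" by simp
    show "\<forall>\<^sub>F k in sequentially. norm (Re (coupling (v k $ 1) (v k $ 2) (v k $ 3))) \<le> ?M * (mass (v k $ 1) + mass (v k $ 2))"
    proof (intro always_eventually allI)
      fix k
      have "\<bar>Re (coupling (v k $ 1) (v k $ 2) (v k $ 3))\<bar> \<le> cmod (coupling (v k $ 1) (v k $ 2) (v k $ 3))" by (rule abs_Re_le_cmod)
      also have "\<dots> \<le> abs_coupling (v k $ 1) (v k $ 2) (v k $ 3)" by (intro coupling_le_abs_coupling H1C_vec_D V)
      also have "\<dots> \<le> ?M * (mass (v k $ 1) + mass (v k $ 2))" by (intro abs_coupling_bound H1C_vec_D V H1C_sup4[OF H1C_vec_D[OF V(1)] V(2,3)])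
      finally show "norm (Re (coupling (v k $ 1) (v k $ 2) (v k $ 3))) \<le> ?M * (mass (v k $ 1) + mass (v k $ 2))" by simp
    qed
  qed
  \<comment> \<open>Once mass, potential and coupling of the remainder tend to zero, its energy is
    asymptotically half its Dirichlet energy. The limit \<open>e\<close> is thus nonnegative, and it
    is at most 0 because \<open>\<phi>\<close> is admissible; so \<open>\<phi>\<close> is a
    minimizer and the convergence is strong.\<close>
  let ?D = "\<lambda>k. dirichlet (v k $ 1) + dirichlet (v k $ 2) + dirichlet (v k $ 3)"
  have "(\<lambda>k. 2 * (total_energy (v k) + \<beta> / (p + 1) * (potential p (v k $ 1) + potential p (v k $ 2) + potential p (v k $ 3)) + \<alpha> * Re (coupling (v k $ 1) (v k $ 2) (v k $ 3))))
      \<longlonglongrightarrow> 2 * (e + \<beta> / (p + 1) * (0 + 0 + 0) + \<alpha> * 0)"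
    by (intro tendsto_mult_left tendsto_add ve Pv Tv)
  moreover have "2 * (total_energy (v k) + \<beta> / (p + 1) * (potential p (v k $ 1) + potential p (v k $ 2) + potential p (v k $ 3)) + \<alpha> * Re (coupling (v k $ 1) (v k $ 2) (v k $ 3))) = ?D k" for k
    unfolding total_energy_def part_energy_def distrib_left by argo
  ultimately have Dv: "?D \<longlonglongrightarrow> 2 * e" by simp
  have "?J \<le> total_energy \<phi>" using J_le[OF \<phi>(1)] Q\<phi> by simp
  moreover have "0 \<le> 2 * e" by (rule LIMSEQ_le_const[OF Dv]) simp
  ultimately have e0: "e = 0" "total_energy \<phi> = ?J" unfolding e_def by simp_all
  have "(\<lambda>k. dirichlet (v k $ i)) \<longlonglongrightarrow> 0" for i
  proof (rule Lim_null_comparison)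
    show "?D \<longlonglongrightarrow> 0" using Dv e0(1) by simp
    show "\<forall>\<^sub>F k in sequentially. norm (dirichlet (v k $ i)) \<le> ?D k"
    proof (intro always_eventually allI)
      fix k
      have "i = 1 \<or> i = 2 \<or> i = 3" using exhaust_3 by blast
      thus "norm (dirichlet (v k $ i)) \<le> ?D k" by (elim disjE) simp_all
    qed
  qed
  thus ?thesis using r \<phi>(1) Q\<phi> e0(2) Nv unfolding v_def by blast
qed

end

lemma AE_translate:
  fixes f h :: "real \<Rightarrow> complex"
  assumes "AE x in lborel. f x = h x" "f \<in> borel_measurable borel" "h \<in> borel_measurable borel"
  shows "AE x in lborel. f (x + y) = (h (x + y) :: complex)"
proof -
  have [measurable]: "f \<in> borel_measurable borel" "h \<in> borel_measurable borel" by fact+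
  have "AE x in lborel. f (y + 1 * x) = h (y + 1 * x)"
    by (rule AE_borel_affine[of 1 "\<lambda>x. f x = h x" y]) (use assms in auto)
  thus ?thesis by (simp add: add.commute)
qed

context three_wave begin

theorem minimizing_sequence_compact:
  assumes pos: "\<gamma> > 0" "\<mu> > 0" and u: "minimizing_sequence \<alpha> \<beta> p \<gamma> \<mu> u"
  shows "\<exists>y :: nat \<Rightarrow> real. \<exists>\<phi>\<in>H1_vec. \<exists>r :: nat \<Rightarrow> nat. strict_mono r \<and>
             (\<lambda>k. H1_dist (translate (y (r k)) (u (r k))) \<phi>) \<longlonglongrightarrow> 0"
proof -
  have uH: "u n \<in> H1_vec" for n using u by (simp add: minimizing_sequence_def)
  have "\<exists>v. v \<in> H1C_vec \<and> (\<forall>i. AE x in lborel. (u n $ i) x = (v $ i) x) \<and> total_energy v = total_energy (u n) \<and> Q1 v = Q1 (u n) \<and> Q2 v = Q2 (u n)" for n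
    using H1_vec_rep[OF uH] by blast
  then obtain U where U: "\<And>n. U n \<in> H1C_vec" "\<And>n i. AE x in lborel. (u n $ i) x = (U n $ i) x"
    "\<And>n. total_energy (U n) = total_energy (u n)" "\<And>n. Q1 (U n) = Q1 (u n)" "\<And>n. Q2 (U n) = Q2 (u n)" by metis
  have lim: "(\<lambda>n. Q1 (U n)) \<longlonglongrightarrow> \<gamma>" "(\<lambda>n. Q2 (U n)) \<longlonglongrightarrow> \<mu>" "(\<lambda>n. total_energy (U n)) \<longlonglongrightarrow> Jm \<gamma> \<mu>"
    using u unfolding minimizing_sequence_def energy_eq by (simp_all add: U)
  obtain y r \<phi> where r: "strict_mono (r :: nat \<Rightarrow> nat)" and \<phi>: "\<phi> \<in> H1C_vec"
    and c: "\<And>i. (\<lambda>k. mass (vdiff (translate (y k) (U (r k))) \<phi> $ i)) \<longlonglongrightarrow> 0" "\<And>i. (\<lambda>k. dirichlet (vdiff (translate (y k) (U (r k))) \<phi> $ i)) \<longlonglongrightarrow> 0"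
    using compactness[OF pos U(1) lim] by blast
  \<comment> \<open>The translations in the theorem are indexed by the full sequence, so
    \<open>y\<close> is spread along the range of \<open>r\<close>; elsewhere the values are
    irrelevant.\<close>
  define Y where "Y n = y (inv r n)" for n
  have Yr: "Y (r k) = y k" for k using strict_mono_imp_inj_on[OF r] by (simp add: Y_def inv_f_f)
  have um: "u n $ i \<in> borel_measurable borel" for n i using uH L2_measurable by (auto simp: H1_vec_def H1_def)
  have Um: "U n $ i \<in> borel_measurable borel" for n i using H1C_measurable[OF H1C_vec_D[OF U(1)]] .
  have \<phi>m: "\<phi> $ i \<in> borel_measurable borel" for i using H1C_measurable[OF H1C_vec_D[OF \<phi>]] .
  have eq: "H1_dist (translate (Y (r k)) (u (r k))) \<phi> =
      sqrt (\<Sum>i\<in>UNIV. mass (vdiff (translate (y k) (U (r k))) \<phi> $ i) + dirichlet (vdiff (translate (y k) (U (r k))) \<phi> $ i))" for k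
  proof -
    have m: "(\<lambda>x. (u (r k) $ i) (x + y k) - (\<phi> $ i) x) \<in> borel_measurable borel" "(\<lambda>x. (U (r k) $ i) (x + y k) - (\<phi> $ i) x) \<in> borel_measurable borel" for i
      using um[of "r k" i] Um[of "r k" i] \<phi>m[of i] by measurable
    have ae: "AE x in lborel. (u (r k) $ i) (x + y k) - (\<phi> $ i) x = (U (r k) $ i) (x + y k) - (\<phi> $ i) x" for i
      using AE_translate[OF U(2) um Um, of "r k" i "y k"] by eventually_elim simp
    show ?thesis
      unfolding H1_dist_def L2_norm_sq Yr translate_nth dirichlet_def vdiff_nth
      using mass_cong_AE[OF ae m] weak_deriv_cong_AE[OF ae m] by simp
  qed
  have "(\<lambda>k. sqrt (\<Sum>i\<in>UNIV. mass (vdiff (translate (y k) (U (r k))) \<phi> $ i) + dirichlet (vdiff (translate (y k) (U (r k))) \<phi> $ i))) \<longlonglongrightarrow> sqrt (\<Sum>i\<in>(UNIV :: 3 set). 0 + 0)"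
    by (intro tendsto_real_sqrt tendsto_sum tendsto_add c)
  hence "(\<lambda>k. H1_dist (translate (Y (r k)) (u (r k))) \<phi>) \<longlonglongrightarrow> 0" unfolding eq by simp
  thus ?thesis using r H1C_vec_H1_vec[OF \<phi>] by blast
qed

theorem minimizer_exists:
  assumes pos: "\<gamma> > 0" "\<mu> > 0"
  shows "minimizers \<alpha> \<beta> p \<gamma> \<mu> \<noteq> {}"
proof -
  have "\<exists>u\<in>H1C_vec. Q1 u = \<gamma> \<and> Q2 u = \<mu> \<and> total_energy u < Jm \<gamma> \<mu> + inverse (real (Suc n))" for n
    by (rule J_approach[OF pos]) simp
  then obtain U where U: "\<And>n. U n \<in> H1C_vec" "\<And>n. Q1 (U n) = \<gamma>" "\<And>n. Q2 (U n) = \<mu>" "\<And>n. total_energy (U n) < Jm \<gamma> \<mu> + inverse (real (Suc n))"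
    by metis
  have J: "Jm \<gamma> \<mu> \<le> total_energy (U n)" for n using J_le[OF U(1)] U(2,3) by metis
  have "(\<lambda>n. total_energy (U n) - Jm \<gamma> \<mu>) \<longlonglongrightarrow> 0"
  proof (rule Lim_null_comparison[OF _ LIMSEQ_inverse_real_of_nat], intro always_eventually allI)
    fix n show "norm (total_energy (U n) - Jm \<gamma> \<mu>) \<le> inverse (real (Suc n))" using J[of n] U(4)[of n] by simp
  qed
  hence lim: "(\<lambda>n. total_energy (U n)) \<longlonglongrightarrow> Jm \<gamma> \<mu>" by (simp add: LIM_zero_iff)
  have q: "(\<lambda>n. Q1 (U n)) \<longlonglongrightarrow> \<gamma>" "(\<lambda>n. Q2 (U n)) \<longlonglongrightarrow> \<mu>" by (simp_all add: U)
  obtain \<phi> where "\<phi> \<in> H1C_vec" "Q1 \<phi> = \<gamma>" "Q2 \<phi> = \<mu>" "total_energy \<phi> = Jm \<gamma> \<mu>" using compactness[OF pos U(1) q lim] by blast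
  thus ?thesis using H1C_vec_H1_vec unfolding minimizers_def energy_eq by blast
qed

end

section \<open>Phases and positivity\<close>

lemma cell_hi_le: "cell_hi n x \<le> x + 1"
proof -
  have "1 / 2 ^ n \<le> (1::real)" by simp
  thus ?thesis using cell_lo_le(1)[of n x] cell_lo_le(4)[of n x] by linarith
qed

lemma cell_lo_ge: "x - 1 \<le> cell_lo n x"
  using cell_hi_le[of n "x - 1"] cell_lo_le(2)[where x = x and n = n] cell_lo_le(4)[of n x] by (smt (verit) divide_le_eq_1 one_le_power)

text \<open>The law of cosines separates the radial from the angular part of a distance; the angular
  part is what passing to moduli discards.\<close>

lemma dist_polar:
  assumes "a \<noteq> 0" "b \<noteq> (0::complex)"
  shows "(cmod (a - b))\<^sup>2 = (cmod a - cmod b)\<^sup>2 + cmod a * cmod b * (cmod (sgn a - sgn b))\<^sup>2"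
proof -
  have p: "(cmod (x - y))\<^sup>2 = (cmod x)\<^sup>2 + (cmod y)\<^sup>2 - 2 * Re (x * cnj y)" for x y
    by (simp add: cmod_power2 power2_diff algebra_simps)
  have "sgn a * cnj (sgn b) = (a * cnj b) /\<^sub>R (cmod a * cmod b)" by (simp add: sgn_div_norm scaleR_conv_of_real field_simps)
  hence "Re (sgn a * cnj (sgn b)) = Re (a * cnj b) / (cmod a * cmod b)" by (simp add: divide_inverse mult.commute)
  thus ?thesis unfolding p using assms by (simp add: norm_sgn power2_diff field_simps)
qed

text \<open>The Dirichlet energy lost by taking moduli controls the variation of
  \<open>sgn (f x)\<close> wherever \<open>cmod (f x)\<close> is bounded below by a positive number,
  hence on every bounded interval. Equal energies leave no variation.\<close>

lemma constant_phase:
  assumes f: "f \<in> H1C" "\<And>x. f x \<noteq> 0" and eq: "dirichlet (join1 f (\<lambda>x. 0)) = dirichlet f"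
  shows "\<exists>\<theta>::real. \<forall>x. f x = exp (\<i> * complex_of_real \<theta>) * complex_of_real (cmod (f x))"
proof -
  let ?h = "join1 f (\<lambda>x. 0)"
  have h: "?h \<in> H1C" by (rule join1_H1C(1)[OF f(1) H1C_zero(1)])
  have hx: "?h x = complex_of_real (cmod (f x))" for x by (simp add: join1_def)
  define \<omega> where "\<omega> x = sgn (f x)" for x
  have cf: "continuous_on UNIV f" by (rule H1C_continuous[OF f(1)])
  have c\<omega>: "continuous_on UNIV \<omega>" unfolding \<omega>_def sgn_div_norm using cf f(2) by (intro continuous_intros) auto
  have w1: "cmod (\<omega> x) = 1" for x using f(2) by (simp add: \<omega>_def norm_sgn)
  have const: "\<omega> x = \<omega> y" if xy: "x < y" for x y
  proof (rule ccontr)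
    assume ne: "\<omega> x \<noteq> \<omega> y"
    \<comment> \<open>Widened by 1 on either side, because the dyadic cells that meet the interval
      have length at most 1.\<close>
    have "\<exists>t\<in>{x-1..y+1}. \<forall>s\<in>{x-1..y+1}. cmod (f t) \<le> cmod (f s)"
      by (rule continuous_attains_inf) (use xy in \<open>auto intro!: continuous_on_norm continuous_on_subset[OF cf]\<close>)
    then obtain t0 where t0: "\<And>s. s \<in> {x-1..y+1} \<Longrightarrow> cmod (f t0) \<le> cmod (f s)" by blast
    define m where "m = cmod (f t0)"
    have m: "m > 0" using f(2) by (simp add: m_def)
    have bound: "m\<^sup>2 * (cmod (\<omega> (cell_lo n y) - \<omega> (cell_lo n x)))\<^sup>2 / (y - x + 1) \<le> mass (dyadic_diff n f) - mass (dyadic_diff n ?h)" for n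
    proof -
      let ?I = "{cell_lo n x..cell_lo n y}"
      \<comment> \<open>The difference quotient of the phase is cut off to \<open>?I\<close>: there
        \<open>cmod f\<close> is at least \<open>m\<close> at the cell ends and the cut-off is
        square integrable. Elsewhere the inequality for moduli alone suffices.\<close>
      let ?k = "\<lambda>t. indicator ?I t *\<^sub>R dyadic_diff n \<omega> t"
      note df = dyadic_diff_L2(1)[OF H1C_H1_pair[OF f(1)], of n] and dh = dyadic_diff_L2(1)[OF H1C_H1_pair[OF h], of n]
      have lm: "cell_lo n x \<le> cell_lo n y" using xy by (intro cell_lo_mono) simp
      have dm [measurable]: "dyadic_diff n \<omega> \<in> borel_measurable borel"
        by (rule dyadic_diff_measurable[OF borel_measurable_continuous_onI[OF c\<omega>]])
      have db: "cmod (dyadic_diff n \<omega> t) \<le> 2 ^ n * 2" for t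
      proof -
        have "cmod (\<omega> (cell_hi n t) - \<omega> (cell_lo n t)) \<le> 2" using norm_triangle_ineq4[of "\<omega> (cell_hi n t)" "\<omega> (cell_lo n t)"] w1 by simp
        thus ?thesis by (simp add: dyadic_diff_def norm_mult norm_power)
      qed
      have k2: "(cmod (indicat_real {a..b} t *\<^sub>R dyadic_diff n \<omega> t))\<^sup>2 \<le> (2 ^ n * 2)\<^sup>2 * indicator {a..b} t" for a b t
        using power_mono[OF db[of t], of 2] by (simp add: indicator_def)
      have kL: "(\<lambda>t. indicat_real {a..b} t *\<^sub>R dyadic_diff n \<omega> t) \<in> L2" for a b
        by (rule L2_bound[OF _ _ k2]) (auto simp: emeasure_lborel_Icc_eq)
      have li: "loc_int (dyadic_diff n \<omega>)"
        unfolding loc_int_def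
      proof (intro conjI allI dm)
        fix a b
        have "(\<lambda>t. indicat_real {a..b} t *\<^sub>R (indicat_real {a..b} t *\<^sub>R dyadic_diff n \<omega> t)) = (\<lambda>t. indicat_real {a..b} t *\<^sub>R dyadic_diff n \<omega> t)"
          by (auto simp: indicator_def)
        thus "set_integrable lborel {a..b} (dyadic_diff n \<omega>)"
          using loc_intD(2)[OF L2_loc_int[OF kL[of a b]], of a b] unfolding set_integrable_def by simp
      qed
      have pw: "(cmod (dyadic_diff n ?h t))\<^sup>2 + m\<^sup>2 * (cmod (?k t))\<^sup>2 \<le> (cmod (dyadic_diff n f t))\<^sup>2" for t
      proof (cases "t \<in> ?I")
        case False
        thus ?thesis using dyadic_diff_join1[of n f "\<lambda>x. 0" t] by (simp add: dyadic_diff_def)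
      next
        case True
        have t: "x - 1 \<le> cell_lo n t" "cell_lo n t \<le> y + 1" "x - 1 \<le> cell_hi n t" "cell_hi n t \<le> y + 1"
        proof -
          have "cell_lo n x \<le> t" "t \<le> cell_lo n y" using True by auto
          have "cell_lo n (cell_lo n x) = cell_lo n x" by (simp add: cell_lo_def)
          hence "cell_lo n x \<le> cell_lo n t" using cell_lo_mono[OF \<open>cell_lo n x \<le> t\<close>, of n] by simp
          moreover have "t \<le> y" using \<open>t \<le> cell_lo n y\<close> cell_lo_le(1)[of n y] by linarith
          ultimately show "x - 1 \<le> cell_lo n t" "cell_lo n t \<le> y + 1" "x - 1 \<le> cell_hi n t" "cell_hi n t \<le> y + 1"
            using cell_lo_ge[of x n] cell_lo_le(1)[of n t] cell_lo_le(3)[of n t] cell_hi_le[of n t] by linarith+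
        qed
        have "m * m \<le> cmod (f (cell_hi n t)) * cmod (f (cell_lo n t))"
          using t0[of "cell_hi n t"] t0[of "cell_lo n t"] t m unfolding m_def by (intro mult_mono) auto
        hence "m\<^sup>2 * (cmod (\<omega> (cell_hi n t) - \<omega> (cell_lo n t)))\<^sup>2 \<le> cmod (f (cell_hi n t)) * cmod (f (cell_lo n t)) * (cmod (sgn (f (cell_hi n t)) - sgn (f (cell_lo n t))))\<^sup>2"
          unfolding \<omega>_def power2_eq_square[of m] by (intro mult_right_mono) auto
        hence "(cmod (f (cell_hi n t)) - cmod (f (cell_lo n t)))\<^sup>2 + m\<^sup>2 * (cmod (\<omega> (cell_hi n t) - \<omega> (cell_lo n t)))\<^sup>2 \<le> (cmod (f (cell_hi n t) - f (cell_lo n t)))\<^sup>2"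
          using dist_polar[OF f(2) f(2), of "cell_hi n t" "cell_lo n t"] by linarith
        hence "(2^n)\<^sup>2 * ((cmod (f (cell_hi n t)) - cmod (f (cell_lo n t)))\<^sup>2 + m\<^sup>2 * (cmod (\<omega> (cell_hi n t) - \<omega> (cell_lo n t)))\<^sup>2) \<le> (2^n)\<^sup>2 * (cmod (f (cell_hi n t) - f (cell_lo n t)))\<^sup>2"
          by (intro mult_left_mono) auto
        moreover have "cmod (?h (cell_hi n t) - ?h (cell_lo n t)) = \<bar>cmod (f (cell_hi n t)) - cmod (f (cell_lo n t))\<bar>"
          unfolding hx by (simp add: norm_of_real flip: of_real_diff)
        ultimately show ?thesis using True
          by (simp add: dyadic_diff_def norm_mult norm_power power_mult_distrib distrib_left mult.left_commute)
      qed
      have "mass (dyadic_diff n ?h) + m\<^sup>2 * mass ?k = (LINT t|lborel. (cmod (dyadic_diff n ?h t))\<^sup>2 + m\<^sup>2 * (cmod (?k t))\<^sup>2)"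
        unfolding mass_def using L2_integrable[OF dh] L2_integrable[OF kL[of "cell_lo n x" "cell_lo n y"]] by simp
      also have "\<dots> \<le> mass (dyadic_diff n f)"
        unfolding mass_def
        by (rule integral_mono[OF _ L2_integrable[OF df] pw])
          (use L2_integrable[OF dh] L2_integrable[OF kL[of "cell_lo n x" "cell_lo n y"]] in auto)
      finally have 1: "m\<^sup>2 * mass ?k \<le> mass (dyadic_diff n f) - mass (dyadic_diff n ?h)" by simp
      have "\<lfloor>2 ^ n * x\<rfloor> \<le> \<lfloor>2 ^ n * y\<rfloor>" using xy by (intro floor_mono) simp
      then obtain j :: nat where j: "\<lfloor>2 ^ n * y\<rfloor> = \<lfloor>2 ^ n * x\<rfloor> + int j" using zle_iff_zadd by blast
      hence "cell_lo n y = (of_int \<lfloor>2 ^ n * x\<rfloor> + real j) / 2 ^ n" by (simp add: cell_lo_def)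
      hence "\<omega> (cell_lo n y) - \<omega> (cell_lo n x) = (LINT t:?I|lborel. dyadic_diff n \<omega> t)"
        using interval_dyadic_diff[OF li, where k = "\<lfloor>2 ^ n * x\<rfloor>" and j = j] by (simp add: cell_lo_def)
      also have "\<dots> = (LINT t:?I|lborel. ?k t)"
        unfolding set_lebesgue_integral_def by (intro Bochner_Integration.integral_cong) (auto simp: indicator_def)
      finally have "(cmod (\<omega> (cell_lo n y) - \<omega> (cell_lo n x)))\<^sup>2 \<le> (cell_lo n y - cell_lo n x) * (LINT t:?I|lborel. (cmod (?k t))\<^sup>2)"
        using interval_bound[OF kL lm, of "cell_lo n x" "cell_lo n y"] by simp
      also have "\<dots> \<le> (y - x + 1) * mass ?k"
      proof (rule mult_mono)
        show "cell_lo n y - cell_lo n x \<le> y - x + 1" using cell_lo_le(1)[of n y] cell_lo_ge[of x n] by linarith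
        show "(LINT t:?I|lborel. (cmod (?k t))\<^sup>2) \<le> mass ?k" by (rule set_integral_le_mass[OF kL]) simp
        show "0 \<le> (LINT t:?I|lborel. (cmod (?k t))\<^sup>2)" by (simp add: set_lebesgue_integral_def)
      qed (use xy in simp)
      finally have "(cmod (\<omega> (cell_lo n y) - \<omega> (cell_lo n x)))\<^sup>2 / (y - x + 1) \<le> mass ?k" using xy by (simp add: divide_le_eq mult.commute)
      hence "m\<^sup>2 * ((cmod (\<omega> (cell_lo n y) - \<omega> (cell_lo n x)))\<^sup>2 / (y - x + 1)) \<le> m\<^sup>2 * mass ?k" by (intro mult_left_mono) auto
      thus ?thesis using 1 by simp
    qed
    have l1: "(\<lambda>n. mass (dyadic_diff n f) - mass (dyadic_diff n ?h)) \<longlonglongrightarrow> dirichlet f - dirichlet ?h"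
      unfolding dirichlet_def by (intro tendsto_diff mass_dyadic_diff_tendsto H1C_H1_pair f h)
    have lw: "(\<lambda>n. \<omega> (cell_lo n z)) \<longlonglongrightarrow> \<omega> z" for z
      by (rule continuous_on_tendsto_compose[OF c\<omega> cell_lo_tendsto]) auto
    have l2: "(\<lambda>n. m\<^sup>2 * (cmod (\<omega> (cell_lo n y) - \<omega> (cell_lo n x)))\<^sup>2 / (y - x + 1)) \<longlonglongrightarrow> m\<^sup>2 * (cmod (\<omega> y - \<omega> x))\<^sup>2 / (y - x + 1)"
      by (intro tendsto_intros lw) (use xy in simp)
    have "m\<^sup>2 * (cmod (\<omega> y - \<omega> x))\<^sup>2 / (y - x + 1) \<le> dirichlet f - dirichlet ?h"
      by (rule LIMSEQ_le[OF l2 l1]) (use bound in blast)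
    moreover have "m\<^sup>2 * (cmod (\<omega> y - \<omega> x))\<^sup>2 / (y - x + 1) > 0" using m ne xy by simp
    ultimately show False using eq by simp
  qed
  have const': "\<omega> x = \<omega> 0" for x
  proof (cases rule: linorder_cases[of x 0])
    case less thus ?thesis by (rule const)
  next
    case greater thus ?thesis by (rule const[symmetric])
  qed simp
  obtain \<theta> where \<theta>: "\<omega> 0 = exp (\<i> * complex_of_real \<theta>)"
    using complex_norm_eq_1_exp[of "\<omega> 0"] w1[of 0] by metis
  have "f x = exp (\<i> * complex_of_real \<theta>) * complex_of_real (cmod (f x))" for x
  proof -
    have "f x = sgn (f x) * complex_of_real (cmod (f x))" using f(2)[of x] by (simp add: sgn_div_norm scaleR_conv_of_real)
    thus ?thesis using const'[of x] \<theta> by (simp add: \<omega>_def)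
  qed
  thus ?thesis by blast
qed

text \<open>\<open>a1\<close> is the last point before \<open>x0\<close> at which \<open>F\<close>
  meets \<open>l\<close>, which exists by compactness; a later point with \<open>F\<close> above
  \<open>l\<close> would produce a still later crossing by the intermediate value theorem.\<close>

lemma chord_crossing:
  fixes F l :: "real \<Rightarrow> real"
  assumes c: "continuous_on UNIV F" "continuous_on UNIV l" and ab: "a \<le> x0" "F a = l a" "F x0 < l x0"
  shows "\<exists>a1. a \<le> a1 \<and> a1 < x0 \<and> F a1 = l a1 \<and> (\<forall>t. a1 \<le> t \<longrightarrow> t \<le> x0 \<longrightarrow> F t \<le> l t)"
proof -
  let ?S = "{a..x0} \<inter> {t. F t = l t}"
  have "compact ?S" by (intro compact_Int_closed closed_Collect_eq c) auto
  moreover have "a \<in> ?S" using ab by auto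
  ultimately obtain a1 where a1: "a1 \<in> ?S" "\<And>t. t \<in> ?S \<Longrightarrow> t \<le> a1"
    using compact_attains_sup[of ?S] by blast
  have "a1 \<noteq> x0" using a1(1) ab by auto
  hence lt: "a1 < x0" using a1(1) by auto
  have "F t \<le> l t" if t: "a1 \<le> t" "t \<le> x0" for t
  proof (rule ccontr)
    assume n: "\<not> F t \<le> l t"
    have cc: "continuous_on {t..x0} (\<lambda>z. F z - l z)"
      using continuous_on_subset[OF c(1)] continuous_on_subset[OF c(2)] by (intro continuous_intros) auto
    obtain z where z: "t \<le> z" "z \<le> x0" "F z - l z = 0"
      using IVT2'[of "\<lambda>z. F z - l z" x0 0 t, OF _ _ t(2) cc] n ab by auto
    hence "z \<le> a1" using a1(1) t by (intro a1(2)) auto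
    hence "t = a1" using z t by simp
    thus False using n a1(1) by auto
  qed
  thus ?thesis using a1(1) lt by auto
qed

text \<open>The modified function is \<open>f\<close> plus a correction that vanishes at both ends
  of the interval; extended by zero, the correction has as weak derivative the cut-off of its
  derivative inside.\<close>

lemma glue_H1C:
  assumes f: "f \<in> H1C" and ab: "a1 \<le> b1" and l: "\<And>t. l t = L + s * (t - x0)"
    and ends: "f a1 = complex_of_real (l a1)" "f b1 = complex_of_real (l b1)"
  defines "k \<equiv> \<lambda>t. if t \<in> {a1..b1} then complex_of_real (l t) else f t"
  shows "k \<in> H1C" "dirichlet f - dirichlet k = (LINT t:{a1..b1}|lborel. (cmod (weak_deriv f t))\<^sup>2) - s\<^sup>2 * (b1 - a1)"
proof -
  let ?g = "weak_deriv f" and ?I = "{a1..b1}"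
  note Wf = H1C_H1_pair[OF f]
  define G where "G t = complex_of_real (l t) - f t" for t
  define h where "h t = complex_of_real s - ?g t" for t
  have cG: "continuous_on UNIV G" unfolding G_def l using H1C_continuous[OF f] by (intro continuous_intros)
  have Gh: "G y - G x = (LINT t:{x..y}|lborel. h t)" if "x \<le> y" for x y
  proof -
    have "(LINT t:{x..y}|lborel. h t) = (LINT t:{x..y}|lborel. complex_of_real s) - (LINT t:{x..y}|lborel. ?g t)"
      unfolding h_def
      by (rule set_integral_diff(2)[OF loc_intD(2)[OF loc_int_continuous[OF continuous_on_const]] loc_intD(2)[OF L2_loc_int[OF H1_pair_L2(2)[OF Wf]]]])
    also have "(LINT t:{x..y}|lborel. complex_of_real s) = complex_of_real (s * (y - x))"
      using that by (simp add: set_lebesgue_integral_def scaleR_conv_of_real)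
    also have "(LINT t:{x..y}|lborel. ?g t) = f y - f x" using H1_pair_diff_eq[OF Wf that] by simp
    finally show ?thesis by (simp add: G_def l algebra_simps)
  qed
  \<comment> \<open>Clamping to the interval: since \<open>G\<close> vanishes at both ends,
    \<open>G\<close> after the clamp is its extension by zero, and increments of the extension are
    again increments of \<open>G\<close>.\<close>
  define cl where "cl z = max a1 (min z b1)" for z
  define \<eta> where "\<eta> z = G (cl z)" for z
  have G0: "G a1 = 0" "G b1 = 0" using ends by (simp_all add: G_def)
  have \<eta>: "\<eta> z = indicator ?I z *\<^sub>R G z" for z
    using G0 ab by (auto simp: \<eta>_def cl_def indicator_def max_def min_def)
  have H1_pair\<eta>: "H1_pair \<eta> (\<lambda>t. indicator ?I t *\<^sub>R h t)"
    unfolding H1_pair_def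
  proof (intro conjI allI impI)
    have [measurable]: "G \<in> borel_measurable borel" by (rule borel_measurable_continuous_onI[OF cG])
    show "\<eta> \<in> L2"
    proof (rule L2_bound)
      show "\<eta> \<in> borel_measurable borel" unfolding \<eta>[abs_def] by measurable
      have "integrable lborel (\<lambda>z. indicat_real ?I z *\<^sub>R (cmod (G z))\<^sup>2)"
        by (intro borel_integrable_compact continuous_intros continuous_on_subset[OF cG]) auto
      thus "integrable lborel (\<lambda>z. indicat_real ?I z *\<^sub>R (cmod (G z))\<^sup>2)" .
      show "(cmod (\<eta> z))\<^sup>2 \<le> indicat_real ?I z *\<^sub>R (cmod (G z))\<^sup>2" for z by (simp add: \<eta> indicator_def)
    qed
    have "(\<lambda>t. complex_of_real s * complex_of_real (indicator ?I t) - indicator ?I t *\<^sub>R ?g t) \<in> L2"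
      by (intro L2_diff L2_scale indicator_L2 L2_indicator H1_pair_L2(2)[OF Wf]) auto
    thus "(\<lambda>t. indicator ?I t *\<^sub>R h t) \<in> L2"
      by (rule back_subst[of "\<lambda>f. f \<in> L2"]) (auto simp: h_def indicator_def)
    fix x y :: real assume xy: "x \<le> y"
    have e: "(LINT t:{x..y}|lborel. indicat_real ?I t *\<^sub>R h t) = (LINT t:{max x a1..min y b1}|lborel. h t)"
      unfolding set_lebesgue_integral_def by (intro Bochner_Integration.integral_cong) (auto simp: indicator_def)
    show "\<eta> y - \<eta> x = (LINT t:{x..y}|lborel. indicat_real ?I t *\<^sub>R h t)"
    proof (cases "max x a1 \<le> min y b1")
      case True
      hence "cl y = min y b1" "cl x = max x a1" using ab by (auto simp: cl_def max_def min_def split: if_splits)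
      thus ?thesis unfolding e Gh[OF True, symmetric] \<eta>_def by simp
    next
      case False
      hence "cl y = cl x" using xy ab by (auto simp: cl_def max_def min_def split: if_splits)
      moreover have "{max x a1..min y b1} = {}" using False by auto
      ultimately show ?thesis unfolding e \<eta>_def by (simp add: set_lebesgue_integral_def)
    qed
  qed
  have keq: "k = (\<lambda>x. f x + \<eta> x)" by (auto simp: k_def \<eta> G_def indicator_def)
  have Wk: "H1_pair k (\<lambda>t. ?g t + indicator ?I t *\<^sub>R h t)" unfolding keq by (rule H1_pair_add[OF Wf H1_pair\<eta>])
  show "k \<in> H1C" by (rule H1_pair_H1C(1)[OF Wk])
  have Dk: "dirichlet k = mass (\<lambda>t. ?g t + indicator ?I t *\<^sub>R h t)" by (rule H1_pair_H1C(2)[OF Wk])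
  have ii: "integrable lborel (\<lambda>t. indicat_real ?I t *\<^sub>R (cmod (?g t))\<^sup>2)"
    by (rule integrable_mult_indicator[OF _ L2_integrable[OF H1_pair_L2(2)[OF Wf]]]) simp
  have i2: "integrable lborel (\<lambda>t. s\<^sup>2 * indicat_real ?I t)" by (simp add: emeasure_lborel_Icc_eq)
  have "dirichlet f - dirichlet k = (LINT t|lborel. (cmod (?g t))\<^sup>2 - (cmod (?g t + indicator ?I t *\<^sub>R h t))\<^sup>2)"
    unfolding Dk unfolding dirichlet_def mass_def
    by (rule Bochner_Integration.integral_diff[OF L2_integrable[OF H1_pair_L2(2)[OF Wf]] L2_integrable[OF H1_pair_L2(2)[OF Wk]], symmetric])
  also have "\<dots> = (LINT t|lborel. indicat_real ?I t *\<^sub>R (cmod (?g t))\<^sup>2 - s\<^sup>2 * indicat_real ?I t)"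
    by (intro Bochner_Integration.integral_cong) (auto simp: indicator_def h_def)
  also have "\<dots> = (LINT t:?I|lborel. (cmod (?g t))\<^sup>2) - s\<^sup>2 * (b1 - a1)"
    unfolding set_lebesgue_integral_def Bochner_Integration.integral_diff[OF ii i2] using ab by simp
  finally show "dirichlet f - dirichlet k = (LINT t:?I|lborel. (cmod (?g t))\<^sup>2) - s\<^sup>2 * (b1 - a1)" .
qed

text \<open>The function \<open>k\<close> follows the chord of \<open>f\<close> over \<open>[x0 - d, x0 + d]\<close>, of height \<open>L\<close> at \<open>x0\<close>, on the largest
  interval around \<open>x0\<close> where \<open>f\<close> lies below it. The mass added is of order \<open>d L\<^sup>2\<close>, the Dirichlet energy
  gained of order \<open>L\<^sup>2 / d\<close>.\<close>
lemma chord: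
  assumes f: "f \<in> H1C" "nonneg_fun f" and x0: "f x0 = 0" and d: "d > 0" and nz: "f (x0 - d) \<noteq> 0 \<or> f (x0 + d) \<noteq> 0"
  shows "\<exists>k\<in>H1C. nonneg_fun k \<and> (\<forall>x. cmod (f x) \<le> cmod (k x)) \<and> (\<exists>L>0. mass k - mass f \<le> 8 * d * L\<^sup>2 \<and> 2 * L\<^sup>2 / d \<le> dirichlet f - dirichlet k)"
proof -
  define F where "F t = cmod (f t)" for t
  have fF: "f t = complex_of_real (F t)" for t using f(2) by (simp add: nonneg_fun_def F_def)
  have cF: "continuous_on UNIV F" unfolding F_def using H1C_continuous[OF f(1)] by (intro continuous_intros)
  have F0: "0 \<le> F t" "F x0 = 0" for t using x0 by (simp_all add: F_def)
  \<comment> \<open>\<open>L\<close> is the mean of the two end values and \<open>s\<close> the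
    slope of the chord. End values are nonnegative, so \<open>\<bar>s\<bar> * d \<le> L\<close> and
    the chord lies between 0 and \<open>2 * L\<close>.\<close>
  define L where "L = (F (x0 - d) + F (x0 + d)) / 2"
  define s where "s = (F (x0 + d) - F (x0 - d)) / (2 * d)"
  define l where "l t = L + s * (t - x0)" for t
  have L: "L > 0" using nz F0(1)[of "x0 - d"] F0(1)[of "x0 + d"] unfolding L_def F_def by (auto simp: add_pos_nonneg add_nonneg_pos)
  have sd: "s * d = (F (x0 + d) - F (x0 - d)) / 2" using d by (simp add: s_def)
  have le: "l (x0 - d) = F (x0 - d)" "l (x0 + d) = F (x0 + d)"
  proof -
    have "l (x0 - d) = L - s * d" "l (x0 + d) = L + s * d" by (simp_all add: l_def)
    thus "l (x0 - d) = F (x0 - d)" "l (x0 + d) = F (x0 + d)" unfolding sd L_def by (simp_all add: field_simps)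
  qed
  have lx: "l x0 = L" by (simp add: l_def)
  have cl: "continuous_on UNIV l" unfolding l_def by (intro continuous_intros)
  have sabs: "\<bar>s\<bar> * d \<le> L"
  proof -
    have "\<bar>s\<bar> * d = \<bar>s * d\<bar>" using d by (simp add: abs_mult)
    thus ?thesis unfolding sd L_def using F0(1)[of "x0 - d"] F0(1)[of "x0 + d"] by (simp add: abs_le_iff)
  qed
  have lb: "0 \<le> l t" "l t \<le> 2 * L" if "\<bar>t - x0\<bar> \<le> d" for t
  proof -
    have "\<bar>s * (t - x0)\<bar> \<le> \<bar>s\<bar> * d" unfolding abs_mult using that by (intro mult_left_mono) auto
    hence "\<bar>s * (t - x0)\<bar> \<le> L" using sabs by linarith
    thus "0 \<le> l t" "l t \<le> 2 * L" unfolding l_def abs_le_iff by linarith+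
  qed
  obtain a1 where a1: "x0 - d \<le> a1" "a1 < x0" "F a1 = l a1" "\<And>t. a1 \<le> t \<Longrightarrow> t \<le> x0 \<Longrightarrow> F t \<le> l t"
    using chord_crossing[OF cF cl, of "x0 - d" x0] le F0(2) lx L d by auto
  \<comment> \<open>The crossing to the right of \<open>x0\<close> is found as a crossing to the
    left after reflection at \<open>x0\<close>.\<close>
  have crefl: "continuous_on UNIV (\<lambda>t. F (2 * x0 - t))" "continuous_on UNIV (\<lambda>t. l (2 * x0 - t))"
    by (auto intro!: continuous_on_compose2[OF cF] continuous_on_compose2[OF cl] continuous_intros)
  obtain b2 where b2: "x0 - d \<le> b2" "b2 < x0" "F (2 * x0 - b2) = l (2 * x0 - b2)"
    "\<And>t. b2 \<le> t \<Longrightarrow> t \<le> x0 \<Longrightarrow> F (2 * x0 - t) \<le> l (2 * x0 - t)"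
    using chord_crossing[OF crefl, of "x0 - d" x0] le F0(2) lx L d by auto
  define b1 where "b1 = 2 * x0 - b2"
  have b1: "x0 < b1" "b1 \<le> x0 + d" "F b1 = l b1" using b2 by (auto simp: b1_def)
  have Fl: "F t \<le> l t" if "a1 \<le> t" "t \<le> b1" for t
  proof (cases "t \<le> x0")
    case True thus ?thesis using a1(4) that by blast
  next
    case False
    thus ?thesis using b2(4)[of "2 * x0 - t"] that by (simp add: b1_def)
  qed
  define k where "k t = (if t \<in> {a1..b1} then complex_of_real (l t) else f t)" for t
  have ab: "a1 \<le> b1" using a1 b1 by simp
  have e1: "f a1 = complex_of_real (l a1)" "f b1 = complex_of_real (l b1)" unfolding fF a1(3) b1(3) by simp_all
  note gl = glue_H1C[OF f(1) ab l_def e1, folded k_def]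
  have kabs: "cmod (k t) = (if t \<in> {a1..b1} then l t else F t)" for t
    using lb(1)[of t] a1 b1 by (auto simp: k_def F_def)
  have "nonneg_fun k" unfolding nonneg_fun_def kabs by (auto simp: k_def fF)
  moreover have le': "cmod (f x) \<le> cmod (k x)" for x unfolding kabs using Fl by (auto simp: F_def)
  moreover have "mass k - mass f \<le> 8 * d * L\<^sup>2"
  proof -
    have "mass k - mass f = (LINT t|lborel. (cmod (k t))\<^sup>2 - (cmod (f t))\<^sup>2)"
      unfolding mass_def
      by (rule Bochner_Integration.integral_diff[OF L2_integrable[OF H1C_L2[OF gl(1)]] L2_integrable[OF H1C_L2[OF f(1)]], symmetric])
    also have "\<dots> \<le> (LINT t|lborel. (2 * L)\<^sup>2 * indicator {a1..b1} t)"
    proof (rule integral_mono)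
      show "integrable lborel (\<lambda>t. (cmod (k t))\<^sup>2 - (cmod (f t))\<^sup>2)"
        using L2_integrable[OF H1C_L2[OF gl(1)]] L2_integrable[OF H1C_L2[OF f(1)]] by simp
      show "integrable lborel (\<lambda>t. (2 * L)\<^sup>2 * indicat_real {a1..b1} t)" by (simp add: emeasure_lborel_Icc_eq)
      fix t
      show "(cmod (k t))\<^sup>2 - (cmod (f t))\<^sup>2 \<le> (2 * L)\<^sup>2 * indicat_real {a1..b1} t"
      proof (cases "t \<in> {a1..b1}")
        case True
        hence "\<bar>t - x0\<bar> \<le> d" using a1 b1 by (auto simp: abs_le_iff)
        hence "(l t)\<^sup>2 \<le> (2 * L)\<^sup>2" using lb by (intro power_mono) auto
        moreover have "0 \<le> (cmod (f t))\<^sup>2" by simp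
        ultimately show ?thesis using True unfolding kabs by (simp only: if_True indicator_simps mult_1_right)
      next
        case False
        hence "cmod (k t) = cmod (f t)" by (simp only: kabs if_False F_def)
        thus ?thesis by simp
      qed
    qed
    also have "\<dots> = (2 * L)\<^sup>2 * (b1 - a1)" using ab by simp
    also have "\<dots> \<le> (2 * L)\<^sup>2 * (2 * d)" using a1 b1 by (intro mult_left_mono) auto
    finally show ?thesis by (simp add: power2_eq_square algebra_simps)
  qed
  moreover have "2 * L\<^sup>2 / d \<le> dirichlet f - dirichlet k"
  proof -
    let ?g = "weak_deriv f"
    note Wf = H1C_H1_pair[OF f(1)] and gL = H1_pair_L2(2)[OF H1C_H1_pair[OF f(1)]]
    define p q where "p = x0 - a1" and "q = b1 - x0"
    have pq: "0 < p" "p \<le> d" "0 < q" "q \<le> d" using a1 b1 by (auto simp: p_def q_def)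
    let ?A = "LINT t:{a1..x0}|lborel. (cmod (?g t))\<^sup>2" and ?B = "LINT t:{x0..b1}|lborel. (cmod (?g t))\<^sup>2"
    have si: "integrable lborel (\<lambda>t. indicat_real {u..v} t *\<^sub>R (cmod (?g t))\<^sup>2)" for u v
      by (rule integrable_mult_indicator[OF _ L2_integrable[OF gL]]) simp
    have gm [measurable]: "?g \<in> borel_measurable borel" by (rule L2_measurable[OF gL])
    have sum: "(LINT t:{a1..b1}|lborel. (cmod (?g t))\<^sup>2) = ?A + ?B"
    proof -
      have "?A + ?B = (LINT t|lborel. indicat_real {a1..x0} t *\<^sub>R (cmod (?g t))\<^sup>2 + indicat_real {x0..b1} t *\<^sub>R (cmod (?g t))\<^sup>2)"
        unfolding set_lebesgue_integral_def by (rule Bochner_Integration.integral_add[OF si si, symmetric])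
      also have "\<dots> = (LINT t:{a1..b1}|lborel. (cmod (?g t))\<^sup>2)"
        unfolding set_lebesgue_integral_def
      proof (rule integral_cong_AE)
        show "AE t in lborel. indicat_real {a1..x0} t *\<^sub>R (cmod (?g t))\<^sup>2 + indicat_real {x0..b1} t *\<^sub>R (cmod (?g t))\<^sup>2 = indicat_real {a1..b1} t *\<^sub>R (cmod (?g t))\<^sup>2"
          using AE_lborel_singleton[of x0] by eventually_elim (use a1 b1 in \<open>auto simp: indicator_def\<close>)
      qed measurable
      finally show ?thesis by simp
    qed
    \<comment> \<open>Cauchy-Schwarz on either side of \<open>x0\<close>, where \<open>f\<close>
      goes from 0 to the height of the chord. In the sum the terms \<open>2 * L * s\<close> cancel,
      the terms in \<open>s^2\<close> are the Dirichlet energy of the chord, and the gain is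
      \<open>L^2 / p + L^2 / q\<close> with \<open>p\<close> and \<open>q\<close> at most
      \<open>d\<close>.\<close>
    have "(cmod (f x0 - f a1))\<^sup>2 \<le> p * ?A"
      using interval_bound[OF gL, of a1 x0] H1_pair_diff_eq[OF Wf, of a1 x0] a1 by (simp add: p_def)
    moreover have "(cmod (f x0 - f a1))\<^sup>2 = (L - s * p)\<^sup>2"
    proof -
      have "(cmod (f x0 - f a1))\<^sup>2 = (l a1)\<^sup>2" by (simp add: x0 e1)
      also have "l a1 = L - s * p" by (simp add: l_def p_def algebra_simps)
      finally show ?thesis .
    qed
    ultimately have "(L - s * p)\<^sup>2 / p \<le> ?A" using pq by (simp add: divide_le_eq mult.commute)
    moreover have "(L - s * p)\<^sup>2 / p = L\<^sup>2 / p - 2 * L * s + s\<^sup>2 * p" using pq by (simp add: power2_eq_square field_simps)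
    ultimately have A: "L\<^sup>2 / p - 2 * L * s + s\<^sup>2 * p \<le> ?A" by simp
    have "(cmod (f b1 - f x0))\<^sup>2 \<le> q * ?B"
      using interval_bound[OF gL, of x0 b1] H1_pair_diff_eq[OF Wf, of x0 b1] b1 by (simp add: q_def)
    moreover have "(cmod (f b1 - f x0))\<^sup>2 = (L + s * q)\<^sup>2"
    proof -
      have "(cmod (f b1 - f x0))\<^sup>2 = (l b1)\<^sup>2" by (simp add: x0 e1)
      also have "l b1 = L + s * q" by (simp add: l_def q_def)
      finally show ?thesis .
    qed
    ultimately have "(L + s * q)\<^sup>2 / q \<le> ?B" using pq by (simp add: divide_le_eq mult.commute)
    moreover have "(L + s * q)\<^sup>2 / q = L\<^sup>2 / q + 2 * L * s + s\<^sup>2 * q" using pq by (simp add: power2_eq_square field_simps)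
    ultimately have B: "L\<^sup>2 / q + 2 * L * s + s\<^sup>2 * q \<le> ?B" by simp
    have "L\<^sup>2 / d \<le> L\<^sup>2 / p" "L\<^sup>2 / d \<le> L\<^sup>2 / q" using pq by (auto intro!: divide_left_mono)
    moreover have "s\<^sup>2 * (b1 - a1) = s\<^sup>2 * p + s\<^sup>2 * q" by (simp add: p_def q_def algebra_simps)
    moreover have "2 * L\<^sup>2 / d = L\<^sup>2 / d + L\<^sup>2 / d" by simp
    ultimately show ?thesis unfolding gl(2) sum using A B by linarith
  qed
  ultimately show ?thesis using gl(1) L by blast
qed

section \<open>Minimizers have no zeros, and their phases are related\<close>

context three_wave begin

text \<open>A one-sided substitute for the Euler-Lagrange equation. Enlarging a component lowers
  neither potential nor coupling, so only the loss from rescaling to the old mass counts, and this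
  is of the order of the added mass.\<close>

lemma variational_inequality:
  assumes w: "w \<in> H1C_vec" "\<And>m. nonneg_fun (w $ m)" and i: "w $ i \<noteq> (\<lambda>x. 0)"
    and min: "\<And>h. h \<in> H1C_vec \<Longrightarrow> Q1 h = Q1 w \<Longrightarrow> Q2 h = Q2 w \<Longrightarrow> total_energy w \<le> total_energy h"
  shows "\<exists>C\<ge>0. \<forall>k\<in>H1C. nonneg_fun k \<longrightarrow> (\<forall>x. cmod ((w $ i) x) \<le> cmod (k x)) \<longrightarrow> dirichlet (w $ i) - dirichlet k \<le> C * (mass k - mass (w $ i))"
proof -
  let ?f = "w $ i" and ?T = "abs_coupling (w $ 1) (w $ 2) (w $ 3)"
  have fC: "?f \<in> H1C" by (rule H1C_vec_D[OF w(1)])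
  have Nf: "mass ?f > 0" using mass_zero_iff[OF fC] i mass_nonneg[of ?f] by (metis less_eq_real_def)
  \<comment> \<open>Rescaling loses at most \<open>t * \<beta> / 2\<close> times the potential and
    \<open>t * \<alpha>\<close> times the coupling, with \<open>t\<close> the relative loss of mass.
    Division by the mass converts \<open>t\<close> into \<open>mass k - mass ?f\<close>, and the
    factor 2 undoes the \<open>1 / 2\<close> of the Dirichlet term.\<close>
  define C where "C = 2 * (\<beta> / 2 * potential p ?f + \<alpha> * ?T) / mass ?f"
  have C0: "C \<ge> 0" unfolding C_def using Nf a0 b0 abs_coupling_nonneg by simp
  have "dirichlet ?f - dirichlet k \<le> C * (mass k - mass ?f)" if k: "k \<in> H1C" "nonneg_fun k" "\<And>x. cmod (?f x) \<le> cmod (k x)" for k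
  proof -
    have NN: "mass ?f \<le> mass k" unfolding mass_def
      by (rule integral_mono[OF L2_integrable[OF H1C_L2[OF fC]] L2_integrable[OF H1C_L2[OF k(1)]]]) (use k(3) in \<open>auto intro: power_mono\<close>)
    have PP: "potential p ?f \<le> potential p k" unfolding potential_def
      by (rule integral_mono[OF potential_integrable[OF fC p1] potential_integrable[OF k(1) p1]]) (use k(3) p1 in \<open>auto intro!: powr_mono2\<close>)
    define r where "r = mass ?f / mass k"
    have Nk: "mass k > 0" using NN Nf by linarith
    have r: "0 < r" "r \<le> 1" using NN Nf Nk by (auto simp: r_def)
    \<comment> \<open>The coupling is linear in the rescaled component and keeps the factor
      \<open>c\<close>; for \<open>r \<le> 1\<close> this is at least \<open>r\<close>, so its
      relative loss is at most \<open>1 - r\<close>.\<close>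
    define c where "c = sqrt r"
    have c: "0 < c" "c \<le> 1" "r \<le> c"
    proof -
      show "0 < c" "c \<le> 1" using r by (auto simp: c_def)
      have "r * r \<le> r * 1" using r by (intro mult_left_mono) auto
      thus "r \<le> c" unfolding c_def by (intro real_le_rsqrt) (simp add: power2_eq_square)
    qed
    have c2: "c\<^sup>2 = r" using r by (simp add: c_def)
    define t where "t = 1 - r"
    have t: "0 \<le> t" "t * mass ?f \<le> mass k - mass ?f"
    proof -
      show "0 \<le> t" using r by (simp add: t_def)
      have "t * mass k = mass k - mass ?f" using Nk by (simp add: t_def r_def left_diff_distrib)
      moreover have "t * mass ?f \<le> t * mass k" using NN \<open>0 \<le> t\<close> by (intro mult_left_mono)
      ultimately show "t * mass ?f \<le> mass k - mass ?f" by simp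
    qed
    define ck where "ck = (\<lambda>x. complex_of_real c * k x)"
    have ckC: "ck \<in> H1C" unfolding ck_def by (rule H1C_scale(1)[OF k(1)])
    have ckN: "mass ck = mass ?f" unfolding ck_def mass_scale using c c2 Nk by (simp add: r_def)
    define h where "h = (\<chi> m. if m = i then ck else w $ m)"
    have hm: "h $ m = (if m = i then ck else w $ m)" for m by (simp add: h_def)
    have hC: "h \<in> H1C_vec" using ckC H1C_vec_D[OF w(1)] by (simp add: H1C_vec_def hm)
    have hN: "mass (h $ m) = mass (w $ m)" for m using ckN by (simp add: hm)
    have Q: "Q1 h = Q1 w" "Q2 h = Q2 w" by (simp_all add: Q_eq hN)
    have hn: "nonneg_fun (h $ m)" for m using w(2) nonneg_fun_scale[OF k(2), of c] c by (simp add: hm ck_def)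
    have Eh: "total_energy w \<le> total_energy h" by (rule min[OF hC Q])
    have i3: "i = 1 \<or> i = 2 \<or> i = 3" using exhaust_3 by blast
    have Ssum: "part_energy (h $ 1) + part_energy (h $ 2) + part_energy (h $ 3) = part_energy (w $ 1) + part_energy (w $ 2) + part_energy (w $ 3) - part_energy ?f + part_energy ck"
      using i3 by (elim disjE) (simp_all add: hm)
    have ckb: "c * cmod (?f x) \<le> cmod (ck x)" for x using k(3)[of x] c by (simp add: ck_def norm_mult mult_left_mono)
    have Th: "c * ?T \<le> abs_coupling (h $ 1) (h $ 2) (h $ 3)"
    proof -
      have "c * ?T = (LINT x|lborel. c * (cmod ((w $ 1) x) * cmod ((w $ 2) x) * cmod ((w $ 3) x)))"
        unfolding abs_coupling_def by (rule integral_mult_right_zero[symmetric])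
      also have "\<dots> \<le> abs_coupling (h $ 1) (h $ 2) (h $ 3)"
        unfolding abs_coupling_def
      proof (rule integral_mono)
        show "integrable lborel (\<lambda>x. c * (cmod ((w $ 1) x) * cmod ((w $ 2) x) * cmod ((w $ 3) x)))"
          by (intro integrable_mult_right triple_integrable H1C_vec_D w)
        show "integrable lborel (\<lambda>x. cmod ((h $ 1) x) * cmod ((h $ 2) x) * cmod ((h $ 3) x))"
          by (intro triple_integrable H1C_vec_D hC)
        fix x
        have m: "c * (u * v * z) \<le> u' * v * z" "c * (v * u * z) \<le> v * u' * z" "c * (v * z * u) \<le> v * z * u'"
          if "c * u \<le> u'" "0 \<le> v" "0 \<le> z" for u u' v z :: real
          using mult_right_mono[OF that(1), of "v * z"] that by (simp_all add: mult_ac)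
        show "c * (cmod ((w $ 1) x) * cmod ((w $ 2) x) * cmod ((w $ 3) x)) \<le> cmod ((h $ 1) x) * cmod ((h $ 2) x) * cmod ((h $ 3) x)"
          using i3
        proof (elim disjE)
          assume "i = 1" thus ?thesis using m(1)[OF ckb[of x]] by (simp add: hm)
        next
          assume "i = 2" thus ?thesis using m(2)[OF ckb[of x]] by (simp add: hm)
        next
          assume "i = 3" thus ?thesis using m(3)[OF ckb[of x]] by (simp add: hm)
        qed
      qed
      finally show ?thesis .
    qed
    have Sck: "part_energy ck \<le> 1 / 2 * dirichlet k - \<beta> / (p + 1) * potential p ?f + \<beta> / 2 * t * potential p ?f"
    proof -
      have "1 + (p + 1) / 2 * (r - 1) \<le> r powr ((p + 1) / 2)" using r p1 by (intro Bernoulli_powr) auto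
      moreover have cp: "c powr (p + 1) = r powr ((p + 1) / 2)" using r by (simp add: c_def powr_half_sqrt[symmetric] powr_powr)
      moreover have "(p + 1) / 2 * (r - 1) = - ((p + 1) / 2 * t)" unfolding t_def by (simp only: right_diff_distrib minus_diff_eq)
      ultimately have b: "1 - (p + 1) / 2 * t \<le> c powr (p + 1)" by linarith
      have "(1 - (p + 1) / 2 * t) * potential p ?f \<le> c powr (p + 1) * potential p ?f" by (intro mult_right_mono b) simp
      also have "\<dots> \<le> c powr (p + 1) * potential p k" by (intro mult_left_mono PP) simp
      finally have "\<beta> / (p + 1) * ((1 - (p + 1) / 2 * t) * potential p ?f) \<le> \<beta> / (p + 1) * (c powr (p + 1) * potential p k)"
        using b0 p1 by (intro mult_left_mono) auto
      moreover have "\<beta> / (p + 1) * ((1 - (p + 1) / 2 * t) * potential p ?f) = \<beta> / (p + 1) * potential p ?f - \<beta> / 2 * t * potential p ?f"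
        using p1 by (simp add: field_simps)
      moreover have "c\<^sup>2 * dirichlet k \<le> 1 * dirichlet k" using c2 r by (intro mult_right_mono) auto
      moreover have "part_energy ck = 1 / 2 * (c\<^sup>2 * dirichlet k) - \<beta> / (p + 1) * (c powr (p + 1) * potential p k)"
        using c unfolding part_energy_def ck_def H1C_scale(2)[OF k(1)] potential_scale by simp
      ultimately show ?thesis by linarith
    qed
    have "r * ?T \<le> c * ?T" using c abs_coupling_nonneg by (intro mult_right_mono) auto
    hence "r * ?T \<le> abs_coupling (h $ 1) (h $ 2) (h $ 3)" using Th by (rule order_trans)
    hence aT: "\<alpha> * (r * ?T) \<le> \<alpha> * abs_coupling (h $ 1) (h $ 2) (h $ 3)" using a0 by (intro mult_left_mono) auto
    have rT: "\<alpha> * (r * ?T) = \<alpha> * ?T - t * (\<alpha> * ?T)" by (simp add: t_def algebra_simps)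
    have EW: "total_energy w = part_energy (w $ 1) + part_energy (w $ 2) + part_energy (w $ 3) - \<alpha> * ?T" by (simp add: total_energy_def coupling_nonneg_fun w(2))
    have EH: "total_energy h = part_energy (w $ 1) + part_energy (w $ 2) + part_energy (w $ 3) - part_energy ?f + part_energy ck - \<alpha> * abs_coupling (h $ 1) (h $ 2) (h $ 3)"
      unfolding Ssum[symmetric] by (simp add: total_energy_def coupling_nonneg_fun hn)
    have Sf: "part_energy ?f = 1 / 2 * dirichlet ?f - \<beta> / (p + 1) * potential p ?f" by (simp add: part_energy_def)
    have "part_energy ?f - \<alpha> * ?T \<le> part_energy ck - \<alpha> * abs_coupling (h $ 1) (h $ 2) (h $ 3)" using Eh unfolding EW EH by argo
    hence "1 / 2 * dirichlet ?f - 1 / 2 * dirichlet k \<le> \<beta> / 2 * t * potential p ?f + t * (\<alpha> * ?T)"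
      using Sck aT unfolding rT Sf by argo
    also have "\<dots> = t * mass ?f * (C / 2)" using Nf by (simp add: C_def field_simps)
    also have "\<dots> \<le> (mass k - mass ?f) * (C / 2)" using t(2) C0 by (intro mult_right_mono) auto
    finally have "1 / 2 * (dirichlet ?f - dirichlet k) \<le> 1 / 2 * (C * (mass k - mass ?f))" by (simp add: algebra_simps)
    thus ?thesis by simp
  qed
  thus ?thesis using C0 by blast
qed

text \<open>A chord of half-width \<open>d\<close> around a zero gains \<open>2 * L^2 / d\<close> of
  Dirichlet energy, while the variational inequality allows only \<open>8 * C * d * L^2\<close>. For
  small \<open>d\<close> both ends must be zeros too. The threshold is the same for all zeros, so
  the zero set is open as well as closed.\<close>

lemma minimizer_nonvanishing:
  assumes w: "w \<in> H1C_vec" "\<And>m. nonneg_fun (w $ m)" and i: "w $ i \<noteq> (\<lambda>x. 0)"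
    and min: "\<And>h. h \<in> H1C_vec \<Longrightarrow> Q1 h = Q1 w \<Longrightarrow> Q2 h = Q2 w \<Longrightarrow> total_energy w \<le> total_energy h"
  shows "(w $ i) x \<noteq> 0"
proof
  assume zero: "(w $ i) x = 0"
  let ?f = "w $ i"
  obtain C where C: "C \<ge> 0" "\<And>k. k \<in> H1C \<Longrightarrow> nonneg_fun k \<Longrightarrow> (\<And>x. cmod (?f x) \<le> cmod (k x)) \<Longrightarrow> dirichlet ?f - dirichlet k \<le> C * (mass k - mass ?f)"
    using variational_inequality[OF w i min] by blast
  \<comment> \<open>Gives \<open>4 * C * d0 < 1\<close> and \<open>d0 \<le> 1\<close>, hence
    \<open>4 * C * d^2 < 1\<close> for positive \<open>d < d0\<close>; the summand 1 in the
    denominator covers \<open>C = 0\<close>.\<close>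
  define d0 where "d0 = 1 / (4 * C + 1)"
  have d0: "0 < d0" "d0 \<le> 1" "4 * C * d0 < 1" using C(1) by (auto simp: d0_def)
  have spread: "?f (x0 - d) = 0 \<and> ?f (x0 + d) = 0" if x0: "?f x0 = 0" and d: "0 < d" "d < d0" for x0 d
  proof (rule ccontr)
    assume "\<not> (?f (x0 - d) = 0 \<and> ?f (x0 + d) = 0)"
    then obtain k L where k: "k \<in> H1C" "nonneg_fun k" "\<And>x. cmod (?f x) \<le> cmod (k x)" and L: "L > 0"
      "mass k - mass ?f \<le> 8 * d * L\<^sup>2" "2 * L\<^sup>2 / d \<le> dirichlet ?f - dirichlet k"
      using chord[OF H1C_vec_D[OF w(1)] w(2) x0 d(1)] by blast
    have "2 * L\<^sup>2 / d \<le> C * (8 * d * L\<^sup>2)"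
      using L(3) C(2)[OF k] mult_left_mono[OF L(2) C(1)] by linarith
    hence "2 * L\<^sup>2 \<le> C * (8 * d * L\<^sup>2) * d" using d by (simp add: divide_le_eq)
    hence "2 * L\<^sup>2 * 1 \<le> 2 * L\<^sup>2 * (4 * C * d * d)" by (simp add: algebra_simps)
    hence "1 \<le> 4 * C * d * d" using L(1) by simp
    also have "\<dots> \<le> 4 * C * d0 * 1" using C(1) d d0 by (intro mult_mono) auto
    finally show False using d0 by simp
  qed
  let ?Z = "{x. ?f x = 0}"
  have "closed ?Z" using H1C_continuous[OF H1C_vec_D[OF w(1)], of i] by (intro closed_Collect_eq continuous_intros) auto
  moreover have "open ?Z"
    unfolding open_dist
  proof (intro ballI exI[of _ d0] conjI allI impI d0(1))
    fix x0 y assume x0: "x0 \<in> ?Z" and y: "dist y x0 < d0"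
    show "y \<in> ?Z"
    proof (cases rule: linorder_cases[of y x0])
      case less thus ?thesis using spread[of x0 "x0 - y"] x0 y by (simp add: dist_real_def)
    next
      case greater thus ?thesis using spread[of x0 "y - x0"] x0 y by (simp add: dist_real_def)
    qed (use x0 in simp)
  qed
  ultimately have "?Z = {} \<or> ?Z = UNIV" using clopen[of ?Z] by blast
  thus False using zero i by auto
qed

theorem minimizer_phases:
  assumes u: "u \<in> minimizers \<alpha> \<beta> p \<gamma> \<mu>"
  shows "\<exists>v :: (real \<Rightarrow> complex)^3. (\<forall>i. is_continuous_rep (u $ i) (v $ i)) \<and>
          (\<exists>(\<theta>1 :: real) (\<theta>2 :: real) (\<rho>1 :: real \<Rightarrow> real) (\<rho>2 :: real \<Rightarrow> real) (\<rho>3 :: real \<Rightarrow> real).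
             (\<forall>x. 0 \<le> \<rho>1 x \<and> 0 \<le> \<rho>2 x \<and> 0 \<le> \<rho>3 x) \<and>
             (\<forall>x. (v $ 1) x = exp (\<i> * complex_of_real \<theta>1) * complex_of_real (\<rho>1 x) \<and>
                  (v $ 2) x = exp (\<i> * complex_of_real \<theta>2) * complex_of_real (\<rho>2 x) \<and>
                  (v $ 3) x = exp (\<i> * complex_of_real (\<theta>1 + \<theta>2)) * complex_of_real (\<rho>3 x)))"
proof -
  have uH: "u \<in> H1_vec" "Q1 u = \<gamma>" "Q2 u = \<mu>" "total_energy u = Jm \<gamma> \<mu>" using u by (simp_all add: minimizers_def energy_eq)
  obtain v where v: "v \<in> H1C_vec" "\<And>i. AE x in lborel. (u $ i) x = (v $ i) x" "total_energy v = total_energy u" "Q1 v = Q1 u" "Q2 v = Q2 u"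
    using H1_vec_rep[OF uH(1)] by blast
  define w where "w = (\<chi> m. join1 (v $ m) (\<lambda>x. 0))"
  have wm: "w $ m = join1 (v $ m) (\<lambda>x. 0)" for m by (simp add: w_def)
  have wx: "(w $ m) x = complex_of_real (cmod ((v $ m) x))" for m x by (simp add: wm join1_def)
  have vC: "v $ m \<in> H1C" for m by (rule H1C_vec_D[OF v(1)])
  have wC: "w \<in> H1C_vec" using join1_H1C(1)[OF vC H1C_zero(1)] by (simp add: H1C_vec_def wm)
  have wn: "nonneg_fun (w $ m)" for m unfolding wm by (rule nonneg_fun_join1)
  have wN: "mass (w $ m) = mass (v $ m)" for m unfolding mass_def wx by simp
  have wP: "potential p (w $ m) = potential p (v $ m)" for m unfolding potential_def wx by simp
  have wD: "dirichlet (w $ m) \<le> dirichlet (v $ m)" for m using join1_H1C(2)[OF vC H1C_zero(1), of m] by (simp add: wm H1C_zero)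
  have wT: "abs_coupling (w $ 1) (w $ 2) (w $ 3) = abs_coupling (v $ 1) (v $ 2) (v $ 3)" unfolding abs_coupling_def wx by simp
  have Qw: "Q1 w = \<gamma>" "Q2 w = \<mu>" using v uH by (simp_all add: Q_eq wN)
  have Ev: "total_energy v = Jm \<gamma> \<mu>" using v uH by simp
  have Jw: "Jm \<gamma> \<mu> \<le> total_energy w" using J_le[OF wC] Qw by simp
  have Sw: "part_energy (w $ m) = part_energy (v $ m) - 1 / 2 * (dirichlet (v $ m) - dirichlet (w $ m))" for m unfolding part_energy_def wP by argo
  have aT: "\<alpha> * Re (coupling (v $ 1) (v $ 2) (v $ 3)) \<le> \<alpha> * abs_coupling (v $ 1) (v $ 2) (v $ 3)"
    using Re_coupling_le[OF v(1)] a0 by (intro mult_left_mono) auto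
  have Ew: "total_energy w = part_energy (w $ 1) + part_energy (w $ 2) + part_energy (w $ 3) - \<alpha> * abs_coupling (v $ 1) (v $ 2) (v $ 3)" by (simp add: total_energy_def coupling_nonneg_fun wn wT)
  \<comment> \<open>Passing to moduli keeps the constraints and raises none of the four terms, so
    minimality turns three Dirichlet inequalities and the one for the coupling into
    equalities.\<close>
  have D: "dirichlet (w $ 1) = dirichlet (v $ 1)" "dirichlet (w $ 2) = dirichlet (v $ 2)" "dirichlet (w $ 3) = dirichlet (v $ 3)"
    and T: "\<alpha> * Re (coupling (v $ 1) (v $ 2) (v $ 3)) = \<alpha> * abs_coupling (v $ 1) (v $ 2) (v $ 3)"
    using Jw Ev aT wD[of 1] wD[of 2] wD[of 3] unfolding Ew Sw unfolding total_energy_def by argo+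
  have T': "Re (coupling (v $ 1) (v $ 2) (v $ 3)) = abs_coupling (v $ 1) (v $ 2) (v $ 3)" using T a0 by simp
  have Dm: "dirichlet (join1 (v $ m) (\<lambda>x. 0)) = dirichlet (v $ m)" for m
  proof -
    have "m = 1 \<or> m = 2 \<or> m = 3" using exhaust_3 by blast
    thus ?thesis using D unfolding wm by (elim disjE) simp_all
  qed
  have minw: "total_energy w \<le> total_energy h" if "h \<in> H1C_vec" "Q1 h = Q1 w" "Q2 h = Q2 w" for h
  proof -
    have "total_energy w \<le> Jm \<gamma> \<mu>" using Ev aT wD[of 1] wD[of 2] wD[of 3] unfolding Ew Sw unfolding total_energy_def by argo
    also have "\<dots> \<le> total_energy h" using J_le[OF that(1)] that Qw by simp
    finally show ?thesis .
  qed
  have nz: "(v $ m) x \<noteq> 0" if nn: "v $ m \<noteq> (\<lambda>x. 0)" for m x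
  proof -
    obtain y where "(v $ m) y \<noteq> 0" using nn unfolding fun_eq_iff by blast
    hence "(w $ m) y \<noteq> 0" by (simp add: wx)
    hence "w $ m \<noteq> (\<lambda>x. 0)" by auto
    have "(w $ m) x \<noteq> 0" by (rule minimizer_nonvanishing[OF wC wn \<open>w $ m \<noteq> (\<lambda>x. 0)\<close> minw])
    thus ?thesis by (simp add: wx)
  qed
  have ph: "\<exists>\<theta>::real. \<forall>x. (v $ m) x = exp (\<i> * complex_of_real \<theta>) * complex_of_real (cmod ((v $ m) x))" for m
  proof (cases "v $ m = (\<lambda>x. 0)")
    case False
    show ?thesis by (rule constant_phase[OF vC nz[OF False] Dm])
  qed simp
  then obtain \<theta> :: "3 \<Rightarrow> real" where \<theta>: "\<And>m x. (v $ m) x = exp (\<i> * complex_of_real (\<theta> m)) * complex_of_real (cmod ((v $ m) x))" by metis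
  have rep: "is_continuous_rep (u $ i) (v $ i)" for i
    using v(2) H1C_continuous[OF vC] by (simp add: is_continuous_rep_def)
  have "\<exists>t1 t2. (\<forall>x. (v $ 1) x = exp (\<i> * complex_of_real t1) * complex_of_real (cmod ((v $ 1) x))) \<and>
      (\<forall>x. (v $ 2) x = exp (\<i> * complex_of_real t2) * complex_of_real (cmod ((v $ 2) x))) \<and>
      (\<forall>x. (v $ 3) x = exp (\<i> * complex_of_real (t1 + t2)) * complex_of_real (cmod ((v $ 3) x)))"
  proof -
    \<comment> \<open>The phase of an identically zero component is free and can be chosen to fit
      the relation; only when all three are present does the relation have to come from the
      coupling.\<close>
    consider "v $ 1 = (\<lambda>x. 0)" | "v $ 2 = (\<lambda>x. 0)" | "v $ 3 = (\<lambda>x. 0)"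
      | "v $ 1 \<noteq> (\<lambda>x. 0)" "v $ 2 \<noteq> (\<lambda>x. 0)" "v $ 3 \<noteq> (\<lambda>x. 0)" by blast
    thus ?thesis
    proof cases
      case 1
      show ?thesis by (rule exI[of _ "\<theta> 3 - \<theta> 2"], rule exI[of _ "\<theta> 2"]) (use \<theta>[of 2] \<theta>[of 3] 1 in simp)
    next
      case 2
      show ?thesis by (rule exI[of _ "\<theta> 1"], rule exI[of _ "\<theta> 3 - \<theta> 1"]) (use \<theta>[of 1] \<theta>[of 3] 2 in simp)
    next
      case 3
      show ?thesis by (rule exI[of _ "\<theta> 1"], rule exI[of _ "\<theta> 2"]) (use \<theta>[of 1] \<theta>[of 2] 3 in simp)
    next
      case 4
      have Tpos: "abs_coupling (v $ 1) (v $ 2) (v $ 3) > 0" using nz 4 by (intro abs_coupling_pos[of _ _ _ 0] vC) auto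
      \<comment> \<open>The phase of the integrand of the coupling. It is constant, so equality of
        the coupling with \<open>abs_coupling\<close> forces this unit number to have real part
        1.\<close>
      define z where "z = exp (\<i> * complex_of_real (\<theta> 1)) * exp (\<i> * complex_of_real (\<theta> 2)) * cnj (exp (\<i> * complex_of_real (\<theta> 3)))"
      have nz1: "cmod z = 1" by (simp add: z_def norm_mult)
      have "(v $ 1) x * (v $ 2) x * cnj ((v $ 3) x) = z * complex_of_real (cmod ((v $ 1) x) * cmod ((v $ 2) x) * cmod ((v $ 3) x))" for x
        by (subst \<theta>[of 1 x], subst \<theta>[of 2 x], subst \<theta>[of 3 x]) (simp add: z_def mult_ac)
      hence "coupling (v $ 1) (v $ 2) (v $ 3) = z * complex_of_real (abs_coupling (v $ 1) (v $ 2) (v $ 3))"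
        unfolding coupling_def abs_coupling_def by (simp only: integral_mult_right_zero integral_complex_of_real)
      hence "Re z * abs_coupling (v $ 1) (v $ 2) (v $ 3) = abs_coupling (v $ 1) (v $ 2) (v $ 3)" using T' by simp
      hence "Re z = 1" using Tpos by simp
      moreover have "(Re z)\<^sup>2 + (Im z)\<^sup>2 = 1" using nz1 cmod_power2[of z] by simp
      ultimately have z1: "z = 1" by (simp add: complex_eq_iff)
      have "exp (\<i> * complex_of_real (\<theta> 3)) = z * exp (\<i> * complex_of_real (\<theta> 3))" by (simp add: z1)
      also have "\<dots> = exp (\<i> * complex_of_real (\<theta> 1)) * exp (\<i> * complex_of_real (\<theta> 2)) * (cnj (exp (\<i> * complex_of_real (\<theta> 3))) * exp (\<i> * complex_of_real (\<theta> 3)))"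
        by (simp add: z_def mult_ac)
      also have "cnj (exp (\<i> * complex_of_real (\<theta> 3))) * exp (\<i> * complex_of_real (\<theta> 3)) = 1"
        using complex_norm_square[of "exp (\<i> * complex_of_real (\<theta> 3))"] by (simp add: mult.commute)
      finally have e: "exp (\<i> * complex_of_real (\<theta> 1 + \<theta> 2)) = exp (\<i> * complex_of_real (\<theta> 3))"
        by (simp add: exp_add distrib_left)
      show ?thesis
        by (rule exI[of _ "\<theta> 1"], rule exI[of _ "\<theta> 2"]) (use \<theta>[of 1] \<theta>[of 2] \<theta>[of 3] e in simp)
    qed
  qed
  then obtain t1 t2 where t: "\<And>x. (v $ 1) x = exp (\<i> * complex_of_real t1) * complex_of_real (cmod ((v $ 1) x))"
      "\<And>x. (v $ 2) x = exp (\<i> * complex_of_real t2) * complex_of_real (cmod ((v $ 2) x))"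
      "\<And>x. (v $ 3) x = exp (\<i> * complex_of_real (t1 + t2)) * complex_of_real (cmod ((v $ 3) x))" by blast
  show ?thesis
    by (rule exI[of _ v], rule conjI, rule allI, rule rep, rule exI[of _ t1], rule exI[of _ t2],
        rule exI[of _ "\<lambda>x. cmod ((v $ 1) x)"], rule exI[of _ "\<lambda>x. cmod ((v $ 2) x)"], rule exI[of _ "\<lambda>x. cmod ((v $ 3) x)"])
      (intro conjI allI norm_ge_zero t)
qed

end

theorem theorem1p4:
  fixes \<alpha> \<beta> p :: real
  assumes "\<alpha> > 0" and "\<beta> > 0" and "1 < p" and "p < 5"
  shows
    "(\<forall>\<gamma>>0. \<forall>\<mu>>0.
        (\<forall>u. minimizing_sequence \<alpha> \<beta> p \<gamma> \<mu> u \<longrightarrow>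
          (\<exists>y :: nat \<Rightarrow> real. \<exists>\<phi>\<in>H1_vec. \<exists>r :: nat \<Rightarrow> nat. strict_mono r \<and>
             (\<lambda>k. H1_dist (translate (y (r k)) (u (r k))) \<phi>) \<longlonglongrightarrow> 0)) \<and>
        minimizers \<alpha> \<beta> p \<gamma> \<mu> \<noteq> {}) \<and>
     (\<forall>\<gamma>1>0. \<forall>\<mu>1>0. \<forall>\<gamma>2>0. \<forall>\<mu>2>0. (\<gamma>1, \<mu>1) \<noteq> (\<gamma>2, \<mu>2) \<longrightarrow>
        minimizers \<alpha> \<beta> p \<gamma>1 \<mu>1 \<inter> minimizers \<alpha> \<beta> p \<gamma>2 \<mu>2 = {}) \<and>
     (\<forall>\<gamma>>0. \<forall>\<mu>>0. \<forall>u\<in>minimizers \<alpha> \<beta> p \<gamma> \<mu>.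
        \<exists>v :: (real \<Rightarrow> complex)^3. (\<forall>i. is_continuous_rep (u $ i) (v $ i)) \<and>
          (\<exists>(\<theta>1 :: real) (\<theta>2 :: real) (\<rho>1 :: real \<Rightarrow> real) (\<rho>2 :: real \<Rightarrow> real) (\<rho>3 :: real \<Rightarrow> real).
             (\<forall>x. 0 \<le> \<rho>1 x \<and> 0 \<le> \<rho>2 x \<and> 0 \<le> \<rho>3 x) \<and>
             (\<forall>x. (v $ 1) x = exp (\<i> * complex_of_real \<theta>1) * complex_of_real (\<rho>1 x) \<and>
                  (v $ 2) x = exp (\<i> * complex_of_real \<theta>2) * complex_of_real (\<rho>2 x) \<and>
                  (v $ 3) x = exp (\<i> * complex_of_real (\<theta>1 + \<theta>2)) * complex_of_real (\<rho>3 x))))"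
proof -
  interpret three_wave \<alpha> \<beta> p by unfold_locales (fact assms)+
  show ?thesis
  proof (intro conjI allI impI ballI)
    fix \<gamma> \<mu> :: real assume pos: "\<gamma> > 0" "\<mu> > 0"
    show "\<exists>y :: nat \<Rightarrow> real. \<exists>\<phi>\<in>H1_vec. \<exists>r :: nat \<Rightarrow> nat. strict_mono r \<and>
        (\<lambda>k. H1_dist (translate (y (r k)) (u (r k))) \<phi>) \<longlonglongrightarrow> 0"
      if "minimizing_sequence \<alpha> \<beta> p \<gamma> \<mu> u" for u
      by (rule minimizing_sequence_compact[OF pos that])
    show "minimizers \<alpha> \<beta> p \<gamma> \<mu> \<noteq> {}" by (rule minimizer_exists[OF pos])
  next
    fix \<gamma>1 \<mu>1 \<gamma>2 \<mu>2 :: real assume "(\<gamma>1, \<mu>1) \<noteq> (\<gamma>2, \<mu>2)"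
    thus "minimizers \<alpha> \<beta> p \<gamma>1 \<mu>1 \<inter> minimizers \<alpha> \<beta> p \<gamma>2 \<mu>2 = {}" by (auto simp: minimizers_def)
  next
    fix \<gamma> \<mu> :: real and u assume "u \<in> minimizers \<alpha> \<beta> p \<gamma> \<mu>"
    thus "\<exists>v :: (real \<Rightarrow> complex)^3. (\<forall>i. is_continuous_rep (u $ i) (v $ i)) \<and>
          (\<exists>(\<theta>1 :: real) (\<theta>2 :: real) (\<rho>1 :: real \<Rightarrow> real) (\<rho>2 :: real \<Rightarrow> real) (\<rho>3 :: real \<Rightarrow> real).
             (\<forall>x. 0 \<le> \<rho>1 x \<and> 0 \<le> \<rho>2 x \<and> 0 \<le> \<rho>3 x) \<and>
             (\<forall>x. (v $ 1) x = exp (\<i> * complex_of_real \<theta>1) * complex_of_real (\<rho>1 x) \<and>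
                  (v $ 2) x = exp (\<i> * complex_of_real \<theta>2) * complex_of_real (\<rho>2 x) \<and>
                  (v $ 3) x = exp (\<i> * complex_of_real (\<theta>1 + \<theta>2)) * complex_of_real (\<rho>3 x)))"
      by (rule minimizer_phases)
  qed
qed

end
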